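(* Let $k$ be a field of characteristic zero and $N$ a natural number. Let $B\colon\mathsf{Rep}(\mathrm{M}(N,k))\to\mathsf{Rep}(k^N)$ be the 2-rig map that restricts algebraic representations of the affine monoid $\mathrm{M}(N,k)$ of $N\times N$ matrices to the affine submonoid $k^N$ of diagonal matrices. Then $B$ is a 2-rig extension, i.e. $B$ is faithful, conservative (it reflects isomorphisms) and essentially injective (if $B(a)\cong B(b)$ then $a\cong b$).
   Context: A 2-rig is a symmetric monoidal $k$-linear category (tensor product $k$-bilinear on morphisms) that is Cauchy complete (has finite biproducts, and idempotents split). A map of 2-rigs is a $k$-linear (strong) symmetric monoidal functor. A 2-rig extension is a 2-rig map whose underlying functor is faithful, conservative and essentially injective. An affine monoid is a monoid object in the category of affine schemes over $k$ (the opposite of the category of commutative $k$-algebras), equivalently a commutative bialgebra $\mathcal{O}(M)$ over $k$. For an affine monoid $M$, $\mathsf{Rep}(M)$ is the category of algebraic representations of $M$ on finite-dimensional $k$-vector spaces $V$, i.e. morphisms of affine monoids from $M$ to the affine monoid of endomorphisms of $V$ (whose coordinate algebra is the symmetric algebra on the dual of $\mathrm{End}(V)$). Equivalently, it is the category of finite-dimensional $\mathcal{O}(M)$-comodules. Morphisms are equivariant linear maps (comodule maps). With the usual direct sum, tensor product and symmetry it is a 2-rig. Here $\mathrm{M}(N,k)$ has coordinate bialgebra the polynomial algebra on $e_{ij}$ ($1\le i,j\le N$) with $\Delta(e_{ij})=\sum_{l=1}^N e_{il}\otimes e_{lj}$, and $k^N=\mathrm{Spec}(k[\mathbb{N}^N])$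 is the $N$-fold product of the affine line with multiplication as monoid operation. *)

theory Defs
  imports Complex_Main "HOL-Library.Poly_Mapping" "HOL-Library.Product_Plus" "HOL-Library.FuncSet"
begin

section \<open>Two-rigs and their maps\<close>

record ('o, 'a) category_data =
  Obj :: "'o set"
  Arr :: "'a set"
  Dom :: "'a \<Rightarrow> 'o"
  Cod :: "'a \<Rightarrow> 'o"
  Id :: "'o \<Rightarrow> 'a"
  Comp :: "'a \<Rightarrow> 'a \<Rightarrow> 'a"  (infixr "\<cdot>\<index>" 70)

definition Hom :: "('o, 'a, 'z) category_data_scheme \<Rightarrow> 'o \<Rightarrow> 'o \<Rightarrow> 'a set"
  where "Hom C a b = {f \<in> Arr C. Dom C f = a \<and> Cod C f = b}"

definition iso_arr :: "('o, 'a, 'z) category_data_scheme \<Rightarrow> 'a \<Rightarrow> bool"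
  where "iso_arr C f \<longleftrightarrow> f \<in> Arr C \<and>
    (\<exists>g \<in> Hom C (Cod C f) (Dom C f).
       Comp C g f = Id C (Dom C f) \<and> Comp C f g = Id C (Cod C f))"

definition isomorphic :: "('o, 'a, 'z) category_data_scheme \<Rightarrow> 'o \<Rightarrow> 'o \<Rightarrow> bool"
  where "isomorphic C a b \<longleftrightarrow> (\<exists>f \<in> Hom C a b. iso_arr C f)"

locale category =
  fixes C :: "('o, 'a, 'z) category_data_scheme" (structure)
  assumes Dom_in: "f \<in> Arr C \<Longrightarrow> Dom C f \<in> Obj C"
    and Cod_in: "f \<in> Arr C \<Longrightarrow> Cod C f \<in> Obj C"
    and Id_in: "a \<in> Obj C \<Longrightarrow> Id C a \<in> Hom C a a"
    and Comp_in: "\<lbrakk>f \<in> Hom C a b; g \<in> Hom C b c\<rbrakk> \<Longrightarrow> g \<cdot> f \<in> Hom C a c"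
    and Comp_Id_right: "f \<in> Hom C a b \<Longrightarrow> f \<cdot> Id C a = f"
    and Comp_Id_left: "f \<in> Hom C a b \<Longrightarrow> Id C b \<cdot> f = f"
    and Comp_assoc: "\<lbrakk>f \<in> Hom C a b; g \<in> Hom C b c; h \<in> Hom C c d\<rbrakk>
      \<Longrightarrow> h \<cdot> (g \<cdot> f) = (h \<cdot> g) \<cdot> f"

text \<open>Sums and multiples of arrows are only meaningful within a fixed hom-set.\<close>

record ('o, 'a, 'k) linear_category_data = "('o, 'a) category_data" +
  Add :: "'a \<Rightarrow> 'a \<Rightarrow> 'a"  (infixl "\<oplus>\<index>" 65)
  Zero :: "'o \<Rightarrow> 'o \<Rightarrow> 'a"
  Scale :: "'k \<Rightarrow> 'a \<Rightarrow> 'a"  (infixr "\<odot>\<index>" 75)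

locale linear_category = category C
  for C :: "('o, 'a, 'k::field, 'z) linear_category_data_scheme" (structure) +
  assumes Add_in: "\<lbrakk>f \<in> Hom C a b; g \<in> Hom C a b\<rbrakk> \<Longrightarrow> f \<oplus> g \<in> Hom C a b"
    and Zero_in: "\<lbrakk>a \<in> Obj C; b \<in> Obj C\<rbrakk> \<Longrightarrow> Zero C a b \<in> Hom C a b"
    and Scale_in: "f \<in> Hom C a b \<Longrightarrow> r \<odot> f \<in> Hom C a b"
    and Add_assoc: "\<lbrakk>f \<in> Hom C a b; g \<in> Hom C a b; h \<in> Hom C a b\<rbrakk>
      \<Longrightarrow> (f \<oplus> g) \<oplus> h = f \<oplus> (g \<oplus> h)"
    and Add_commute: "\<lbrakk>f \<in> Hom C a b; g \<in> Hom C a b\<rbrakk> \<Longrightarrow> f \<oplus> g = g \<oplus> f"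
    and Add_Zero: "f \<in> Hom C a b \<Longrightarrow> f \<oplus> Zero C a b = f"
    and Add_inverse: "f \<in> Hom C a b \<Longrightarrow> \<exists>g \<in> Hom C a b. f \<oplus> g = Zero C a b"
    and Scale_one: "f \<in> Hom C a b \<Longrightarrow> 1 \<odot> f = f"
    and Scale_Scale: "f \<in> Hom C a b \<Longrightarrow> r \<odot> (s \<odot> f) = (r * s) \<odot> f"
    and Scale_Add: "\<lbrakk>f \<in> Hom C a b; g \<in> Hom C a b\<rbrakk> \<Longrightarrow> r \<odot> (f \<oplus> g) = r \<odot> f \<oplus> r \<odot> g"
    and add_Scale: "f \<in> Hom C a b \<Longrightarrow> (r + s) \<odot> f = r \<odot> f \<oplus> s \<odot> f"
    and Comp_Add_right: "\<lbrakk>f \<in> Hom C a b; g \<in> Hom C a b; h \<in> Hom C b c\<rbrakk>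
      \<Longrightarrow> h \<cdot> (f \<oplus> g) = (h \<cdot> f) \<oplus> (h \<cdot> g)"
    and Comp_Add_left: "\<lbrakk>f \<in> Hom C a b; g \<in> Hom C b c; h \<in> Hom C b c\<rbrakk>
      \<Longrightarrow> (g \<oplus> h) \<cdot> f = (g \<cdot> f) \<oplus> (h \<cdot> f)"
    and Comp_Scale_right: "\<lbrakk>f \<in> Hom C a b; g \<in> Hom C b c\<rbrakk> \<Longrightarrow> g \<cdot> (r \<odot> f) = r \<odot> (g \<cdot> f)"
    and Comp_Scale_left: "\<lbrakk>f \<in> Hom C a b; g \<in> Hom C b c\<rbrakk> \<Longrightarrow> (r \<odot> g) \<cdot> f = r \<odot> (g \<cdot> f)"

locale cauchy_complete_linear_category = linear_category C
  for C :: "('o, 'a, 'k::field, 'z) linear_category_data_scheme" (structure) +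
  assumes zero_object: "\<exists>z \<in> Obj C. Id C z = Zero C z z"
    and biproduct: "\<lbrakk>a \<in> Obj C; b \<in> Obj C\<rbrakk> \<Longrightarrow>
      \<exists>c \<in> Obj C. \<exists>i \<in> Hom C a c. \<exists>j \<in> Hom C b c. \<exists>p \<in> Hom C c a. \<exists>q \<in> Hom C c b.
        p \<cdot> i = Id C a \<and> q \<cdot> j = Id C b \<and> p \<cdot> j = Zero C b a \<and> q \<cdot> i = Zero C a b \<and>
        (i \<cdot> p) \<oplus> (j \<cdot> q) = Id C c"
    and idempotents_split: "\<lbrakk>e \<in> Hom C a a; e \<cdot> e = e\<rbrakk> \<Longrightarrow>
      \<exists>b \<in> Obj C. \<exists>r \<in> Hom C a b. \<exists>s \<in> Hom C b a. s \<cdot> r = e \<and> r \<cdot> s = Id C b"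

record ('o, 'a, 'k) two_rig_data = "('o, 'a, 'k) linear_category_data" +
  TObj :: "'o \<Rightarrow> 'o \<Rightarrow> 'o"  (infixr "\<otimes>\<index>" 80)
  TArr :: "'a \<Rightarrow> 'a \<Rightarrow> 'a"  (infixr "\<boxtimes>\<index>" 80)
  Unit :: "'o"
  Assoc :: "'o \<Rightarrow> 'o \<Rightarrow> 'o \<Rightarrow> 'a"
  LUnit :: "'o \<Rightarrow> 'a"
  RUnit :: "'o \<Rightarrow> 'a"
  Braid :: "'o \<Rightarrow> 'o \<Rightarrow> 'a"

locale two_rig = cauchy_complete_linear_category C
  for C :: "('o, 'a, 'k::field, 'z) two_rig_data_scheme" (structure) +
  assumes TObj_in: "\<lbrakk>a \<in> Obj C; b \<in> Obj C\<rbrakk> \<Longrightarrow> a \<otimes> b \<in> Obj C"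
    and Unit_in: "Unit C \<in> Obj C"
    and TArr_in: "\<lbrakk>f \<in> Hom C a b; g \<in> Hom C c d\<rbrakk> \<Longrightarrow> f \<boxtimes> g \<in> Hom C (a \<otimes> c) (b \<otimes> d)"
    and TArr_Id: "\<lbrakk>a \<in> Obj C; b \<in> Obj C\<rbrakk> \<Longrightarrow> Id C a \<boxtimes> Id C b = Id C (a \<otimes> b)"
    and TArr_Comp: "\<lbrakk>f \<in> Hom C a b; f' \<in> Hom C b c; g \<in> Hom C a' b'; g' \<in> Hom C b' c'\<rbrakk>
      \<Longrightarrow> (f' \<cdot> f) \<boxtimes> (g' \<cdot> g) = (f' \<boxtimes> g') \<cdot> (f \<boxtimes> g)"
    and TArr_Add_left: "\<lbrakk>f \<in> Hom C a b; g \<in> Hom C a b; h \<in> Hom C c d\<rbrakk>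
      \<Longrightarrow> (f \<oplus> g) \<boxtimes> h = (f \<boxtimes> h) \<oplus> (g \<boxtimes> h)"
    and TArr_Add_right: "\<lbrakk>f \<in> Hom C a b; g \<in> Hom C a b; h \<in> Hom C c d\<rbrakk>
      \<Longrightarrow> h \<boxtimes> (f \<oplus> g) = (h \<boxtimes> f) \<oplus> (h \<boxtimes> g)"
    and TArr_Scale_left: "\<lbrakk>f \<in> Hom C a b; g \<in> Hom C c d\<rbrakk> \<Longrightarrow> (r \<odot> f) \<boxtimes> g = r \<odot> (f \<boxtimes> g)"
    and TArr_Scale_right: "\<lbrakk>f \<in> Hom C a b; g \<in> Hom C c d\<rbrakk> \<Longrightarrow> f \<boxtimes> (r \<odot> g) = r \<odot> (f \<boxtimes> g)"
    and Assoc_in: "\<lbrakk>a \<in> Obj C; b \<in> Obj C; c \<in> Obj C\<rbrakk>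
      \<Longrightarrow> Assoc C a b c \<in> Hom C ((a \<otimes> b) \<otimes> c) (a \<otimes> (b \<otimes> c))"
    and Assoc_iso: "\<lbrakk>a \<in> Obj C; b \<in> Obj C; c \<in> Obj C\<rbrakk> \<Longrightarrow> iso_arr C (Assoc C a b c)"
    and Assoc_natural: "\<lbrakk>f \<in> Hom C a a'; g \<in> Hom C b b'; h \<in> Hom C c c'\<rbrakk>
      \<Longrightarrow> Assoc C a' b' c' \<cdot> ((f \<boxtimes> g) \<boxtimes> h) = (f \<boxtimes> (g \<boxtimes> h)) \<cdot> Assoc C a b c"
    and LUnit_in: "a \<in> Obj C \<Longrightarrow> LUnit C a \<in> Hom C (Unit C \<otimes> a) a"
    and LUnit_iso: "a \<in> Obj C \<Longrightarrow> iso_arr C (LUnit C a)"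
    and LUnit_natural: "f \<in> Hom C a b \<Longrightarrow> LUnit C b \<cdot> (Id C (Unit C) \<boxtimes> f) = f \<cdot> LUnit C a"
    and RUnit_in: "a \<in> Obj C \<Longrightarrow> RUnit C a \<in> Hom C (a \<otimes> Unit C) a"
    and RUnit_iso: "a \<in> Obj C \<Longrightarrow> iso_arr C (RUnit C a)"
    and RUnit_natural: "f \<in> Hom C a b \<Longrightarrow> RUnit C b \<cdot> (f \<boxtimes> Id C (Unit C)) = f \<cdot> RUnit C a"
    and Braid_in: "\<lbrakk>a \<in> Obj C; b \<in> Obj C\<rbrakk> \<Longrightarrow> Braid C a b \<in> Hom C (a \<otimes> b) (b \<otimes> a)"
    and Braid_natural: "\<lbrakk>f \<in> Hom C a a'; g \<in> Hom C b b'\<rbrakk>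
      \<Longrightarrow> Braid C a' b' \<cdot> (f \<boxtimes> g) = (g \<boxtimes> f) \<cdot> Braid C a b"
    and Braid_symmetric: "\<lbrakk>a \<in> Obj C; b \<in> Obj C\<rbrakk> \<Longrightarrow> Braid C b a \<cdot> Braid C a b = Id C (a \<otimes> b)"
    and pentagon: "\<lbrakk>a \<in> Obj C; b \<in> Obj C; c \<in> Obj C; d \<in> Obj C\<rbrakk> \<Longrightarrow>
      Assoc C a b (c \<otimes> d) \<cdot> Assoc C (a \<otimes> b) c d =
      (Id C a \<boxtimes> Assoc C b c d) \<cdot> Assoc C a (b \<otimes> c) d \<cdot> (Assoc C a b c \<boxtimes> Id C d)"
    and triangle: "\<lbrakk>a \<in> Obj C; b \<in> Obj C\<rbrakk> \<Longrightarrow>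
      (Id C a \<boxtimes> LUnit C b) \<cdot> Assoc C a (Unit C) b = RUnit C a \<boxtimes> Id C b"
    and hexagon: "\<lbrakk>a \<in> Obj C; b \<in> Obj C; c \<in> Obj C\<rbrakk> \<Longrightarrow>
      Assoc C b c a \<cdot> Braid C a (b \<otimes> c) \<cdot> Assoc C a b c =
      (Id C b \<boxtimes> Braid C a c) \<cdot> Assoc C b a c \<cdot> (Braid C a b \<boxtimes> Id C c)"

text \<open>
  A strong symmetric monoidal functor \<open>F\<close> carries as structure the comparison arrows
  \<open>FMult F a b : F a \<otimes> F b \<rightarrow> F (a \<otimes> b)\<close> and \<open>FUnit F : I \<rightarrow> F I\<close>.
\<close>

record ('o, 'a, 'p, 'b) two_rig_map_data =
  FObj :: "'o \<Rightarrow> 'p"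
  FArr :: "'a \<Rightarrow> 'b"
  FMult :: "'o \<Rightarrow> 'o \<Rightarrow> 'b"
  FUnit :: "'b"

locale two_rig_map = C: two_rig C + D: two_rig D
  for C :: "('o, 'a, 'k::field, 'y) two_rig_data_scheme"
    and D :: "('p, 'b, 'k, 'z) two_rig_data_scheme" +
  fixes F :: "('o, 'a, 'p, 'b) two_rig_map_data"
  assumes FObj_in: "a \<in> Obj C \<Longrightarrow> FObj F a \<in> Obj D"
    and FArr_in: "f \<in> Hom C a b \<Longrightarrow> FArr F f \<in> Hom D (FObj F a) (FObj F b)"
    and FArr_Id: "a \<in> Obj C \<Longrightarrow> FArr F (Id C a) = Id D (FObj F a)"
    and FArr_Comp: "\<lbrakk>f \<in> Hom C a b; g \<in> Hom C b c\<rbrakk>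
      \<Longrightarrow> FArr F (g \<cdot>\<^bsub>C\<^esub> f) = FArr F g \<cdot>\<^bsub>D\<^esub> FArr F f"
    and FArr_Add: "\<lbrakk>f \<in> Hom C a b; g \<in> Hom C a b\<rbrakk>
      \<Longrightarrow> FArr F (f \<oplus>\<^bsub>C\<^esub> g) = FArr F f \<oplus>\<^bsub>D\<^esub> FArr F g"
    and FArr_Scale: "f \<in> Hom C a b \<Longrightarrow> FArr F (r \<odot>\<^bsub>C\<^esub> f) = r \<odot>\<^bsub>D\<^esub> FArr F f"
    and FMult_in: "\<lbrakk>a \<in> Obj C; b \<in> Obj C\<rbrakk>
      \<Longrightarrow> FMult F a b \<in> Hom D (FObj F a \<otimes>\<^bsub>D\<^esub> FObj F b) (FObj F (a \<otimes>\<^bsub>C\<^esub> b))"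
    and FMult_iso: "\<lbrakk>a \<in> Obj C; b \<in> Obj C\<rbrakk> \<Longrightarrow> iso_arr D (FMult F a b)"
    and FMult_natural: "\<lbrakk>f \<in> Hom C a a'; g \<in> Hom C b b'\<rbrakk> \<Longrightarrow>
      FMult F a' b' \<cdot>\<^bsub>D\<^esub> (FArr F f \<boxtimes>\<^bsub>D\<^esub> FArr F g) = FArr F (f \<boxtimes>\<^bsub>C\<^esub> g) \<cdot>\<^bsub>D\<^esub> FMult F a b"
    and FUnit_in: "FUnit F \<in> Hom D (Unit D) (FObj F (Unit C))"
    and FUnit_iso: "iso_arr D (FUnit F)"
    and F_Assoc: "\<lbrakk>a \<in> Obj C; b \<in> Obj C; c \<in> Obj C\<rbrakk> \<Longrightarrow>
      FArr F (Assoc C a b c) \<cdot>\<^bsub>D\<^esub> FMult F (a \<otimes>\<^bsub>C\<^esub> b) c \<cdot>\<^bsub>D\<^esub> (FMult F a b \<boxtimes>\<^bsub>D\<^esub> Id D (FObj F c)) =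
      FMult F a (b \<otimes>\<^bsub>C\<^esub> c) \<cdot>\<^bsub>D\<^esub> (Id D (FObj F a) \<boxtimes>\<^bsub>D\<^esub> FMult F b c) \<cdot>\<^bsub>D\<^esub>
        Assoc D (FObj F a) (FObj F b) (FObj F c)"
    and F_LUnit: "a \<in> Obj C \<Longrightarrow>
      FArr F (LUnit C a) \<cdot>\<^bsub>D\<^esub> FMult F (Unit C) a \<cdot>\<^bsub>D\<^esub> (FUnit F \<boxtimes>\<^bsub>D\<^esub> Id D (FObj F a)) =
      LUnit D (FObj F a)"
    and F_RUnit: "a \<in> Obj C \<Longrightarrow>
      FArr F (RUnit C a) \<cdot>\<^bsub>D\<^esub> FMult F a (Unit C) \<cdot>\<^bsub>D\<^esub> (Id D (FObj F a) \<boxtimes>\<^bsub>D\<^esub> FUnit F) =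
      RUnit D (FObj F a)"
    and F_Braid: "\<lbrakk>a \<in> Obj C; b \<in> Obj C\<rbrakk> \<Longrightarrow>
      FArr F (Braid C a b) \<cdot>\<^bsub>D\<^esub> FMult F a b = FMult F b a \<cdot>\<^bsub>D\<^esub> Braid D (FObj F a) (FObj F b)"

locale two_rig_extension = two_rig_map C D F
  for C :: "('o, 'a, 'k::field, 'y) two_rig_data_scheme"
    and D :: "('p, 'b, 'k, 'z) two_rig_data_scheme"
    and F :: "('o, 'a, 'p, 'b) two_rig_map_data" +
  assumes faithful: "\<lbrakk>f \<in> Hom C a b; g \<in> Hom C a b; FArr F f = FArr F g\<rbrakk> \<Longrightarrow> f = g"
    and conservative: "\<lbrakk>f \<in> Arr C; iso_arr D (FArr F f)\<rbrakk> \<Longrightarrow> iso_arr C f"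
    and essentially_injective:
      "\<lbrakk>a \<in> Obj C; b \<in> Obj C; isomorphic D (FObj F a) (FObj F b)\<rbrakk> \<Longrightarrow> isomorphic C a b"


section \<open>Affine monoids\<close>

text \<open>
  The type \<open>'m \<Rightarrow>\<^sub>0 'k\<close> carries the convolution product, so for a submonoid \<open>P\<close> of \<open>'m\<close> the
  elements with support in \<open>P\<close> form the monoid algebra \<open>k[P]\<close>; we describe an affine monoid
  by a bialgebra structure on such a \<open>k[P]\<close>, with \<open>k[P] \<otimes> k[P]\<close> identified with
  \<open>k[P \<times> P]\<close>.  Polynomial algebras are the case where \<open>'m\<close> consists of exponent vectors
  \<open>'x \<Rightarrow>\<^sub>0 nat\<close>.
\<close>

record (overloaded) ('m, 'k) affine_monoid =
  exponents :: "'m set"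
  comult :: "('m \<Rightarrow>\<^sub>0 'k::zero) \<Rightarrow> ('m \<times> 'm \<Rightarrow>\<^sub>0 'k)"
  counit :: "('m \<Rightarrow>\<^sub>0 'k) \<Rightarrow> 'k"

text \<open>The algebra homomorphism that is \<open>\<iota>\<close> on scalars and sends the variable \<open>x\<close> to \<open>g x\<close>.\<close>

definition poly_eval ::
    "('k::zero \<Rightarrow> 'a::comm_ring_1) \<Rightarrow> ('x \<Rightarrow> 'a) \<Rightarrow> (('x \<Rightarrow>\<^sub>0 nat) \<Rightarrow>\<^sub>0 'k) \<Rightarrow> 'a"
  where "poly_eval \<iota> g p =
    (\<Sum>e \<in> Poly_Mapping.keys p. \<iota> (Poly_Mapping.lookup p e) *
       (\<Prod>x \<in> Poly_Mapping.keys e. g x ^ Poly_Mapping.lookup e x))"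

abbreviation var :: "'x \<Rightarrow> ('x \<Rightarrow>\<^sub>0 nat)"
  where "var x \<equiv> Poly_Mapping.single x 1"

abbreviation monomial :: "'m \<Rightarrow> ('m \<Rightarrow>\<^sub>0 'k::zero_neq_one)"
  where "monomial m \<equiv> Poly_Mapping.single m 1"

abbreviation const :: "'k::zero \<Rightarrow> ('m::zero \<Rightarrow>\<^sub>0 'k)"
  where "const \<equiv> Poly_Mapping.single 0"

text \<open>
  \<open>M(N,k)\<close>, with variables \<open>e\<^bsub>ij\<^esub>\<close> indexed by pairs \<open>i, j < N\<close>:
  \<open>\<Delta> e\<^bsub>ij\<^esub> = \<Sum>\<^bsub>l<N\<^esub> e\<^bsub>il\<^esub> \<otimes> e\<^bsub>lj\<^esub>\<close> and \<open>\<epsilon> e\<^bsub>ij\<^esub> = \<delta>\<^bsub>ij\<^esub>\<close>.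
\<close>

definition matrix_monoid :: "nat \<Rightarrow> (nat \<times> nat \<Rightarrow>\<^sub>0 nat, 'k::comm_ring_1) affine_monoid"
  where "matrix_monoid N = \<lparr>
    exponents = {e. Poly_Mapping.keys e \<subseteq> {..<N} \<times> {..<N}},
    comult = poly_eval const (\<lambda>(i, j). \<Sum>l<N. monomial (var (i, l), var (l, j))),
    counit = poly_eval id (\<lambda>(i, j). if i = j then 1 else 0)\<rparr>"

text \<open>\<open>k\<^sup>N\<close> under multiplication: \<open>\<Delta> x\<^sub>i = x\<^sub>i \<otimes> x\<^sub>i\<close> and \<open>\<epsilon> x\<^sub>i = 1\<close>.\<close>

definition power_monoid :: "nat \<Rightarrow> (nat \<Rightarrow>\<^sub>0 nat, 'k::comm_ring_1) affine_monoid"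
  where "power_monoid N = \<lparr>
    exponents = {e. Poly_Mapping.keys e \<subseteq> {..<N}},
    comult = poly_eval const (\<lambda>i. monomial (var i, var i)),
    counit = poly_eval id (\<lambda>i. 1)\<rparr>"

text \<open>
  The homomorphism \<open>\<O>(M(N,k)) \<rightarrow> \<O>(k\<^sup>N)\<close>, \<open>e\<^bsub>ij\<^esub> \<mapsto> \<delta>\<^bsub>ij\<^esub> x\<^sub>i\<close>, dual to the inclusion of the
  diagonal matrices.
\<close>

definition restrict_to_diagonal ::
    "((nat \<times> nat \<Rightarrow>\<^sub>0 nat) \<Rightarrow>\<^sub>0 'k::comm_ring_1) \<Rightarrow> ((nat \<Rightarrow>\<^sub>0 nat) \<Rightarrow>\<^sub>0 'k)"
  where "restrict_to_diagonal =
    poly_eval const (\<lambda>(i, j). if i = j then monomial (var i) else 0)"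


section \<open>Finite-dimensional representations\<close>

text \<open>
  The objects of \<open>Rep(M)\<close> have to be drawn from some type.  We take the underlying vector
  spaces to be the finite-dimensional subspaces of an arbitrary ambient space \<open>U\<close>, whose
  carrier is the whole type \<open>'v\<close>.  Every finite-dimensional space occurs in a suitable \<open>U\<close>;
  infinite dimension of \<open>U\<close> guarantees room for direct sums and tensor products.
\<close>

record (overloaded) ('m, 'v) comodule =
  vspace :: "'v set"
  coaction :: "'v \<Rightarrow> ('m \<Rightarrow>\<^sub>0 'v::zero)"

datatype ('o, 'f) arrow = Arrow (source: 'o) (the_map: 'f) (target: 'o)

locale ambient_vector_space = vector_space scale
  for scale :: "'k::field \<Rightarrow> 'v::ab_group_add \<Rightarrow> 'v"  (infixr "*s" 75) +
  assumes infinite_dimensional: "\<not> (\<exists>B. finite B \<and> span B = UNIV)"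
begin

definition fin_dim_subspace :: "'v set \<Rightarrow> bool"
  where "fin_dim_subspace V \<longleftrightarrow> subspace V \<and> (\<exists>B. finite B \<and> span B = V)"

text \<open>Linear maps on \<open>V\<close> are normalised to be \<open>undefined\<close> outside \<open>V\<close>.\<close>

definition linear_on :: "'v set \<Rightarrow> ('k \<Rightarrow> 'w \<Rightarrow> 'w) \<Rightarrow> ('v \<Rightarrow> 'w::ab_group_add) \<Rightarrow> bool"
  where "linear_on V sc f \<longleftrightarrow> f \<in> extensional V \<and>
    (\<forall>x\<in>V. \<forall>y\<in>V. f (x + y) = f x + f y) \<and> (\<forall>c. \<forall>x\<in>V. f (c *s x) = sc c (f x))"

text \<open>
  \<open>V \<otimes> k[P]\<close> is the direct sum of copies of \<open>V\<close> indexed by \<open>P\<close>, realised as the finitely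
  supported functions \<open>P \<rightarrow> V\<close>.  Below are the pure tensor \<open>v \<otimes> p\<close>, scalar multiplication,
  the map \<open>id \<otimes> \<phi>\<close> for linear \<open>\<phi>\<close> on \<open>k[P]\<close>, and \<open>\<rho> \<otimes> id\<close> for
  \<open>\<rho> : V \<rightarrow> V \<otimes> k[P]\<close>.
\<close>

definition tensor_poly :: "'v set \<Rightarrow> 'm set \<Rightarrow> ('m \<Rightarrow>\<^sub>0 'v) set"
  where "tensor_poly V P =
    {F. Poly_Mapping.keys F \<subseteq> P \<and> (\<forall>m. Poly_Mapping.lookup F m \<in> V)}"

definition pure :: "'v \<Rightarrow> ('m \<Rightarrow>\<^sub>0 'k) \<Rightarrow> ('m \<Rightarrow>\<^sub>0 'v)"
  where "pure v p = Poly_Mapping.map (\<lambda>c. c *s v) p"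

definition scale_poly :: "'k \<Rightarrow> ('m \<Rightarrow>\<^sub>0 'v) \<Rightarrow> ('m \<Rightarrow>\<^sub>0 'v)"
  where "scale_poly c F = Poly_Mapping.map (\<lambda>v. c *s v) F"

definition id_tensor :: "(('m \<Rightarrow>\<^sub>0 'k) \<Rightarrow> ('n \<Rightarrow>\<^sub>0 'k)) \<Rightarrow> ('m \<Rightarrow>\<^sub>0 'v) \<Rightarrow> ('n \<Rightarrow>\<^sub>0 'v)"
  where "id_tensor \<phi> F =
    (\<Sum>m \<in> Poly_Mapping.keys F. pure (Poly_Mapping.lookup F m) (\<phi> (monomial m)))"

definition id_tensor_functional :: "(('m \<Rightarrow>\<^sub>0 'k) \<Rightarrow> 'k) \<Rightarrow> ('m \<Rightarrow>\<^sub>0 'v) \<Rightarrow> 'v"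
  where "id_tensor_functional \<epsilon> F =
    (\<Sum>m \<in> Poly_Mapping.keys F. \<epsilon> (monomial m) *s Poly_Mapping.lookup F m)"

definition coaction_tensor_id ::
    "('v \<Rightarrow> ('m \<Rightarrow>\<^sub>0 'v)) \<Rightarrow> ('m \<Rightarrow>\<^sub>0 'v) \<Rightarrow> ('m \<times> 'm \<Rightarrow>\<^sub>0 'v)"
  where "coaction_tensor_id \<rho> F =
    (\<Sum>m \<in> Poly_Mapping.keys F. \<Sum>l \<in> Poly_Mapping.keys (\<rho> (Poly_Mapping.lookup F m)).
       Poly_Mapping.single (l, m) (Poly_Mapping.lookup (\<rho> (Poly_Mapping.lookup F m)) l))"

definition is_comodule :: "('m, 'k) affine_monoid \<Rightarrow> ('m, 'v) comodule \<Rightarrow> bool"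
  where "is_comodule M a \<longleftrightarrow>
    fin_dim_subspace (vspace a) \<and>
    linear_on (vspace a) scale_poly (coaction a) \<and>
    (\<forall>v \<in> vspace a.
       coaction a v \<in> tensor_poly (vspace a) (exponents M) \<and>
       coaction_tensor_id (coaction a) (coaction a v) = id_tensor (comult M) (coaction a v) \<and>
       id_tensor_functional (counit M) (coaction a v) = v)"

definition is_comodule_map ::
    "('m, 'v) comodule \<Rightarrow> ('m, 'v) comodule \<Rightarrow> ('v \<Rightarrow> 'v) \<Rightarrow> bool"
  where "is_comodule_map a b f \<longleftrightarrow>
    linear_on (vspace a) scale f \<and>
    (\<forall>v \<in> vspace a. f v \<in> vspace b \<and> coaction b (f v) = Poly_Mapping.map f (coaction a v))"

subsection \<open>Tensor products\<close>

definition bilinear_on :: "'v set \<Rightarrow> 'v set \<Rightarrow> ('v \<Rightarrow> 'v \<Rightarrow> 'v) \<Rightarrow> bool"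
  where "bilinear_on V W \<beta> \<longleftrightarrow>
    (\<forall>x\<in>V. \<forall>y\<in>V. \<forall>w\<in>W. \<beta> (x + y) w = \<beta> x w + \<beta> y w) \<and>
    (\<forall>v\<in>V. \<forall>x\<in>W. \<forall>y\<in>W. \<beta> v (x + y) = \<beta> v x + \<beta> v y) \<and>
    (\<forall>c. \<forall>v\<in>V. \<forall>w\<in>W. \<beta> (c *s v) w = c *s \<beta> v w \<and> \<beta> v (c *s w) = c *s \<beta> v w)"

definition pure_span :: "'v set \<Rightarrow> 'v set \<Rightarrow> ('v \<Rightarrow> 'v \<Rightarrow> 'v) \<Rightarrow> 'v set"
  where "pure_span V W t = span {t v w | v w. v \<in> V \<and> w \<in> W}"

definition is_tensor_product :: "'v set \<Rightarrow> 'v set \<Rightarrow> ('v \<Rightarrow> 'v \<Rightarrow> 'v) \<Rightarrow> bool"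
  where "is_tensor_product V W t \<longleftrightarrow> bilinear_on V W t \<and>
    (\<forall>\<beta>. bilinear_on V W \<beta> \<longrightarrow>
      (\<exists>!f. linear_on (pure_span V W t) scale f \<and> (\<forall>v\<in>V. \<forall>w\<in>W. f (t v w) = \<beta> v w)))"

text \<open>A fixed choice of universal bilinear map for each pair of spaces.\<close>

definition tensor :: "'v set \<Rightarrow> 'v set \<Rightarrow> 'v \<Rightarrow> 'v \<Rightarrow> 'v"
  where "tensor V W = (SOME t. is_tensor_product V W t)"

definition tensor_space :: "'v set \<Rightarrow> 'v set \<Rightarrow> 'v set"
  where "tensor_space V W = pure_span V W (tensor V W)"

text \<open>The ground field as a one-dimensional space, \<open>c \<in> k\<close> being identified with \<open>c *s unit_vector\<close>.\<close>

definition unit_vector :: 'v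
  where "unit_vector = (SOME u. u \<noteq> 0)"

definition the_linear :: "'v set \<Rightarrow> (('v \<Rightarrow> 'v) \<Rightarrow> bool) \<Rightarrow> 'v \<Rightarrow> 'v"
  where "the_linear V P = (THE f. linear_on V scale f \<and> P f)"

text \<open>The coaction \<open>v \<otimes> w \<mapsto> \<Sum> (v\<^bsub>(0)\<^esub> \<otimes> w\<^bsub>(0)\<^esub>) \<otimes> v\<^bsub>(1)\<^esub> w\<^bsub>(1)\<^esub>\<close>.\<close>

definition tensor_comodule ::
    "('m::comm_monoid_add, 'v) comodule \<Rightarrow> ('m, 'v) comodule \<Rightarrow> ('m, 'v) comodule"
  where "tensor_comodule a b = \<lparr>
    vspace = tensor_space (vspace a) (vspace b),
    coaction = (THE \<rho>. linear_on (tensor_space (vspace a) (vspace b)) scale_poly \<rho> \<and>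
      (\<forall>v \<in> vspace a. \<forall>w \<in> vspace b.
        \<rho> (tensor (vspace a) (vspace b) v w) =
        (\<Sum>p \<in> Poly_Mapping.keys (coaction a v). \<Sum>q \<in> Poly_Mapping.keys (coaction b w).
          Poly_Mapping.single (p + q)
            (tensor (vspace a) (vspace b)
              (Poly_Mapping.lookup (coaction a v) p) (Poly_Mapping.lookup (coaction b w) q)))))\<rparr>"

definition unit_comodule :: "('m::comm_monoid_add, 'v) comodule"
  where "unit_comodule = \<lparr>
    vspace = span {unit_vector},
    coaction = (\<lambda>v \<in> span {unit_vector}. Poly_Mapping.single 0 v)\<rparr>"

definition tensor_map :: "'v set \<Rightarrow> 'v set \<Rightarrow> 'v set \<Rightarrow> 'v set \<Rightarrow> ('v \<Rightarrow> 'v) \<Rightarrow> ('v \<Rightarrow> 'v) \<Rightarrow> 'v \<Rightarrow> 'v"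
  where "tensor_map V V' W W' f g = the_linear (tensor_space V W)
    (\<lambda>h. \<forall>v\<in>V. \<forall>w\<in>W. h (tensor V W v w) = tensor V' W' (f v) (g w))"

definition associator :: "'v set \<Rightarrow> 'v set \<Rightarrow> 'v set \<Rightarrow> 'v \<Rightarrow> 'v"
  where "associator U V W = the_linear (tensor_space (tensor_space U V) W)
    (\<lambda>h. \<forall>u\<in>U. \<forall>v\<in>V. \<forall>w\<in>W.
      h (tensor (tensor_space U V) W (tensor U V u v) w) =
      tensor U (tensor_space V W) u (tensor V W v w))"

definition left_unitor :: "'v set \<Rightarrow> 'v \<Rightarrow> 'v"
  where "left_unitor V = the_linear (tensor_space (span {unit_vector}) V)
    (\<lambda>h. \<forall>c. \<forall>v\<in>V. h (tensor (span {unit_vector}) V (c *s unit_vector) v) = c *s v)"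

definition right_unitor :: "'v set \<Rightarrow> 'v \<Rightarrow> 'v"
  where "right_unitor V = the_linear (tensor_space V (span {unit_vector}))
    (\<lambda>h. \<forall>c. \<forall>v\<in>V. h (tensor V (span {unit_vector}) v (c *s unit_vector)) = c *s v)"

definition symmetry :: "'v set \<Rightarrow> 'v set \<Rightarrow> 'v \<Rightarrow> 'v"
  where "symmetry V W = the_linear (tensor_space V W)
    (\<lambda>h. \<forall>v\<in>V. \<forall>w\<in>W. h (tensor V W v w) = tensor W V w v)"

subsection \<open>The 2-rig of representations and restriction\<close>

definition Rep :: "('m::comm_monoid_add, 'k) affine_monoid \<Rightarrow>
    (('m, 'v) comodule, (('m, 'v) comodule, 'v \<Rightarrow> 'v) arrow, 'k) two_rig_data"
  where "Rep M = \<lparr>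
    Obj = {a. is_comodule M a},
    Arr = {f. is_comodule M (source f) \<and> is_comodule M (target f) \<and>
              is_comodule_map (source f) (target f) (the_map f)},
    Dom = source,
    Cod = target,
    Id = (\<lambda>a. Arrow a (\<lambda>v \<in> vspace a. v) a),
    Comp = (\<lambda>g f. Arrow (source f) (compose (vspace (source f)) (the_map g) (the_map f)) (target g)),
    Add = (\<lambda>f g. Arrow (source f)
             (\<lambda>v \<in> vspace (source f). the_map f v + the_map g v) (target f)),
    Zero = (\<lambda>a b. Arrow a (\<lambda>v \<in> vspace a. 0) b),
    Scale = (\<lambda>c f. Arrow (source f) (\<lambda>v \<in> vspace (source f). c *s the_map f v) (target f)),
    TObj = tensor_comodule,
    TArr = (\<lambda>f g. Arrow (tensor_comodule (source f) (source g))
              (tensor_map (vspace (source f)) (vspace (target f)) (vspace (source g)) (vspace (target g))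
                (the_map f) (the_map g))
              (tensor_comodule (target f) (target g))),
    Unit = unit_comodule,
    Assoc = (\<lambda>a b c. Arrow (tensor_comodule (tensor_comodule a b) c)
               (associator (vspace a) (vspace b) (vspace c))
               (tensor_comodule a (tensor_comodule b c))),
    LUnit = (\<lambda>a. Arrow (tensor_comodule unit_comodule a) (left_unitor (vspace a)) a),
    RUnit = (\<lambda>a. Arrow (tensor_comodule a unit_comodule) (right_unitor (vspace a)) a),
    Braid = (\<lambda>a b. Arrow (tensor_comodule a b) (symmetry (vspace a) (vspace b))
               (tensor_comodule b a))\<rparr>"

text \<open>
  Restriction along a homomorphism of affine monoids with dual \<open>\<phi>\<close>: the underlying spaces,
  linear maps and tensor products are unchanged, so the comparison arrows are identity maps.
\<close>

definition restrict_comodule ::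
    "(('m \<Rightarrow>\<^sub>0 'k) \<Rightarrow> ('n \<Rightarrow>\<^sub>0 'k)) \<Rightarrow> ('m, 'v) comodule \<Rightarrow> ('n, 'v) comodule"
  where "restrict_comodule \<phi> a = \<lparr>
    vspace = vspace a,
    coaction = (\<lambda>v \<in> vspace a. id_tensor \<phi> (coaction a v))\<rparr>"

definition restriction :: "(('m::comm_monoid_add \<Rightarrow>\<^sub>0 'k) \<Rightarrow> ('n::comm_monoid_add \<Rightarrow>\<^sub>0 'k)) \<Rightarrow>
    (('m, 'v) comodule, (('m, 'v) comodule, 'v \<Rightarrow> 'v) arrow,
     ('n, 'v) comodule, (('n, 'v) comodule, 'v \<Rightarrow> 'v) arrow) two_rig_map_data"
  where "restriction \<phi> = \<lparr>
    FObj = restrict_comodule \<phi>,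
    FArr = (\<lambda>f. Arrow (restrict_comodule \<phi> (source f)) (the_map f) (restrict_comodule \<phi> (target f))),
    FMult = (\<lambda>a b. Arrow (tensor_comodule (restrict_comodule \<phi> a) (restrict_comodule \<phi> b))
               (\<lambda>x \<in> tensor_space (vspace a) (vspace b). x)
               (restrict_comodule \<phi> (tensor_comodule a b))),
    FUnit = Arrow unit_comodule (\<lambda>x \<in> span {unit_vector}. x) (restrict_comodule \<phi> unit_comodule)\<rparr>"

end

end

theory Submission
  imports Defs "HOL-Computational_Algebra.Polynomial"
begin

text \<open>
  Write \<open>\<rho>\<^sub>m\<close> for the operator on a representation which is the coefficient of the monomial \<open>m\<close> in
  the coaction, so that a representation is a family of operators composing by the structure
  constants of the comultiplication.  Restriction to the diagonal matrices retains the operators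
  \<open>\<rho>\<^sub>m\<close> with \<open>m\<close> supported on the diagonal, the projections to the weight spaces.  Neither the
  underlying linear map nor the tensor products change, so faithfulness and conservativity are
  immediate, and it remains to see that the dimensions of the weight spaces determine a
  representation.

  For a linear map \<open>f : V \<rightarrow> W\<close> the average \<open>\<Sum>\<^sub>m m! \<rho>\<^sub>m f \<rho>\<^bsub>m\<^sup>T\<^esub>\<close> is equivariant.  Let \<open>\<nu>\<close> be a weight of
  \<open>V\<close> of maximal height and let \<open>u\<close> have weight \<open>\<nu>\<close>.  As a function of the matrix \<open>X\<close>, the component of \<open>X u\<close>
  of weight \<open>\<nu>\<close> is invariant under unipotent row and column operations, so by Gaussian elimination
  it is \<open>s(X) u\<close> for a universal polynomial \<open>s\<close>, whose coefficients are rational and invariant under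
  transposition.  Averaging an isomorphism of the \<open>\<nu>\<close>-weight spaces of \<open>V\<close> and \<open>W\<close> therefore
  multiplies it by \<open>\<Sum>\<^sub>m m! s\<^sub>m\<^sup>2\<close>, which is positive.  After rescaling, the averages of the isomorphism and of its
  inverse split off isomorphic summands of \<open>V\<close> and \<open>W\<close>, and one concludes by induction on the
  dimension.
\<close>

text \<open>Equivariance of the average rests on the pairing of polynomials in which
  \<open>x\<^sup>n\<close> has norm \<open>n!\<close>: translation by a matrix is adjoint to
  translation by its transpose. This algebraic identity stands in for integration over the unitary
  group, so the argument runs over every field of characteristic zero and never invokes complete
  reducibility. The obstacle is that an average might vanish. On the weight space it acts by a sum
  of products of the coefficient at \<open>n\<close> with the coefficient at the transpose of
  \<open>n\<close>. Invariance under transposition turns these products into squares, and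
  rationality makes their sum positive although \<open>k\<close> carries no order. To obtain
  rational coefficients, vectors are tested with functionals that are linear over the rational
  numbers only. The height is chosen so that monomials in variables on or above the diagonal, not
  all on it, raise it and their transposes lower it. It depends on the weight alone, so equal
  multiplicities make the same weight \<open>\<nu>\<close> maximal for both representations, and
  both then share the polynomial \<open>s\<close>.\<close>

abbreviation (input) "lookup \<equiv> Poly_Mapping.lookup"
abbreviation (input) "keys \<equiv> Poly_Mapping.keys"
abbreviation (input) "single \<equiv> Poly_Mapping.single"

lemma lookup_map_eq:
  "lookup (Poly_Mapping.map f p) k = (if lookup p k = 0 then 0 else f (lookup p k))"
  by transfer (simp add: when_def)

text \<open>Enlarging the index sets beyond the supports only adds zero terms; this freedom lets
  several products be summed over one common index set.\<close>

lemma lookup_times_sum: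
  fixes f g :: "'m::comm_monoid_add \<Rightarrow>\<^sub>0 'k::comm_semiring_0"
  assumes "finite A" "finite B" "keys f \<subseteq> A" "keys g \<subseteq> B"
  shows "lookup (f * g) k =
    (\<Sum>x\<in>A. \<Sum>y\<in>B. if x + y = k then lookup f x * lookup g y else 0)"
proof -
  have 1: "(\<Sum>q. lookup g q when k = l + q) = (\<Sum>y\<in>B. lookup g y when k = l + y)" for l
    by (rule Sum_any.expand_superset) (use assms in \<open>auto simp: in_keys_iff subset_iff\<close>)
  have "lookup (f * g) k =
     (\<Sum>x\<in>A. lookup f x * (\<Sum>y\<in>B. lookup g y when k = x + y))"
    unfolding lookup_mult 1
    by (rule Sum_any.expand_superset)
      (use assms in_keys_iff mult_zero_left in \<open>fastforce+\<close>)
  also have "\<dots> = (\<Sum>x\<in>A. \<Sum>y\<in>B. if x + y = k then lookup f x * lookup g y else 0)"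
    unfolding sum_distrib_left
    by (intro sum.cong refl) (auto simp: when_def)
  finally show ?thesis .
qed

section \<open>Linear maps between subspaces of the ambient space\<close>

context ambient_vector_space
begin

text \<open>The linearity part of \<open>linear_on\<close> without extensionality, so that
  coefficient operators and maps defined on the whole ambient space can be added and composed
  without restricting them.\<close>

definition lin :: "'v set \<Rightarrow> ('v \<Rightarrow> 'v) \<Rightarrow> bool"
  where "lin V f \<longleftrightarrow> (\<forall>x\<in>V. \<forall>y\<in>V. f (x + y) = f x + f y) \<and> (\<forall>c. \<forall>x\<in>V. f (scale c x) = scale c (f x))"

lemma linI:
  "\<lbrakk>\<And>x y. x \<in> V \<Longrightarrow> y \<in> V \<Longrightarrow> f (x + y) = f x + f y; \<And>c x. x \<in> V \<Longrightarrow> f (scale c x) = scale c (f x)\<rbrakk> \<Longrightarrow> lin V f"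
  by (auto simp: lin_def)

lemma lin_add: "\<lbrakk>lin V f; x \<in> V; y \<in> V\<rbrakk> \<Longrightarrow> f (x + y) = f x + f y"
  and lin_scale: "\<lbrakk>lin V f; x \<in> V\<rbrakk> \<Longrightarrow> f (scale c x) = scale c (f x)"
  by (auto simp: lin_def)

lemma lin_0: "\<lbrakk>lin V f; subspace V\<rbrakk> \<Longrightarrow> f 0 = 0"
  using lin_scale[of V f 0 0] subspace_0 by auto

lemma lin_diff: "\<lbrakk>lin V f; subspace V; x \<in> V; y \<in> V\<rbrakk> \<Longrightarrow> f (x - y) = f x - f y"
  using lin_add[of V f "x - y" y] subspace_diff by (metis diff_add_cancel add_diff_cancel_right')

lemma lin_sum: "\<lbrakk>lin V f; subspace V; \<And>i. i \<in> I \<Longrightarrow> g i \<in> V\<rbrakk> \<Longrightarrow> f (\<Sum>i\<in>I. g i) = (\<Sum>i\<in>I. f (g i))"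
proof (induction I rule: infinite_finite_induct)
  case (insert x F)
  then show ?case by (simp add: lin_add subspace_sum)
qed (auto simp: lin_0)

lemma lin_mono: "\<lbrakk>lin V f; W \<subseteq> V\<rbrakk> \<Longrightarrow> lin W f"
  unfolding lin_def by blast

lemma lin_cong: "\<lbrakk>subspace V; \<And>x. x \<in> V \<Longrightarrow> f x = g x\<rbrakk> \<Longrightarrow> lin V f \<longleftrightarrow> lin V g"
  by (simp add: lin_def subspace_add subspace_scale)

lemma lin_compose: "\<lbrakk>lin V f; lin W g; f ` V \<subseteq> W\<rbrakk> \<Longrightarrow> lin V (\<lambda>x. g (f x))"
  by (auto simp: lin_def image_subset_iff)

lemma lin_plus: "\<lbrakk>lin V f; lin V g\<rbrakk> \<Longrightarrow> lin V (\<lambda>x. f x + g x)"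
  by (auto simp: lin_def scale_right_distrib algebra_simps)

lemma lin_minus: "\<lbrakk>lin V f; lin V g\<rbrakk> \<Longrightarrow> lin V (\<lambda>x. f x - g x)"
  by (auto simp: lin_def scale_right_diff_distrib algebra_simps)

lemma lin_cmult: "lin V f \<Longrightarrow> lin V (\<lambda>x. scale c (f x))"
  by (auto simp: lin_def scale_right_distrib scale_left_commute)

lemma lin_zero: "lin V (\<lambda>x. 0)"
  by (auto simp: lin_def)

lemma lin_ident: "lin V (\<lambda>x. x)"
  by (auto simp: lin_def)

lemma lin_setsum: "(\<And>i. i \<in> I \<Longrightarrow> lin V (f i)) \<Longrightarrow> lin V (\<lambda>x. \<Sum>i\<in>I. f i x)"
proof (induction I rule: infinite_finite_induct)
  case (insert x F)
  then show ?case by (simp add: lin_plus)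
qed (auto simp: lin_zero)

lemma subspace_lin_image: "\<lbrakk>lin V f; subspace V\<rbrakk> \<Longrightarrow> subspace (f ` V)"
  unfolding subspace_def
proof (intro conjI ballI allI)
  assume a: "lin V f" "0 \<in> V \<and> (\<forall>x\<in>V. \<forall>y\<in>V. x + y \<in> V) \<and> (\<forall>c. \<forall>x\<in>V. scale c x \<in> V)"
  then have "subspace V" by (simp add: subspace_def)
  show "0 \<in> f ` V" using lin_0[OF a(1) \<open>subspace V\<close>] a(2) by (metis imageI)
  fix x assume "x \<in> f ` V"
  then obtain x' where x: "x = f x'" "x' \<in> V" by auto
  show "scale c x \<in> f ` V" for c
    using a x lin_scale[OF a(1) x(2)] by (metis imageI)
  fix y assume "y \<in> f ` V"
  then obtain y' where y: "y = f y'" "y' \<in> V" by auto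
  show "x + y \<in> f ` V"
    using a x y lin_add[OF a(1) x(2) y(2)] by (metis imageI)
qed

text \<open>The step also provides \<open>y \<in> span S\<close>: a map that is linear only on the
  span cannot be expanded at \<open>c *s x + y\<close> without it.\<close>

lemma span_induct_step [consumes 1, case_names base step]:
  assumes "x \<in> span S" "P 0" "\<And>c x y. \<lbrakk>x \<in> S; y \<in> span S; P y\<rbrakk> \<Longrightarrow> P (c *s x + y)"
  shows "P x"
proof -
  have "x \<in> span S \<and> P x"
    using assms(1)
    by (induction rule: span_induct_alt) (auto intro: assms span_zero span_add span_scale span_base)
  then show ?thesis ..
qed

lemma lin_image_span: 
  assumes "lin (span B) f" 
  shows "f ` span B = span (f ` B)"
proof
  show "span (f ` B) \<subseteq> f ` span B"
    using assms by (intro span_minimal image_mono span_superset subspace_lin_image) auto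
  have "f x \<in> span (f ` B)" if "x \<in> span B" for x
    using that
  proof (induction rule: span_induct_step)
    case base
    have "f 0 = 0" using assms lin_0 by blast
    then show ?case using span_zero by simp
  next
    case (step c x y)
    then have "f (scale c x + y) = scale c (f x) + f y"
      using assms by (simp add: lin_add lin_scale span_base span_scale)
    then show ?case using step by (simp add: span_add span_base span_scale)
  qed
  then show "f ` span B \<subseteq> span (f ` B)" by auto
qed

lemma lin_eq_on_span:
  assumes "lin (span B) f" "lin (span B) g" "\<And>x. x \<in> B \<Longrightarrow> f x = g x" "x \<in> span B"
  shows "f x = g x"
  using assms(4)
proof (induction rule: span_induct_step)
  case base
  then show ?case using assms lin_0 by (metis subspace_span)
next
  case (step c x y)
  then show ?case 
    using assms by (simp add: lin_add lin_scale span_base span_scale)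
qed

lemma independent_extend:
  assumes "independent B"
  shows "\<exists>g. lin UNIV g \<and> (\<forall>x\<in>B. g x = f x) \<and> range g \<subseteq> span (f ` B)"
proof -
  interpret vector_space_pair scale scale by unfold_locales
  obtain g where g: "Vector_Spaces.linear scale scale g" "\<forall>x\<in>B. g x = f x" "range g = span (f ` B)"
    using linear_independent_extend_subspace[OF assms, of f] by auto
  then have "lin UNIV g"
    by (intro linI) (auto simp: linear_add linear_scale)
  with g show ?thesis by blast
qed

lemma fin_dim_basis:
  assumes "subspace V" "finite B" "span B = V"
  obtains A where "finite A" "independent A" "span A = V"
proof -
  obtain A where A: "A \<subseteq> V" "independent A" "V \<subseteq> span A"
    using maximal_independent_subset[of V] by blast
  have "finite A" using independent_span_bound[OF assms(2) A(2)] A assms by auto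
  then show ?thesis using A assms that by (metis span_subspace)
qed

lemma fin_dim_subset:
  assumes "finite B" "subspace W" "W \<subseteq> span B"
  obtains A where "finite A" "independent A" "span A = W"
proof -
  obtain A where A: "A \<subseteq> W" "independent A" "W \<subseteq> span A"
    using maximal_independent_subset[of W] by blast
  have "finite A" using independent_span_bound[OF assms(1) A(2)] A assms by auto
  then show ?thesis using A assms that by (metis span_subspace)
qed

end

context ambient_vector_space
begin

lemma linear_on_iff: "linear_on V scale f \<longleftrightarrow> f \<in> extensional V \<and> lin V f"
  by (auto simp: linear_on_def lin_def)

lemma fin_dimE:
  assumes "fin_dim_subspace V"
  obtains A where "finite A" "independent A" "span A = V"
  using assms fin_dim_basis unfolding fin_dim_subspace_def by metis

lemma fin_dimI: "finite B \<Longrightarrow> fin_dim_subspace (span B)"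
  by (auto simp: fin_dim_subspace_def)

lemma fin_dim_subspaceI: "fin_dim_subspace V \<Longrightarrow> subspace V"
  by (auto simp: fin_dim_subspace_def)

lemma fin_dim_sub: "\<lbrakk>fin_dim_subspace V; subspace W; W \<subseteq> V\<rbrakk> \<Longrightarrow> fin_dim_subspace W"
  by (metis fin_dim_subspace_def fin_dim_subset)

lemma fin_dim_image: "\<lbrakk>fin_dim_subspace V; lin V f\<rbrakk> \<Longrightarrow> fin_dim_subspace (f ` V)"
  by (metis fin_dim_subspace_def lin_image_span finite_imageI subspace_span)

text \<open>Infinite dimension enters here: a basis of the ambient space extending \<open>A\<close>
  is infinite, so any number of further independent vectors is available for direct sums and tensor
  products.\<close>

lemma exists_room:
  assumes "finite A" "independent A"
  shows "\<exists>C. finite C \<and> card C = n \<and> A \<inter> C = {} \<and> independent (A \<union> C)"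
proof -
  let ?E = "extend_basis A"
  have E: "A \<subseteq> ?E" "independent ?E" "span ?E = UNIV"
    using extend_basis_superset[OF assms(2)] independent_extend_basis[OF assms(2)] span_extend_basis[OF assms(2)] by auto
  have "infinite ?E" using infinite_dimensional E by auto
  then have "infinite (?E - A)" using assms by auto
  then obtain C where C: "C \<subseteq> ?E - A" "finite C" "card C = n"
    using infinite_arbitrarily_large by blast
  then have "independent (A \<union> C)" using E independent_mono by (metis Diff_subset Un_subset_iff subset_trans)
  then show ?thesis using C by blast
qed

text \<open>Fresh independent vectors, one for each basis vector of \<open>W\<close>, carry a copy
  \<open>j W\<close> of \<open>W\<close> that is independent of \<open>V\<close>. The sum
  \<open>V + j W\<close> is then direct and serves as the underlying space of a biproduct;
  \<open>j'\<close> is its projection onto \<open>W\<close>.\<close>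

lemma exists_disjoint_copy:
  assumes "fin_dim_subspace V" "fin_dim_subspace W"
  shows "\<exists>j j'. lin UNIV j \<and> lin UNIV j' \<and> (\<forall>w\<in>W. j' (j w) = w) \<and> V \<inter> j ` W = {0} \<and> (\<forall>v\<in>V. j' v = 0) \<and> fin_dim_subspace {v + j w | v w. v \<in> V \<and> w \<in> W}"
proof -
  obtain A where A: "finite A" "independent A" "span A = V" using fin_dimE[OF assms(1)] .
  obtain B where B: "finite B" "independent B" "span B = W" using fin_dimE[OF assms(2)] .
  obtain C where C: "finite C" "card C = card B" "A \<inter> C = {}" "independent (A \<union> C)"
    using exists_room[OF A(1,2)] by blast
  obtain h where h: "bij_betw h B C"
    using B C by (metis bij_betw_iff_card)
  obtain j where j: "lin UNIV j" "\<forall>x\<in>B. j x = h x" 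
    using independent_extend[OF B(2), of h] by auto
  obtain j' where j': "lin UNIV j'" "\<forall>x\<in>A \<union> C. j' x = (if x \<in> A then 0 else inv_into B h x)" 
    using independent_extend[OF C(4), of "\<lambda>x. if x \<in> A then 0 else inv_into B h x"] by auto
  have jB: "j ` B = C" using j h by (metis bij_betw_imp_surj_on image_cong)
  have jb: "j' (j b) = b" if "b \<in> B" for b
  proof -
    have "h b \<in> C" "inv_into B h (h b) = b" using h that by (auto simp: bij_betw_def)
    then show ?thesis using that j j' C by auto
  qed
  have 1: "j' (j w) = w" if "w \<in> W" for w
  proof (rule lin_eq_on_span[of B "\<lambda>w. j' (j w)" "\<lambda>w. w" w])
    show "lin (span B) (\<lambda>w. j' (j w))" using j j' by (auto intro!: linI simp: lin_def)
  qed (use that B jb lin_ident in auto)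
  have 2: "j' v = 0" if "v \<in> V" for v
    using lin_eq_on_span[of A j' "\<lambda>_. 0" v] that A j' lin_zero lin_mono by auto
  have 3: "{v + j w | v w. v \<in> V \<and> w \<in> W} = span (A \<union> C)"
  proof -
    have "j ` W = span C" using lin_image_span[of B j] B j jB lin_mono by blast
    moreover have "{v + j w | v w. v \<in> V \<and> w \<in> W} = {x + y | x y. x \<in> V \<and> y \<in> j ` W}" by blast
    ultimately show ?thesis unfolding span_Un A by simp
  qed
  have 4: "V \<inter> j ` W = {0}"
  proof -
    have "0 \<in> V" using A span_zero by blast
    moreover have "0 \<in> j ` W" using B span_zero lin_0[OF j(1)] by (metis imageI subspace_UNIV)
    moreover have "x = 0" if "x \<in> V" "x \<in> j ` W" for x
      using that 1 2 lin_0[OF j(1)] by (metis imageE subspace_UNIV)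
    ultimately show ?thesis by auto
  qed
  show ?thesis
    using fin_dimI[of "A \<union> C"] A(1) C(1)
    by (intro exI[of _ j] exI[of _ j'] conjI ballI 1 2 4 j(1) j'(1)) (simp_all add: 3)
qed

subsection \<open>Tensor products of finite-dimensional subspaces\<close>

lemma bilinear_on_iff: "bilinear_on V W \<beta> \<longleftrightarrow> (\<forall>v\<in>V. lin W (\<beta> v)) \<and> (\<forall>w\<in>W. lin V (\<lambda>v. \<beta> v w))"
  unfolding bilinear_on_def lin_def by (auto 0 4)

text \<open>The tensor product is realised inside the ambient space: independent vectors
  \<open>h (a, b)\<close>, one for each pair of basis vectors, form its basis, and \<open>t\<close>
  is the bilinear extension of \<open>h\<close>. A bilinear map factors through the linear extension
  of its values on pairs of basis vectors.\<close>

lemma is_tensor_product_exists: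
  assumes "fin_dim_subspace V" "fin_dim_subspace W"
  shows "\<exists>t. is_tensor_product V W t"
proof -
  obtain A where A: "finite A" "independent A" "span A = V" using fin_dimE[OF assms(1)] .
  obtain B where B: "finite B" "independent B" "span B = W" using fin_dimE[OF assms(2)] .
  obtain C where C: "finite C" "card C = card (A \<times> B)" "independent C"
    using exists_room[of "{}" "card (A \<times> B)"] independent_empty by auto
  obtain h where h: "bij_betw h (A \<times> B) C"
    using A B C by (metis bij_betw_iff_card finite_cartesian_product)
  define rA where "rA v a = representation A v a" for v a
  define rB where "rB v a = representation B v a" for v a
  define t where "t v w = (\<Sum>a\<in>A. \<Sum>b\<in>B. scale (rA v a * rB w b) (h (a, b)))" for v w
  have rA: "rA (x + y) a = rA x a + rA y a" "rA (scale c x) a = c * rA x a" if "x \<in> V" "y \<in> V" for x y a c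
    using that A unfolding rA_def by (auto simp: representation_add representation_scale)
  have rB: "rB (x + y) a = rB x a + rB y a" "rB (scale c x) a = c * rB x a" if "x \<in> W" "y \<in> W" for x y a c
    using that B unfolding rB_def by (auto simp: representation_add representation_scale)
  have bil: "bilinear_on V W t"
    unfolding bilinear_on_def t_def
    by (auto simp: rA rB distrib_left distrib_right scale_left_distrib sum.distrib scale_sum_right mult_ac)
  have tab: "t a b = h (a, b)" if "a \<in> A" "b \<in> B" for a b
  proof -
    have "t a b = (\<Sum>a'\<in>A. \<Sum>b'\<in>B. if a' = a \<and> b' = b then h (a, b) else 0)"
      unfolding t_def rA_def rB_def using that A B 
      by (auto simp: representation_basis intro!: sum.cong)
    also have "\<dots> = (\<Sum>a'\<in>A. if a' = a then h (a, b) else 0)"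
      using that B by (intro sum.cong) (auto simp: sum.delta)
    finally show ?thesis using that A by (simp add: sum.delta)
  qed
  have Csub: "C \<subseteq> {t v w | v w. v \<in> V \<and> w \<in> W}"
  proof
    fix c assume "c \<in> C"
    then obtain a b where "a \<in> A" "b \<in> B" "c = h (a, b)" using h by (auto simp: bij_betw_def)
    then show "c \<in> {t v w | v w. v \<in> V \<and> w \<in> W}"
      using tab[of a b] A B span_base by (smt (verit) mem_Collect_eq)
  qed
  have tC: "t v w \<in> span C" for v w
    unfolding t_def using h by (intro span_sum span_scale span_base) (auto simp: bij_betw_def)
  have ps: "pure_span V W t = span C"
    unfolding pure_span_def
    by (intro subset_antisym span_mono Csub span_minimal) (auto simp: tC)
  have expA: "v = (\<Sum>a\<in>A. scale (rA v a) a)" if "v \<in> V" for v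
    using that A sum_representation_eq[OF A(2), of v A] by (simp add: rA_def)
  have expB: "v = (\<Sum>a\<in>B. scale (rB v a) a)" if "v \<in> W" for v
    using that B sum_representation_eq[OF B(2), of v B] by (simp add: rB_def)
  have sV: "subspace V" and sW: "subspace W" using A B by auto
  have ex: "\<exists>!f. linear_on (pure_span V W t) scale f \<and> (\<forall>v\<in>V. \<forall>w\<in>W. f (t v w) = \<beta> v w)" 
    if \<beta>: "bilinear_on V W \<beta>" for \<beta>
  proof -
    have b1: "lin W (\<beta> v)" if "v \<in> V" for v using \<beta> that by (auto simp: bilinear_on_iff)
    have b2: "lin V (\<lambda>v. \<beta> v w)" if "w \<in> W" for w using \<beta> that by (auto simp: bilinear_on_iff)
    obtain g where g: "lin UNIV g" "\<forall>x\<in>C. g x = case_prod \<beta> (inv_into (A \<times> B) h x)" 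
      using independent_extend[OF C(3), of "\<lambda>x. case_prod \<beta> (inv_into (A \<times> B) h x)"] by auto
    have gh: "g (h (a, b)) = \<beta> a b" if "a \<in> A" "b \<in> B" for a b
    proof -
      have "h (a, b) \<in> C" using that h by (auto simp: bij_betw_def)
      then show ?thesis using g that h by (auto simp: bij_betw_def)
    qed
    have gt: "g (t v w) = \<beta> v w" if "v \<in> V" "w \<in> W" for v w
    proof -
      have "\<beta> v w = \<beta> (\<Sum>a\<in>A. scale (rA v a) a) w" using expA that by metis
      also have "\<dots> = (\<Sum>a\<in>A. \<beta> (scale (rA v a) a) w)"
        using A that span_base by (intro lin_sum[OF b2 sV]) (auto intro!: subspace_scale)
      also have "\<dots> = (\<Sum>a\<in>A. scale (rA v a) (\<beta> a w))"
        using A that span_base by (intro sum.cong) (auto intro!: lin_scale[OF b2])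
      also have "\<dots> = (\<Sum>a\<in>A. scale (rA v a) (\<Sum>b\<in>B. scale (rB w b) (\<beta> a b)))"
      proof (intro sum.cong refl arg_cong2[of _ _ _ _ scale])
        fix a assume "a \<in> A" then have a: "a \<in> V" using A span_base by auto
        have "\<beta> a w = \<beta> a (\<Sum>a\<in>B. scale (rB w a) a)" using expB that by metis
        also have "\<dots> = (\<Sum>b\<in>B. \<beta> a (scale (rB w b) b))"
          using B that a span_base by (intro lin_sum[OF b1 sW]) (auto intro!: subspace_scale)
        also have "\<dots> = (\<Sum>b\<in>B. scale (rB w b) (\<beta> a b))"
          using B that a span_base by (intro sum.cong) (auto intro!: lin_scale[OF b1])
        finally show "\<beta> a w = \<dots>" .
      qed
      also have "\<dots> = (\<Sum>a\<in>A. \<Sum>b\<in>B. g (scale (rA v a * rB w b) (h (a, b))))"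
        by (simp add: scale_sum_right gh lin_scale[OF g(1)])
      also have "\<dots> = g (t v w)"
        unfolding t_def by (simp add: lin_sum[OF g(1)])
      finally show ?thesis ..
    qed
    have gg: "lin (pure_span V W t) g" using g lin_mono by blast
    show ?thesis
    proof (rule ex1I[of _ "restrict g (pure_span V W t)"])
      have "lin (pure_span V W t) (restrict g (pure_span V W t))"
        using gg by (subst lin_cong[where g=g]) (auto simp: pure_span_def)
      moreover have "t v w \<in> pure_span V W t" for v w by (simp add: ps tC)
      ultimately show "linear_on (pure_span V W t) scale (restrict g (pure_span V W t)) \<and> (\<forall>v\<in>V. \<forall>w\<in>W. restrict g (pure_span V W t) (t v w) = \<beta> v w)"
        by (simp add: linear_on_iff gt)
    next
      fix f assume f: "linear_on (pure_span V W t) scale f \<and> (\<forall>v\<in>V. \<forall>w\<in>W. f (t v w) = \<beta> v w)"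
      have "f x = g x" if "x \<in> pure_span V W t" for x
      proof (rule lin_eq_on_span[of "{t v w | v w. v \<in> V \<and> w \<in> W}" f g x])
        show "lin (span {t v w | v w. v \<in> V \<and> w \<in> W}) f" "lin (span {t v w | v w. v \<in> V \<and> w \<in> W}) g"
          using f gg by (simp_all add: linear_on_iff pure_span_def)
        show "x \<in> span {t v w | v w. v \<in> V \<and> w \<in> W}" using that by (simp add: pure_span_def)
      qed (use f gt in auto)
      then show "f = restrict g (pure_span V W t)"
        using f by (intro extensionalityI[of _ "pure_span V W t"]) (simp_all add: linear_on_iff)
    qed
  qed
  then show ?thesis using bil unfolding is_tensor_product_def by blast
qed

lemma tensor_is_tensor_product:
  "\<lbrakk>fin_dim_subspace V; fin_dim_subspace W\<rbrakk> \<Longrightarrow> is_tensor_product V W (tensor V W)"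
  unfolding tensor_def using is_tensor_product_exists by (metis someI_ex)

lemma bilinear_tensor: "\<lbrakk>fin_dim_subspace V; fin_dim_subspace W\<rbrakk> \<Longrightarrow> bilinear_on V W (tensor V W)"
  using tensor_is_tensor_product is_tensor_product_def by blast

lemma tensor_lin:
  assumes "fin_dim_subspace V" "fin_dim_subspace W"
  shows "v \<in> V \<Longrightarrow> lin W (tensor V W v)" and "w \<in> W \<Longrightarrow> lin V (\<lambda>v. tensor V W v w)"
  using bilinear_tensor[OF assms] by (auto simp: bilinear_on_iff)

lemma subspace_tensor_space: "subspace (tensor_space V W)"
  by (simp add: tensor_space_def pure_span_def)

lemma tensor_in: "\<lbrakk>v \<in> V; w \<in> W\<rbrakk> \<Longrightarrow> tensor V W v w \<in> tensor_space V W"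
  unfolding tensor_space_def pure_span_def by (intro span_base) auto

lemma tensor_space_eqI:
  assumes "lin (tensor_space V W) f" "lin (tensor_space V W) g"
    "\<And>v w. v \<in> V \<Longrightarrow> w \<in> W \<Longrightarrow> f (tensor V W v w) = g (tensor V W v w)" "x \<in> tensor_space V W"
  shows "f x = g x"
  by (rule lin_eq_on_span[of "{tensor V W v w | v w. v \<in> V \<and> w \<in> W}" f g x])
    (use assms in \<open>auto simp: tensor_space_def pure_span_def\<close>)

text \<open>A scalar is absorbed into the first factor of a pure tensor, so every element of the
  space is a sum of pure tensors and the induction has just these two cases.\<close>

lemma tensor_space_induct [consumes 3, case_names pure add]:
  assumes "x \<in> tensor_space V W" "fin_dim_subspace V" "fin_dim_subspace W"
    and pure: "\<And>v w. v \<in> V \<Longrightarrow> w \<in> W \<Longrightarrow> P (tensor V W v w)"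
    and add: "\<And>x y. x \<in> tensor_space V W \<Longrightarrow> y \<in> tensor_space V W \<Longrightarrow> P x \<Longrightarrow> P y \<Longrightarrow> P (x + y)"
  shows "P x"
proof -
  note sub = fin_dim_subspaceI[OF assms(2)] fin_dim_subspaceI[OF assms(3)]
  have "x \<in> tensor_space V W \<and> P x"
    using assms(1)[unfolded tensor_space_def pure_span_def]
  proof (induction rule: span_induct_step)
    case base
    have "P (tensor V W 0 0)" using sub by (intro pure) (auto simp: subspace_0)
    then show ?case 
      using lin_0[OF tensor_lin(1)[OF assms(2,3), of 0] sub(2)] sub(1)
      by (auto simp: subspace_0 subspace_tensor_space)
  next
    case (step c x y)
    then obtain v w where vw: "v \<in> V" "w \<in> W" "x = tensor V W v w" by auto
    have 1: "scale c x = tensor V W (scale c v) w"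
      using vw lin_scale[OF tensor_lin(2)[OF assms(2,3)]] by auto
    have "P (scale c x)" unfolding 1 using vw sub by (intro pure) (auto simp: subspace_scale)
    moreover have "scale c x \<in> tensor_space V W" 
      unfolding 1 using vw sub by (intro tensor_in) (auto simp: subspace_scale)
    ultimately show ?case using step add by (auto simp: subspace_add subspace_tensor_space)
  qed
  then show ?thesis by simp
qed

lemma tensor_lift:
  assumes "fin_dim_subspace V" "fin_dim_subspace W" "bilinear_on V W \<beta>"
  obtains f where "linear_on (tensor_space V W) scale f" "\<And>v w. v \<in> V \<Longrightarrow> w \<in> W \<Longrightarrow> f (tensor V W v w) = \<beta> v w"
proof -
  have "\<exists>!f. linear_on (pure_span V W (tensor V W)) scale f \<and> (\<forall>v\<in>V. \<forall>w\<in>W. f (tensor V W v w) = \<beta> v w)"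
    using tensor_is_tensor_product[OF assms(1,2)] assms(3) unfolding is_tensor_product_def by simp
  then show ?thesis using that by (auto simp: tensor_space_def)
qed

lemma fin_dim_tensor_space:
  assumes "fin_dim_subspace V" "fin_dim_subspace W"
  shows "fin_dim_subspace (tensor_space V W)"
proof -
  obtain A where A: "finite A" "span A = V" using assms by (auto simp: fin_dim_subspace_def)
  obtain B where B: "finite B" "span B = W" using assms by (auto simp: fin_dim_subspace_def)
  let ?S = "span ((\<lambda>(a, b). tensor V W a b) ` (A \<times> B))"
  have 1: "tensor V W a w \<in> ?S" if a: "a \<in> A" and w: "w \<in> W" for a w
    using w[folded B(2)]
  proof (induction rule: span_induct_step)
    case base
    have "a \<in> V" using a A span_base by auto
    then have "tensor V W a 0 = 0" using lin_0[OF tensor_lin(1)[OF assms]] fin_dim_subspaceI assms by blast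
    then show ?case using span_zero by simp
  next
    case (step c x y)
    have "a \<in> V" using a A span_base by auto
    moreover have "x \<in> W" "y \<in> W" "scale c x \<in> W" using step B span_base span_scale by auto
    ultimately have "tensor V W a (scale c x + y) = scale c (tensor V W a x) + tensor V W a y"
      by (simp add: lin_add[OF tensor_lin(1)[OF assms]] lin_scale[OF tensor_lin(1)[OF assms]])
    moreover have "tensor V W a x \<in> ?S" using a step by (intro span_base) auto
    ultimately show ?case using step by (simp add: span_add span_scale)
  qed
  have 2: "tensor V W v w \<in> ?S" if v: "v \<in> V" and w: "w \<in> W" for v w
    using v[folded A(2)]
  proof (induction rule: span_induct_step)
    case base
    have "tensor V W 0 w = 0" using lin_0[OF tensor_lin(2)[OF assms w]] fin_dim_subspaceI assms by blast
    then show ?case using span_zero by simp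
  next
    case (step c x y)
    have "x \<in> V" "y \<in> V" "scale c x \<in> V" using step A span_base span_scale by auto
    then have "tensor V W (scale c x + y) w = scale c (tensor V W x w) + tensor V W y w"
      by (simp add: lin_add[OF tensor_lin(2)[OF assms w]] lin_scale[OF tensor_lin(2)[OF assms w]])
    then show ?case using step 1 w by (simp add: span_add span_scale)
  qed
  have "tensor_space V W \<subseteq> ?S"
    unfolding tensor_space_def pure_span_def by (rule span_minimal) (use 2 in auto)
  then show ?thesis
    using A(1) B(1) by (intro fin_dim_sub[OF fin_dimI subspace_tensor_space]) simp_all
qed

lemma the_linear_eqI:
  assumes "linear_on V scale f" "P f" "\<And>g. linear_on V scale g \<Longrightarrow> P g \<Longrightarrow> g = f"
  shows "the_linear V P = f"
  unfolding the_linear_def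
proof (rule the_equality)
  show "linear_on V scale f \<and> P f" by (rule conjI[OF assms(1,2)])
next
  fix g assume "linear_on V scale g \<and> P g"
  then show "g = f" using assms(3)[of g] by simp
qed

lemma linear_on_eqI:
  assumes "linear_on V sc f" "linear_on V sc g" "\<And>x. x \<in> V \<Longrightarrow> f x = g x"
  shows "f = g"
proof (rule extensionalityI)
  show "f \<in> extensional V" "g \<in> extensional V"
    using assms(1,2) by (simp_all add: linear_on_def)
qed (rule assms(3))

lemma linear_on_tensor_eqI:
  assumes "linear_on (tensor_space V W) scale f" "linear_on (tensor_space V W) scale g"
    "\<And>v w. v \<in> V \<Longrightarrow> w \<in> W \<Longrightarrow> f (tensor V W v w) = g (tensor V W v w)"
  shows "f = g"
proof (rule linear_on_eqI[OF assms(1,2)])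
  fix x assume "x \<in> tensor_space V W"
  then show "f x = g x"
    using tensor_space_eqI[of V W f g x] assms by (simp add: linear_on_iff)
qed

end

context ambient_vector_space
begin

subsection \<open>Comodules as families of operators\<close>

definition co :: "('m, 'v) comodule \<Rightarrow> 'm \<Rightarrow> 'v \<Rightarrow> 'v"
  where "co a m v = lookup (coaction a v) m"

definition csupp :: "('m, 'v) comodule \<Rightarrow> 'm set"
  where "csupp a = (\<Union>v\<in>vspace a. keys (coaction a v))"

definition mk_comodule :: "'v set \<Rightarrow> ('m \<Rightarrow> 'v \<Rightarrow> 'v) \<Rightarrow> ('m, 'v) comodule"
  where "mk_comodule V r = \<lparr>vspace = V, coaction = (\<lambda>v\<in>V. Abs_poly_mapping (\<lambda>m. r m v))\<rparr>"

text \<open>The comodule axioms in terms of coefficient operators: coassociativity is the comparison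
  of coefficients at \<open>(l, m)\<close>. The set \<open>K\<close> may be larger than the actual
  support, so the support of a constructed comodule does not have to be determined exactly.\<close>

definition action_family :: "('m, 'k) affine_monoid \<Rightarrow> 'v set \<Rightarrow> 'm set \<Rightarrow> ('m \<Rightarrow> 'v \<Rightarrow> 'v) \<Rightarrow> bool"
  where "action_family M V K r \<longleftrightarrow> fin_dim_subspace V \<and> finite K \<and> K \<subseteq> exponents M \<and>
    (\<forall>m. lin V (r m)) \<and> (\<forall>m. \<forall>v\<in>V. r m v \<in> V) \<and> (\<forall>m. \<forall>v\<in>V. m \<notin> K \<longrightarrow> r m v = 0) \<and>
    (\<forall>l m. \<forall>v\<in>V. r l (r m v) = (\<Sum>n\<in>K. lookup (comult M (monomial n)) (l, m) *s r n v)) \<and>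
    (\<forall>v\<in>V. (\<Sum>n\<in>K. counit M (monomial n) *s r n v) = v)"

lemma lookup_scale_poly [simp]: "lookup (scale_poly c F) m = c *s lookup F m"
  by (simp add: scale_poly_def lookup_map_eq)

lemma lookup_pure [simp]: "lookup (pure v p) m = lookup p m *s v"
  by (simp add: pure_def lookup_map_eq)

lemma lookup_id_tensor:
  assumes "finite A" "keys F \<subseteq> A"
  shows "lookup (id_tensor \<phi> F) n =
    (\<Sum>m\<in>A. lookup (\<phi> (monomial m)) n *s lookup F m)"
  unfolding id_tensor_def lookup_sum lookup_pure
  by (rule sum.mono_neutral_left) (use assms in \<open>simp_all add: in_keys_iff\<close>)

lemma id_tensor_functional_eq:
  assumes "finite A" "keys F \<subseteq> A"
  shows "id_tensor_functional \<epsilon> F = (\<Sum>m\<in>A. \<epsilon> (monomial m) *s lookup F m)"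
  unfolding id_tensor_functional_def
  by (rule sum.mono_neutral_left) (use assms in \<open>simp_all add: in_keys_iff\<close>)

text \<open>For \<open>m\<close> outside the support of \<open>F\<close> the left side is zero and
  the right side is a coefficient of \<open>\<rho> 0\<close>; this is where the assumption enters.
  In the pair the exponent of the operator applied last comes first.\<close>

lemma lookup_coaction_tensor_id:
  assumes "\<rho> 0 = 0"
  shows "lookup (coaction_tensor_id \<rho> F) (l, m) = lookup (\<rho> (lookup F m)) l"
proof -
  have 1: "(\<Sum>l'\<in>keys G. lookup (single (l', m') (lookup G l')) (l, m))
      = (if m' = m then lookup G l else 0)" for G :: "'a \<Rightarrow>\<^sub>0 'v" and m'
    by (cases "m' = m") (auto simp: lookup_single when_def in_keys_iff)
  show ?thesis
    unfolding coaction_tensor_id_def lookup_sum 1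
    using assms by (auto simp: sum.delta in_keys_iff)
qed

lemma scale_poly_zero: "scale_poly 0 F = 0"
  by (rule poly_mapping_eqI) simp

text \<open>A linear combination has its support inside the union of the supports of its terms, so a
  finite spanning set of the space bounds the support of the whole coaction.\<close>

lemma finite_csupp:
  assumes "is_comodule M a"
  shows "finite (csupp a)"
proof -
  have lo: "linear_on (vspace a) scale_poly (coaction a)" using assms by (simp add: is_comodule_def)
  obtain B where B: "finite B" "span B = vspace a"
    using assms by (auto simp: is_comodule_def fin_dim_subspace_def)
  have "keys (coaction a v) \<subseteq> (\<Union>b\<in>B. keys (coaction a b))" if "v \<in> span B" for v
    using that
  proof (induction rule: span_induct_step)
    case base
    have "coaction a (0 *s 0) = scale_poly 0 (coaction a 0)"
      using lo B(2) span_zero[of B] unfolding linear_on_def by blast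
    then show ?case by (simp add: scale_poly_zero)
  next
    case (step c x y)
    have "x \<in> vspace a" "y \<in> vspace a" "c *s x \<in> vspace a" using step B span_base span_scale by auto
    then have "coaction a (c *s x + y) = scale_poly c (coaction a x) + coaction a y"
      using lo unfolding linear_on_def by simp
    then have "keys (coaction a (c *s x + y)) \<subseteq> keys (coaction a x) \<union> keys (coaction a y)"
      by (auto simp: in_keys_iff lookup_add)
    then show ?case using step by auto
  qed
  then have "csupp a \<subseteq> (\<Union>b\<in>B. keys (coaction a b))" using B by (auto simp: csupp_def)
  then show ?thesis by (rule finite_subset) (use B in auto)
qed

lemma keys_coaction: "v \<in> vspace a \<Longrightarrow> keys (coaction a v) \<subseteq> csupp a"
  by (auto simp: csupp_def)

lemma comodule_action_family:
  assumes "is_comodule M a"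
  shows "action_family M (vspace a) (csupp a) (co a)"
proof -
  have fd: "fin_dim_subspace (vspace a)" and lo: "linear_on (vspace a) scale_poly (coaction a)"
    and tp: "\<And>v. v \<in> vspace a \<Longrightarrow> coaction a v \<in> tensor_poly (vspace a) (exponents M)"
    and ca: "\<And>v. v \<in> vspace a \<Longrightarrow> coaction_tensor_id (coaction a) (coaction a v) = id_tensor (comult M) (coaction a v)"
    and cu: "\<And>v. v \<in> vspace a \<Longrightarrow> id_tensor_functional (counit M) (coaction a v) = v"
    using assms by (simp_all add: is_comodule_def)
  note fin = finite_csupp[OF assms]
  have l: "lin (vspace a) (co a m)" for m
    using lo by (intro linI) (simp_all add: co_def linear_on_def lookup_add)
  have z: "coaction a 0 = 0"
    using lin_0[OF l fin_dim_subspaceI[OF fd]] by (intro poly_mapping_eqI) (simp add: co_def)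
  have "co a l' (co a m v) = (\<Sum>n\<in>csupp a. lookup (comult M (monomial n)) (l', m) *s co a n v)"
    if "v \<in> vspace a" for l' m v
    using arg_cong[OF ca[OF that], of "\<lambda>F. lookup F (l', m)"]
    unfolding lookup_coaction_tensor_id[where \<rho> = "coaction a", OF z] lookup_id_tensor[OF fin keys_coaction[OF that]] co_def .
  moreover have "(\<Sum>n\<in>csupp a. counit M (monomial n) *s co a n v) = v" if "v \<in> vspace a" for v
    using cu[OF that] unfolding id_tensor_functional_eq[OF fin keys_coaction[OF that]] co_def .
  moreover have "csupp a \<subseteq> exponents M" "\<forall>m. \<forall>v\<in>vspace a. co a m v \<in> vspace a"
    using tp by (auto simp: csupp_def tensor_poly_def co_def)
  moreover have "\<forall>m. \<forall>v\<in>vspace a. m \<notin> csupp a \<longrightarrow> co a m v = 0"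
    by (auto simp: csupp_def co_def in_keys_iff)
  ultimately show ?thesis using fd fin l by (simp add: action_family_def)
qed

lemma vspace_mk_comodule [simp]: "vspace (mk_comodule V r) = V"
  by (simp add: mk_comodule_def)

lemma action_family_finite: "\<lbrakk>action_family M V K r; v \<in> V\<rbrakk> \<Longrightarrow> finite {m. r m v \<noteq> 0}"
  by (rule finite_subset[of _ K]) (auto simp: action_family_def)

lemma co_mk_comodule:
  "\<lbrakk>action_family M V K r; v \<in> V\<rbrakk> \<Longrightarrow> co (mk_comodule V r) m v = r m v"
  using lookup_Abs_poly_mapping[OF action_family_finite[of M V K r v]] by (simp add: mk_comodule_def co_def)

lemma csupp_mk_comodule:
  assumes "action_family M V K r"
  shows "csupp (mk_comodule V r) \<subseteq> K"
proof
  fix m assume "m \<in> csupp (mk_comodule V r)"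
  then obtain v where v: "v \<in> V" "co (mk_comodule V r) m v \<noteq> 0"
    by (auto simp: csupp_def in_keys_iff co_def)
  then have "r m v \<noteq> 0" using co_mk_comodule[OF assms] by simp
  then show "m \<in> K" using assms v unfolding action_family_def by blast
qed

lemma is_comodule_mk_comodule:
  assumes "action_family M V K r"
  shows "is_comodule M (mk_comodule V r)"
proof -
  let ?a = "mk_comodule V r"
  have fd: "fin_dim_subspace V" and fin: "finite K" and KM: "K \<subseteq> exponents M" and l: "\<And>m. lin V (r m)"
    and rV: "\<And>m v. v \<in> V \<Longrightarrow> r m v \<in> V" and K: "\<And>m v. v \<in> V \<Longrightarrow> m \<notin> K \<Longrightarrow> r m v = 0"
    and ca: "\<And>l m v. v \<in> V \<Longrightarrow> r l (r m v) = (\<Sum>n\<in>K. lookup (comult M (monomial n)) (l, m) *s r n v)"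
    and cu: "\<And>v. v \<in> V \<Longrightarrow> (\<Sum>n\<in>K. counit M (monomial n) *s r n v) = v"
    using assms unfolding action_family_def by auto
  have sub: "subspace V" using fd by (rule fin_dim_subspaceI)
  have lk: "lookup (coaction ?a v) m = r m v" if "v \<in> V" for v m
    using co_mk_comodule[OF assms that] by (simp add: co_def)
  have ks: "keys (coaction ?a v) \<subseteq> K" if "v \<in> V" for v
    using K[OF that] lk[OF that] by (metis in_keys_iff subsetI)
  have "linear_on V scale_poly (coaction ?a)"
    unfolding linear_on_def
  proof (intro conjI ballI allI)
    show "coaction ?a \<in> extensional V" by (simp add: mk_comodule_def)
    fix x assume x: "x \<in> V"
    show "coaction ?a (c *s x) = scale_poly c (coaction ?a x)" for c
      using x sub by (intro poly_mapping_eqI) (simp add: lk subspace_scale lin_scale[OF l])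
    fix y assume y: "y \<in> V"
    show "coaction ?a (x + y) = coaction ?a x + coaction ?a y"
      using x y sub by (intro poly_mapping_eqI) (simp add: lk lookup_add subspace_add lin_add[OF l])
  qed
  moreover have "coaction ?a v \<in> tensor_poly V (exponents M)" if "v \<in> V" for v
    using ks[OF that] KM rV[OF that] lk[OF that] by (auto simp: tensor_poly_def)
  moreover have z: "coaction ?a 0 = 0"
    using lk[of 0] sub lin_0[OF l] by (intro poly_mapping_eqI) (simp add: subspace_0)
  have "coaction_tensor_id (coaction ?a) (coaction ?a v) = id_tensor (comult M) (coaction ?a v)" if "v \<in> V" for v
  proof (rule poly_mapping_eqI)
    fix lm :: "'a \<times> 'a"
    obtain l' m where lm: "lm = (l', m)" by (cases lm)
    show "lookup (coaction_tensor_id (coaction ?a) (coaction ?a v)) lm =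
      lookup (id_tensor (comult M) (coaction ?a v)) lm"
      unfolding lm lookup_coaction_tensor_id[where \<rho> = "coaction ?a", OF z] lookup_id_tensor[OF fin ks[OF that]]
      using that by (simp add: lk rV ca)
  qed
  moreover have "id_tensor_functional (counit M) (coaction ?a v) = v" if "v \<in> V" for v
    unfolding id_tensor_functional_eq[OF fin ks[OF that]] using that by (simp add: lk cu)
  ultimately show ?thesis using fd by (simp add: is_comodule_def)
qed

lemma comodule_fin_dim: "is_comodule M a \<Longrightarrow> fin_dim_subspace (vspace a)"
  by (simp add: is_comodule_def)

lemma comodule_subspace: "is_comodule M a \<Longrightarrow> subspace (vspace a)"
  by (rule fin_dim_subspaceI[OF comodule_fin_dim])

lemma co_lin: "is_comodule M a \<Longrightarrow> lin (vspace a) (co a m)"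
  and co_in: "\<lbrakk>is_comodule M a; v \<in> vspace a\<rbrakk> \<Longrightarrow> co a m v \<in> vspace a"
  and co_coassoc: "\<lbrakk>is_comodule M a; v \<in> vspace a\<rbrakk> \<Longrightarrow> co a l (co a m v) =
    (\<Sum>n\<in>csupp a. lookup (comult M (monomial n)) (l, m) *s co a n v)"
  and co_counit: "\<lbrakk>is_comodule M a; v \<in> vspace a\<rbrakk> \<Longrightarrow>
    (\<Sum>n\<in>csupp a. counit M (monomial n) *s co a n v) = v"
  and csupp_exponents: "is_comodule M a \<Longrightarrow> csupp a \<subseteq> exponents M"
  using comodule_action_family[of M a] by (simp_all add: action_family_def)

lemma co_outside: "\<lbrakk>v \<in> vspace a; m \<notin> csupp a\<rbrakk> \<Longrightarrow> co a m v = 0"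
  by (auto simp: csupp_def co_def in_keys_iff)

lemma comodule_eqI:
  assumes "is_comodule M a" "is_comodule M b" "vspace a = vspace b"
    "\<And>m v. v \<in> vspace a \<Longrightarrow> co a m v = co b m v"
  shows "a = b"
proof -
  have "coaction a \<in> extensional (vspace a)" "coaction b \<in> extensional (vspace a)"
    using assms(1-3) by (simp_all add: is_comodule_def linear_on_def)
  then have "coaction a = coaction b"
  proof (rule extensionalityI)
    fix v assume "v \<in> vspace a"
    then show "coaction a v = coaction b v" using assms(4) by (intro poly_mapping_eqI) (simp add: co_def)
  qed
  then show ?thesis using assms(3) by simp
qed

text \<open>\<open>Poly_Mapping.map f\<close> keeps zero coefficients at zero, which agrees with
  applying \<open>f\<close> because \<open>f 0 = 0\<close>; comparing coefficients therefore yields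
  one commutation relation for each exponent.\<close>

lemma is_comodule_map_iff:
  assumes "is_comodule M a" "is_comodule M b"
  shows "is_comodule_map a b f \<longleftrightarrow> f \<in> extensional (vspace a) \<and> lin (vspace a) f \<and>
    (\<forall>v\<in>vspace a. f v \<in> vspace b) \<and> (\<forall>m. \<forall>v\<in>vspace a. co b m (f v) = f (co a m v))"
proof -
  have 1: "coaction b (f v) = Poly_Mapping.map f (coaction a v) \<longleftrightarrow> (\<forall>m. co b m (f v) = f (co a m v))"
    if "lin (vspace a) f" "v \<in> vspace a" for v
  proof -
    have "f 0 = 0" using lin_0[OF that(1)] comodule_subspace[OF assms(1)] by simp
    then have "lookup (Poly_Mapping.map f (coaction a v)) m = f (co a m v)" for m
      by (simp add: lookup_map_eq co_def)
    then show ?thesis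
      by (simp add: poly_mapping_eq_iff fun_eq_iff co_def[of b])
  qed
  show ?thesis
    unfolding is_comodule_map_def linear_on_iff using 1 by blast
qed

end

section \<open>Unit and tensor product of comodules over a bialgebra with monomial basis\<close>

locale bialgebra_reps = ambient_vector_space scale
  for scale :: "'k::field \<Rightarrow> 'v::ab_group_add \<Rightarrow> 'v"  (infixr "*s" 75) +
  fixes M :: "('m::comm_monoid_add, 'k) affine_monoid"
  assumes exponents_0: "0 \<in> exponents M"
    and exponents_add: "\<lbrakk>p \<in> exponents M; q \<in> exponents M\<rbrakk> \<Longrightarrow> p + q \<in> exponents M"
    and comult_0: "comult M (monomial 0) = monomial 0"
    and comult_add: "comult M (monomial (p + q)) = comult M (monomial p) * comult M (monomial q)"
    and counit_0: "counit M (monomial 0) = 1"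
    and counit_add: "counit M (monomial (p + q)) = counit M (monomial p) * counit M (monomial q)"
begin

lemma unit_action_family:
  "action_family M (span {unit_vector}) {0} (\<lambda>m v. if m = 0 then v else 0)"
  unfolding action_family_def
  using exponents_0 comult_0 counit_0
  by (auto simp: lookup_one lookup_single when_def zero_prod_def fin_dimI span_zero intro!: linI)

lemma unit_comodule_eq:
  "unit_comodule = mk_comodule (span {unit_vector}) (\<lambda>m::'m. \<lambda>v. if m = 0 then v else 0)"
proof -
  have "single 0 v = Abs_poly_mapping (\<lambda>m::'m. if m = 0 then v else 0)"
    if "v \<in> span {unit_vector}" for v
    by (rule poly_mapping_eqI)
      (simp add: lookup_Abs_poly_mapping[OF action_family_finite[OF unit_action_family that]] lookup_single when_def)
  then show ?thesis by (auto simp: unit_comodule_def mk_comodule_def intro!: restrict_ext)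
qed

lemma is_comodule_unit: "is_comodule M unit_comodule"
  unfolding unit_comodule_eq by (rule is_comodule_mk_comodule[OF unit_action_family])

lemma co_unit: "v \<in> span {unit_vector} \<Longrightarrow> co unit_comodule (m::'m) v = (if m = 0 then v else 0)"
  unfolding unit_comodule_eq using co_mk_comodule[OF unit_action_family] by simp

lemma vspace_unit [simp]: "vspace unit_comodule = span {unit_vector}"
  by (simp add: unit_comodule_def)

text \<open>The coefficient at \<open>n\<close> of the diagonal coaction on a pure tensor, kept as a
  function of two arguments so that its bilinearity allows it to be lifted to the tensor
  space.\<close>

definition tensor_co :: "('m, 'v) comodule \<Rightarrow> ('m, 'v) comodule \<Rightarrow> 'm \<Rightarrow> 'v \<Rightarrow> 'v \<Rightarrow> 'v"
  where "tensor_co a b n v w = (\<Sum>p\<in>csupp a. \<Sum>q\<in>csupp b.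
    if p + q = n then tensor (vspace a) (vspace b) (co a p v) (co b q w) else 0)"

context
  fixes a b :: "('m, 'v) comodule"
  assumes a: "is_comodule M a" and b: "is_comodule M b"
begin

private abbreviation "V \<equiv> vspace a"
private abbreviation "W \<equiv> vspace b"
private abbreviation "t \<equiv> tensor V W"

private lemma fV: "fin_dim_subspace V" and fW: "fin_dim_subspace W" and sV: "subspace V" and sW: "subspace W"
  using a b comodule_fin_dim comodule_subspace by auto

private lemmas tl = tensor_lin(1)[OF fV fW] and tr = tensor_lin(2)[OF fV fW]
private lemmas t_0r = lin_0[OF tl sW] and t_0l = lin_0[OF tr sV]

text \<open>Operators outside the supports vanish and the tensor is bilinear, so larger index sets
  are allowed; this makes the sums for different comodules comparable term by term.\<close>

lemma tensor_co_superset: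
  assumes "finite A" "csupp a \<subseteq> A" "finite B" "csupp b \<subseteq> B" "v \<in> V" "w \<in> W"
  shows "tensor_co a b n v w = (\<Sum>p\<in>A. \<Sum>q\<in>B. if p + q = n then t (co a p v) (co b q w) else 0)"
proof -
  have "tensor_co a b n v w = (\<Sum>p\<in>csupp a. \<Sum>q\<in>B. if p + q = n then t (co a p v) (co b q w) else 0)"
    unfolding tensor_co_def using assms a b
    by (intro sum.cong refl sum.mono_neutral_left) (auto simp: co_outside t_0r co_in)
  also have "\<dots> = (\<Sum>p\<in>A. \<Sum>q\<in>B. if p + q = n then t (co a p v) (co b q w) else 0)"
    using assms a b
    by (intro sum.mono_neutral_left) (auto simp: co_outside t_0l co_in intro!: sum.neutral)
  finally show ?thesis .
qed

private lemma bilinear_tensor_co: "bilinear_on V W (tensor_co a b n)"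
  unfolding bilinear_on_iff tensor_co_def
proof (intro conjI ballI lin_setsum)
  fix v p q assume v: "v \<in> V"
  have "lin W (\<lambda>w. t (co a p v) (co b q w))"
    by (rule lin_compose[OF co_lin[OF b] tl[OF co_in[OF a v]]]) (auto simp: co_in[OF b])
  then show "lin W (\<lambda>w. if p + q = n then t (co a p v) (co b q w) else 0)"
    by (cases "p + q = n") (simp_all add: lin_zero)
next
  fix w p q assume w: "w \<in> W"
  have "lin V (\<lambda>v. t (co a p v) (co b q w))"
    by (rule lin_compose[OF co_lin[OF a] tr[OF co_in[OF b w]]]) (auto simp: co_in[OF a])
  then show "lin V (\<lambda>v. if p + q = n then t (co a p v) (co b q w) else 0)"
    by (cases "p + q = n") (simp_all add: lin_zero)
qed

private definition "r n = (SOME f. linear_on (tensor_space V W) scale f \<and>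
   (\<forall>v\<in>V. \<forall>w\<in>W. f (t v w) = tensor_co a b n v w))"

private lemma r: "linear_on (tensor_space V W) scale (r n) \<and> (\<forall>v\<in>V. \<forall>w\<in>W. r n (t v w) = tensor_co a b n v w)"
proof -
  obtain f where "linear_on (tensor_space V W) scale f" "\<And>v w. v \<in> V \<Longrightarrow> w \<in> W \<Longrightarrow> f (t v w) = tensor_co a b n v w"
    using tensor_lift[OF fV fW bilinear_tensor_co] by blast
  then have "\<exists>f. linear_on (tensor_space V W) scale f \<and> (\<forall>v\<in>V. \<forall>w\<in>W. f (t v w) = tensor_co a b n v w)"
    by blast
  from someI_ex[OF this] show ?thesis unfolding r_def .
qed

private lemma r_lin: "lin (tensor_space V W) (r n)" and r_ext: "r n \<in> extensional (tensor_space V W)"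
  and r_pure: "v \<in> V \<Longrightarrow> w \<in> W \<Longrightarrow> r n (t v w) = tensor_co a b n v w"
  using r[of n] by (simp_all add: linear_on_iff)

private definition "K = (\<lambda>(p, q). p + q) ` (csupp a \<times> csupp b)"

private lemma finK: "finite K"
  using finite_csupp[OF a] finite_csupp[OF b] by (simp add: K_def)

text \<open>Each pair \<open>(p, q)\<close> contributes to the single exponent
  \<open>k = p + q\<close>.\<close>

private lemma sum_K: 
  "(\<Sum>k\<in>K. c k *s tensor_co a b k v w) = (\<Sum>p\<in>csupp a. \<Sum>q\<in>csupp b. c (p + q) *s t (co a p v) (co b q w))"
proof -
  have "(\<Sum>k\<in>K. c k *s tensor_co a b k v w) =
     (\<Sum>k\<in>K. \<Sum>p\<in>csupp a. \<Sum>q\<in>csupp b. if p + q = k then c k *s t (co a p v) (co b q w) else 0)"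
    unfolding tensor_co_def by (simp add: scale_sum_right if_distrib[of "\<lambda>x. c _ *s x"] cong: if_cong)
  also have "\<dots> = (\<Sum>p\<in>csupp a. \<Sum>k\<in>K. \<Sum>q\<in>csupp b. if p + q = k then c k *s t (co a p v) (co b q w) else 0)"
    by (rule sum.swap)
  also have "\<dots> = (\<Sum>p\<in>csupp a. \<Sum>q\<in>csupp b. \<Sum>k\<in>K. if p + q = k then c k *s t (co a p v) (co b q w) else 0)"
    by (intro sum.cong refl sum.swap)
  also have "\<dots> = (\<Sum>p\<in>csupp a. \<Sum>q\<in>csupp b. c (p + q) *s t (co a p v) (co b q w))"
    using finK by (intro sum.cong refl) (auto simp: sum.delta' K_def)
  finally show ?thesis .
qed

private lemma tensor_co_in: "\<lbrakk>v \<in> V; w \<in> W\<rbrakk> \<Longrightarrow> tensor_co a b n v w \<in> tensor_space V W"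
  unfolding tensor_co_def 
  by (intro subspace_sum subspace_tensor_space) (auto simp: subspace_0 subspace_tensor_space intro!: tensor_in co_in[OF a] co_in[OF b])

private lemmas T_induct = tensor_space_induct[OF _ fV fW, consumes 1, case_names pure add]

private lemma r_in: "x \<in> tensor_space V W \<Longrightarrow> r n x \<in> tensor_space V W"
  by (induction x rule: T_induct)
    (simp_all add: r_pure tensor_co_in lin_add[OF r_lin] subspace_add subspace_tensor_space)

text \<open>Coassociativity of both factors expresses the composite through products of a
  coefficient of the comultiplication of \<open>n\<close> with one of \<open>n'\<close>. Since
  comultiplication is multiplicative, the sum of these products with total exponents
  \<open>l\<close> and \<open>m\<close> is its coefficient at \<open>(l, m)\<close> for
  \<open>n + n'\<close>.\<close>

private lemma r_coassoc_pure:
  assumes v: "v \<in> V" and w: "w \<in> W"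
  shows "r l (r m (t v w)) = (\<Sum>n\<in>K. lookup (comult M (monomial n)) (l, m) *s r n (t v w))"
proof -
  define D where "D n = comult M (monomial n)" for n
  \<comment> \<open>All exponents occurring in a component of the comultiplication of some
    \<open>n\<close> in \<open>csupp a\<close> are included, so \<open>p\<close> and
    \<open>p'\<close> range over one set that contains the support of each convolution
    factor.\<close>
  define A where "A = csupp a \<union> (\<Union>n\<in>csupp a. fst ` keys (D n) \<union> snd ` keys (D n))"
  define B where "B = csupp b \<union> (\<Union>n\<in>csupp b. fst ` keys (D n) \<union> snd ` keys (D n))"
  have A: "finite A" "csupp a \<subseteq> A" using finite_csupp[OF a] by (auto simp: A_def)
  have B: "finite B" "csupp b \<subseteq> B" using finite_csupp[OF b] by (auto simp: B_def)
  have kA: "keys (D n) \<subseteq> A \<times> A" if "n \<in> csupp a" for n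
    using that by (force simp: A_def)
  have kB: "keys (D n) \<subseteq> B \<times> B" if "n \<in> csupp b" for n
    using that by (force simp: B_def)
  note sup = tensor_co_superset[OF A B]
  \<comment> \<open>The common summand of a sixfold sum. The reordering below pairs
    \<open>p'\<close> with \<open>p\<close> and \<open>q'\<close> with \<open>q\<close>, which are
    the index pairs of the two comultiplications.\<close>
  define X where "X = (\<lambda>p q p' q' n n'. if p' + q' = l \<and> p + q = m then
     (lookup (D n) (p', p) * lookup (D n') (q', q)) *s t (co a n v) (co b n' w) else 0)"
  have 1: "t (co a p' (co a p v)) (co b q' (co b q w)) =
     (\<Sum>n\<in>csupp a. \<Sum>n'\<in>csupp b. (lookup (D n) (p', p) * lookup (D n') (q', q)) *s t (co a n v) (co b n' w))"
    for p p' q q'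
  proof -
    have "t (co a p' (co a p v)) (co b q' (co b q w)) = 
      (\<Sum>n\<in>csupp a. t (lookup (D n) (p', p) *s co a n v) (co b q' (co b q w)))"
      unfolding co_coassoc[OF a v] D_def
      by (rule lin_sum[OF tr sV]) (auto simp: co_in[OF b] co_in[OF a] v w subspace_scale[OF sV])
    also have "\<dots> = (\<Sum>n\<in>csupp a. lookup (D n) (p', p) *s t (co a n v) (co b q' (co b q w)))"
      by (intro sum.cong refl lin_scale[OF tr]) (auto simp: co_in[OF b] co_in[OF a] v w)
    also have "\<dots> = (\<Sum>n\<in>csupp a. lookup (D n) (p', p) *s
       (\<Sum>n'\<in>csupp b. t (co a n v) (lookup (D n') (q', q) *s co b n' w)))"
      unfolding co_coassoc[OF b w] D_def[symmetric]
      by (intro sum.cong refl arg_cong2[of _ _ _ _ scale] lin_sum[OF tl sW]) (auto simp: co_in[OF b] co_in[OF a] v w subspace_scale[OF sW])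
    also have "\<dots> = (\<Sum>n\<in>csupp a. lookup (D n) (p', p) *s
       (\<Sum>n'\<in>csupp b. lookup (D n') (q', q) *s t (co a n v) (co b n' w)))"
      by (intro sum.cong refl arg_cong2[of _ _ _ _ scale] lin_scale[OF tl]) (auto simp: co_in[OF b] co_in[OF a] v w)
    finally show ?thesis by (simp add: scale_sum_right)
  qed
  have "r l (r m (t v w)) = (\<Sum>p\<in>A. \<Sum>q\<in>B. if p + q = m then r l (t (co a p v) (co b q w)) else 0)"
    unfolding r_pure[OF v w] sup[OF v w]
    by (subst lin_sum[OF r_lin subspace_tensor_space] |
       auto simp: tensor_in co_in[OF a] co_in[OF b] v w subspace_0[OF subspace_tensor_space] lin_0[OF r_lin subspace_tensor_space]
         intro!: subspace_sum[OF subspace_tensor_space] sum.cong)+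
  also have "\<dots> = (\<Sum>p\<in>A. \<Sum>q\<in>B. \<Sum>p'\<in>A. \<Sum>q'\<in>B. \<Sum>n\<in>csupp a. \<Sum>n'\<in>csupp b. X p q p' q' n n')"
    unfolding X_def
    by (intro sum.cong refl) (auto simp: r_pure sup co_in[OF a] co_in[OF b] v w 1 intro!: sum.cong)
  also have "\<dots> = (\<Sum>n\<in>csupp a. \<Sum>n'\<in>csupp b. \<Sum>x\<in>A \<times> A. \<Sum>y\<in>B \<times> B. X (snd x) (snd y) (fst x) (fst y) n n')"
    unfolding sum.cartesian_product
    by (rule sum.reindex_bij_witness[
        where i = "\<lambda>(n, n', (p', p), (q', q)). (p, q, p', q', n, n')" and
              j = "\<lambda>(p, q, p', q', n, n'). (n, n', (p', p), (q', q))"]) auto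
  also have "\<dots> = (\<Sum>n\<in>csupp a. \<Sum>n'\<in>csupp b. lookup (D (n + n')) (l, m) *s t (co a n v) (co b n' w))"
  proof (intro sum.cong refl)
    fix n n' assume n: "n \<in> csupp a" "n' \<in> csupp b"
    have "lookup (D (n + n')) (l, m) = (\<Sum>x\<in>A \<times> A. \<Sum>y\<in>B \<times> B. if x + y = (l, m) then 
        lookup (D n) x * lookup (D n') y else 0)"
      unfolding D_def comult_add unfolding D_def[symmetric]
      by (rule lookup_times_sum) (use A B n kA kB in auto)
    also have "\<dots> *s t (co a n v) (co b n' w) = (\<Sum>x\<in>A \<times> A. \<Sum>y\<in>B \<times> B. X (snd x) (snd y) (fst x) (fst y) n n')"
      unfolding scale_sum_left by (intro sum.cong refl) (auto simp: X_def)
    finally show "(\<Sum>x\<in>A \<times> A. \<Sum>y\<in>B \<times> B. X (snd x) (snd y) (fst x) (fst y) n n') = 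
       lookup (D (n + n')) (l, m) *s t (co a n v) (co b n' w)" ..
  qed
  also have "\<dots> = (\<Sum>n\<in>K. lookup (D n) (l, m) *s r n (t v w))"
    unfolding r_pure[OF v w] sum_K ..
  finally show ?thesis unfolding D_def .
qed

text \<open>Both factors are expanded by their own counit laws; multiplicativity of the counit
  merges the two coefficients into the one at the sum of the exponents.\<close>

private lemma r_counit_pure:
  assumes v: "v \<in> V" and w: "w \<in> W"
  shows "(\<Sum>n\<in>K. counit M (monomial n) *s r n (t v w)) = t v w"
proof -
  have "t v w = t (\<Sum>n\<in>csupp a. counit M (monomial n) *s co a n v) (\<Sum>n\<in>csupp b. counit M (monomial n) *s co b n w)"
    using co_counit[OF a v] co_counit[OF b w] by simp
  also have "\<dots> = (\<Sum>n\<in>csupp a. t (counit M (monomial n) *s co a n v) (\<Sum>n\<in>csupp b. counit M (monomial n) *s co b n w))"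
    by (rule lin_sum[OF tr sV]) (auto simp: co_in[OF b] co_in[OF a] v w subspace_scale[OF sV] subspace_scale[OF sW] intro!: subspace_sum[OF sW])
  also have "\<dots> = (\<Sum>n\<in>csupp a. counit M (monomial n) *s t (co a n v) (\<Sum>n\<in>csupp b. counit M (monomial n) *s co b n w))"
    by (intro sum.cong refl lin_scale[OF tr]) (auto simp: co_in[OF b] co_in[OF a] v w subspace_scale[OF sW] intro!: subspace_sum[OF sW])
  also have "\<dots> = (\<Sum>n\<in>csupp a. counit M (monomial n) *s (\<Sum>n'\<in>csupp b. t (co a n v) (counit M (monomial n') *s co b n' w)))"
    by (intro sum.cong refl arg_cong2[of _ _ _ _ scale] lin_sum[OF tl sW]) (auto simp: co_in[OF b] co_in[OF a] v w subspace_scale[OF sW])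
  also have "\<dots> = (\<Sum>n\<in>csupp a. counit M (monomial n) *s (\<Sum>n'\<in>csupp b. counit M (monomial n') *s t (co a n v) (co b n' w)))"
    by (intro sum.cong refl arg_cong2[of _ _ _ _ scale] lin_scale[OF tl]) (auto simp: co_in[OF b] co_in[OF a] v w)
  also have "\<dots> = (\<Sum>n\<in>K. counit M (monomial n) *s r n (t v w))"
    unfolding r_pure[OF v w] sum_K by (simp add: scale_sum_right counit_add)
  finally show ?thesis ..
qed

private lemma r_family: "action_family M (tensor_space V W) K r"
  unfolding action_family_def
proof (intro conjI allI ballI impI)
  show "fin_dim_subspace (tensor_space V W)" by (rule fin_dim_tensor_space[OF fV fW])
  show "finite K" by (rule finK)
  show "K \<subseteq> exponents M"
    using csupp_exponents[OF a] csupp_exponents[OF b] exponents_add by (auto simp: K_def)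
  show "lin (tensor_space V W) (r m)" for m by (rule r_lin)
  fix x assume x: "x \<in> tensor_space V W"
  show "r m x \<in> tensor_space V W" for m using x by (rule r_in)
  show "r m x = 0" if "m \<notin> K" for m
    using x
  proof (induction x rule: T_induct)
    case (pure v w)
    have "tensor_co a b m v w = 0"
      unfolding tensor_co_def using that by (intro sum.neutral ballI) (auto simp: K_def)
    then show ?case using pure by (simp add: r_pure)
  next
    case (add x y)
    then show ?case by (simp add: lin_add[OF r_lin])
  qed
  show "r l (r m x) = (\<Sum>n\<in>K. lookup (comult M (monomial n)) (l, m) *s r n x)" for l m
    using x
  proof (induction x rule: T_induct)
    case (pure v w)
    then show ?case by (rule r_coassoc_pure)
  next
    case (add x y)
    then show ?case by (simp add: lin_add[OF r_lin] r_in scale_right_distrib sum.distrib)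
  qed
  show "(\<Sum>n\<in>K. counit M (monomial n) *s r n x) = x"
    using x
  proof (induction x rule: T_induct)
    case (pure v w)
    then show ?case by (rule r_counit_pure)
  next
    case (add x y)
    then show ?case by (simp add: lin_add[OF r_lin] r_in scale_right_distrib sum.distrib)
  qed
qed

text \<open>Shows that the definite description in \<open>tensor_comodule\<close> denotes something:
  the lifted operators have the required values on pure tensors, and any competitor has linear
  coefficient maps, which are determined by these values.\<close>

private lemma tensor_comodule_eq: "tensor_comodule a b = mk_comodule (tensor_space V W) r"
proof -
  let ?T = "tensor_space V W"
  let ?m = "mk_comodule ?T r"
  let ?P = "\<lambda>\<rho>. linear_on ?T scale_poly \<rho> \<and>
      (\<forall>v \<in> V. \<forall>w \<in> W. \<rho> (t v w) =
        (\<Sum>p \<in> keys (coaction a v). \<Sum>q \<in> keys (coaction b w).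
          single (p + q) (t (lookup (coaction a v) p) (lookup (coaction b w) q))))"
  have lk: "lookup (\<Sum>p \<in> keys (coaction a v). \<Sum>q \<in> keys (coaction b w).
          single (p + q) (t (lookup (coaction a v) p) (lookup (coaction b w) q))) n
      = tensor_co a b n v w" if v: "v \<in> V" and w: "w \<in> W" for v w n
  proof -
    have "tensor_co a b n v w = (\<Sum>p\<in>csupp a. \<Sum>q\<in>keys (coaction b w). if p + q = n then t (co a p v) (co b q w) else 0)"
      unfolding tensor_co_def using finite_csupp[OF b] keys_coaction[OF w]
      by (intro sum.cong refl sum.mono_neutral_right) (auto simp: co_def[of b] in_keys_iff t_0r co_in[OF a v])
    also have "\<dots> = (\<Sum>p\<in>keys (coaction a v). \<Sum>q\<in>keys (coaction b w). if p + q = n then t (co a p v) (co b q w) else 0)"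
      using finite_csupp[OF a] keys_coaction[OF v]
      by (intro sum.mono_neutral_right) (auto simp: co_def[of a] in_keys_iff t_0l co_in[OF b w] intro!: sum.neutral)
    finally show ?thesis
      by (simp add: lookup_sum lookup_single when_def co_def cong: if_cong)
  qed
  have m: "is_comodule M ?m" by (rule is_comodule_mk_comodule[OF r_family])
  have "(THE \<rho>. ?P \<rho>) = coaction ?m"
  proof (rule the_equality)
    have "coaction ?m (t v w) = (\<Sum>p \<in> keys (coaction a v). \<Sum>q \<in> keys (coaction b w).
          single (p + q) (t (lookup (coaction a v) p) (lookup (coaction b w) q)))"
      if "v \<in> V" "w \<in> W" for v w
      unfolding poly_mapping_eq_iff fun_eq_iff
      using co_mk_comodule[OF r_family tensor_in[OF that]] lk[OF that] r_pure[OF that] by (simp add: co_def)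
    then show "?P (coaction ?m)" using m by (simp add: is_comodule_def)
  next
    fix \<rho> assume \<rho>: "?P \<rho>"
    show "\<rho> = coaction ?m"
    proof (rule linear_on_eqI)
      show "linear_on ?T scale_poly \<rho>" using \<rho> by simp
      show "linear_on ?T scale_poly (coaction ?m)" using m by (simp add: is_comodule_def)
      fix x assume x: "x \<in> ?T"
      show "\<rho> x = coaction ?m x"
      proof (rule poly_mapping_eqI)
        fix n
        have "lin ?T (\<lambda>x. lookup (\<rho> x) n)"
          using \<rho> by (intro linI) (simp_all add: linear_on_def lookup_add)
        moreover have "lin ?T (co ?m n)" using co_lin[OF m] by simp
        moreover have "lookup (\<rho> (t v w)) n = co ?m n (t v w)" if "v \<in> V" "w \<in> W" for v w
          using \<rho> that lk[OF that] co_mk_comodule[OF r_family tensor_in[OF that]] r_pure[OF that] by simp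
        ultimately have "lookup (\<rho> x) n = co ?m n x"
          using x by (rule tensor_space_eqI)
        then show "lookup (\<rho> x) n = lookup (coaction ?m x) n"
          by (simp add: co_def)
      qed
    qed
  qed
  moreover have "?m = \<lparr>vspace = ?T, coaction = coaction ?m\<rparr>"
    by (simp add: mk_comodule_def)
  ultimately show ?thesis unfolding tensor_comodule_def by simp
qed

lemma is_comodule_tensor: "is_comodule M (tensor_comodule a b)"
  unfolding tensor_comodule_eq by (rule is_comodule_mk_comodule[OF r_family])

lemma co_tensor:
  assumes "v \<in> V" "w \<in> W"
  shows "co (tensor_comodule a b) n (tensor V W v w) = tensor_co a b n v w"
  unfolding tensor_comodule_eq using co_mk_comodule[OF r_family tensor_in[OF assms]] r_pure[OF assms] by simp

end

lemma vspace_tensor [simp]: "vspace (tensor_comodule a b) = tensor_space (vspace a) (vspace b)"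
  by (simp add: tensor_comodule_def)

end

section \<open>Equivariant maps\<close>

context bialgebra_reps
begin

definition chom :: "('m, 'v) comodule \<Rightarrow> ('m, 'v) comodule \<Rightarrow> ('v \<Rightarrow> 'v) \<Rightarrow> bool"
  where "chom a b f \<longleftrightarrow> is_comodule M a \<and> is_comodule M b \<and> is_comodule_map a b f"

lemma chom_iff: "chom a b f \<longleftrightarrow> is_comodule M a \<and> is_comodule M b \<and> f \<in> extensional (vspace a) \<and>
    lin (vspace a) f \<and> (\<forall>v\<in>vspace a. f v \<in> vspace b) \<and> (\<forall>m. \<forall>v\<in>vspace a. co b m (f v) = f (co a m v))"
  using is_comodule_map_iff by (auto simp: chom_def)

lemma chom_dom: "chom a b f \<Longrightarrow> is_comodule M a"
  and chom_cod: "chom a b f \<Longrightarrow> is_comodule M b"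
  and chom_lin: "chom a b f \<Longrightarrow> lin (vspace a) f"
  and chom_in: "\<lbrakk>chom a b f; v \<in> vspace a\<rbrakk> \<Longrightarrow> f v \<in> vspace b"
  and chom_co: "\<lbrakk>chom a b f; v \<in> vspace a\<rbrakk> \<Longrightarrow> co b m (f v) = f (co a m v)"
  and chom_ext: "chom a b f \<Longrightarrow> f \<in> extensional (vspace a)"
  by (simp_all add: chom_iff)

lemma chom_linear_on: "chom a b f \<Longrightarrow> linear_on (vspace a) scale f"
  by (simp add: linear_on_iff chom_lin chom_ext)

lemma chom_eqI: "\<lbrakk>chom a b f; chom a b' g; \<And>v. v \<in> vspace a \<Longrightarrow> f v = g v\<rbrakk> \<Longrightarrow> f = g"
  by (rule linear_on_eqI[OF chom_linear_on chom_linear_on])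

text \<open>Arrows carry extensional functions. Constructions can be given by unrestricted formulas
  and are cut down to the domain at this single place.\<close>

lemma chom_restrictI:
  assumes "is_comodule M a" "is_comodule M b" "lin (vspace a) f" "\<And>v. v \<in> vspace a \<Longrightarrow> f v \<in> vspace b"
    "\<And>m v. v \<in> vspace a \<Longrightarrow> co b m (f v) = f (co a m v)"
  shows "chom a b (restrict f (vspace a))"
proof -
  have "lin (vspace a) (restrict f (vspace a))"
    using assms(3) lin_cong[OF comodule_subspace[OF assms(1)], of "restrict f (vspace a)" f] by simp
  then show ?thesis
    using assms co_in[OF assms(1)] by (simp add: chom_iff)
qed

lemma chom_id: "is_comodule M a \<Longrightarrow> chom a a (\<lambda>v\<in>vspace a. v)"
  by (rule chom_restrictI) (simp_all add: lin_ident)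

lemma chom_compose:
  assumes "chom a b f" "chom b c g"
  shows "chom a c (compose (vspace a) g f)"
  unfolding compose_def
proof (rule chom_restrictI)
  show "lin (vspace a) (\<lambda>x. g (f x))"
    by (rule lin_compose[OF chom_lin[OF assms(1)] chom_lin[OF assms(2)]]) (auto simp: chom_in[OF assms(1)])
qed (use assms in \<open>auto simp: chom_dom chom_cod chom_in chom_co\<close>)

lemma chom_zero: "\<lbrakk>is_comodule M a; is_comodule M b\<rbrakk> \<Longrightarrow> chom a b (\<lambda>v\<in>vspace a. 0)"
  by (rule chom_restrictI) (simp_all add: lin_zero subspace_0 comodule_subspace lin_0[OF co_lin])

lemma chom_add:
  assumes "chom a b f" "chom a b g"
  shows "chom a b (\<lambda>v\<in>vspace a. f v + g v)"
  using assms chom_in[OF assms(1)] chom_in[OF assms(2)]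
  by (intro chom_restrictI)
    (simp_all add: chom_dom chom_cod chom_lin lin_plus subspace_add[OF comodule_subspace[OF chom_cod[OF assms(1)]]]
       lin_add[OF co_lin[OF chom_cod[OF assms(1)]]] chom_co)

lemma chom_scale:
  assumes "chom a b f"
  shows "chom a b (\<lambda>v\<in>vspace a. c *s f v)"
  using assms chom_in[OF assms]
  by (intro chom_restrictI)
    (simp_all add: chom_dom chom_cod chom_lin lin_cmult subspace_scale[OF comodule_subspace[OF chom_cod[OF assms]]]
       lin_scale[OF co_lin[OF chom_cod[OF assms]]] chom_co)

text \<open>A linear inverse of an equivariant map is equivariant, since \<open>w\<close> may be
  replaced by \<open>f (g w)\<close> and \<open>f\<close> commutes with the coefficient operators.
  Isomorphisms of representations can thus be recognised on the underlying spaces.\<close>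

lemma chom_inverse:
  assumes f: "chom a b f" and g: "lin (vspace b) g" "\<And>w. w \<in> vspace b \<Longrightarrow> g w \<in> vspace a"
    and gf: "\<And>v. v \<in> vspace a \<Longrightarrow> g (f v) = v" and fg: "\<And>w. w \<in> vspace b \<Longrightarrow> f (g w) = w"
  shows "chom b a (restrict g (vspace b))"
proof (rule chom_restrictI[OF chom_cod[OF f] chom_dom[OF f] g])
  fix m w assume w: "w \<in> vspace b"
  have "g (co b m w) = g (co b m (f (g w)))" using fg[OF w] by simp
  also have "\<dots> = co a m (g w)"
    using g(2)[OF w] gf by (simp add: chom_co[OF f] co_in[OF chom_dom[OF f]])
  finally show "co a m (g w) = g (co b m w)" ..
qed

subsection \<open>The category of representations\<close>

lemma Rep_simps [simp]:
  "Obj (Rep M) = {a. is_comodule M a}"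
  "Dom (Rep M) = source"
  "Cod (Rep M) = target"
  "Id (Rep M) a = Arrow a (\<lambda>v \<in> vspace a. v) a"
  "Comp (Rep M) (Arrow b' g c) (Arrow a f b) = Arrow a (compose (vspace a) g f) c"
  "Add (Rep M) (Arrow a f b) (Arrow a' g b') = Arrow a (\<lambda>v \<in> vspace a. f v + g v) b"
  "Zero (Rep M) a b = Arrow a (\<lambda>v \<in> vspace a. 0) b"
  "Scale (Rep M) r (Arrow a f b) = Arrow a (\<lambda>v \<in> vspace a. r *s f v) b"
  "TObj (Rep M) = tensor_comodule"
  "TArr (Rep M) (Arrow a f b) (Arrow c g d) = Arrow (tensor_comodule a c)
     (tensor_map (vspace a) (vspace b) (vspace c) (vspace d) f g) (tensor_comodule b d)"
  "Unit (Rep M) = unit_comodule"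
  "Assoc (Rep M) a b c = Arrow (tensor_comodule (tensor_comodule a b) c)
     (associator (vspace a) (vspace b) (vspace c)) (tensor_comodule a (tensor_comodule b c))"
  "LUnit (Rep M) a = Arrow (tensor_comodule unit_comodule a) (left_unitor (vspace a)) a"
  "RUnit (Rep M) a = Arrow (tensor_comodule a unit_comodule) (right_unitor (vspace a)) a"
  "Braid (Rep M) a b = Arrow (tensor_comodule a b) (symmetry (vspace a) (vspace b)) (tensor_comodule b a)"
  by (simp_all add: Rep_def)

lemma Hom_Rep: "f \<in> Hom (Rep M) a b \<longleftrightarrow> (\<exists>g. f = Arrow a g b \<and> chom a b g)"
  by (cases f) (auto simp: Hom_def Rep_def chom_def)

lemma Arr_Rep: "f \<in> Arr (Rep M) \<longleftrightarrow> (\<exists>a b g. f = Arrow a g b \<and> chom a b g)"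
  by (cases f) (auto simp: Rep_def chom_def)

lemma HomE_Rep:
  assumes "f \<in> Hom (Rep M) a b"
  obtains g where "f = Arrow a g b" "chom a b g"
  using assms Hom_Rep by blast

lemma Arrow_in_Hom [simp]: "Arrow a g b \<in> Hom (Rep M) a b \<longleftrightarrow> chom a b g"
  by (simp add: Hom_Rep)

lemma iso_arr_RepI:
  assumes "chom a b f" "chom b a g" "\<And>v. v \<in> vspace a \<Longrightarrow> g (f v) = v" "\<And>w. w \<in> vspace b \<Longrightarrow> f (g w) = w"
  shows "iso_arr (Rep M) (Arrow a f b)"
  unfolding iso_arr_def
proof
  show "Arrow a f b \<in> Arr (Rep M)" using assms(1) by (auto simp: Arr_Rep)
  have "compose (vspace a) g f = (\<lambda>v\<in>vspace a. v)"
    by (rule chom_eqI[OF chom_compose[OF assms(1,2)] chom_id[OF chom_dom[OF assms(1)]]]) (simp add: compose_eq assms)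
  moreover have "compose (vspace b) f g = (\<lambda>v\<in>vspace b. v)"
    by (rule chom_eqI[OF chom_compose[OF assms(2,1)] chom_id[OF chom_dom[OF assms(2)]]]) (simp add: compose_eq assms)
  ultimately show "\<exists>g\<in>Hom (Rep M) (Cod (Rep M) (Arrow a f b)) (Dom (Rep M) (Arrow a f b)).
       Comp (Rep M) g (Arrow a f b) = Id (Rep M) (Dom (Rep M) (Arrow a f b)) \<and>
       Comp (Rep M) (Arrow a f b) g = Id (Rep M) (Cod (Rep M) (Arrow a f b))"
    using assms(2) by (intro bexI[of _ "Arrow b g a"]) simp_all
qed

lemma iso_arr_RepE:
  assumes "iso_arr (Rep M) f"
  obtains a b g h where "f = Arrow a g b" "chom a b g" "chom b a h"
    "\<And>v. v \<in> vspace a \<Longrightarrow> h (g v) = v" "\<And>w. w \<in> vspace b \<Longrightarrow> g (h w) = w"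
proof -
  obtain a b g where f: "f = Arrow a g b" "chom a b g" using assms by (auto simp: iso_arr_def Arr_Rep)
  obtain h' where h': "h' \<in> Hom (Rep M) b a" "Comp (Rep M) h' f = Id (Rep M) a" "Comp (Rep M) f h' = Id (Rep M) b"
    using assms f by (auto simp: iso_arr_def)
  obtain h where h: "h' = Arrow b h a" "chom b a h" using h'(1) by (rule HomE_Rep)
  have "compose (vspace a) h g = (\<lambda>v\<in>vspace a. v)" "compose (vspace b) g h = (\<lambda>v\<in>vspace b. v)"
    using h' f h by auto
  then have "h (g v) = v" if "v \<in> vspace a" for v using that by (metis compose_eq restrict_apply')
  moreover have "g (h w) = w" if "w \<in> vspace b" for w
    using that \<open>compose (vspace b) g h = (\<lambda>v\<in>vspace b. v)\<close> by (metis compose_eq restrict_apply')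
  ultimately show ?thesis using that f h by blast
qed

lemma linear_category_Rep: "linear_category (Rep M)"
proof
  fix f assume "f \<in> Arr (Rep M)"
  then show "Dom (Rep M) f \<in> Obj (Rep M)" "Cod (Rep M) f \<in> Obj (Rep M)"
    by (auto simp: Arr_Rep chom_dom chom_cod)
next
  fix a assume "a \<in> Obj (Rep M)"
  then show "Id (Rep M) a \<in> Hom (Rep M) a a" by (simp add: chom_id)
next
  fix f a b g c assume fg: "f \<in> Hom (Rep M) a b" "g \<in> Hom (Rep M) b c"
  then show "Comp (Rep M) g f \<in> Hom (Rep M) a c"
    by (auto elim!: HomE_Rep simp: chom_compose)
  fix h d assume "h \<in> Hom (Rep M) c d"
  with fg obtain f' g' h' where 1: "f = Arrow a f' b" "chom a b f'" "g = Arrow b g' c" "chom b c g'"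
    "h = Arrow c h' d" "chom c d h'" by (elim HomE_Rep)
  have "compose (vspace a) h' (compose (vspace a) g' f') = compose (vspace a) (compose (vspace b) h' g') f'"
    using chom_in[OF 1(2)] by (auto simp: compose_def fun_eq_iff)
  then show "Comp (Rep M) h (Comp (Rep M) g f) = Comp (Rep M) (Comp (Rep M) h g) f"
    using 1 by simp
next
  fix f a b assume "f \<in> Hom (Rep M) a b"
  then obtain f' where f: "f = Arrow a f' b" "chom a b f'" by (elim HomE_Rep)
  have "compose (vspace a) f' (\<lambda>v\<in>vspace a. v) = f'"
    by (rule chom_eqI[OF chom_compose[OF chom_id f(2)] f(2)]) (simp_all add: compose_eq chom_dom[OF f(2)])
  then show "Comp (Rep M) f (Id (Rep M) a) = f" using f by simp
  have "compose (vspace a) (\<lambda>v\<in>vspace b. v) f' = f'"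
    by (rule chom_eqI[OF chom_compose[OF f(2) chom_id] f(2)]) (simp_all add: compose_eq chom_cod[OF f(2)] chom_in[OF f(2)])
  then show "Comp (Rep M) (Id (Rep M) b) f = f" using f by simp
  have ext: "g = f'" if "g \<in> extensional (vspace a)" "\<And>v. v \<in> vspace a \<Longrightarrow> g v = f' v" for g
    using that chom_ext[OF f(2)] by (intro extensionalityI)
  show "Scale (Rep M) r f \<in> Hom (Rep M) a b" for r using f by (simp add: chom_scale)
  show "Add (Rep M) f (Zero (Rep M) a b) = f" using f by (auto intro: ext)
  show "Scale (Rep M) 1 f = f" using f by (auto intro: ext)
  show "Scale (Rep M) r (Scale (Rep M) s f) = Scale (Rep M) (r * s) f" for r s using f by (auto simp: fun_eq_iff)
  show "Scale (Rep M) (r + s) f = Add (Rep M) (Scale (Rep M) r f) (Scale (Rep M) s f)" for r s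
    using f by (auto simp: fun_eq_iff scale_left_distrib)
  have "chom a b (\<lambda>v\<in>vspace a. (-1) *s f' v)" using chom_scale[OF f(2)] .
  then show "\<exists>g\<in>Hom (Rep M) a b. Add (Rep M) f g = Zero (Rep M) a b"
    using f by (intro bexI[of _ "Arrow a (\<lambda>v\<in>vspace a. (-1) *s f' v) b"]) (auto simp: fun_eq_iff)
next
  fix f a b g assume "f \<in> Hom (Rep M) a b" "g \<in> Hom (Rep M) a b"
  then obtain f' g' where f: "f = Arrow a f' b" "chom a b f'" and g: "g = Arrow a g' b" "chom a b g'"
    by (elim HomE_Rep)
  show "Add (Rep M) f g \<in> Hom (Rep M) a b" using f g by (simp add: chom_add)
  show "Add (Rep M) f g = Add (Rep M) g f" using f g by (auto simp: fun_eq_iff)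
  show "Scale (Rep M) r (Add (Rep M) f g) = Add (Rep M) (Scale (Rep M) r f) (Scale (Rep M) r g)" for r
    using f g by (auto simp: fun_eq_iff scale_right_distrib)
  {
    fix h assume "h \<in> Hom (Rep M) a b"
    then obtain h' where "h = Arrow a h' b" "chom a b h'" by (elim HomE_Rep)
    then show "Add (Rep M) (Add (Rep M) f g) h = Add (Rep M) f (Add (Rep M) g h)"
      using f g by (auto simp: fun_eq_iff)
  }
  {
    fix h c assume "h \<in> Hom (Rep M) b c"
    then obtain h' where h: "h = Arrow b h' c" "chom b c h'" by (elim HomE_Rep)
    then show "Comp (Rep M) h (Add (Rep M) f g) = Add (Rep M) (Comp (Rep M) h f) (Comp (Rep M) h g)"
      using f g by (auto simp: fun_eq_iff compose_def lin_add[OF chom_lin[OF h(2)]] chom_in)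
  }
next
  fix a b assume "a \<in> Obj (Rep M)" "b \<in> Obj (Rep M)"
  then show "Zero (Rep M) a b \<in> Hom (Rep M) a b" by (simp add: chom_zero)
next
  fix f a b g c h assume "f \<in> Hom (Rep M) a b" "g \<in> Hom (Rep M) b c" "h \<in> Hom (Rep M) b c"
  then obtain f' g' h' where "f = Arrow a f' b" "chom a b f'" "g = Arrow b g' c" "chom b c g'" "h = Arrow b h' c" "chom b c h'"
    by (elim HomE_Rep)
  then show "Comp (Rep M) (Add (Rep M) g h) f = Add (Rep M) (Comp (Rep M) g f) (Comp (Rep M) h f)"
    by (auto simp: fun_eq_iff compose_def chom_in)
next
  fix f a b g c r assume "f \<in> Hom (Rep M) a b" "g \<in> Hom (Rep M) b c"
  then obtain f' g' where f: "f = Arrow a f' b" "chom a b f'" and g: "g = Arrow b g' c" "chom b c g'"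
    by (elim HomE_Rep)
  show "Comp (Rep M) g (Scale (Rep M) r f) = Scale (Rep M) r (Comp (Rep M) g f)"
    using f g by (auto simp: fun_eq_iff compose_def lin_scale[OF chom_lin[OF g(2)]] chom_in)
  show "Comp (Rep M) (Scale (Rep M) r g) f = Scale (Rep M) r (Comp (Rep M) g f)"
    using f g by (auto simp: fun_eq_iff compose_def chom_in)
qed

lemma zero_comodule: "is_comodule M (mk_comodule {0} (\<lambda>m v. 0))"
proof (rule is_comodule_mk_comodule)
  show "action_family M {0} {} (\<lambda>m v. 0)"
    using fin_dimI[of "{}"] by (simp add: action_family_def lin_zero)
qed

lemma subcomodule:
  assumes a: "is_comodule M a" and W: "subspace W" "W \<subseteq> vspace a" "\<And>m v. v \<in> W \<Longrightarrow> co a m v \<in> W"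
  shows "is_comodule M (mk_comodule W (co a))" "v \<in> W \<Longrightarrow> co (mk_comodule W (co a)) m v = co a m v"
proof -
  have "action_family M W (csupp a) (co a)"
    using comodule_action_family[OF a] W fin_dim_sub[OF comodule_fin_dim[OF a] W(1,2)] lin_mono[OF _ W(2)]
    unfolding action_family_def by (auto simp: subset_iff)
  then show "is_comodule M (mk_comodule W (co a))" "v \<in> W \<Longrightarrow> co (mk_comodule W (co a)) m v = co a m v"
    by (auto intro: is_comodule_mk_comodule co_mk_comodule)
qed

text \<open>The internal direct sum of \<open>V\<close> and a disjoint copy \<open>j W\<close>
  carries the operators of \<open>a\<close> on the first summand and those of \<open>b\<close>,
  transported along \<open>j\<close>, on the second.\<close>

lemma biproduct_Rep:
  assumes a: "is_comodule M a" and b: "is_comodule M b"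
  obtains c i j p q where "is_comodule M c" "chom a c i" "chom b c j" "chom c a p" "chom c b q"
    "\<And>v. v \<in> vspace a \<Longrightarrow> p (i v) = v" "\<And>w. w \<in> vspace b \<Longrightarrow> q (j w) = w"
    "\<And>w. w \<in> vspace b \<Longrightarrow> p (j w) = 0" "\<And>v. v \<in> vspace a \<Longrightarrow> q (i v) = 0"
    "\<And>x. x \<in> vspace c \<Longrightarrow> i (p x) + j (q x) = x"
proof -
  let ?V = "vspace a" and ?W = "vspace b"
  obtain j j' where j: "lin UNIV j" and j': "lin UNIV j'" and j'j: "\<And>w. w \<in> ?W \<Longrightarrow> j' (j w) = w"
    and j'V: "\<And>v. v \<in> ?V \<Longrightarrow> j' v = 0" and fd: "fin_dim_subspace {v + j w | v w. v \<in> ?V \<and> w \<in> ?W}"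
    using exists_disjoint_copy[OF comodule_fin_dim[OF a] comodule_fin_dim[OF b]] by blast
  let ?C = "{v + j w | v w. v \<in> ?V \<and> w \<in> ?W}"
  \<comment> \<open>As \<open>j'\<close> kills \<open>V\<close> and inverts \<open>j\<close>, this
    is the projection of \<open>V + j W\<close> onto \<open>V\<close>.\<close>
  define p where "p x = x - j (j' x)" for x
  note sV = comodule_subspace[OF a] and sW = comodule_subspace[OF b]
  note sub = fin_dim_subspaceI[OF fd]
  have j'x: "j' (v + j w) = w" "p (v + j w) = v" if "v \<in> ?V" "w \<in> ?W" for v w
    using that lin_add[OF j'] lin_0[OF j] j'V j'j by (simp_all add: p_def)
  have linp: "lin UNIV p"
    unfolding p_def using lin_compose[OF j' j] by (intro lin_minus lin_ident) simp
  have r1: "lin V f" if "lin UNIV f" for f V using that lin_mono by blast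
  define r where "r m x = co a m (p x) + j (co b m (j' x))" for m x
  have rx: "r m (v + j w) = co a m v + j (co b m w)" if "v \<in> ?V" "w \<in> ?W" for v w m
    using that by (simp add: r_def j'x)
  have rC: "r m x \<in> ?C" if x: "x \<in> ?C" for m x
  proof -
    obtain v w where vw: "x = v + j w" "v \<in> ?V" "w \<in> ?W" using x by blast
    then show ?thesis using rx[OF vw(2,3), of m] co_in[OF a vw(2), of m] co_in[OF b vw(3), of m] by blast
  qed
  let ?K = "csupp a \<union> csupp b"
  have sup: "(\<Sum>n\<in>csupp a. c n *s co a n v) = (\<Sum>n\<in>?K. c n *s co a n v)" if "v \<in> ?V" for c v
    using that finite_csupp[OF a] finite_csupp[OF b] by (intro sum.mono_neutral_left) (auto simp: co_outside)
  have sup': "(\<Sum>n\<in>csupp b. c n *s co b n v) = (\<Sum>n\<in>?K. c n *s co b n v)" if "v \<in> ?W" for c v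
    using that finite_csupp[OF a] finite_csupp[OF b] by (intro sum.mono_neutral_left) (auto simp: co_outside)
  have fam: "action_family M ?C ?K r"
    unfolding action_family_def
  proof (intro conjI allI ballI impI)
    show "fin_dim_subspace ?C" by (rule fd)
    show "finite ?K" using finite_csupp a b by blast
    show "?K \<subseteq> exponents M" using csupp_exponents a b by blast
    show "lin ?C (r m)" for m
      unfolding r_def
    proof (rule lin_plus)
      show "lin ?C (\<lambda>x. co a m (p x))"
        by (rule lin_compose[OF r1[OF linp] co_lin[OF a]]) (auto simp: j'x)
      have "lin ?C (\<lambda>x. co b m (j' x))"
        by (rule lin_compose[OF r1[OF j'] co_lin[OF b]]) (auto simp: j'x)
      then show "lin ?C (\<lambda>x. j (co b m (j' x)))"
        by (rule lin_compose[OF _ j]) simp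
    qed
    fix x assume x: "x \<in> ?C"
    then obtain v w where vw: "x = v + j w" "v \<in> ?V" "w \<in> ?W" by blast
    show "r m x \<in> ?C" for m using rC[OF x] .
    show "r m x = 0" if "m \<notin> ?K" for m
      using that vw rx by (simp add: co_outside lin_0[OF j])
    show "r l (r m x) = (\<Sum>n\<in>?K. lookup (comult M (monomial n)) (l, m) *s r n x)" for l m
      using vw co_in[OF a vw(2)] co_in[OF b vw(3)]
      by (simp add: rx co_coassoc[OF a] co_coassoc[OF b] sup sup' lin_sum[OF j] lin_scale[OF j] 
          scale_right_distrib sum.distrib)
    show "(\<Sum>n\<in>?K. counit M (monomial n) *s r n x) = x"
    proof -
      have "(\<Sum>n\<in>?K. counit M (monomial n) *s r n x) = (\<Sum>n\<in>?K. counit M (monomial n) *s co a n v) + j (\<Sum>n\<in>?K. counit M (monomial n) *s co b n w)"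
        using vw by (simp add: rx lin_sum[OF j] lin_scale[OF j] scale_right_distrib sum.distrib)
      also have "\<dots> = v + j w"
        using vw co_counit[OF a] co_counit[OF b] by (simp flip: sup sup')
      finally show ?thesis using vw by simp
    qed
  qed
  let ?c = "mk_comodule ?C r"
  have c: "is_comodule M ?c" by (rule is_comodule_mk_comodule[OF fam])
  have inV: "v \<in> ?C" if "v \<in> ?V" for v
  proof -
    have "v = v + j 0" by (simp add: lin_0[OF j])
    then show ?thesis using that subspace_0[OF sW] by blast
  qed
  have inW: "j w \<in> ?C" if "w \<in> ?W" for w
  proof -
    have "j w = 0 + j w" by simp
    then show ?thesis using that subspace_0[OF sV] by blast
  qed
  have jW: "j' (j w) = w" "p (j w) = 0" if "w \<in> ?W" for w
    using j'x[OF subspace_0[OF sV] that] by simp_all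
  have Vp: "p v = v" if "v \<in> ?V" for v using j'V[OF that] by (simp add: p_def lin_0[OF j])
  have a0: "co a m 0 = 0" and b0: "co b m 0 = 0" for m
    using lin_0[OF co_lin[OF a] sV] lin_0[OF co_lin[OF b] sW] by auto
  show ?thesis
  proof (rule that[of ?c "restrict (\<lambda>v. v) ?V" "restrict j ?W" "restrict p ?C" "restrict j' ?C"])
    show "is_comodule M ?c" by (rule c)
    show "chom a ?c (restrict (\<lambda>v. v) ?V)"
      by (rule chom_restrictI[OF a c]) (simp_all only: vspace_mk_comodule inV co_mk_comodule[OF fam] r_def Vp j'V b0 lin_0[OF j] subspace_UNIV lin_ident add_0_right)
    show "chom b ?c (restrict j ?W)"
      by (rule chom_restrictI[OF b c]) (simp_all only: vspace_mk_comodule inW co_mk_comodule[OF fam] r_def jW a0 r1[OF j] add_0_left)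
    have "chom ?c a (restrict p (vspace ?c))"
    proof (rule chom_restrictI[OF c a])
      fix m x assume "x \<in> vspace ?c"
      then obtain v w where vw: "x = v + j w" "v \<in> ?V" "w \<in> ?W" by auto
      then have "x \<in> ?C" by blast
      then show "co a m (p x) = p (co ?c m x)"
        unfolding co_mk_comodule[OF fam \<open>x \<in> ?C\<close>] using vw by (simp add: rx j'x co_in[OF a] co_in[OF b])
    qed (auto simp: r1[OF linp] j'x)
    then show "chom ?c a (restrict p ?C)" by simp
    have "chom ?c b (restrict j' (vspace ?c))"
    proof (rule chom_restrictI[OF c b])
      fix m x assume "x \<in> vspace ?c"
      then obtain v w where vw: "x = v + j w" "v \<in> ?V" "w \<in> ?W" by auto
      then have "x \<in> ?C" by blast
      then show "co b m (j' x) = j' (co ?c m x)"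
        unfolding co_mk_comodule[OF fam \<open>x \<in> ?C\<close>] using vw by (simp add: rx j'x co_in[OF a] co_in[OF b])
    qed (auto simp: r1[OF j'] j'x)
    then show "chom ?c b (restrict j' ?C)" by simp
    fix x assume "x \<in> vspace ?c"
    then obtain v w where vw: "x = v + j w" "v \<in> ?V" "w \<in> ?W" by auto
    then have "x \<in> ?C" by blast
    then show "restrict (\<lambda>v. v) ?V (restrict p ?C x) + restrict j ?W (restrict j' ?C x) = x"
      using vw by (simp add: j'x del: mem_Collect_eq)
  next
    fix v assume v: "v \<in> ?V"
    show "restrict p ?C (restrict (\<lambda>v. v) ?V v) = v" "restrict j' ?C (restrict (\<lambda>v. v) ?V v) = 0"
      using inV[OF v] Vp[OF v] j'V[OF v] v by (simp_all del: mem_Collect_eq)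
  next
    fix w assume w: "w \<in> ?W"
    show "restrict j' ?C (restrict j ?W w) = w" "restrict p ?C (restrict j ?W w) = 0"
      using inW[OF w] jW[OF w] w by (simp_all del: mem_Collect_eq)
  qed
qed

text \<open>The image of an equivariant map is stable under the coefficient operators. The splitting
  consists of \<open>e\<close> itself, with its image as codomain, and the inclusion of the
  image.\<close>

lemma idempotent_split_Rep:
  assumes e: "chom a a e" and idem: "\<And>v. v \<in> vspace a \<Longrightarrow> e (e v) = e v"
  obtains b where "is_comodule M b" "vspace b = e ` vspace a" "chom a b e" "chom b a (\<lambda>v\<in>vspace b. v)"
proof -
  let ?W = "e ` vspace a"
  note a = chom_dom[OF e]
  have W: "subspace ?W" "?W \<subseteq> vspace a" "\<And>m v. v \<in> ?W \<Longrightarrow> co a m v \<in> ?W"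
    using subspace_lin_image[OF chom_lin[OF e] comodule_subspace[OF a]] chom_in[OF e]
    by (auto simp: chom_co[OF e] co_in[OF a])
  let ?b = "mk_comodule ?W (co a)"
  note b = subcomodule[OF a W]
  have "chom a ?b e"
    using e b chom_in[OF e] by (simp add: chom_iff)
  moreover have "chom ?b a (\<lambda>v\<in>vspace ?b. v)"
    by (rule chom_restrictI[OF b(1) a]) (use W b in \<open>auto simp: lin_ident\<close>)
  ultimately show ?thesis using that[of ?b] b(1) by simp
qed

lemma cauchy_complete_Rep: "cauchy_complete_linear_category (Rep M)"
proof -
  interpret linear_category "Rep M" by (rule linear_category_Rep)
  show ?thesis
  proof
    show "\<exists>z\<in>Obj (Rep M). Id (Rep M) z = Zero (Rep M) z z"
      using zero_comodule by (intro bexI[of _ "mk_comodule {0} (\<lambda>m v. 0)"]) (auto simp: fun_eq_iff)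
  next
    fix a b assume "a \<in> Obj (Rep M)" "b \<in> Obj (Rep M)"
    then have "is_comodule M a" "is_comodule M b" by simp_all
    then obtain c i j p q where c: "is_comodule M c" "chom a c i" "chom b c j" "chom c a p" "chom c b q"
      "\<And>v. v \<in> vspace a \<Longrightarrow> p (i v) = v" "\<And>w. w \<in> vspace b \<Longrightarrow> q (j w) = w"
      "\<And>w. w \<in> vspace b \<Longrightarrow> p (j w) = 0" "\<And>v. v \<in> vspace a \<Longrightarrow> q (i v) = 0"
      "\<And>x. x \<in> vspace c \<Longrightarrow> i (p x) + j (q x) = x"
      by (rule biproduct_Rep) blast
    show "\<exists>c\<in>Obj (Rep M). \<exists>i\<in>Hom (Rep M) a c. \<exists>j\<in>Hom (Rep M) b c. \<exists>p\<in>Hom (Rep M) c a. \<exists>q\<in>Hom (Rep M) c b.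
         Comp (Rep M) p i = Id (Rep M) a \<and> Comp (Rep M) q j = Id (Rep M) b \<and>
         Comp (Rep M) p j = Zero (Rep M) b a \<and> Comp (Rep M) q i = Zero (Rep M) a b \<and>
         Add (Rep M) (Comp (Rep M) i p) (Comp (Rep M) j q) = Id (Rep M) c"
      using c by (intro bexI[of _ c] bexI[of _ "Arrow a i c"] bexI[of _ "Arrow b j c"]
         bexI[of _ "Arrow c p a"] bexI[of _ "Arrow c q b"]) (auto simp: compose_def fun_eq_iff)
  next
    fix e a assume "e \<in> Hom (Rep M) a a" and idem: "Comp (Rep M) e e = e"
    then obtain f where f: "e = Arrow a f a" "chom a a f" by (elim HomE_Rep)
    have "f (f v) = f v" if "v \<in> vspace a" for v
    proof -
      have "compose (vspace a) f f = f" using idem f by simp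
      from fun_cong[OF this, of v] show ?thesis using that by (simp add: compose_eq)
    qed
    then obtain b where b: "is_comodule M b" "vspace b = f ` vspace a" "chom a b f" "chom b a (\<lambda>v\<in>vspace b. v)"
      using idempotent_split_Rep[OF f(2)] by blast
    have 1: "compose (vspace a) (\<lambda>v\<in>vspace b. v) f = f"
      by (rule chom_eqI[OF chom_compose[OF b(3,4)] f(2)]) (simp add: compose_eq b(2))
    have 2: "compose (vspace b) f (\<lambda>v\<in>vspace b. v) = (\<lambda>v\<in>vspace b. v)"
      by (rule chom_eqI[OF chom_compose[OF b(4,3)] b(4)]) (use \<open>\<And>v. v \<in> vspace a \<Longrightarrow> f (f v) = f v\<close> in \<open>auto simp: compose_eq b(2)\<close>)
    show "\<exists>b\<in>Obj (Rep M). \<exists>r\<in>Hom (Rep M) a b. \<exists>s\<in>Hom (Rep M) b a.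
       Comp (Rep M) s r = e \<and> Comp (Rep M) r s = Id (Rep M) b"
      using b f 1 2 by (intro bexI[of _ b] bexI[of _ "Arrow a f b"] bexI[of _ "Arrow b (\<lambda>v\<in>vspace b. v) a"]) simp_all
  qed
qed

end

section \<open>Symmetric monoidal structure on finite-dimensional spaces\<close>

context ambient_vector_space
begin

text \<open>The arrows of the category of finite-dimensional spaces. Coherence is an identity
  between such maps and is proved at this level; representations inherit it, because their arrows
  compose and tensor as linear maps.\<close>

definition lmap :: "'v set \<Rightarrow> 'v set \<Rightarrow> ('v \<Rightarrow> 'v) \<Rightarrow> bool"
  where "lmap V W f \<longleftrightarrow> fin_dim_subspace V \<and> fin_dim_subspace W \<and> linear_on V scale f \<and> (\<forall>v\<in>V. f v \<in> W)"

lemma lmap_fin_dim: "lmap V W f \<Longrightarrow> fin_dim_subspace V" "lmap V W f \<Longrightarrow> fin_dim_subspace W"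
  and lmap_linear_on: "lmap V W f \<Longrightarrow> linear_on V scale f"
  and lmap_lin: "lmap V W f \<Longrightarrow> lin V f"
  and lmap_in: "\<lbrakk>lmap V W f; v \<in> V\<rbrakk> \<Longrightarrow> f v \<in> W"
  by (simp_all add: lmap_def linear_on_iff)

lemma lmap_restrict:
  assumes "fin_dim_subspace V" "fin_dim_subspace W" "lin V f" "\<And>v. v \<in> V \<Longrightarrow> f v \<in> W"
  shows "lmap V W (restrict f V)"
  using assms lin_cong[OF fin_dim_subspaceI[OF assms(1)], of "restrict f V" f]
  by (simp add: lmap_def linear_on_iff)

lemma lmap_id: "fin_dim_subspace V \<Longrightarrow> lmap V V (\<lambda>v\<in>V. v)"
  by (rule lmap_restrict) (simp_all add: lin_ident)

lemma lmap_compose: "\<lbrakk>lmap U V f; lmap V W g\<rbrakk> \<Longrightarrow> lmap U W (compose U g f)"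
  unfolding compose_def
  by (rule lmap_restrict) (auto simp: lmap_fin_dim lmap_in intro: lin_compose[OF lmap_lin lmap_lin])

lemma the_linear_props:
  assumes "linear_on V scale f" "P f" "\<And>f g. \<lbrakk>linear_on V scale f; linear_on V scale g; P f; P g\<rbrakk> \<Longrightarrow> f = g"
  shows "linear_on V scale (the_linear V P)" "P (the_linear V P)"
proof -
  have "the_linear V P = f" by (rule the_linear_eqI[where P = P, OF assms(1,2)]) (rule assms(3)[OF _ assms(1) _ assms(2)])
  then show "linear_on V scale (the_linear V P)" "P (the_linear V P)" using assms by simp_all
qed

lemma the_linear_tensor:
  assumes "fin_dim_subspace V" "fin_dim_subspace W" "bilinear_on V W \<beta>"
  defines "h \<equiv> the_linear (tensor_space V W) (\<lambda>h. \<forall>v\<in>V. \<forall>w\<in>W. h (tensor V W v w) = \<beta> v w)"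
  shows "linear_on (tensor_space V W) scale h" "\<And>v w. \<lbrakk>v \<in> V; w \<in> W\<rbrakk> \<Longrightarrow> h (tensor V W v w) = \<beta> v w"
proof -
  let ?P = "\<lambda>h. \<forall>v\<in>V. \<forall>w\<in>W. h (tensor V W v w) = \<beta> v w"
  obtain f where f: "linear_on (tensor_space V W) scale f" "\<And>v w. v \<in> V \<Longrightarrow> w \<in> W \<Longrightarrow> f (tensor V W v w) = \<beta> v w"
    using tensor_lift[OF assms(1-3)] by blast
  have u: "g = g'" if "linear_on (tensor_space V W) scale g" "linear_on (tensor_space V W) scale g'" "?P g" "?P g'" for g g'
    by (rule linear_on_tensor_eqI[OF that(1,2)]) (use that(3,4) in simp)
  have "?P f" using f(2) by blast
  note the_linear_props[of "tensor_space V W" f ?P, OF f(1) this u]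
  then show "linear_on (tensor_space V W) scale h" "\<And>v w. \<lbrakk>v \<in> V; w \<in> W\<rbrakk> \<Longrightarrow> h (tensor V W v w) = \<beta> v w"
    unfolding h_def by blast+
qed

lemma lmap_tensorI:
  assumes "fin_dim_subspace V" "fin_dim_subspace W" "fin_dim_subspace X" "linear_on (tensor_space V W) scale h"
    "\<And>v w. \<lbrakk>v \<in> V; w \<in> W\<rbrakk> \<Longrightarrow> h (tensor V W v w) \<in> X"
  shows "lmap (tensor_space V W) X h"
proof -
  have "h x \<in> X" if "x \<in> tensor_space V W" for x
    using that assms(1,2)
    by (induction x rule: tensor_space_induct)
      (use assms in \<open>auto simp: linear_on_iff lin_add subspace_add[OF fin_dim_subspaceI]\<close>)
  then show ?thesis using assms by (simp add: lmap_def fin_dim_tensor_space)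
qed

lemma bilinear_tensor_map:
  assumes "lmap V V' f" "lmap W W' g"
  shows "bilinear_on V W (\<lambda>v w. tensor V' W' (f v) (g w))"
proof -
  note fd = lmap_fin_dim[OF assms(1)] lmap_fin_dim[OF assms(2)]
  show ?thesis
    unfolding bilinear_on_iff
    using lmap_in[OF assms(1)] lmap_in[OF assms(2)]
    by (auto intro!: lin_compose[OF lmap_lin[OF assms(2)] tensor_lin(1)[OF fd(2,4)]]
        lin_compose[OF lmap_lin[OF assms(1)] tensor_lin(2)[OF fd(2,4)]])
qed

lemma tensor_map_pure:
  assumes "lmap V V' f" "lmap W W' g" "v \<in> V" "w \<in> W"
  shows "tensor_map V V' W W' f g (tensor V W v w) = tensor V' W' (f v) (g w)"
  unfolding tensor_map_def
  by (rule the_linear_tensor(2)[OF lmap_fin_dim(1)[OF assms(1)] lmap_fin_dim(1)[OF assms(2)]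
    bilinear_tensor_map[OF assms(1,2)] assms(3,4)])

lemma lmap_tensor_map:
  assumes "lmap V V' f" "lmap W W' g"
  shows "lmap (tensor_space V W) (tensor_space V' W') (tensor_map V V' W W' f g)"
proof (rule lmap_tensorI)
  show "linear_on (tensor_space V W) scale (tensor_map V V' W W' f g)"
    unfolding tensor_map_def
    by (rule the_linear_tensor(1)[OF lmap_fin_dim(1)[OF assms(1)] lmap_fin_dim(1)[OF assms(2)]
      bilinear_tensor_map[OF assms(1,2)]])
qed (use assms in \<open>auto simp: tensor_map_pure lmap_fin_dim fin_dim_tensor_space lmap_in intro!: tensor_in\<close>)

lemma bilinear_symmetry:
  assumes "fin_dim_subspace V" "fin_dim_subspace W"
  shows "bilinear_on V W (\<lambda>v w. tensor W V w v)"
  unfolding bilinear_on_iff using tensor_lin[OF assms(2,1)] by auto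

lemma symmetry_pure:
  assumes "fin_dim_subspace V" "fin_dim_subspace W" "v \<in> V" "w \<in> W"
  shows "symmetry V W (tensor V W v w) = tensor W V w v"
  unfolding symmetry_def by (rule the_linear_tensor(2)[OF assms(1,2) bilinear_symmetry[OF assms(1,2)] assms(3,4)])

lemma lmap_symmetry:
  assumes "fin_dim_subspace V" "fin_dim_subspace W"
  shows "lmap (tensor_space V W) (tensor_space W V) (symmetry V W)"
  by (rule lmap_tensorI)
    (auto simp: assms fin_dim_tensor_space symmetry_pure
      the_linear_tensor(1)[OF assms bilinear_symmetry[OF assms], folded symmetry_def] intro!: tensor_in)

lemma unit_vector_nonzero: "unit_vector \<noteq> 0"
proof -
  have "\<exists>u::'v. u \<noteq> 0"
  proof (rule ccontr)
    assume "\<nexists>u::'v. u \<noteq> 0"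
    then have "span {} = UNIV" by auto
    then show False using infinite_dimensional by blast
  qed
  then show ?thesis unfolding unit_vector_def by (rule someI_ex)
qed

definition unit_coeff :: "'v \<Rightarrow> 'k"
  where "unit_coeff x = (SOME c. x = c *s unit_vector)"

lemma unit_coeff [simp]: "unit_coeff (c *s unit_vector) = c"
  unfolding unit_coeff_def using unit_vector_nonzero by (auto intro: some_equality)

lemma unit_spaceE:
  assumes "x \<in> span {unit_vector}"
  obtains c where "x = c *s unit_vector"
  using assms by (auto simp: span_singleton)

lemma unit_coeff_add: "\<lbrakk>x \<in> span {unit_vector}; y \<in> span {unit_vector}\<rbrakk> \<Longrightarrow> unit_coeff (x + y) = unit_coeff x + unit_coeff y"
  by (elim unit_spaceE) (simp flip: scale_left_distrib)

lemma unit_coeff_scale: "x \<in> span {unit_vector} \<Longrightarrow> unit_coeff (c *s x) = c * unit_coeff x"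
  by (elim unit_spaceE) simp

lemma fin_dim_unit: "fin_dim_subspace (span {unit_vector})"
  by (rule fin_dimI) simp

lemma bilinear_left_unitor: "bilinear_on (span {unit_vector}) V (\<lambda>x v. unit_coeff x *s v)"
  unfolding bilinear_on_def
  by (auto simp: unit_coeff_add unit_coeff_scale scale_left_distrib scale_right_distrib mult.commute)

lemma bilinear_right_unitor: "bilinear_on V (span {unit_vector}) (\<lambda>v x. unit_coeff x *s v)"
  unfolding bilinear_on_def
  by (auto simp: unit_coeff_add unit_coeff_scale scale_left_distrib scale_right_distrib mult.commute)

text \<open>Replacing the scalar by a vector of the unit space gives the description the shape of a
  lift of a bilinear map, to which \<open>the_linear_tensor\<close> applies.\<close>

lemma left_unitor_altdef: "left_unitor V = the_linear (tensor_space (span {unit_vector}) V)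
    (\<lambda>h. \<forall>x\<in>span {unit_vector}. \<forall>v\<in>V. h (tensor (span {unit_vector}) V x v) = unit_coeff x *s v)"
proof -
  have "(\<forall>c. \<forall>v\<in>V. h (tensor (span {unit_vector}) V (c *s unit_vector) v) = c *s v) \<longleftrightarrow>
      (\<forall>x\<in>span {unit_vector}. \<forall>v\<in>V. h (tensor (span {unit_vector}) V x v) = unit_coeff x *s v)" for h
    unfolding span_singleton by simp
  then show ?thesis unfolding left_unitor_def by simp
qed

lemma right_unitor_altdef: "right_unitor V = the_linear (tensor_space V (span {unit_vector}))
    (\<lambda>h. \<forall>v\<in>V. \<forall>x\<in>span {unit_vector}. h (tensor V (span {unit_vector}) v x) = unit_coeff x *s v)"
proof -
  have "(\<forall>c. \<forall>v\<in>V. h (tensor V (span {unit_vector}) v (c *s unit_vector)) = c *s v) \<longleftrightarrow>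
      (\<forall>v\<in>V. \<forall>x\<in>span {unit_vector}. h (tensor V (span {unit_vector}) v x) = unit_coeff x *s v)" for h
    unfolding span_singleton by auto
  then show ?thesis unfolding right_unitor_def by simp
qed

lemma left_unitor_pure:
  "\<lbrakk>fin_dim_subspace V; x \<in> span {unit_vector}; v \<in> V\<rbrakk> \<Longrightarrow>
    left_unitor V (tensor (span {unit_vector}) V x v) = unit_coeff x *s v"
  unfolding left_unitor_altdef by (rule the_linear_tensor(2)[OF fin_dim_unit _ bilinear_left_unitor])

lemma right_unitor_pure:
  "\<lbrakk>fin_dim_subspace V; x \<in> span {unit_vector}; v \<in> V\<rbrakk> \<Longrightarrow>
    right_unitor V (tensor V (span {unit_vector}) v x) = unit_coeff x *s v"
  unfolding right_unitor_altdef by (rule the_linear_tensor(2)[OF _ fin_dim_unit bilinear_right_unitor])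

lemma lmap_left_unitor:
  assumes "fin_dim_subspace V"
  shows "lmap (tensor_space (span {unit_vector}) V) V (left_unitor V)"
proof (rule lmap_tensorI)
  show "linear_on (tensor_space (span {unit_vector}) V) scale (left_unitor V)"
    unfolding left_unitor_altdef by (rule the_linear_tensor(1)[OF fin_dim_unit assms bilinear_left_unitor])
qed (use assms fin_dim_subspaceI[OF assms] in \<open>auto simp: fin_dim_unit left_unitor_pure subspace_scale\<close>)

lemma lmap_right_unitor:
  assumes "fin_dim_subspace V"
  shows "lmap (tensor_space V (span {unit_vector})) V (right_unitor V)"
proof (rule lmap_tensorI)
  show "linear_on (tensor_space V (span {unit_vector})) scale (right_unitor V)"
    unfolding right_unitor_altdef by (rule the_linear_tensor(1)[OF assms fin_dim_unit bilinear_right_unitor])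
qed (use assms fin_dim_subspaceI[OF assms] in \<open>auto simp: fin_dim_unit right_unitor_pure subspace_scale\<close>)

lemma tensor3L_eqI:
  assumes fd: "fin_dim_subspace U" "fin_dim_subspace V" "fin_dim_subspace W"
    and lin: "lin (tensor_space (tensor_space U V) W) f" "lin (tensor_space (tensor_space U V) W) g"
    and eq: "\<And>u v w. \<lbrakk>u \<in> U; v \<in> V; w \<in> W\<rbrakk> \<Longrightarrow>
      f (tensor (tensor_space U V) W (tensor U V u v) w) = g (tensor (tensor_space U V) W (tensor U V u v) w)"
    and x: "x \<in> tensor_space (tensor_space U V) W"
  shows "f x = g x"
proof (rule tensor_space_eqI[OF lin _ x])
  fix y w assume y: "y \<in> tensor_space U V" and w: "w \<in> W"
  note l = tensor_lin(2)[OF fin_dim_tensor_space[OF fd(1,2)] fd(3) w]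
  show "f (tensor (tensor_space U V) W y w) = g (tensor (tensor_space U V) W y w)"
    by (rule tensor_space_eqI[OF lin_compose[OF l lin(1)] lin_compose[OF l lin(2)] eq y])
      (auto intro!: tensor_in w)
qed

lemma tensor3R_eqI:
  assumes fd: "fin_dim_subspace U" "fin_dim_subspace V" "fin_dim_subspace W"
    and lin: "lin (tensor_space U (tensor_space V W)) f" "lin (tensor_space U (tensor_space V W)) g"
    and eq: "\<And>u v w. \<lbrakk>u \<in> U; v \<in> V; w \<in> W\<rbrakk> \<Longrightarrow>
      f (tensor U (tensor_space V W) u (tensor V W v w)) = g (tensor U (tensor_space V W) u (tensor V W v w))"
    and x: "x \<in> tensor_space U (tensor_space V W)"
  shows "f x = g x"
proof (rule tensor_space_eqI[OF lin _ x])
  fix y u assume y: "y \<in> tensor_space V W" and u: "u \<in> U"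
  note l = tensor_lin(1)[OF fd(1) fin_dim_tensor_space[OF fd(2,3)] u]
  show "f (tensor U (tensor_space V W) u y) = g (tensor U (tensor_space V W) u y)"
    by (rule tensor_space_eqI[OF lin_compose[OF l lin(1)] lin_compose[OF l lin(2)] eq y])
      (auto intro!: tensor_in u)
qed

text \<open>For fixed \<open>w\<close> the first two arguments are lifted. The lift depends linearly
  on \<open>w\<close> because lifts are determined on pure tensors, and a second lift then takes
  care of \<open>w\<close>.\<close>

lemma tensor_lift3L:
  assumes fd: "fin_dim_subspace U" "fin_dim_subspace V" "fin_dim_subspace W"
    and \<tau>: "\<And>w. w \<in> W \<Longrightarrow> bilinear_on U V (\<lambda>u v. \<tau> u v w)" "\<And>u v. \<lbrakk>u \<in> U; v \<in> V\<rbrakk> \<Longrightarrow> lin W (\<tau> u v)"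
  obtains f where "linear_on (tensor_space (tensor_space U V) W) scale f"
    "\<And>u v w. \<lbrakk>u \<in> U; v \<in> V; w \<in> W\<rbrakk> \<Longrightarrow> f (tensor (tensor_space U V) W (tensor U V u v) w) = \<tau> u v w"
proof -
  note sW = fin_dim_subspaceI[OF fd(3)]
  define g where "g w = (SOME f. linear_on (tensor_space U V) scale f \<and> (\<forall>u\<in>U. \<forall>v\<in>V. f (tensor U V u v) = \<tau> u v w))" for w
  have g: "linear_on (tensor_space U V) scale (g w) \<and> (\<forall>u\<in>U. \<forall>v\<in>V. g w (tensor U V u v) = \<tau> u v w)" if w: "w \<in> W" for w
  proof -
    obtain f where "linear_on (tensor_space U V) scale f" "\<And>u v. u \<in> U \<Longrightarrow> v \<in> V \<Longrightarrow> f (tensor U V u v) = \<tau> u v w"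
      using tensor_lift[OF fd(1,2) \<tau>(1)[OF w]] by blast
    then have "\<exists>f. linear_on (tensor_space U V) scale f \<and> (\<forall>u\<in>U. \<forall>v\<in>V. f (tensor U V u v) = \<tau> u v w)" by blast
    from someI_ex[OF this] show ?thesis unfolding g_def .
  qed
  have gl: "lin (tensor_space U V) (g w)" if "w \<in> W" for w using g[OF that] by (simp add: linear_on_iff)
  have gp: "g w (tensor U V u v) = \<tau> u v w" if "w \<in> W" "u \<in> U" "v \<in> V" for u v w using g[OF that(1)] that by blast
  have "lin W (\<lambda>w. g w x)" if x: "x \<in> tensor_space U V" for x
  proof (rule linI)
    fix w w' assume w: "w \<in> W" "w' \<in> W"
    note w'' = subspace_add[OF sW w]
    show "g (w + w') x = g w x + g w' x"
      by (rule tensor_space_eqI[OF gl[OF w''] lin_plus[OF gl[OF w(1)] gl[OF w(2)]] _ x])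
        (simp add: gp w w'' lin_add[OF \<tau>(2)])
  next
    fix c w assume w: "w \<in> W"
    note w'' = subspace_scale[OF sW w]
    show "g (c *s w) x = c *s g w x"
      by (rule tensor_space_eqI[OF gl[OF w''] lin_cmult[OF gl[OF w]] _ x])
        (simp add: gp w w'' lin_scale[OF \<tau>(2)])
  qed
  then have "bilinear_on (tensor_space U V) W (\<lambda>x w. g w x)"
    unfolding bilinear_on_iff using gl by blast
  then obtain f where "linear_on (tensor_space (tensor_space U V) W) scale f"
     "\<And>x w. x \<in> tensor_space U V \<Longrightarrow> w \<in> W \<Longrightarrow> f (tensor (tensor_space U V) W x w) = g w x"
    using tensor_lift[OF fin_dim_tensor_space[OF fd(1,2)] fd(3)] by blast
  then show ?thesis using that[of f] gp by (simp add: tensor_in)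
qed

text \<open>Moving \<open>U\<close> to the right by the symmetry reduces this bracketing to the
  other one.\<close>

lemma tensor_lift3R:
  assumes fd: "fin_dim_subspace U" "fin_dim_subspace V" "fin_dim_subspace W"
    and \<tau>: "\<And>u. u \<in> U \<Longrightarrow> bilinear_on V W (\<tau> u)" "\<And>v w. \<lbrakk>v \<in> V; w \<in> W\<rbrakk> \<Longrightarrow> lin U (\<lambda>u. \<tau> u v w)"
  obtains f where "linear_on (tensor_space U (tensor_space V W)) scale f"
    "\<And>u v w. \<lbrakk>u \<in> U; v \<in> V; w \<in> W\<rbrakk> \<Longrightarrow> f (tensor U (tensor_space V W) u (tensor V W v w)) = \<tau> u v w"
proof -
  obtain f where f: "linear_on (tensor_space (tensor_space V W) U) scale f"
    "\<And>v w u. \<lbrakk>v \<in> V; w \<in> W; u \<in> U\<rbrakk> \<Longrightarrow> f (tensor (tensor_space V W) U (tensor V W v w) u) = \<tau> u v w"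
    using tensor_lift3L[OF fd(2,3,1), of "\<lambda>v w u. \<tau> u v w"] \<tau> by blast
  let ?s = "symmetry U (tensor_space V W)"
  note fd' = fin_dim_tensor_space[OF fd(2,3)]
  note s = lmap_symmetry[OF fd(1) fd']
  have lf: "lin (tensor_space (tensor_space V W) U) f" using f(1) by (simp add: linear_on_iff)
  have "lin (tensor_space U (tensor_space V W)) (\<lambda>x. f (?s x))"
    by (rule lin_compose[OF lmap_lin[OF s] lf]) (auto simp: lmap_in[OF s])
  then have "lin (tensor_space U (tensor_space V W)) (restrict (\<lambda>x. f (?s x)) (tensor_space U (tensor_space V W)))"
    by (subst lin_cong[where g = "\<lambda>x. f (?s x)"]) (simp_all add: subspace_tensor_space)
  then show ?thesis
    using that[of "restrict (\<lambda>x. f (?s x)) (tensor_space U (tensor_space V W))"] f(2) fd fd'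
    by (simp add: linear_on_iff symmetry_pure tensor_in)
qed

lemma associator_props:
  assumes fd: "fin_dim_subspace U" "fin_dim_subspace V" "fin_dim_subspace W"
  shows "lmap (tensor_space (tensor_space U V) W) (tensor_space U (tensor_space V W)) (associator U V W)"
    and associator_pure: "\<And>u v w. \<lbrakk>u \<in> U; v \<in> V; w \<in> W\<rbrakk> \<Longrightarrow> associator U V W (tensor (tensor_space U V) W (tensor U V u v) w) =
        tensor U (tensor_space V W) u (tensor V W v w)"
proof -
  let ?T = "tensor_space (tensor_space U V) W" and ?T' = "tensor_space U (tensor_space V W)"
  let ?P = "\<lambda>h. \<forall>u\<in>U. \<forall>v\<in>V. \<forall>w\<in>W.
      h (tensor (tensor_space U V) W (tensor U V u v) w) = tensor U (tensor_space V W) u (tensor V W v w)"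
  note fd1 = fin_dim_tensor_space[OF fd(2,3)] and fd2 = fin_dim_tensor_space[OF fd(1,2)]
  have b1: "bilinear_on U V (\<lambda>u v. tensor U (tensor_space V W) u (tensor V W v w))" if "w \<in> W" for w
    unfolding bilinear_on_iff using that
    by (auto intro!: lin_compose[OF tensor_lin(2)[OF fd(2,3)] tensor_lin(1)[OF fd(1) fd1]] tensor_lin(2)[OF fd(1) fd1] tensor_in)
  have b2: "lin W (\<lambda>w. tensor U (tensor_space V W) u (tensor V W v w))" if "u \<in> U" "v \<in> V" for u v
    using that by (auto intro!: lin_compose[OF tensor_lin(1)[OF fd(2,3)] tensor_lin(1)[OF fd(1) fd1]] tensor_in)
  obtain f where f: "linear_on ?T scale f"
    "\<And>u v w. \<lbrakk>u \<in> U; v \<in> V; w \<in> W\<rbrakk> \<Longrightarrow> f (tensor (tensor_space U V) W (tensor U V u v) w) = tensor U (tensor_space V W) u (tensor V W v w)"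
    using tensor_lift3L[OF fd b1 b2] by blast
  have u: "g = g'" if "linear_on ?T scale g" "linear_on ?T scale g'" "?P g" "?P g'" for g g'
  proof (rule linear_on_eqI[OF that(1,2)])
    fix x assume "x \<in> ?T"
    then show "g x = g' x"
      using that by (intro tensor3L_eqI[OF fd, of g g' x]) (simp_all add: linear_on_iff)
  qed
  have "?P f" using f(2) by blast
  note p = the_linear_props[of ?T f ?P, OF f(1) this u, folded associator_def]
  show pure: "\<And>u v w. \<lbrakk>u \<in> U; v \<in> V; w \<in> W\<rbrakk> \<Longrightarrow> associator U V W (tensor (tensor_space U V) W (tensor U V u v) w) =
        tensor U (tensor_space V W) u (tensor V W v w)"
    using p(2) by blast
  have l: "linear_on ?T scale (associator U V W)" using p(1) by blast
  then have ll: "lin ?T (associator U V W)" by (simp add: linear_on_iff)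
  show "lmap ?T ?T' (associator U V W)"
  proof (rule lmap_tensorI[OF fd2 fd(3) fin_dim_tensor_space[OF fd(1) fd1] l])
    fix x w assume x: "x \<in> tensor_space U V" and w: "w \<in> W"
    show "associator U V W (tensor (tensor_space U V) W x w) \<in> ?T'"
      using x fd(1,2)
    proof (induction x rule: tensor_space_induct)
      case (pure u v)
      then show ?case using w by (simp add: \<open>\<And>w v u. \<lbrakk>u \<in> U; v \<in> V; w \<in> W\<rbrakk> \<Longrightarrow> associator U V W (tensor (tensor_space U V) W (tensor U V u v) w) =
        tensor U (tensor_space V W) u (tensor V W v w)\<close> tensor_in)
    next
      case (add x y)
      then show ?case
        using w by (simp add: lin_add[OF tensor_lin(2)[OF fd2 fd(3) w]] lin_add[OF ll] tensor_in subspace_add subspace_tensor_space)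
    qed
  qed
qed

lemmas lmap_associator = associator_props(1)

lemma associator_inverse:
  assumes fd: "fin_dim_subspace U" "fin_dim_subspace V" "fin_dim_subspace W"
  obtains g where "lmap (tensor_space U (tensor_space V W)) (tensor_space (tensor_space U V) W) g"
    "\<And>u v w. \<lbrakk>u \<in> U; v \<in> V; w \<in> W\<rbrakk> \<Longrightarrow> g (tensor U (tensor_space V W) u (tensor V W v w)) =
      tensor (tensor_space U V) W (tensor U V u v) w"
proof -
  let ?T = "tensor_space (tensor_space U V) W" and ?T' = "tensor_space U (tensor_space V W)"
  note fd1 = fin_dim_tensor_space[OF fd(2,3)] and fd2 = fin_dim_tensor_space[OF fd(1,2)]
  have b1: "bilinear_on V W (\<lambda>v w. tensor (tensor_space U V) W (tensor U V u v) w)" if "u \<in> U" for u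
    unfolding bilinear_on_iff using that
    by (auto intro!: lin_compose[OF tensor_lin(1)[OF fd(1,2)] tensor_lin(2)[OF fd2 fd(3)]] tensor_lin(1)[OF fd2 fd(3)] tensor_in)
  have b2: "lin U (\<lambda>u. tensor (tensor_space U V) W (tensor U V u v) w)" if "v \<in> V" "w \<in> W" for v w
    using that by (auto intro!: lin_compose[OF tensor_lin(2)[OF fd(1,2)] tensor_lin(2)[OF fd2 fd(3)]] tensor_in)
  obtain g where g: "linear_on ?T' scale g"
    "\<And>u v w. \<lbrakk>u \<in> U; v \<in> V; w \<in> W\<rbrakk> \<Longrightarrow> g (tensor U (tensor_space V W) u (tensor V W v w)) = tensor (tensor_space U V) W (tensor U V u v) w"
    using tensor_lift3R[OF fd b1 b2] by blast
  have ll: "lin ?T' g" using g(1) by (simp add: linear_on_iff)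
  have "lmap ?T' ?T g"
  proof (rule lmap_tensorI[OF fd(1) fd1 fin_dim_tensor_space[OF fd2 fd(3)] g(1)])
    fix u x assume u: "u \<in> U" and x: "x \<in> tensor_space V W"
    show "g (tensor U (tensor_space V W) u x) \<in> ?T"
      using x fd(2,3)
    proof (induction x rule: tensor_space_induct)
      case (pure v w)
      then show ?case using u by (simp add: g tensor_in)
    next
      case (add x y)
      then show ?case
        using u by (simp add: lin_add[OF tensor_lin(1)[OF fd(1) fd1 u]] lin_add[OF ll] tensor_in subspace_add subspace_tensor_space)
    qed
  qed
  then show ?thesis using that g(2) by blast
qed

text \<open>With its analogues for three and four factors, this reduces naturality and coherence to
  computations on pure tensors.\<close>

lemma lmap_eq_tensor:
  assumes "lmap (tensor_space V W) X f" "lmap (tensor_space V W) X g"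
    "\<And>v w. \<lbrakk>v \<in> V; w \<in> W\<rbrakk> \<Longrightarrow> f (tensor V W v w) = g (tensor V W v w)"
  shows "f = g"
  by (rule linear_on_tensor_eqI[OF lmap_linear_on[OF assms(1)] lmap_linear_on[OF assms(2)] assms(3)])

lemma lmap_eq_tensor3L:
  assumes "fin_dim_subspace U" "fin_dim_subspace V" "fin_dim_subspace W"
    and f: "lmap (tensor_space (tensor_space U V) W) X f" and g: "lmap (tensor_space (tensor_space U V) W) X g"
    and eq: "\<And>u v w. \<lbrakk>u \<in> U; v \<in> V; w \<in> W\<rbrakk> \<Longrightarrow>
      f (tensor (tensor_space U V) W (tensor U V u v) w) = g (tensor (tensor_space U V) W (tensor U V u v) w)"
  shows "f = g"
  by (rule linear_on_eqI[OF lmap_linear_on[OF f] lmap_linear_on[OF g]])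
    (rule tensor3L_eqI[OF assms(1-3) lmap_lin[OF f] lmap_lin[OF g] eq])

lemma lmap_eq_tensor4L:
  assumes "fin_dim_subspace U" "fin_dim_subspace V" "fin_dim_subspace W" "fin_dim_subspace Z"
    and f: "lmap (tensor_space (tensor_space (tensor_space U V) W) Z) X f"
    and g: "lmap (tensor_space (tensor_space (tensor_space U V) W) Z) X g"
    and eq: "\<And>u v w z. \<lbrakk>u \<in> U; v \<in> V; w \<in> W; z \<in> Z\<rbrakk> \<Longrightarrow>
      f (tensor (tensor_space (tensor_space U V) W) Z (tensor (tensor_space U V) W (tensor U V u v) w) z) =
      g (tensor (tensor_space (tensor_space U V) W) Z (tensor (tensor_space U V) W (tensor U V u v) w) z)"
  shows "f = g"
proof (rule lmap_eq_tensor3L[OF fin_dim_tensor_space[OF assms(1,2)] assms(3,4) f g])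
  fix x w z assume x: "x \<in> tensor_space U V" and w: "w \<in> W" and z: "z \<in> Z"
  note fd = fin_dim_tensor_space[OF assms(1,2)]
  note fd' = fin_dim_tensor_space[OF fd assms(3)]
  have l: "lin (tensor_space U V) (\<lambda>x. tensor (tensor_space (tensor_space U V) W) Z (tensor (tensor_space U V) W x w) z)"
    by (rule lin_compose[OF tensor_lin(2)[OF fd assms(3) w] tensor_lin(2)[OF fd' assms(4) z]]) (auto intro!: tensor_in w)
  have im: "(\<lambda>x. tensor (tensor_space (tensor_space U V) W) Z (tensor (tensor_space U V) W x w) z) ` tensor_space U V
     \<subseteq> tensor_space (tensor_space (tensor_space U V) W) Z"
    by (auto intro!: tensor_in w z)
  show "f (tensor (tensor_space (tensor_space U V) W) Z (tensor (tensor_space U V) W x w) z) =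
     g (tensor (tensor_space (tensor_space U V) W) Z (tensor (tensor_space U V) W x w) z)"
    by (rule tensor_space_eqI[OF lin_compose[OF l lmap_lin[OF f] im] lin_compose[OF l lmap_lin[OF g] im] _ x])
      (rule eq[OF _ _ w z])
qed

lemmas pure_simps = compose_eq tensor_map_pure associator_pure symmetry_pure left_unitor_pure right_unitor_pure
  tensor_in lmap_in lmap_fin_dim fin_dim_tensor_space fin_dim_unit

lemma associator_natural:
  assumes "lmap U U' f" "lmap V V' g" "lmap W W' h"
  shows "compose (tensor_space (tensor_space U V) W) (associator U' V' W')
      (tensor_map (tensor_space U V) (tensor_space U' V') W W' (tensor_map U U' V V' f g) h) =
    compose (tensor_space (tensor_space U V) W)
      (tensor_map U U' (tensor_space V W) (tensor_space V' W') f (tensor_map V V' W W' g h)) (associator U V W)"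
proof -
  note fd = lmap_fin_dim[OF assms(1)] lmap_fin_dim[OF assms(2)] lmap_fin_dim[OF assms(3)]
  note L = lmap_tensor_map[OF assms(1,2)] lmap_tensor_map[OF assms(2,3)]
  show ?thesis
    by (rule lmap_eq_tensor3L[OF fd(1,3,5)
        lmap_compose[OF lmap_tensor_map[OF L(1) assms(3)] lmap_associator[OF fd(2,4,6)]]
        lmap_compose[OF lmap_associator[OF fd(1,3,5)] lmap_tensor_map[OF assms(1) L(2)]]])
      (simp add: pure_simps assms fd L lmap_in[OF assms(1)] lmap_in[OF assms(2)] lmap_in[OF assms(3)]
        tensor_map_pure[OF assms(1,2)] tensor_map_pure[OF assms(2,3)] tensor_map_pure[OF L(1) assms(3)] tensor_map_pure[OF assms(1) L(2)])
qed

lemma left_unitor_natural: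
  assumes "lmap V W f"
  shows "compose (tensor_space (span {unit_vector}) V) (left_unitor W)
      (tensor_map (span {unit_vector}) (span {unit_vector}) V W (\<lambda>v\<in>span {unit_vector}. v) f) =
    compose (tensor_space (span {unit_vector}) V) f (left_unitor V)"
proof -
  note fd = lmap_fin_dim[OF assms] and i = lmap_id[OF fin_dim_unit]
  show ?thesis
    by (rule lmap_eq_tensor[OF lmap_compose[OF lmap_tensor_map[OF i assms] lmap_left_unitor[OF fd(2)]]
        lmap_compose[OF lmap_left_unitor[OF fd(1)] assms]])
      (simp add: pure_simps fd tensor_map_pure[OF i assms] lmap_in[OF assms] lin_scale[OF lmap_lin[OF assms]])
qed

lemma right_unitor_natural:
  assumes "lmap V W f"
  shows "compose (tensor_space V (span {unit_vector})) (right_unitor W)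
      (tensor_map V W (span {unit_vector}) (span {unit_vector}) f (\<lambda>v\<in>span {unit_vector}. v)) =
    compose (tensor_space V (span {unit_vector})) f (right_unitor V)"
proof -
  note fd = lmap_fin_dim[OF assms] and i = lmap_id[OF fin_dim_unit]
  show ?thesis
    by (rule lmap_eq_tensor[OF lmap_compose[OF lmap_tensor_map[OF assms i] lmap_right_unitor[OF fd(2)]]
        lmap_compose[OF lmap_right_unitor[OF fd(1)] assms]])
      (simp add: pure_simps fd tensor_map_pure[OF assms i] lmap_in[OF assms] lin_scale[OF lmap_lin[OF assms]])
qed

lemma symmetry_natural:
  assumes "lmap V V' f" "lmap W W' g"
  shows "compose (tensor_space V W) (symmetry V' W') (tensor_map V V' W W' f g) =
    compose (tensor_space V W) (tensor_map W W' V V' g f) (symmetry V W)"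
proof -
  note fd = lmap_fin_dim[OF assms(1)] lmap_fin_dim[OF assms(2)]
  show ?thesis
    by (rule lmap_eq_tensor[OF lmap_compose[OF lmap_tensor_map[OF assms] lmap_symmetry[OF fd(2,4)]]
        lmap_compose[OF lmap_symmetry[OF fd(1,3)] lmap_tensor_map[OF assms(2,1)]]])
      (simp add: pure_simps fd tensor_map_pure[OF assms] tensor_map_pure[OF assms(2,1)] lmap_in[OF assms(1)] lmap_in[OF assms(2)])
qed

lemma symmetry_symmetry:
  assumes "fin_dim_subspace V" "fin_dim_subspace W"
  shows "compose (tensor_space V W) (symmetry W V) (symmetry V W) = (\<lambda>x\<in>tensor_space V W. x)"
  by (rule lmap_eq_tensor[OF lmap_compose[OF lmap_symmetry lmap_symmetry] lmap_id])
    (simp_all add: pure_simps assms)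

lemma associator_pentagon:
  assumes "fin_dim_subspace U" "fin_dim_subspace V" "fin_dim_subspace W" "fin_dim_subspace Z"
  defines "T \<equiv> tensor_space (tensor_space (tensor_space U V) W) Z"
  shows "compose T (associator U V (tensor_space W Z)) (associator (tensor_space U V) W Z) =
    compose T (tensor_map U U (tensor_space (tensor_space V W) Z) (tensor_space V (tensor_space W Z)) (\<lambda>u\<in>U. u) (associator V W Z))
     (compose T (associator U (tensor_space V W) Z)
       (tensor_map (tensor_space (tensor_space U V) W) (tensor_space U (tensor_space V W)) Z Z (associator U V W) (\<lambda>z\<in>Z. z)))"
proof -
  note fd = assms(1-4)
  note A = lmap_associator[OF fd(1-3)] lmap_associator[OF fd(2-4)] and I = lmap_id[OF fd(1)] lmap_id[OF fd(4)]
  note t = lmap_tensor_map[OF I(1) A(2)] lmap_tensor_map[OF A(1) I(2)]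
  show ?thesis
    unfolding T_def
    by (rule lmap_eq_tensor4L[OF fd lmap_compose[OF lmap_associator lmap_associator]
       lmap_compose[OF lmap_compose[OF t(2) lmap_associator] t(1)]])
      (simp_all add: pure_simps fd tensor_map_pure[OF I(1) A(2)] tensor_map_pure[OF A(1) I(2)])
qed

lemma unitor_triangle:
  assumes "fin_dim_subspace V" "fin_dim_subspace W"
  defines "E \<equiv> span {unit_vector}"
  shows "compose (tensor_space (tensor_space V E) W)
     (tensor_map V V (tensor_space E W) W (\<lambda>v\<in>V. v) (left_unitor W)) (associator V E W) =
     tensor_map (tensor_space V E) V W W (right_unitor V) (\<lambda>w\<in>W. w)"
proof -
  note fd = assms(1,2)
  note U = lmap_left_unitor[OF fd(2)] lmap_right_unitor[OF fd(1)] and I = lmap_id[OF fd(1)] lmap_id[OF fd(2)]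
  \<comment> \<open>The middle factor is a multiple of \<open>unit_vector\<close>. The two sides of
    the triangle hand its scalar to different outer factors, where bilinearity identifies
    them.\<close>
  have "tensor V W v (c *s w) = tensor V W (c *s v) w" if "v \<in> V" "w \<in> W" for c v w
    using that by (simp add: lin_scale[OF tensor_lin(1)[OF fd]] lin_scale[OF tensor_lin(2)[OF fd]])
  then show ?thesis
    unfolding E_def
    by (intro lmap_eq_tensor3L[OF fd(1) fin_dim_unit fd(2) lmap_compose[OF lmap_associator lmap_tensor_map[OF I(1) U(1)]] lmap_tensor_map[OF U(2) I(2)]])
      (simp_all add: pure_simps fd tensor_map_pure[OF I(1) U(1)] tensor_map_pure[OF U(2) I(2)] subspace_scale[OF fin_dim_subspaceI])
qed

lemma symmetry_hexagon:
  assumes "fin_dim_subspace U" "fin_dim_subspace V" "fin_dim_subspace W"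
  defines "T \<equiv> tensor_space (tensor_space U V) W"
  shows "compose T (associator V W U) (compose T (symmetry U (tensor_space V W)) (associator U V W)) =
    compose T (tensor_map V V (tensor_space U W) (tensor_space W U) (\<lambda>v\<in>V. v) (symmetry U W))
     (compose T (associator V U W) (tensor_map (tensor_space U V) (tensor_space V U) W W (symmetry U V) (\<lambda>w\<in>W. w)))"
proof -
  note fd = assms(1-3)
  note S = lmap_symmetry[OF fd(1,3)] lmap_symmetry[OF fd(1,2)] and I = lmap_id[OF fd(2)] lmap_id[OF fd(3)]
  show ?thesis
    unfolding T_def
    by (rule lmap_eq_tensor3L[OF fd lmap_compose[OF lmap_compose[OF lmap_associator lmap_symmetry] lmap_associator]
        lmap_compose[OF lmap_compose[OF lmap_tensor_map[OF S(2) I(2)] lmap_associator] lmap_tensor_map[OF I(1) S(1)]]])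
      (simp_all add: pure_simps fd tensor_map_pure[OF I(1) S(1)] tensor_map_pure[OF S(2) I(2)])
qed

end

context ambient_vector_space
begin

lemma lin_sum_if2:
  assumes "lin V h" "subspace V" "\<And>p q. \<lbrakk>p \<in> A; q \<in> B\<rbrakk> \<Longrightarrow> X p q \<in> V"
  shows "h (\<Sum>p\<in>A. \<Sum>q\<in>B. if P p q then X p q else 0) = (\<Sum>p\<in>A. \<Sum>q\<in>B. if P p q then h (X p q) else 0)"
proof -
  have 1: "(if P p q then X p q else 0) \<in> V" if "p \<in> A" "q \<in> B" for p q
    using assms(3)[OF that] subspace_0[OF assms(2)] by simp
  have "h (\<Sum>p\<in>A. \<Sum>q\<in>B. if P p q then X p q else 0) = (\<Sum>p\<in>A. h (\<Sum>q\<in>B. if P p q then X p q else 0))"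
    by (rule lin_sum[OF assms(1,2)]) (intro subspace_sum[OF assms(2)] 1)
  also have "\<dots> = (\<Sum>p\<in>A. \<Sum>q\<in>B. h (if P p q then X p q else 0))"
    by (intro sum.cong refl lin_sum[OF assms(1,2)] 1)
  finally show ?thesis by (simp add: if_distrib[of h] lin_0[OF assms(1,2)] cong: if_cong)
qed

lemma lin_sum_if3:
  assumes "lin V h" "subspace V" "\<And>p q r. \<lbrakk>p \<in> A; q \<in> B; r \<in> C\<rbrakk> \<Longrightarrow> X p q r \<in> V"
  shows "h (\<Sum>p\<in>A. \<Sum>q\<in>B. \<Sum>r\<in>C. if P p q r then X p q r else 0) =
    (\<Sum>p\<in>A. \<Sum>q\<in>B. \<Sum>r\<in>C. if P p q r then h (X p q r) else 0)"
proof -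
  have 1: "(if P p q r then X p q r else 0) \<in> V" if "p \<in> A" "q \<in> B" "r \<in> C" for p q r
    using assms(3)[OF that] subspace_0[OF assms(2)] by simp
  have "h (\<Sum>p\<in>A. \<Sum>q\<in>B. \<Sum>r\<in>C. if P p q r then X p q r else 0) = (\<Sum>p\<in>A. h (\<Sum>q\<in>B. \<Sum>r\<in>C. if P p q r then X p q r else 0))"
    by (rule lin_sum[OF assms(1,2)]) (intro subspace_sum[OF assms(2)] 1)
  also have "\<dots> = (\<Sum>p\<in>A. \<Sum>q\<in>B. \<Sum>r\<in>C. if P p q r then h (X p q r) else 0)"
    by (intro sum.cong refl lin_sum_if2[OF assms(1,2)] assms(3))
  finally show ?thesis .
qed

lemma lmap_compose_id:
  assumes "lmap V W f"
  shows "compose V f (\<lambda>v\<in>V. v) = f" "compose V (\<lambda>w\<in>W. w) f = f"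
proof -
  have e: "f \<in> extensional V" using lmap_linear_on[OF assms] by (simp add: linear_on_def)
  show "compose V f (\<lambda>v\<in>V. v) = f" "compose V (\<lambda>w\<in>W. w) f = f"
    by (rule extensionalityI[OF _ e]; simp add: compose_eq lmap_in[OF assms])+
qed

lemma tensor_map_id:
  assumes "fin_dim_subspace V" "fin_dim_subspace W"
  shows "tensor_map V V W W (\<lambda>v\<in>V. v) (\<lambda>w\<in>W. w) = (\<lambda>x\<in>tensor_space V W. x)"
  using lmap_eq_tensor[OF lmap_tensor_map[OF lmap_id[OF assms(1)] lmap_id[OF assms(2)]] lmap_id[OF fin_dim_tensor_space[OF assms]]]
  by (simp add: tensor_map_pure lmap_id assms tensor_in)

lemma tensor_map_compose:
  assumes "lmap V V' f" "lmap V' V'' f'" "lmap W W' g" "lmap W' W'' g'"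
  shows "tensor_map V V'' W W'' (compose V f' f) (compose W g' g) =
    compose (tensor_space V W) (tensor_map V' V'' W' W'' f' g') (tensor_map V V' W W' f g)"
  by (rule lmap_eq_tensor[OF lmap_tensor_map[OF lmap_compose[OF assms(1,2)] lmap_compose[OF assms(3,4)]]
        lmap_compose[OF lmap_tensor_map[OF assms(1,3)] lmap_tensor_map[OF assms(2,4)]]])
    (simp add: compose_eq tensor_in tensor_map_pure[OF lmap_compose[OF assms(1,2)] lmap_compose[OF assms(3,4)]]
      tensor_map_pure[OF assms(1,3)] tensor_map_pure[OF assms(2,4)] lmap_in[OF assms(1)] lmap_in[OF assms(3)])

end

section \<open>Equivariance of the monoidal structure\<close>

context bialgebra_reps
begin

lemma chom_lmap: "chom a b f \<Longrightarrow> lmap (vspace a) (vspace b) f"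
  unfolding lmap_def using chom_linear_on chom_in comodule_fin_dim chom_dom chom_cod by blast

lemma chomI:
  assumes "is_comodule M a" "is_comodule M b" "lmap (vspace a) (vspace b) f"
    "\<And>m v. v \<in> vspace a \<Longrightarrow> co b m (f v) = f (co a m v)"
  shows "chom a b f"
  using assms by (simp add: chom_iff lmap_def linear_on_iff)

text \<open>Both sides of the equivariance condition are linear on the tensor space, so pure tensors
  decide it.\<close>

lemma chom_tensorI:
  assumes a: "is_comodule M a" and b: "is_comodule M b" and c: "is_comodule M c"
    and h: "lmap (tensor_space (vspace a) (vspace b)) (vspace c) h"
    and eq: "\<And>n v w. \<lbrakk>v \<in> vspace a; w \<in> vspace b\<rbrakk> \<Longrightarrow>
      co c n (h (tensor (vspace a) (vspace b) v w)) = h (tensor_co a b n v w)"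
  shows "chom (tensor_comodule a b) c h"
proof (rule chomI[OF is_comodule_tensor[OF a b] c])
  show "lmap (vspace (tensor_comodule a b)) (vspace c) h" using h by simp
  fix n x assume x: "x \<in> vspace (tensor_comodule a b)"
  let ?T = "tensor_space (vspace a) (vspace b)"
  have l: "lin ?T (co (tensor_comodule a b) n)" using co_lin[OF is_comodule_tensor[OF a b]] by simp
  have i: "co (tensor_comodule a b) n y \<in> ?T" if "y \<in> ?T" for y
    using co_in[OF is_comodule_tensor[OF a b]] that by simp
  show "co c n (h x) = h (co (tensor_comodule a b) n x)"
  proof (rule tensor_space_eqI[of "vspace a" "vspace b" "\<lambda>x. co c n (h x)" "\<lambda>x. h (co (tensor_comodule a b) n x)" x])
    show "lin ?T (\<lambda>x. co c n (h x))"
      by (rule lin_compose[OF lmap_lin[OF h] co_lin[OF c]]) (auto simp: lmap_in[OF h])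
    show "lin ?T (\<lambda>x. h (co (tensor_comodule a b) n x))"
      by (rule lin_compose[OF l lmap_lin[OF h]]) (auto simp: i)
    show "x \<in> ?T" using x by simp
  qed (simp add: eq co_tensor[OF a b])
qed

lemma chom_tensor_map:
  assumes f: "chom a a' f" and g: "chom b b' g"
  shows "chom (tensor_comodule a b) (tensor_comodule a' b')
    (tensor_map (vspace a) (vspace a') (vspace b) (vspace b') f g)"
proof (rule chom_tensorI[OF chom_dom[OF f] chom_dom[OF g] is_comodule_tensor[OF chom_cod[OF f] chom_cod[OF g]]])
  let ?h = "tensor_map (vspace a) (vspace a') (vspace b) (vspace b') f g"
  note L = lmap_tensor_map[OF chom_lmap[OF f] chom_lmap[OF g]]
  note pure = tensor_map_pure[OF chom_lmap[OF f] chom_lmap[OF g]]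
  show "lmap (tensor_space (vspace a) (vspace b)) (vspace (tensor_comodule a' b')) ?h" using L by simp
  note fin = finite_csupp[OF chom_dom[OF f]] finite_csupp[OF chom_cod[OF f]] finite_csupp[OF chom_dom[OF g]] finite_csupp[OF chom_cod[OF g]]
  fix n v w assume vw: "v \<in> vspace a" "w \<in> vspace b"
  note vw' = chom_in[OF f vw(1)] chom_in[OF g vw(2)]
  let ?A = "csupp a \<union> csupp a'" and ?B = "csupp b \<union> csupp b'"
  have "co (tensor_comodule a' b') n (?h (tensor (vspace a) (vspace b) v w)) = tensor_co a' b' n (f v) (g w)"
    by (simp add: pure vw co_tensor[OF chom_cod[OF f] chom_cod[OF g]] vw')
  also have "\<dots> = (\<Sum>p\<in>?A. \<Sum>q\<in>?B. if p + q = n then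
      tensor (vspace a') (vspace b') (co a' p (f v)) (co b' q (g w)) else 0)"
    by (rule tensor_co_superset[OF chom_cod[OF f] chom_cod[OF g]]) (use fin vw' in auto)
  also have "\<dots> = (\<Sum>p\<in>?A. \<Sum>q\<in>?B. if p + q = n then
      ?h (tensor (vspace a) (vspace b) (co a p v) (co b q w)) else 0)"
    by (simp add: chom_co[OF f] chom_co[OF g] vw pure co_in[OF chom_dom[OF f]] co_in[OF chom_dom[OF g]] cong: if_cong)
  also have "\<dots> = ?h (\<Sum>p\<in>?A. \<Sum>q\<in>?B. if p + q = n then tensor (vspace a) (vspace b) (co a p v) (co b q w) else 0)"
    by (rule lin_sum_if2[OF lmap_lin[OF L] subspace_tensor_space, symmetric])
      (intro tensor_in co_in[OF chom_dom[OF f]] co_in[OF chom_dom[OF g]] vw)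
  also have "\<dots> = ?h (tensor_co a b n v w)"
    by (rule arg_cong[of _ _ ?h], rule tensor_co_superset[OF chom_dom[OF f] chom_dom[OF g], symmetric]) (use fin vw in auto)
  finally show "co (tensor_comodule a' b') n (?h (tensor (vspace a) (vspace b) v w)) = ?h (tensor_co a b n v w)" .
qed

text \<open>The flip is equivariant because exponents add commutatively, that is, because the
  coordinate algebra is commutative.\<close>

lemma chom_symmetry:
  assumes a: "is_comodule M a" and b: "is_comodule M b"
  shows "chom (tensor_comodule a b) (tensor_comodule b a) (symmetry (vspace a) (vspace b))"
proof (rule chom_tensorI[OF a b is_comodule_tensor[OF b a]])
  note fd = comodule_fin_dim[OF a] comodule_fin_dim[OF b]
  show "lmap (tensor_space (vspace a) (vspace b)) (vspace (tensor_comodule b a)) (symmetry (vspace a) (vspace b))"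
    using lmap_symmetry[OF fd] by simp
  fix n v w assume vw: "v \<in> vspace a" "w \<in> vspace b"
  have "co (tensor_comodule b a) n (symmetry (vspace a) (vspace b) (tensor (vspace a) (vspace b) v w)) = tensor_co b a n w v"
    by (simp add: symmetry_pure fd vw co_tensor[OF b a])
  also have "\<dots> = (\<Sum>p\<in>csupp a. \<Sum>q\<in>csupp b. if p + q = n then tensor (vspace b) (vspace a) (co b q w) (co a p v) else 0)"
    unfolding tensor_co_def by (subst sum.swap) (simp add: add.commute)
  also have "\<dots> = symmetry (vspace a) (vspace b) (tensor_co a b n v w)"
    unfolding tensor_co_def
    by (subst lin_sum_if2[OF lmap_lin[OF lmap_symmetry[OF fd]] subspace_tensor_space])
      (auto simp: symmetry_pure fd co_in[OF a] co_in[OF b] vw intro!: tensor_in sum.cong)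
  finally show "co (tensor_comodule b a) n (symmetry (vspace a) (vspace b) (tensor (vspace a) (vspace b) v w)) =
    symmetry (vspace a) (vspace b) (tensor_co a b n v w)" .
qed

lemma tensor_co_unit_left:
  assumes a: "is_comodule M a" and x: "x \<in> span {unit_vector}" and v: "v \<in> vspace a"
  shows "tensor_co unit_comodule a n x v = tensor (span {unit_vector}) (vspace a) x (co a n v)"
proof -
  have "csupp unit_comodule \<subseteq> {0::'m}"
    unfolding unit_comodule_eq by (rule csupp_mk_comodule[OF unit_action_family])
  \<comment> \<open>The unit is supported at exponent 0, so only \<open>q = n\<close> survives.
    Inserting \<open>n\<close> makes this term present also when \<open>n\<close> lies outside
    \<open>csupp a\<close>, where it is zero.\<close>
  then have "tensor_co unit_comodule a n x v = (\<Sum>p\<in>{0}. \<Sum>q\<in>insert n (csupp a). if p + q = n then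
      tensor (vspace (unit_comodule :: ('m, 'v) comodule)) (vspace a) (co unit_comodule p x) (co a q v) else 0)"
    by (intro tensor_co_superset[OF is_comodule_unit a]) (use finite_csupp[OF a] x v in auto)
  also have "\<dots> = (\<Sum>q\<in>insert n (csupp a). if q = n then tensor (span {unit_vector}) (vspace a) x (co a n v) else 0)"
    using x by (auto simp: co_unit intro!: sum.cong)
  also have "\<dots> = tensor (span {unit_vector}) (vspace a) x (co a n v)"
    using finite_csupp[OF a] by (simp add: sum.delta)
  finally show ?thesis .
qed

lemma tensor_co_unit_right:
  assumes a: "is_comodule M a" and x: "x \<in> span {unit_vector}" and v: "v \<in> vspace a"
  shows "tensor_co a unit_comodule n v x = tensor (vspace a) (span {unit_vector}) (co a n v) x"
proof -
  have "csupp unit_comodule \<subseteq> {0::'m}"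
    unfolding unit_comodule_eq by (rule csupp_mk_comodule[OF unit_action_family])
  then have "tensor_co a unit_comodule n v x = (\<Sum>q\<in>insert n (csupp a). \<Sum>p\<in>{0}. if q + p = n then
      tensor (vspace a) (vspace (unit_comodule :: ('m, 'v) comodule)) (co a q v) (co unit_comodule p x) else 0)"
    by (intro tensor_co_superset[OF a is_comodule_unit]) (use finite_csupp[OF a] x v in auto)
  also have "\<dots> = (\<Sum>q\<in>insert n (csupp a). if q = n then tensor (vspace a) (span {unit_vector}) (co a n v) x else 0)"
    using x by (auto simp: co_unit intro!: sum.cong)
  also have "\<dots> = tensor (vspace a) (span {unit_vector}) (co a n v) x"
    using finite_csupp[OF a] by (simp add: sum.delta)
  finally show ?thesis .
qed

lemma chom_left_unitor:
  assumes a: "is_comodule M a"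
  shows "chom (tensor_comodule unit_comodule a) a (left_unitor (vspace a))"
proof (rule chom_tensorI[OF is_comodule_unit a a])
  note fd = comodule_fin_dim[OF a]
  show "lmap (tensor_space (vspace (unit_comodule :: ('m, 'v) comodule)) (vspace a)) (vspace a) (left_unitor (vspace a))"
    using lmap_left_unitor[OF fd] by simp
  fix n :: 'm and x v assume "x \<in> vspace (unit_comodule :: ('m, 'v) comodule)" "v \<in> vspace a"
  then show "co a n (left_unitor (vspace a) (tensor (vspace (unit_comodule :: ('m, 'v) comodule)) (vspace a) x v)) =
      left_unitor (vspace a) (tensor_co unit_comodule a n x v)"
    by (simp add: left_unitor_pure fd tensor_co_unit_left[OF a] co_in[OF a] lin_scale[OF co_lin[OF a]])
qed

lemma chom_right_unitor:
  assumes a: "is_comodule M a"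
  shows "chom (tensor_comodule a unit_comodule) a (right_unitor (vspace a))"
proof (rule chom_tensorI[OF a is_comodule_unit a])
  note fd = comodule_fin_dim[OF a]
  show "lmap (tensor_space (vspace a) (vspace (unit_comodule :: ('m, 'v) comodule))) (vspace a) (right_unitor (vspace a))"
    using lmap_right_unitor[OF fd] by simp
  fix n :: 'm and x v assume "x \<in> vspace (unit_comodule :: ('m, 'v) comodule)" "v \<in> vspace a"
  then show "co a n (right_unitor (vspace a) (tensor (vspace a) (vspace (unit_comodule :: ('m, 'v) comodule)) v x)) =
      right_unitor (vspace a) (tensor_co a unit_comodule n v x)"
    by (simp add: right_unitor_pure fd tensor_co_unit_right[OF a] co_in[OF a] lin_scale[OF co_lin[OF a]])
qed

text \<open>Eliminates the intermediate exponent \<open>s = p + q\<close> of an iterated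
  convolution. The remaining triple sum has the same shape for both bracketings, which gives
  equivariance of the associator.\<close>

lemma sum_if_collapse:
  assumes "finite S" "\<And>p q. \<lbrakk>p \<in> A; q \<in> B\<rbrakk> \<Longrightarrow> p + q \<in> S"
  shows "(\<Sum>s\<in>S. \<Sum>r\<in>C. if s + r = n then (\<Sum>p\<in>A. \<Sum>q\<in>B. if p + q = s then X p q r else 0) else (0::'v)) =
    (\<Sum>p\<in>A. \<Sum>q\<in>B. \<Sum>r\<in>C. if p + q + r = (n::'m) then X p q r else 0)"
proof -
  have "(\<Sum>s\<in>S. \<Sum>r\<in>C. if s + r = n then (\<Sum>p\<in>A. \<Sum>q\<in>B. if p + q = s then X p q r else 0) else 0) =
      (\<Sum>s\<in>S. \<Sum>r\<in>C. \<Sum>p\<in>A. \<Sum>q\<in>B. if p + q = s then (if p + q + r = n then X p q r else 0) else 0)"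
    by (intro sum.cong refl) (auto intro!: sum.cong sum.neutral)
  also have "\<dots> = (\<Sum>p\<in>A. \<Sum>q\<in>B. \<Sum>r\<in>C. \<Sum>s\<in>S. if p + q = s then (if p + q + r = n then X p q r else 0) else 0)"
    unfolding sum.cartesian_product
    by (rule sum.reindex_bij_witness[where i = "\<lambda>(p, q, r, s). (s, r, p, q)" and j = "\<lambda>(s, r, p, q). (p, q, r, s)"]) auto
  also have "\<dots> = (\<Sum>p\<in>A. \<Sum>q\<in>B. \<Sum>r\<in>C. if p + q + r = n then X p q r else 0)"
    using assms by (intro sum.cong refl) (simp add: sum.delta')
  finally show ?thesis .
qed

lemma tensor_co_3L:
  assumes a: "is_comodule M a" and b: "is_comodule M b" and c: "is_comodule M c"
    and uvw: "u \<in> vspace a" "v \<in> vspace b" "w \<in> vspace c"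
  defines "T \<equiv> tensor_space (vspace a) (vspace b)"
  shows "tensor_co (tensor_comodule a b) c n (tensor (vspace a) (vspace b) u v) w =
    (\<Sum>p\<in>csupp a. \<Sum>q\<in>csupp b. \<Sum>r\<in>csupp c. if p + q + r = n then
      tensor T (vspace c) (tensor (vspace a) (vspace b) (co a p u) (co b q v)) (co c r w) else 0)"
proof -
  note ab = is_comodule_tensor[OF a b]
  note fd = comodule_fin_dim[OF a] comodule_fin_dim[OF b] comodule_fin_dim[OF c]
  let ?S = "csupp (tensor_comodule a b) \<union> (\<lambda>(p, q). p + q) ` (csupp a \<times> csupp b)"
  have S: "finite ?S" using finite_csupp[OF ab] finite_csupp[OF a] finite_csupp[OF b] by simp
  have "tensor_co (tensor_comodule a b) c n (tensor (vspace a) (vspace b) u v) w =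
     (\<Sum>s\<in>?S. \<Sum>r\<in>csupp c. if s + r = n then
        tensor (vspace (tensor_comodule a b)) (vspace c) (co (tensor_comodule a b) s (tensor (vspace a) (vspace b) u v)) (co c r w) else 0)"
    by (rule tensor_co_superset[OF ab c]) (use S finite_csupp[OF c] uvw in \<open>auto simp: tensor_in\<close>)
  also have "\<dots> = (\<Sum>s\<in>?S. \<Sum>r\<in>csupp c. if s + r = n then (\<Sum>p\<in>csupp a. \<Sum>q\<in>csupp b. if p + q = s then
        tensor T (vspace c) (tensor (vspace a) (vspace b) (co a p u) (co b q v)) (co c r w) else 0) else 0)"
  proof (intro sum.cong refl if_cong)
    fix s r
    note l = tensor_lin(2)[OF fin_dim_tensor_space[OF fd(1,2)] fd(3) co_in[OF c uvw(3)]]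
    show "tensor (vspace (tensor_comodule a b)) (vspace c) (co (tensor_comodule a b) s (tensor (vspace a) (vspace b) u v)) (co c r w) =
       (\<Sum>p\<in>csupp a. \<Sum>q\<in>csupp b. if p + q = s then
        tensor T (vspace c) (tensor (vspace a) (vspace b) (co a p u) (co b q v)) (co c r w) else 0)"
      unfolding vspace_tensor co_tensor[OF a b uvw(1,2)] tensor_co_def T_def
      by (rule lin_sum_if2[OF l subspace_tensor_space]) (intro tensor_in co_in[OF a] co_in[OF b] uvw)
  qed
  also have "\<dots> = (\<Sum>p\<in>csupp a. \<Sum>q\<in>csupp b. \<Sum>r\<in>csupp c. if p + q + r = n then
      tensor T (vspace c) (tensor (vspace a) (vspace b) (co a p u) (co b q v)) (co c r w) else 0)"
    by (rule sum_if_collapse[OF S]) auto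
  finally show ?thesis .
qed

lemma tensor_co_3R:
  assumes a: "is_comodule M a" and b: "is_comodule M b" and c: "is_comodule M c"
    and uvw: "u \<in> vspace a" "v \<in> vspace b" "w \<in> vspace c"
  defines "T \<equiv> tensor_space (vspace b) (vspace c)"
  shows "tensor_co a (tensor_comodule b c) n u (tensor (vspace b) (vspace c) v w) =
    (\<Sum>p\<in>csupp a. \<Sum>q\<in>csupp b. \<Sum>r\<in>csupp c. if p + q + r = n then
      tensor (vspace a) T (co a p u) (tensor (vspace b) (vspace c) (co b q v) (co c r w)) else 0)"
proof -
  note bc = is_comodule_tensor[OF b c]
  note fd = comodule_fin_dim[OF a] comodule_fin_dim[OF b] comodule_fin_dim[OF c]
  let ?S = "csupp (tensor_comodule b c) \<union> (\<lambda>(p, q). p + q) ` (csupp b \<times> csupp c)"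
  have S: "finite ?S" using finite_csupp[OF bc] finite_csupp[OF b] finite_csupp[OF c] by simp
  have "tensor_co a (tensor_comodule b c) n u (tensor (vspace b) (vspace c) v w) =
     (\<Sum>p\<in>csupp a. \<Sum>s\<in>?S. if p + s = n then
        tensor (vspace a) (vspace (tensor_comodule b c)) (co a p u) (co (tensor_comodule b c) s (tensor (vspace b) (vspace c) v w)) else 0)"
    by (rule tensor_co_superset[OF a bc]) (use S finite_csupp[OF a] uvw in \<open>auto simp: tensor_in\<close>)
  also have "\<dots> = (\<Sum>p\<in>csupp a. \<Sum>s\<in>?S. if p + s = n then (\<Sum>q\<in>csupp b. \<Sum>r\<in>csupp c. if q + r = s then
        tensor (vspace a) T (co a p u) (tensor (vspace b) (vspace c) (co b q v) (co c r w)) else 0) else 0)"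
  proof (intro sum.cong refl if_cong)
    fix s p
    note l = tensor_lin(1)[OF fd(1) fin_dim_tensor_space[OF fd(2,3)] co_in[OF a uvw(1)]]
    show "tensor (vspace a) (vspace (tensor_comodule b c)) (co a p u) (co (tensor_comodule b c) s (tensor (vspace b) (vspace c) v w)) =
       (\<Sum>q\<in>csupp b. \<Sum>r\<in>csupp c. if q + r = s then
        tensor (vspace a) T (co a p u) (tensor (vspace b) (vspace c) (co b q v) (co c r w)) else 0)"
      unfolding vspace_tensor co_tensor[OF b c uvw(2,3)] tensor_co_def T_def
      by (rule lin_sum_if2[OF l subspace_tensor_space]) (intro tensor_in co_in[OF b] co_in[OF c] uvw)
  qed
  also have "\<dots> = (\<Sum>s\<in>?S. \<Sum>p\<in>csupp a. if s + p = n then (\<Sum>q\<in>csupp b. \<Sum>r\<in>csupp c. if q + r = s then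
        tensor (vspace a) T (co a p u) (tensor (vspace b) (vspace c) (co b q v) (co c r w)) else 0) else 0)"
    by (subst sum.swap) (simp only: add.commute)
  also have "\<dots> = (\<Sum>q\<in>csupp b. \<Sum>r\<in>csupp c. \<Sum>p\<in>csupp a. if q + r + p = n then
      tensor (vspace a) T (co a p u) (tensor (vspace b) (vspace c) (co b q v) (co c r w)) else 0)"
    by (rule sum_if_collapse[OF S]) auto
  also have "\<dots> = (\<Sum>p\<in>csupp a. \<Sum>q\<in>csupp b. \<Sum>r\<in>csupp c. if p + q + r = n then
      tensor (vspace a) T (co a p u) (tensor (vspace b) (vspace c) (co b q v) (co c r w)) else 0)"
    unfolding sum.cartesian_product
    by (rule sum.reindex_bij_witness[where i = "\<lambda>(p, q, r). (q, r, p)" and j = "\<lambda>(q, r, p). (p, q, r)"])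
      (auto simp: add_ac)
  finally show ?thesis .
qed

lemma chom_associator:
  assumes a: "is_comodule M a" and b: "is_comodule M b" and c: "is_comodule M c"
  shows "chom (tensor_comodule (tensor_comodule a b) c) (tensor_comodule a (tensor_comodule b c))
    (associator (vspace a) (vspace b) (vspace c))"
proof (rule chomI)
  let ?U = "vspace a" and ?V = "vspace b" and ?W = "vspace c"
  let ?l = "tensor_comodule (tensor_comodule a b) c" and ?r = "tensor_comodule a (tensor_comodule b c)"
  let ?A = "associator ?U ?V ?W"
  note ab = is_comodule_tensor[OF a b] and bc = is_comodule_tensor[OF b c]
  show l: "is_comodule M ?l" by (rule is_comodule_tensor[OF ab c])
  show r: "is_comodule M ?r" by (rule is_comodule_tensor[OF a bc])
  note fd = comodule_fin_dim[OF a] comodule_fin_dim[OF b] comodule_fin_dim[OF c]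
  note L = lmap_associator[OF fd]
  show "lmap (vspace ?l) (vspace ?r) ?A" using L by simp
  fix n x assume x: "x \<in> vspace ?l"
  show "co ?r n (?A x) = ?A (co ?l n x)"
  proof (rule tensor3L_eqI[OF fd, of "\<lambda>x. co ?r n (?A x)" "\<lambda>x. ?A (co ?l n x)" x])
    show "lin (tensor_space (tensor_space ?U ?V) ?W) (\<lambda>x. co ?r n (?A x))"
      by (rule lin_compose[OF lmap_lin[OF L] co_lin[OF r, unfolded vspace_tensor]]) (auto simp: lmap_in[OF L])
    show "lin (tensor_space (tensor_space ?U ?V) ?W) (\<lambda>x. ?A (co ?l n x))"
      by (rule lin_compose[OF co_lin[OF l, unfolded vspace_tensor] lmap_lin[OF L]])
        (auto simp: co_in[OF l, unfolded vspace_tensor])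
    show "x \<in> tensor_space (tensor_space ?U ?V) ?W" using x by simp
    fix u v w assume uvw: "u \<in> ?U" "v \<in> ?V" "w \<in> ?W"
    have "co ?r n (?A (tensor (tensor_space ?U ?V) ?W (tensor ?U ?V u v) w)) =
       tensor_co a (tensor_comodule b c) n u (tensor ?V ?W v w)"
      using co_tensor[OF a bc, unfolded vspace_tensor, OF uvw(1) tensor_in[OF uvw(2,3)]]
      by (simp add: associator_pure fd uvw)
    also have "\<dots> = ?A (tensor_co (tensor_comodule a b) c n (tensor ?U ?V u v) w)"
      unfolding tensor_co_3R[OF a b c uvw] tensor_co_3L[OF a b c uvw]
      by (subst lin_sum_if3[OF lmap_lin[OF L] subspace_tensor_space])
        (auto simp: associator_pure fd co_in[OF a] co_in[OF b] co_in[OF c] uvw intro!: tensor_in sum.cong)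
    also have "tensor_co (tensor_comodule a b) c n (tensor ?U ?V u v) w = co ?l n (tensor (tensor_space ?U ?V) ?W (tensor ?U ?V u v) w)"
      using co_tensor[OF ab c, unfolded vspace_tensor, OF tensor_in[OF uvw(1,2)] uvw(3)] by simp
    finally show "co ?r n (?A (tensor (tensor_space ?U ?V) ?W (tensor ?U ?V u v) w)) =
        ?A (co ?l n (tensor (tensor_space ?U ?V) ?W (tensor ?U ?V u v) w))" .
  qed
qed

lemma iso_arr_RepI2:
  assumes f: "chom a b f" and g: "lmap (vspace b) (vspace a) g"
    and gf: "\<And>v. v \<in> vspace a \<Longrightarrow> g (f v) = v" and fg: "\<And>w. w \<in> vspace b \<Longrightarrow> f (g w) = w"
  shows "iso_arr (Rep M) (Arrow a f b)"
  by (rule iso_arr_RepI[OF f chom_inverse[OF f lmap_lin[OF g] lmap_in[OF g] gf fg]])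
    (simp_all add: gf fg chom_in[OF f])

lemma iso_associator:
  assumes a: "is_comodule M a" and b: "is_comodule M b" and c: "is_comodule M c"
  shows "iso_arr (Rep M) (Assoc (Rep M) a b c)"
proof -
  let ?U = "vspace a" and ?V = "vspace b" and ?W = "vspace c"
  note fd = comodule_fin_dim[OF a] comodule_fin_dim[OF b] comodule_fin_dim[OF c]
  note L = lmap_associator[OF fd]
  obtain g where g: "lmap (tensor_space ?U (tensor_space ?V ?W)) (tensor_space (tensor_space ?U ?V) ?W) g"
    "\<And>u v w. \<lbrakk>u \<in> ?U; v \<in> ?V; w \<in> ?W\<rbrakk> \<Longrightarrow> g (tensor ?U (tensor_space ?V ?W) u (tensor ?V ?W v w)) =
      tensor (tensor_space ?U ?V) ?W (tensor ?U ?V u v) w"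
    using associator_inverse[OF fd] by blast
  have gf: "g (associator ?U ?V ?W x) = x" if "x \<in> tensor_space (tensor_space ?U ?V) ?W" for x
    by (rule tensor3L_eqI[OF fd lin_compose[OF lmap_lin[OF L] lmap_lin[OF g(1)]] lin_ident _ that])
      (auto simp: lmap_in[OF L] associator_pure fd g(2))
  have fg: "associator ?U ?V ?W (g x) = x" if "x \<in> tensor_space ?U (tensor_space ?V ?W)" for x
    by (rule tensor3R_eqI[OF fd lin_compose[OF lmap_lin[OF g(1)] lmap_lin[OF L]] lin_ident _ that])
      (auto simp: lmap_in[OF g(1)] associator_pure fd g(2))
  show ?thesis
    unfolding Rep_simps by (rule iso_arr_RepI2[OF chom_associator[OF a b c], of g]) (use g(1) gf fg in simp_all)
qed

lemma unit_vector_in [simp]: "unit_vector \<in> span {unit_vector}"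
  by (simp add: span_base)

lemma iso_left_unitor:
  assumes a: "is_comodule M a"
  shows "iso_arr (Rep M) (LUnit (Rep M) a)"
proof -
  note fd = comodule_fin_dim[OF a]
  let ?t = "tensor (span {unit_vector}) (vspace a)"
  let ?g = "restrict (?t unit_vector) (vspace a)"
  have u1: "unit_coeff unit_vector = 1" using unit_coeff[of 1] by simp
  have l: "lin (vspace a) (?t unit_vector)" by (rule tensor_lin(1)[OF fin_dim_unit fd]) simp
  have g: "lmap (vspace a) (tensor_space (span {unit_vector}) (vspace a)) ?g"
    by (rule lmap_restrict[OF fd fin_dim_tensor_space[OF fin_dim_unit fd] l]) (simp add: tensor_in)
  note L = lmap_left_unitor[OF fd]
  have gf: "?g (left_unitor (vspace a) x) = x" if "x \<in> tensor_space (span {unit_vector}) (vspace a)" for x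
  proof (rule tensor_space_eqI[OF lin_compose[OF lmap_lin[OF L] lmap_lin[OF g]] lin_ident _ that])
    fix y v assume y: "y \<in> span {unit_vector}" and v: "v \<in> vspace a"
    obtain c where c: "y = c *s unit_vector" using y by (rule unit_spaceE)
    show "?g (left_unitor (vspace a) (?t y v)) = ?t y v"
      using left_unitor_pure[OF fd y v] v
      by (simp add: c subspace_scale[OF fin_dim_subspaceI[OF fd]] lin_scale[OF l] lin_scale[OF tensor_lin(2)[OF fin_dim_unit fd v]])
  qed (auto simp: lmap_in[OF L])
  show ?thesis
    unfolding Rep_simps by (rule iso_arr_RepI2[OF chom_left_unitor[OF a], of ?g])
      (use g gf in \<open>simp_all add: left_unitor_pure fd u1\<close>)
qed

lemma iso_right_unitor:
  assumes a: "is_comodule M a"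
  shows "iso_arr (Rep M) (RUnit (Rep M) a)"
proof -
  note fd = comodule_fin_dim[OF a]
  let ?t = "tensor (vspace a) (span {unit_vector})"
  let ?g = "restrict (\<lambda>v. ?t v unit_vector) (vspace a)"
  have u1: "unit_coeff unit_vector = 1" using unit_coeff[of 1] by simp
  have l: "lin (vspace a) (\<lambda>v. ?t v unit_vector)" by (rule tensor_lin(2)[OF fd fin_dim_unit]) simp
  have g: "lmap (vspace a) (tensor_space (vspace a) (span {unit_vector})) ?g"
    by (rule lmap_restrict[OF fd fin_dim_tensor_space[OF fd fin_dim_unit] l]) (simp add: tensor_in)
  note L = lmap_right_unitor[OF fd]
  have gf: "?g (right_unitor (vspace a) x) = x" if "x \<in> tensor_space (vspace a) (span {unit_vector})" for x
  proof (rule tensor_space_eqI[OF lin_compose[OF lmap_lin[OF L] lmap_lin[OF g]] lin_ident _ that])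
    fix v y assume v: "v \<in> vspace a" and y: "y \<in> span {unit_vector}"
    obtain c where c: "y = c *s unit_vector" using y by (rule unit_spaceE)
    show "?g (right_unitor (vspace a) (?t v y)) = ?t v y"
      using right_unitor_pure[OF fd y v] v
      by (simp add: c subspace_scale[OF fin_dim_subspaceI[OF fd]] lin_scale[OF l] lin_scale[OF tensor_lin(1)[OF fd fin_dim_unit v]])
  qed (auto simp: lmap_in[OF L])
  show ?thesis
    unfolding Rep_simps by (rule iso_arr_RepI2[OF chom_right_unitor[OF a], of ?g])
      (use g gf in \<open>simp_all add: right_unitor_pure fd u1\<close>)
qed

theorem two_rig_Rep: "two_rig (Rep M)"
proof -
  interpret cauchy_complete_linear_category "Rep M" by (rule cauchy_complete_Rep)
  note fd = comodule_fin_dim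
  show ?thesis
  proof
    fix a assume "a \<in> Obj (Rep M)"
    then have a: "is_comodule M a" by simp
    show "LUnit (Rep M) a \<in> Hom (Rep M) (TObj (Rep M) (Unit (Rep M)) a) a"
      using chom_left_unitor[OF a] by simp
    show "RUnit (Rep M) a \<in> Hom (Rep M) (TObj (Rep M) a (Unit (Rep M))) a"
      using chom_right_unitor[OF a] by simp
    show "iso_arr (Rep M) (LUnit (Rep M) a)" by (rule iso_left_unitor[OF a])
    show "iso_arr (Rep M) (RUnit (Rep M) a)" by (rule iso_right_unitor[OF a])
    fix b assume "b \<in> Obj (Rep M)"
    then have b: "is_comodule M b" by simp
    show "TObj (Rep M) a b \<in> Obj (Rep M)" using is_comodule_tensor[OF a b] by simp
    show "TArr (Rep M) (Id (Rep M) a) (Id (Rep M) b) = Id (Rep M) (TObj (Rep M) a b)"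
      by (simp add: tensor_map_id fd[OF a] fd[OF b])
    show "Braid (Rep M) a b \<in> Hom (Rep M) (TObj (Rep M) a b) (TObj (Rep M) b a)"
      using chom_symmetry[OF a b] by simp
    show "Comp (Rep M) (Braid (Rep M) b a) (Braid (Rep M) a b) = Id (Rep M) (TObj (Rep M) a b)"
      by (simp add: symmetry_symmetry fd[OF a] fd[OF b])
    show "Comp (Rep M) (TArr (Rep M) (Id (Rep M) a) (LUnit (Rep M) b)) (Assoc (Rep M) a (Unit (Rep M)) b) =
        TArr (Rep M) (RUnit (Rep M) a) (Id (Rep M) b)"
      by (simp add: unitor_triangle fd[OF a] fd[OF b])
    fix c assume "c \<in> Obj (Rep M)"
    then have c: "is_comodule M c" by simp
    show "Assoc (Rep M) a b c \<in> Hom (Rep M) (TObj (Rep M) (TObj (Rep M) a b) c) (TObj (Rep M) a (TObj (Rep M) b c))"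
      using chom_associator[OF a b c] by simp
    show "iso_arr (Rep M) (Assoc (Rep M) a b c)" by (rule iso_associator[OF a b c])
    show "Comp (Rep M) (Assoc (Rep M) b c a) (Comp (Rep M) (Braid (Rep M) a (TObj (Rep M) b c)) (Assoc (Rep M) a b c)) =
      Comp (Rep M) (TArr (Rep M) (Id (Rep M) b) (Braid (Rep M) a c))
       (Comp (Rep M) (Assoc (Rep M) b a c) (TArr (Rep M) (Braid (Rep M) a b) (Id (Rep M) c)))"
      by (simp add: symmetry_hexagon fd[OF a] fd[OF b] fd[OF c])
    fix d assume "d \<in> Obj (Rep M)"
    then have d: "is_comodule M d" by simp
    show "Comp (Rep M) (Assoc (Rep M) a b (TObj (Rep M) c d)) (Assoc (Rep M) (TObj (Rep M) a b) c d) =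
      Comp (Rep M) (TArr (Rep M) (Id (Rep M) a) (Assoc (Rep M) b c d))
       (Comp (Rep M) (Assoc (Rep M) a (TObj (Rep M) b c) d) (TArr (Rep M) (Assoc (Rep M) a b c) (Id (Rep M) d)))"
      by (simp add: associator_pentagon fd[OF a] fd[OF b] fd[OF c] fd[OF d])
  next
    show "Unit (Rep M) \<in> Obj (Rep M)" by (simp add: is_comodule_unit)
  next
    fix f a b g c d assume "f \<in> Hom (Rep M) a b" "g \<in> Hom (Rep M) c d"
    then obtain f' g' where f: "f = Arrow a f' b" "chom a b f'" and g: "g = Arrow c g' d" "chom c d g'"
      by (elim HomE_Rep)
    note L = chom_lmap[OF f(2)] chom_lmap[OF g(2)]
    show "TArr (Rep M) f g \<in> Hom (Rep M) (TObj (Rep M) a c) (TObj (Rep M) b d)"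
      using f g chom_tensor_map by simp
    show "Comp (Rep M) (Braid (Rep M) b d) (TArr (Rep M) f g) = Comp (Rep M) (TArr (Rep M) g f) (Braid (Rep M) a c)"
      using f g symmetry_natural[OF L] by simp
    have fr: "chom a b (\<lambda>v\<in>vspace a. r *s f' v)" and gr: "chom c d (\<lambda>v\<in>vspace c. r *s g' v)" for r
      using chom_scale f g by auto
    have 1: "tensor_map (vspace a) (vspace b) (vspace c) (vspace d) (\<lambda>v\<in>vspace a. r *s f' v) g' =
      (\<lambda>x\<in>tensor_space (vspace a) (vspace c). r *s tensor_map (vspace a) (vspace b) (vspace c) (vspace d) f' g' x)" for r
      using chom_lmap[OF chom_scale[OF chom_tensor_map[OF f(2) g(2)]], of r]
      by (intro lmap_eq_tensor[OF lmap_tensor_map[OF chom_lmap[OF fr] L(2)]])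
        (simp_all add: tensor_in tensor_map_pure[OF chom_lmap[OF fr] L(2)] tensor_map_pure[OF L] chom_in[OF f(2)] chom_in[OF g(2)]
          lin_scale[OF tensor_lin(2)[OF lmap_fin_dim(2)[OF L(1)] lmap_fin_dim(2)[OF L(2)]]])
    show "TArr (Rep M) (Scale (Rep M) r f) g = Scale (Rep M) r (TArr (Rep M) f g)" for r
      using f g 1 by simp
    have 2: "tensor_map (vspace a) (vspace b) (vspace c) (vspace d) f' (\<lambda>v\<in>vspace c. r *s g' v) =
      (\<lambda>x\<in>tensor_space (vspace a) (vspace c). r *s tensor_map (vspace a) (vspace b) (vspace c) (vspace d) f' g' x)" for r
      using chom_lmap[OF chom_scale[OF chom_tensor_map[OF f(2) g(2)]], of r]
      by (intro lmap_eq_tensor[OF lmap_tensor_map[OF L(1) chom_lmap[OF gr]]])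
        (simp_all add: tensor_in tensor_map_pure[OF L(1) chom_lmap[OF gr]] tensor_map_pure[OF L] chom_in[OF f(2)] chom_in[OF g(2)]
          lin_scale[OF tensor_lin(1)[OF lmap_fin_dim(2)[OF L(1)] lmap_fin_dim(2)[OF L(2)]]])
    show "TArr (Rep M) f (Scale (Rep M) r g) = Scale (Rep M) r (TArr (Rep M) f g)" for r
      using f g 2 by simp
    fix f1 b1 g1 d1 assume "f1 \<in> Hom (Rep M) b b1" "g1 \<in> Hom (Rep M) d d1"
    then obtain f1' g1' where f1: "f1 = Arrow b f1' b1" "chom b b1 f1'" and g1: "g1 = Arrow d g1' d1" "chom d d1 g1'"
      by (elim HomE_Rep)
    show "TArr (Rep M) (Comp (Rep M) f1 f) (Comp (Rep M) g1 g) = Comp (Rep M) (TArr (Rep M) f1 g1) (TArr (Rep M) f g)"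
      using f g f1 g1 tensor_map_compose[OF L(1) chom_lmap[OF f1(2)] L(2) chom_lmap[OF g1(2)]] by simp
  next
    fix f a b g h c d assume "f \<in> Hom (Rep M) a b" "g \<in> Hom (Rep M) a b" "h \<in> Hom (Rep M) c d"
    then obtain f' g' h' where f: "f = Arrow a f' b" "chom a b f'" and g: "g = Arrow a g' b" "chom a b g'"
      and h: "h = Arrow c h' d" "chom c d h'"
      by (elim HomE_Rep)
    note L = chom_lmap[OF f(2)] chom_lmap[OF g(2)] chom_lmap[OF h(2)] chom_lmap[OF chom_add[OF f(2) g(2)]]
    note fd' = lmap_fin_dim(2)[OF L(1)] lmap_fin_dim(2)[OF L(3)]
    have 1: "tensor_map (vspace a) (vspace b) (vspace c) (vspace d) (\<lambda>v\<in>vspace a. f' v + g' v) h' =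
      (\<lambda>x\<in>tensor_space (vspace a) (vspace c). tensor_map (vspace a) (vspace b) (vspace c) (vspace d) f' h' x +
        tensor_map (vspace a) (vspace b) (vspace c) (vspace d) g' h' x)"
      using chom_lmap[OF chom_add[OF chom_tensor_map[OF f(2) h(2)] chom_tensor_map[OF g(2) h(2)]]]
      by (intro lmap_eq_tensor[OF lmap_tensor_map[OF L(4,3)]])
        (simp_all add: tensor_in tensor_map_pure[OF L(4,3)] tensor_map_pure[OF L(1,3)] tensor_map_pure[OF L(2,3)]
          chom_in[OF f(2)] chom_in[OF g(2)] chom_in[OF h(2)] lin_add[OF tensor_lin(2)[OF fd']])
    then show "TArr (Rep M) (Add (Rep M) f g) h = Add (Rep M) (TArr (Rep M) f h) (TArr (Rep M) g h)"
      using f g h by simp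
    have 2: "tensor_map (vspace c) (vspace d) (vspace a) (vspace b) h' (\<lambda>v\<in>vspace a. f' v + g' v) =
      (\<lambda>x\<in>tensor_space (vspace c) (vspace a). tensor_map (vspace c) (vspace d) (vspace a) (vspace b) h' f' x +
        tensor_map (vspace c) (vspace d) (vspace a) (vspace b) h' g' x)"
      using chom_lmap[OF chom_add[OF chom_tensor_map[OF h(2) f(2)] chom_tensor_map[OF h(2) g(2)]]]
      by (intro lmap_eq_tensor[OF lmap_tensor_map[OF L(3,4)]])
        (simp_all add: tensor_in tensor_map_pure[OF L(3,4)] tensor_map_pure[OF L(3,1)] tensor_map_pure[OF L(3,2)]
          chom_in[OF f(2)] chom_in[OF g(2)] chom_in[OF h(2)] lin_add[OF tensor_lin(1)[OF fd'(2,1)]])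
    then show "TArr (Rep M) h (Add (Rep M) f g) = Add (Rep M) (TArr (Rep M) h f) (TArr (Rep M) h g)"
      using f g h by simp
  next
    fix f a b g c d h u v assume "f \<in> Hom (Rep M) a b" "g \<in> Hom (Rep M) c d" "h \<in> Hom (Rep M) u v"
    then obtain f' g' h' where "f = Arrow a f' b" "chom a b f'" "g = Arrow c g' d" "chom c d g'"
      "h = Arrow u h' v" "chom u v h'"
      by (elim HomE_Rep)
    then show "Comp (Rep M) (Assoc (Rep M) b d v) (TArr (Rep M) (TArr (Rep M) f g) h) =
       Comp (Rep M) (TArr (Rep M) f (TArr (Rep M) g h)) (Assoc (Rep M) a c u)"
      using associator_natural[OF chom_lmap chom_lmap chom_lmap] by simp
  next
    fix f a b assume "f \<in> Hom (Rep M) a b"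
    then obtain f' where f: "f = Arrow a f' b" "chom a b f'" by (elim HomE_Rep)
    show "Comp (Rep M) (LUnit (Rep M) b) (TArr (Rep M) (Id (Rep M) (Unit (Rep M))) f) = Comp (Rep M) f (LUnit (Rep M) a)"
      using f left_unitor_natural[OF chom_lmap[OF f(2)]] by simp
    show "Comp (Rep M) (RUnit (Rep M) b) (TArr (Rep M) f (Id (Rep M) (Unit (Rep M)))) = Comp (Rep M) f (RUnit (Rep M) a)"
      using f right_unitor_natural[OF chom_lmap[OF f(2)]] by simp
  qed
qed

end

section \<open>Restriction along a homomorphism that kills the monomials outside a face\<close>

locale bialgebra_restriction = ambient_vector_space scale + M: bialgebra_reps scale M + M': bialgebra_reps scale M'
  for scale :: "'k::field \<Rightarrow> 'v::ab_group_add \<Rightarrow> 'v"  (infixr "*s" 75)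
    and M :: "('m::comm_monoid_add, 'k) affine_monoid" and M' :: "('n::comm_monoid_add, 'k) affine_monoid" +
  fixes \<phi> :: "('m \<Rightarrow>\<^sub>0 'k) \<Rightarrow> ('n \<Rightarrow>\<^sub>0 'k)" and \<delta> :: "'n \<Rightarrow> 'm"
  assumes inj_\<delta>: "inj \<delta>"
    and \<delta>_0: "\<delta> 0 = 0"
    and \<delta>_add: "\<delta> (\<alpha> + \<beta>) = \<delta> \<alpha> + \<delta> \<beta>"
    and \<delta>_face: "p + q \<in> range \<delta> \<Longrightarrow> p \<in> range \<delta>"
    and \<delta>_exponents: "\<delta> \<mu> \<in> exponents M \<Longrightarrow> \<mu> \<in> exponents M'"
    and \<phi>_\<delta>: "\<phi> (monomial (\<delta> \<mu>)) = monomial \<mu>"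
    and \<phi>_other: "n \<notin> range \<delta> \<Longrightarrow> \<phi> (monomial n) = 0"
    and comult_\<delta>: "\<delta> \<kappa> \<in> exponents M \<Longrightarrow> lookup (comult M (monomial (\<delta> \<kappa>))) (\<delta> \<alpha>, \<delta> \<beta>) =
      lookup (comult M' (monomial \<kappa>)) (\<alpha>, \<beta>)"
    and comult_other: "\<lbrakk>n \<in> exponents M; n \<notin> range \<delta>\<rbrakk> \<Longrightarrow>
      lookup (comult M (monomial n)) (\<delta> \<alpha>, \<delta> \<beta>) = 0"
    and counit_\<delta>: "counit M (monomial (\<delta> \<kappa>)) = counit M' (monomial \<kappa>)"
    and counit_other: "n \<notin> range \<delta> \<Longrightarrow> counit M (monomial n) = 0"
begin

text \<open>\<open>range \<delta>\<close> is a face of the exponent monoid: a summand of an element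
  of it lies in it again. For diagonal matrices it consists of the monomials in the diagonal
  variables. Sums whose terms vanish off the face are reindexed by the exponents of the smaller
  monoid.\<close>

lemma sum_over_face:
  assumes "finite A" "\<And>n. \<lbrakk>n \<in> A; n \<notin> range \<delta>\<rbrakk> \<Longrightarrow> f n = (0::'c::comm_monoid_add)"
  shows "(\<Sum>n\<in>A. f n) = (\<Sum>\<kappa>\<in>\<delta> -` A. f (\<delta> \<kappa>))"
proof -
  have "(\<Sum>n\<in>A. f n) = (\<Sum>n\<in>\<delta> ` (\<delta> -` A). f n)"
    by (rule sum.mono_neutral_right) (use assms in auto)
  also have "\<dots> = (\<Sum>\<kappa>\<in>\<delta> -` A. f (\<delta> \<kappa>))"
    by (rule sum.reindex[unfolded comp_def]) (rule inj_on_subset[OF inj_\<delta>], simp)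
  finally show ?thesis .
qed

text \<open>For \<open>n\<close> off the face the comultiplication has no component with both
  exponents on the face, and the counit vanishes. The comodule laws for face exponents therefore
  involve only operators with face exponents.\<close>

lemma restrict_family:
  assumes a: "is_comodule M a"
  shows "action_family M' (vspace a) (\<delta> -` csupp a) (\<lambda>\<mu>. co a (\<delta> \<mu>))"
  unfolding action_family_def
proof (intro conjI allI ballI impI)
  note fin = finite_csupp[OF a]
  show "fin_dim_subspace (vspace a)" by (rule comodule_fin_dim[OF a])
  show "finite (\<delta> -` csupp a)" by (rule finite_vimageI[OF fin inj_\<delta>])
  show "\<delta> -` csupp a \<subseteq> exponents M'" using csupp_exponents[OF a] \<delta>_exponents by auto
  show "lin (vspace a) (co a (\<delta> m))" for m by (rule co_lin[OF a])
  fix v assume v: "v \<in> vspace a"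
  show "co a (\<delta> m) v \<in> vspace a" for m by (rule co_in[OF a v])
  show "co a (\<delta> m) v = 0" if "m \<notin> \<delta> -` csupp a" for m using that co_outside[OF v] by simp
  show "co a (\<delta> l) (co a (\<delta> m) v) = (\<Sum>n\<in>\<delta> -` csupp a. lookup (comult M' (monomial n)) (l, m) *s co a (\<delta> n) v)" for l m
    unfolding co_coassoc[OF a v]
    by (subst sum_over_face[OF fin]) (use csupp_exponents[OF a] comult_other comult_\<delta> in \<open>auto intro!: sum.cong\<close>)
  show "(\<Sum>n\<in>\<delta> -` csupp a. counit M' (monomial n) *s co a (\<delta> n) v) = v"
    using co_counit[OF a v] sum_over_face[OF fin, of "\<lambda>n. counit M (monomial n) *s co a n v"]
    by (simp add: counit_other counit_\<delta>)
qed

lemma lookup_restrict: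
  assumes a: "is_comodule M a" and v: "v \<in> vspace a"
  shows "lookup (id_tensor \<phi> (coaction a v)) \<mu> = co a (\<delta> \<mu>) v"
proof -
  have "lookup (id_tensor \<phi> (coaction a v)) \<mu> =
      (\<Sum>m\<in>csupp a. lookup (\<phi> (monomial m)) \<mu> *s co a m v)"
    using lookup_id_tensor[OF finite_csupp[OF a] keys_coaction[OF v]] by (simp add: co_def)
  also have "\<dots> = (\<Sum>m\<in>csupp a. if m = \<delta> \<mu> then co a m v else 0)"
  proof (intro sum.cong refl)
    fix m
    show "lookup (\<phi> (monomial m)) \<mu> *s co a m v = (if m = \<delta> \<mu> then co a m v else 0)"
      using \<phi>_\<delta> \<phi>_other[of m] inj_\<delta> by (cases "m \<in> range \<delta>") (auto simp: lookup_single when_def inj_eq)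
  qed
  also have "\<dots> = co a (\<delta> \<mu>) v"
    using finite_csupp[OF a] co_outside[OF v] by (simp add: sum.delta)
  finally show ?thesis .
qed

lemma restrict_comodule_eq:
  assumes a: "is_comodule M a"
  shows "restrict_comodule \<phi> a = mk_comodule (vspace a) (\<lambda>\<mu>. co a (\<delta> \<mu>))"
proof -
  have "id_tensor \<phi> (coaction a v) = Abs_poly_mapping (\<lambda>\<mu>. co a (\<delta> \<mu>) v)" if "v \<in> vspace a" for v
    using lookup_Abs_poly_mapping[OF action_family_finite[OF restrict_family[OF a] that]] lookup_restrict[OF a that]
    by (intro poly_mapping_eqI) simp
  then show ?thesis
    unfolding restrict_comodule_def mk_comodule_def by (auto intro!: restrict_ext)
qed

lemma vspace_restrict [simp]: "vspace (restrict_comodule \<phi> a) = vspace a"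
  by (simp add: restrict_comodule_def)

lemma is_comodule_restrict: "is_comodule M a \<Longrightarrow> is_comodule M' (restrict_comodule \<phi> a)"
  unfolding restrict_comodule_eq by (rule is_comodule_mk_comodule[OF restrict_family])

lemma co_restrict: "\<lbrakk>is_comodule M a; v \<in> vspace a\<rbrakk> \<Longrightarrow> co (restrict_comodule \<phi> a) \<mu> v = co a (\<delta> \<mu>) v"
  unfolding restrict_comodule_eq by (rule co_mk_comodule[OF restrict_family])

lemma csupp_restrict: "is_comodule M a \<Longrightarrow> csupp (restrict_comodule \<phi> a) \<subseteq> \<delta> -` csupp a"
  unfolding restrict_comodule_eq by (rule csupp_mk_comodule[OF restrict_family])

lemma restrict_unit: "restrict_comodule \<phi> unit_comodule = unit_comodule"
proof (rule comodule_eqI[OF is_comodule_restrict[OF M.is_comodule_unit] M'.is_comodule_unit])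
  have "\<delta> m = 0 \<longleftrightarrow> m = 0" for m using \<delta>_0 inj_\<delta> by (metis injD)
  then show "co (restrict_comodule \<phi> unit_comodule) m v = co unit_comodule m v"
    if "v \<in> vspace (restrict_comodule \<phi> unit_comodule)" for m v
    using that co_restrict[OF M.is_comodule_unit] by (simp add: M.co_unit M'.co_unit)
qed simp

lemma \<delta>_face2: "p + q = \<delta> \<mu> \<Longrightarrow> p \<in> range \<delta> \<and> q \<in> range \<delta>"
  using \<delta>_face by (metis add.commute rangeI)

text \<open>An equation \<open>p + q = \<delta> \<mu>\<close> forces \<open>p\<close> and
  \<open>q\<close> into the face, so the convolution at a face exponent sees only the restricted
  operators.\<close>

lemma tensor_co_restrict:
  assumes a: "is_comodule M a" and b: "is_comodule M b" and v: "v \<in> vspace a" and w: "w \<in> vspace b"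
  shows "M'.tensor_co (restrict_comodule \<phi> a) (restrict_comodule \<phi> b) \<mu> v w = M.tensor_co a b (\<delta> \<mu>) v w"
proof -
  let ?t = "tensor (vspace a) (vspace b)"
  have "M.tensor_co a b (\<delta> \<mu>) v w = (\<Sum>p\<in>csupp a. \<Sum>\<beta>\<in>\<delta> -` csupp b. if p + \<delta> \<beta> = \<delta> \<mu> then ?t (co a p v) (co b (\<delta> \<beta>) w) else 0)"
    unfolding M.tensor_co_def
    by (intro sum.cong refl sum_over_face[OF finite_csupp[OF b]]) (auto dest: \<delta>_face2)
  also have "\<dots> = (\<Sum>\<alpha>\<in>\<delta> -` csupp a. \<Sum>\<beta>\<in>\<delta> -` csupp b. if \<delta> \<alpha> + \<delta> \<beta> = \<delta> \<mu> then ?t (co a (\<delta> \<alpha>) v) (co b (\<delta> \<beta>) w) else 0)"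
    by (rule sum_over_face[OF finite_csupp[OF a]]) (auto dest: \<delta>_face2 intro!: sum.neutral)
  also have "\<dots> = (\<Sum>\<alpha>\<in>\<delta> -` csupp a. \<Sum>\<beta>\<in>\<delta> -` csupp b. if \<alpha> + \<beta> = \<mu> then
      tensor (vspace (restrict_comodule \<phi> a)) (vspace (restrict_comodule \<phi> b))
        (co (restrict_comodule \<phi> a) \<alpha> v) (co (restrict_comodule \<phi> b) \<beta> w) else 0)"
    by (simp add: co_restrict a b v w inj_eq[OF inj_\<delta>] flip: \<delta>_add cong: if_cong)
  also have "\<dots> = M'.tensor_co (restrict_comodule \<phi> a) (restrict_comodule \<phi> b) \<mu> v w"
    by (rule M'.tensor_co_superset[OF is_comodule_restrict[OF a] is_comodule_restrict[OF b], symmetric])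
      (use v w csupp_restrict a b finite_csupp in \<open>auto intro!: finite_vimageI[OF _ inj_\<delta>]\<close>)
  finally show ?thesis ..
qed

text \<open>An equality and not merely an isomorphism: the chosen tensor product depends only on the
  underlying spaces. The comparison arrows of the functor are therefore identities.\<close>

lemma restrict_tensor:
  assumes a: "is_comodule M a" and b: "is_comodule M b"
  shows "restrict_comodule \<phi> (tensor_comodule a b) = tensor_comodule (restrict_comodule \<phi> a) (restrict_comodule \<phi> b)"
proof (rule comodule_eqI)
  note ab = M.is_comodule_tensor[OF a b] and ra = is_comodule_restrict[OF a] and rb = is_comodule_restrict[OF b]
  note rab = M'.is_comodule_tensor[OF ra rb]
  show "is_comodule M' (restrict_comodule \<phi> (tensor_comodule a b))" by (rule is_comodule_restrict[OF ab])
  show "is_comodule M' (tensor_comodule (restrict_comodule \<phi> a) (restrict_comodule \<phi> b))" by (rule rab)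
  show "vspace (restrict_comodule \<phi> (tensor_comodule a b)) = vspace (tensor_comodule (restrict_comodule \<phi> a) (restrict_comodule \<phi> b))"
    by simp
  fix \<mu> x assume "x \<in> vspace (restrict_comodule \<phi> (tensor_comodule a b))"
  then have x: "x \<in> tensor_space (vspace a) (vspace b)" by simp
  have "co (tensor_comodule a b) (\<delta> \<mu>) x = co (tensor_comodule (restrict_comodule \<phi> a) (restrict_comodule \<phi> b)) \<mu> x"
  proof (rule tensor_space_eqI[OF _ _ _ x])
    show "lin (tensor_space (vspace a) (vspace b)) (co (tensor_comodule a b) (\<delta> \<mu>))"
      using co_lin[OF ab] by simp
    show "lin (tensor_space (vspace a) (vspace b)) (co (tensor_comodule (restrict_comodule \<phi> a) (restrict_comodule \<phi> b)) \<mu>)"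
      using co_lin[OF rab] by simp
    fix v w assume "v \<in> vspace a" "w \<in> vspace b"
    then show "co (tensor_comodule a b) (\<delta> \<mu>) (tensor (vspace a) (vspace b) v w) =
       co (tensor_comodule (restrict_comodule \<phi> a) (restrict_comodule \<phi> b)) \<mu> (tensor (vspace a) (vspace b) v w)"
      using M'.co_tensor[OF ra rb] by (simp add: M.co_tensor[OF a b] tensor_co_restrict[OF a b])
  qed
  then show "co (restrict_comodule \<phi> (tensor_comodule a b)) \<mu> x = co (tensor_comodule (restrict_comodule \<phi> a) (restrict_comodule \<phi> b)) \<mu> x"
    using x by (simp add: co_restrict[OF ab])
qed

lemma chom_restrict: "M.chom a b f \<Longrightarrow> M'.chom (restrict_comodule \<phi> a) (restrict_comodule \<phi> b) f"
  by (simp add: M.chom_iff M'.chom_iff is_comodule_restrict co_restrict)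

lemma restriction_simps [simp]:
  "FObj (restriction \<phi>) a = restrict_comodule \<phi> a"
  "FArr (restriction \<phi>) (Arrow a f b) = Arrow (restrict_comodule \<phi> a) f (restrict_comodule \<phi> b)"
  "FUnit (restriction \<phi>) = Arrow unit_comodule (\<lambda>x\<in>span {unit_vector}. x) unit_comodule"
  by (simp_all add: restriction_def restrict_unit)

lemma FMult_restriction:
  assumes "is_comodule M a" "is_comodule M b"
  shows "FMult (restriction \<phi>) a b = Id (Rep M') (tensor_comodule (restrict_comodule \<phi> a) (restrict_comodule \<phi> b))"
  using assms by (simp add: restriction_def restrict_tensor)

theorem two_rig_map_restriction: "two_rig_map (Rep M) (Rep M') (restriction \<phi>)"
proof -
  interpret C: two_rig "Rep M" by (rule M.two_rig_Rep)
  interpret D: two_rig "Rep M'" by (rule M'.two_rig_Rep)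
  have iso_id: "iso_arr (Rep M') (Id (Rep M') a)" if "is_comodule M' a" for a
    unfolding M'.Rep_simps by (rule M'.iso_arr_RepI[OF M'.chom_id M'.chom_id]) (use that in simp_all)
  note r = is_comodule_restrict
  show ?thesis
  proof
    fix a assume "a \<in> Obj (Rep M)"
    then have a: "is_comodule M a" by simp
    then show "FObj (restriction \<phi>) a \<in> Obj (Rep M')" by (simp add: r)
    show "FArr (restriction \<phi>) (Id (Rep M) a) = Id (Rep M') (FObj (restriction \<phi>) a)" by simp
    note fd = comodule_fin_dim[OF a]
    show "Comp (Rep M') (FArr (restriction \<phi>) (LUnit (Rep M) a)) (Comp (Rep M') (FMult (restriction \<phi>) (Unit (Rep M)) a)
         (TArr (Rep M') (FUnit (restriction \<phi>)) (Id (Rep M') (FObj (restriction \<phi>) a)))) = LUnit (Rep M') (FObj (restriction \<phi>) a)"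
      by (simp add: FMult_restriction a M.is_comodule_unit restrict_unit tensor_map_id fd fin_dim_unit
         lmap_compose_id[OF lmap_id] fin_dim_tensor_space lmap_compose_id[OF lmap_left_unitor[OF fd]])
    show "Comp (Rep M') (FArr (restriction \<phi>) (RUnit (Rep M) a)) (Comp (Rep M') (FMult (restriction \<phi>) a (Unit (Rep M)))
         (TArr (Rep M') (Id (Rep M') (FObj (restriction \<phi>) a)) (FUnit (restriction \<phi>)))) = RUnit (Rep M') (FObj (restriction \<phi>) a)"
      by (simp add: FMult_restriction a M.is_comodule_unit restrict_unit tensor_map_id fd fin_dim_unit
         lmap_compose_id[OF lmap_id] fin_dim_tensor_space lmap_compose_id[OF lmap_right_unitor[OF fd]])
    fix b assume "b \<in> Obj (Rep M)"
    then have b: "is_comodule M b" by simp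
    note fdb = comodule_fin_dim[OF b]
    show "FMult (restriction \<phi>) a b \<in> Hom (Rep M') (TObj (Rep M') (FObj (restriction \<phi>) a) (FObj (restriction \<phi>) b))
         (FObj (restriction \<phi>) (TObj (Rep M) a b))"
      using M'.chom_id[OF M'.is_comodule_tensor[OF r[OF a] r[OF b]]] by (simp add: FMult_restriction a b restrict_tensor)
    show "iso_arr (Rep M') (FMult (restriction \<phi>) a b)"
      unfolding FMult_restriction[OF a b] by (rule iso_id[OF M'.is_comodule_tensor[OF r[OF a] r[OF b]]])
    show "Comp (Rep M') (FArr (restriction \<phi>) (Braid (Rep M) a b)) (FMult (restriction \<phi>) a b) =
       Comp (Rep M') (FMult (restriction \<phi>) b a) (Braid (Rep M') (FObj (restriction \<phi>) a) (FObj (restriction \<phi>) b))"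
      by (simp add: FMult_restriction a b restrict_tensor lmap_compose_id[OF lmap_symmetry[OF fd fdb]])
    fix c assume "c \<in> Obj (Rep M)"
    then have c: "is_comodule M c" by simp
    note fdc = comodule_fin_dim[OF c]
    note fd3 = fd fdb fdc
    show "Comp (Rep M') (FArr (restriction \<phi>) (Assoc (Rep M) a b c)) (Comp (Rep M') (FMult (restriction \<phi>) (TObj (Rep M) a b) c)
         (TArr (Rep M') (FMult (restriction \<phi>) a b) (Id (Rep M') (FObj (restriction \<phi>) c)))) =
       Comp (Rep M') (FMult (restriction \<phi>) a (TObj (Rep M) b c)) (Comp (Rep M') (TArr (Rep M') (Id (Rep M') (FObj (restriction \<phi>) a))
         (FMult (restriction \<phi>) b c)) (Assoc (Rep M') (FObj (restriction \<phi>) a) (FObj (restriction \<phi>) b) (FObj (restriction \<phi>) c)))"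
      by (simp add: FMult_restriction a b c M.is_comodule_tensor restrict_tensor tensor_map_id fd3 fin_dim_tensor_space
          lmap_compose_id[OF lmap_id] lmap_compose_id[OF lmap_associator[OF fd3]])
  next
    fix f a b assume "f \<in> Hom (Rep M) a b"
    then obtain f' where f: "f = Arrow a f' b" "M.chom a b f'" by (rule M.HomE_Rep)
    show "FArr (restriction \<phi>) f \<in> Hom (Rep M') (FObj (restriction \<phi>) a) (FObj (restriction \<phi>) b)"
      using f by (simp add: chom_restrict)
    show "FArr (restriction \<phi>) (Scale (Rep M) c f) = Scale (Rep M') c (FArr (restriction \<phi>) f)" for c
      using f by simp
    fix g c assume "g \<in> Hom (Rep M) b c"
    then obtain g' where "g = Arrow b g' c" "M.chom b c g'" by (rule M.HomE_Rep)
    then show "FArr (restriction \<phi>) (Comp (Rep M) g f) = Comp (Rep M') (FArr (restriction \<phi>) g) (FArr (restriction \<phi>) f)"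
      using f by simp
  next
    fix f a b g assume "f \<in> Hom (Rep M) a b" "g \<in> Hom (Rep M) a b"
    then obtain f' g' where "f = Arrow a f' b" "g = Arrow a g' b" by (elim M.HomE_Rep)
    then show "FArr (restriction \<phi>) (Add (Rep M) f g) = Add (Rep M') (FArr (restriction \<phi>) f) (FArr (restriction \<phi>) g)"
      by simp
  next
    fix f a a' g b b' assume "f \<in> Hom (Rep M) a a'" "g \<in> Hom (Rep M) b b'"
    then obtain f' g' where f: "f = Arrow a f' a'" "M.chom a a' f'" and g: "g = Arrow b g' b'" "M.chom b b' g'"
      by (elim M.HomE_Rep)
    note L = lmap_tensor_map[OF M.chom_lmap[OF f(2)] M.chom_lmap[OF g(2)]]
    show "Comp (Rep M') (FMult (restriction \<phi>) a' b') (TArr (Rep M') (FArr (restriction \<phi>) f) (FArr (restriction \<phi>) g)) =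
        Comp (Rep M') (FArr (restriction \<phi>) (TArr (Rep M) f g)) (FMult (restriction \<phi>) a b)"
      using f g M.chom_dom[OF f(2)] M.chom_cod[OF f(2)] M.chom_dom[OF g(2)] M.chom_cod[OF g(2)]
      by (simp add: FMult_restriction restrict_tensor lmap_compose_id[OF L])
  next
    show "FUnit (restriction \<phi>) \<in> Hom (Rep M') (Unit (Rep M')) (FObj (restriction \<phi>) (Unit (Rep M)))"
      using M'.chom_id[OF M'.is_comodule_unit] by (simp add: restrict_unit)
    show "iso_arr (Rep M') (FUnit (restriction \<phi>))"
      using iso_id[OF M'.is_comodule_unit] by simp
  qed
qed

theorem two_rig_extension_restriction:
  assumes "\<And>a b. \<lbrakk>is_comodule M a; is_comodule M b;
     isomorphic (Rep M') (restrict_comodule \<phi> a) (restrict_comodule \<phi> b)\<rbrakk> \<Longrightarrow> isomorphic (Rep M) a b"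
  shows "two_rig_extension (Rep M) (Rep M') (restriction \<phi>)"
proof -
  interpret two_rig_map "Rep M" "Rep M'" "restriction \<phi>" by (rule two_rig_map_restriction)
  show ?thesis
  proof
    fix f g a b assume "f \<in> Hom (Rep M) a b" "g \<in> Hom (Rep M) a b" "FArr (restriction \<phi>) f = FArr (restriction \<phi>) g"
    then show "f = g" by (auto elim!: M.HomE_Rep)
  next
    fix f assume "f \<in> Arr (Rep M)" and iso: "iso_arr (Rep M') (FArr (restriction \<phi>) f)"
    then obtain a b f' where f: "f = Arrow a f' b" "M.chom a b f'" unfolding M.Arr_Rep by blast
    obtain a' b' f'' h where h: "FArr (restriction \<phi>) f = Arrow a' f'' b'" "M'.chom a' b' f''" "M'.chom b' a' h"
      "\<And>v. v \<in> vspace a' \<Longrightarrow> h (f'' v) = v" "\<And>w. w \<in> vspace b' \<Longrightarrow> f'' (h w) = w"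
      by (rule M'.iso_arr_RepE[OF iso]) (rule that)
    then have e: "a' = restrict_comodule \<phi> a" "b' = restrict_comodule \<phi> b" "f'' = f'" using f by auto
    \<comment> \<open>The inverse supplied in the target category is in particular a linear inverse,
      and a linear inverse of an equivariant map is equivariant for the larger monoid too.\<close>
    show "iso_arr (Rep M) f"
      unfolding f(1) by (rule M.iso_arr_RepI2[OF f(2), of h]) (use M'.chom_lmap[OF h(3)] h(4,5) e in auto)
  next
    fix a b assume "a \<in> Obj (Rep M)" "b \<in> Obj (Rep M)" "isomorphic (Rep M') (FObj (restriction \<phi>) a) (FObj (restriction \<phi>) b)"
    then show "isomorphic (Rep M) a b" using assms by simp
  qed
qed

end

subsection \<open>The bialgebras of matrices and of diagonal matrices\<close>

text \<open>Keeps the exponent \<open>1\<close> in \<open>var x\<close> from being rewritten to \<open>Suc 0\<close>.\<close>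

declare One_nat_def [simp del]

lemma poly_eval_monomial:
  fixes \<iota> :: "'k::zero_neq_one \<Rightarrow> 'a::comm_ring_1"
  assumes "\<iota> 1 = 1"
  shows "poly_eval \<iota> g (monomial e) = (\<Prod>x\<in>keys e. g x ^ lookup e x)"
  using assms by (simp add: poly_eval_def)

lemma poly_eval_monomial_add:
  fixes \<iota> :: "'k::zero_neq_one \<Rightarrow> 'a::comm_ring_1"
  assumes "\<iota> 1 = 1"
  shows "poly_eval \<iota> g (monomial (p + q)) = poly_eval \<iota> g (monomial p) * poly_eval \<iota> g (monomial q)"
proof -
  let ?A = "keys p \<union> keys q"
  have e: "(\<Prod>x\<in>keys e. g x ^ lookup e x) = (\<Prod>x\<in>?A. g x ^ lookup e x)"
    if "keys e \<subseteq> ?A" for e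
    using that by (intro prod.mono_neutral_left) (auto simp: in_keys_iff)
  show ?thesis
    unfolding poly_eval_monomial[where \<iota> = \<iota>, OF assms]
    using e[of p] e[of q] e[of "p + q"] keys_add[of p q] by (simp add: lookup_add power_add prod.distrib)
qed

lemma poly_eval_one:
  fixes \<iota> :: "'k::zero_neq_one \<Rightarrow> 'a::comm_ring_1"
  assumes "\<iota> 1 = 1"
  shows "poly_eval \<iota> g 1 = 1"
  using poly_eval_monomial[where \<iota> = \<iota> and e = 0, OF assms] by simp

lemma poly_eval_var:
  fixes \<iota> :: "'k::zero_neq_one \<Rightarrow> 'a::comm_ring_1"
  assumes "\<iota> 1 = 1"
  shows "poly_eval \<iota> g (monomial (var x)) = g x"
  using poly_eval_monomial[where \<iota> = \<iota> and e = "var x", OF assms] by simp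

text \<open>Taking one variable out of a nonzero exponent lowers the total degree. Multiplicative
  maps on monomials are computed along this induction, one variable at a time.\<close>

lemma exponent_induct [case_names zero var]:
  fixes n :: "'x \<Rightarrow>\<^sub>0 nat"
  assumes "P 0" "\<And>n x. P n \<Longrightarrow> P (n + var x)"
  shows "P n"
proof (induction "\<Sum>x\<in>keys n. lookup n x" arbitrary: n rule: less_induct)
  case less
  show ?case
  proof (cases "n = 0")
    case False
    then obtain x where x: "x \<in> keys n" by fastforce
    have n: "n = (n - var x) + var x"
      using x by (intro poly_mapping_eqI) (auto simp: lookup_add lookup_minus lookup_single when_def in_keys_iff)
    have "(\<Sum>y\<in>keys (n - var x). lookup (n - var x) y) =
        (\<Sum>y\<in>keys n. lookup (n - var x) y)"
      by (rule sum.mono_neutral_left) (auto simp: in_keys_iff lookup_minus)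
    also have "\<dots> < (\<Sum>y\<in>keys n. lookup n y)"
      by (rule sum_strict_mono_ex1) (use x in \<open>auto simp: lookup_minus in_keys_iff lookup_single when_def intro!: bexI[of _ x]\<close>)
    finally have "P (n - var x)" by (rule less)
    then have "P ((n - var x) + var x)" by (rule assms(2))
    then show ?thesis using n by simp
  qed (simp add: assms(1))
qed

text \<open>By cancellation \<open>t\<close> is the only exponent that reaches \<open>t + s\<close>,
  so multiplication by a monomial merely shifts the coefficients.\<close>

lemma lookup_times_monomial_add:
  fixes F :: "'m::cancel_comm_monoid_add \<Rightarrow>\<^sub>0 'k::comm_semiring_1"
  shows "lookup (F * monomial s) (t + s) = lookup F t"
proof -
  have "lookup (F * monomial s) (t + s) =
      (\<Sum>x\<in>insert t (keys F). \<Sum>y\<in>{s}. if x + y = t + s then lookup F x * lookup (monomial s) y else 0)"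
    by (rule lookup_times_sum) auto
  also have "\<dots> = (\<Sum>x\<in>insert t (keys F). if x = t then lookup F t else 0)"
    by (intro sum.cong) auto
  finally show ?thesis by (simp add: sum.delta)
qed

lemma lookup_times_monomial_other:
  fixes F :: "'m::comm_monoid_add \<Rightarrow>\<^sub>0 'k::comm_semiring_1"
  assumes "\<And>t'. t \<noteq> t' + s"
  shows "lookup (F * monomial s) t = 0"
proof -
  have "lookup (F * monomial s) t =
      (\<Sum>x\<in>keys F. \<Sum>y\<in>{s}. if x + y = t then lookup F x * lookup (monomial s) y else 0)"
    by (rule lookup_times_sum) auto
  also have "\<dots> = 0" using assms by (intro sum.neutral) auto
  finally show ?thesis .
qed

section \<open>Exponents of matrix variables and their weights\<close>

type_synonym mat_exp = "nat \<times> nat \<Rightarrow>\<^sub>0 nat"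

definition diag :: "(nat \<Rightarrow>\<^sub>0 nat) \<Rightarrow> mat_exp"
  where "diag \<mu> = Abs_poly_mapping (\<lambda>(i, j). if i = j then lookup \<mu> i else 0)"

lemma lookup_diag: "lookup (diag \<mu>) (i, j) = (if i = j then lookup \<mu> i else 0)"
proof -
  have "finite {p. (case p of (i, j) \<Rightarrow> if i = j then lookup \<mu> i else 0) \<noteq> 0}"
    by (rule finite_subset[of _ "(\<lambda>i. (i, i)) ` keys \<mu>"]) (auto simp: in_keys_iff split: if_splits)
  then show ?thesis unfolding diag_def by (simp add: lookup_Abs_poly_mapping)
qed

lemma inj_diag: "inj diag"
proof (rule injI, rule poly_mapping_eqI)
  fix \<mu> \<nu> k assume "diag \<mu> = diag \<nu>"
  then have "lookup (diag \<mu>) (k, k) = lookup (diag \<nu>) (k, k)" by simp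
  then show "lookup \<mu> k = lookup \<nu> k" by (simp add: lookup_diag)
qed

lemma diag_0: "diag 0 = 0"
  by (rule poly_mapping_eqI) (auto simp: lookup_diag split: prod.split)

lemma diag_add: "diag (\<mu> + \<nu>) = diag \<mu> + diag \<nu>"
  by (rule poly_mapping_eqI) (auto simp: lookup_diag lookup_add)

lemma diag_var: "diag (var i) = var (i, i)"
proof (rule poly_mapping_eqI)
  fix p :: "nat \<times> nat"
  show "lookup (diag (var i)) p = lookup (var (i, i)) p"
    by (cases p) (auto simp: lookup_diag lookup_single when_def)
qed

lemma range_diag_iff: "n \<in> range diag \<longleftrightarrow> (\<forall>i j. i \<noteq> j \<longrightarrow> lookup n (i, j) = 0)"
proof
  assume n: "\<forall>i j. i \<noteq> j \<longrightarrow> lookup n (i, j) = 0"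
  define \<mu> where "\<mu> = Abs_poly_mapping (\<lambda>i. lookup n (i, i))"
  have "finite {i. lookup n (i, i) \<noteq> 0}"
    using finite_vimageI[of "keys n" "\<lambda>i. (i, i)"] by (simp add: inj_on_def vimage_def in_keys_iff)
  then have "lookup \<mu> i = lookup n (i, i)" for i by (simp add: \<mu>_def)
  then have "n = diag \<mu>" using n by (intro poly_mapping_eqI) (auto simp: lookup_diag)
  then show "n \<in> range diag" by simp
qed (auto simp: lookup_diag)

lemma range_diag_add: "p + q \<in> range diag \<longleftrightarrow> p \<in> range diag \<and> q \<in> range diag"
  unfolding range_diag_iff by (auto simp: lookup_add)

lemma range_diag_var: "var (i, j) \<in> range diag \<longleftrightarrow> i = j"
  unfolding range_diag_iff by (auto simp: lookup_single when_def)

text \<open>The weight of the monomial under left multiplication by diagonal matrices;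
  \<open>col_sum\<close> is its weight under right multiplication.\<close>

definition row_sum :: "mat_exp \<Rightarrow> (nat \<Rightarrow>\<^sub>0 nat)"
  where "row_sum n = (\<Sum>p\<in>keys n. single (fst p) (lookup n p))"

definition col_sum :: "mat_exp \<Rightarrow> (nat \<Rightarrow>\<^sub>0 nat)"
  where "col_sum n = (\<Sum>p\<in>keys n. single (snd p) (lookup n p))"

lemma row_sum_0 [simp]: "row_sum 0 = 0" and col_sum_0 [simp]: "col_sum 0 = 0"
  by (simp_all add: row_sum_def col_sum_def)

lemma row_sum_var [simp]: "row_sum (var p) = var (fst p)" and col_sum_var [simp]: "col_sum (var p) = var (snd p)"
  by (simp_all add: row_sum_def col_sum_def)

lemma row_sum_add: "row_sum (m + n) = row_sum m + row_sum n" and col_sum_add: "col_sum (m + n) = col_sum m + col_sum n"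
  unfolding row_sum_def col_sum_def
  by (rule setsum_keys_plus_distrib; simp add: single_add)+

lemma row_sum_diag: "row_sum (diag \<mu>) = \<mu>" and col_sum_diag: "col_sum (diag \<mu>) = \<mu>"
  by (induction \<mu> rule: exponent_induct) (simp_all add: diag_0 diag_add diag_var row_sum_add col_sum_add)

definition mat_comult :: "nat \<Rightarrow> mat_exp \<Rightarrow> (mat_exp \<times> mat_exp \<Rightarrow>\<^sub>0 'k::comm_ring_1)"
  where "mat_comult N n = comult (matrix_monoid N) (monomial n)"

lemma mat_comult_0: "mat_comult N 0 = 1"
  unfolding mat_comult_def by (simp add: matrix_monoid_def poly_eval_one)

lemma mat_comult_add: "mat_comult N (m + n) = mat_comult N m * mat_comult N n"
  unfolding mat_comult_def by (simp add: matrix_monoid_def poly_eval_monomial_add)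

lemma mat_comult_var: "mat_comult N (var (i, j)) = (\<Sum>l<N. monomial (var (i, l), var (l, j)))"
  unfolding mat_comult_def by (simp add: matrix_monoid_def poly_eval_var)

lemma mat_comult_Suc: "mat_comult N (n + var (i, j)) = (\<Sum>l<N. mat_comult N n * monomial (var (i, l), var (l, j)))"
  by (simp add: mat_comult_add mat_comult_var sum_distrib_left)

definition mat_exponents :: "nat \<Rightarrow> mat_exp set"
  where "mat_exponents N = {n. keys n \<subseteq> {..<N} \<times> {..<N}}"

lemma exponents_matrix: "exponents (matrix_monoid N) = mat_exponents N"
  by (simp add: matrix_monoid_def mat_exponents_def)

lemma mat_exponents_add: "m + n \<in> mat_exponents N \<longleftrightarrow> m \<in> mat_exponents N \<and> n \<in> mat_exponents N"
  unfolding mat_exponents_def by (auto simp: subset_iff in_keys_iff lookup_add)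

lemma mat_exponents_var: "var (i, j) \<in> mat_exponents N \<longleftrightarrow> i < N \<and> j < N"
  unfolding mat_exponents_def by auto

text \<open>Entry (i, j) of a product X D with D diagonal is entry (i, j) of X times d_j. Hence the
  monomial with exponent \<open>n\<close>, evaluated at X D, is its value at X times a monomial in D
  of exponent \<open>col_sum n\<close>.\<close>

lemma mat_comult_diag_right:
  assumes "n \<in> mat_exponents N"
  shows "lookup (mat_comult N n :: _ \<Rightarrow>\<^sub>0 'k::comm_ring_1) (l, diag \<beta>) = (if l = n \<and> col_sum n = \<beta> then 1 else 0)"
  using assms
proof (induction n arbitrary: l \<beta> rule: exponent_induct)
  case zero
  have "diag \<mu> = 0 \<longleftrightarrow> \<mu> = 0" for \<mu> using inj_diag diag_0 by (metis injD)
  then show ?case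
    by (auto simp: mat_comult_0 lookup_one when_def zero_prod_def)
next
  case (var n x)
  obtain i j where x: "x = (i, j)" by (cases x)
  have n: "n \<in> mat_exponents N" "i < N" "j < N"
    using var.prems by (auto simp: x mat_exponents_add mat_exponents_var)
  let ?F = "mat_comult N n :: _ \<Rightarrow>\<^sub>0 'k"
  \<comment> \<open>Such a summand places the off-diagonal variable e_kj into the second tensor
    factor, whose exponent is required to be diagonal.\<close>
  have 0: "lookup (?F * monomial (var (i, k), var (k, j))) (l, diag \<beta>) = 0" if "k \<noteq> j" for k
  proof (rule lookup_times_monomial_other)
    fix t' :: "mat_exp \<times> mat_exp"
    have "diag \<beta> \<noteq> snd t' + var (k, j)"
      using range_diag_add[of "snd t'" "var (k, j)"] that range_diag_var by (metis rangeI)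
    then show "(l, diag \<beta>) \<noteq> t' + (var (i, k), var (k, j))" by (cases t') auto
  qed
  have 1: "lookup (?F * monomial (var (i, j), var (j, j))) (l, diag \<beta>) =
     (if l = n + var (i, j) \<and> col_sum (n + var (i, j)) = \<beta> then 1 else 0)"
  proof (cases "\<exists>l' \<beta>'. l = l' + var (i, j) \<and> \<beta> = \<beta>' + var j")
    case True
    then obtain l' \<beta>' where l: "l = l' + var (i, j)" "\<beta> = \<beta>' + var j" by blast
    have "(l, diag \<beta>) = (l', diag \<beta>') + (var (i, j), var (j, j))" by (simp add: l diag_add diag_var)
    then show ?thesis by (simp only: lookup_times_monomial_add var.IH[OF n(1)]) (simp add: l col_sum_add)
  next
    case False
    have "(l, diag \<beta>) \<noteq> t' + (var (i, j), var (j, j))" for t'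
    proof
      assume e: "(l, diag \<beta>) = t' + (var (i, j), var (j, j))"
      obtain p q where t: "t' = (p, q)" by (cases t')
      have "diag \<beta> = q + var (j, j)" "l = p + var (i, j)" using e by (auto simp: t)
      moreover from this(1) have "q \<in> range diag" using range_diag_add by (metis rangeI)
      ultimately obtain \<beta>' where "diag \<beta> = diag (\<beta>' + var j)" "l = p + var (i, j)" by (auto simp: diag_add diag_var)
      then show False using False inj_diag by (auto simp: inj_eq)
    qed
    then have "lookup (?F * monomial (var (i, j), var (j, j))) (l, diag \<beta>) = 0"
      by (rule lookup_times_monomial_other)
    then show ?thesis using False by (auto simp: col_sum_add)
  qed
  have "lookup (mat_comult N (n + var x) :: _ \<Rightarrow>\<^sub>0 'k) (l, diag \<beta>) =
     (\<Sum>k<N. if k = j then lookup (?F * monomial (var (i, j), var (j, j))) (l, diag \<beta>) else 0)"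
    unfolding x mat_comult_Suc lookup_sum using 0 by (intro sum.cong) auto
  also have "\<dots> = (if l = n + var x \<and> col_sum (n + var x) = \<beta> then 1 else 0)"
    using n(3) by (simp add: 1 x)
  finally show ?case .
qed

text \<open>The mirror image: entry (i, j) of D X is d_i times entry (i, j) of X, so row sums take
  the place of column sums.\<close>

lemma mat_comult_diag_left:
  assumes "n \<in> mat_exponents N"
  shows "lookup (mat_comult N n :: _ \<Rightarrow>\<^sub>0 'k::comm_ring_1) (diag \<alpha>, m) = (if m = n \<and> row_sum n = \<alpha> then 1 else 0)"
  using assms
proof (induction n arbitrary: m \<alpha> rule: exponent_induct)
  case zero
  have "diag \<mu> = 0 \<longleftrightarrow> \<mu> = 0" for \<mu> using inj_diag diag_0 by (metis injD)
  then show ?case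
    by (auto simp: mat_comult_0 lookup_one when_def zero_prod_def)
next
  case (var n x)
  obtain i j where x: "x = (i, j)" by (cases x)
  have n: "n \<in> mat_exponents N" "i < N" "j < N"
    using var.prems by (auto simp: x mat_exponents_add mat_exponents_var)
  let ?F = "mat_comult N n :: _ \<Rightarrow>\<^sub>0 'k"
  have 0: "lookup (?F * monomial (var (i, k), var (k, j))) (diag \<alpha>, m) = 0" if "k \<noteq> i" for k
  proof (rule lookup_times_monomial_other)
    fix t' :: "mat_exp \<times> mat_exp"
    have "diag \<alpha> \<noteq> fst t' + var (i, k)"
      using range_diag_add[of "fst t'" "var (i, k)"] that range_diag_var by (metis rangeI)
    then show "(diag \<alpha>, m) \<noteq> t' + (var (i, k), var (k, j))" by (cases t') auto
  qed
  have 1: "lookup (?F * monomial (var (i, i), var (i, j))) (diag \<alpha>, m) =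
     (if m = n + var (i, j) \<and> row_sum (n + var (i, j)) = \<alpha> then 1 else 0)"
  proof (cases "\<exists>m' \<alpha>'. m = m' + var (i, j) \<and> \<alpha> = \<alpha>' + var i")
    case True
    then obtain m' \<alpha>' where m: "m = m' + var (i, j)" "\<alpha> = \<alpha>' + var i" by blast
    have "(diag \<alpha>, m) = (diag \<alpha>', m') + (var (i, i), var (i, j))" by (simp add: m diag_add diag_var)
    then show ?thesis by (simp only: lookup_times_monomial_add var.IH[OF n(1)]) (simp add: m row_sum_add)
  next
    case False
    have "(diag \<alpha>, m) \<noteq> t' + (var (i, i), var (i, j))" for t'
    proof
      assume e: "(diag \<alpha>, m) = t' + (var (i, i), var (i, j))"
      obtain p q where t: "t' = (p, q)" by (cases t')
      have "diag \<alpha> = p + var (i, i)" "m = q + var (i, j)" using e by (auto simp: t)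
      moreover from this(1) have "p \<in> range diag" using range_diag_add by (metis rangeI)
      ultimately obtain \<alpha>' where "diag \<alpha> = diag (\<alpha>' + var i)" "m = q + var (i, j)" by (auto simp: diag_add diag_var)
      then show False using False inj_diag by (auto simp: inj_eq)
    qed
    then have "lookup (?F * monomial (var (i, i), var (i, j))) (diag \<alpha>, m) = 0"
      by (rule lookup_times_monomial_other)
    then show ?thesis using False by (auto simp: row_sum_add)
  qed
  have "lookup (mat_comult N (n + var x) :: _ \<Rightarrow>\<^sub>0 'k) (diag \<alpha>, m) =
     (\<Sum>k<N. if k = i then lookup (?F * monomial (var (i, i), var (i, j))) (diag \<alpha>, m) else 0)"
    unfolding x mat_comult_Suc lookup_sum using 0 by (intro sum.cong) auto
  also have "\<dots> = (if m = n + var x \<and> row_sum (n + var x) = \<alpha> then 1 else 0)"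
    using n(2) by (simp add: 1 x)
  finally show ?case .
qed

lemma power_comult: "comult (power_monoid N) (monomial \<kappa>) = monomial (\<kappa>, \<kappa>)"
proof (induction \<kappa> rule: exponent_induct)
  case zero
  show ?case by (simp add: power_monoid_def poly_eval_one zero_prod_def[symmetric])
next
  case (var n x)
  then show ?case by (simp add: power_monoid_def poly_eval_monomial_add poly_eval_var mult_single)
qed

lemma power_counit: "counit (power_monoid N) (monomial \<kappa>) = 1"
  by (simp add: power_monoid_def poly_eval_monomial)

text \<open>The counit is evaluation at the identity matrix, where off-diagonal variables are 0 and
  diagonal ones are 1.\<close>

lemma matrix_counit: "counit (matrix_monoid N) (monomial n) = (if n \<in> range diag then 1 else 0)"
proof (induction n rule: exponent_induct)
  case zero
  have "0 \<in> range diag" by (metis diag_0 rangeI)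
  then show ?case by (simp add: matrix_monoid_def poly_eval_one)
next
  case (var n x)
  obtain i j where x: "x = (i, j)" by (cases x)
  show ?case
    using var unfolding range_diag_add x range_diag_var
    by (auto simp: matrix_monoid_def poly_eval_monomial_add poly_eval_var)
qed

lemma restrict_to_diagonal_monomial:
  "restrict_to_diagonal (monomial (diag \<mu>)) = monomial \<mu>"
  "n \<notin> range diag \<Longrightarrow> restrict_to_diagonal (monomial n) = 0"
proof -
  show "restrict_to_diagonal (monomial (diag \<mu>)) = monomial \<mu>"
  proof (induction \<mu> rule: exponent_induct)
    case zero
    show ?case by (simp add: restrict_to_diagonal_def poly_eval_one diag_0)
  next
    case (var n x)
    then show ?case
      by (simp add: restrict_to_diagonal_def poly_eval_monomial_add poly_eval_var diag_add diag_var mult_single)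
  qed
  show "restrict_to_diagonal (monomial n) = 0" if "n \<notin> range diag"
    using that
  proof (induction n rule: exponent_induct)
    case zero
    then show ?case by (metis diag_0 rangeI)
  next
    case (var n x)
    obtain i j where x: "x = (i, j)" by (cases x)
    show ?case
      using var unfolding range_diag_add x range_diag_var
      by (auto simp: restrict_to_diagonal_def poly_eval_monomial_add poly_eval_var)
  qed
qed

context ambient_vector_space
begin

lemma matrix_reps: "bialgebra_reps scale (matrix_monoid N)"
proof unfold_locales
  show "comult (matrix_monoid N) (monomial 0) = monomial 0"
    by (simp add: matrix_monoid_def poly_eval_one)
  show "counit (matrix_monoid N) (monomial 0) = 1"
    by (simp add: matrix_monoid_def poly_eval_one)
qed (auto simp: matrix_monoid_def poly_eval_monomial_add subset_iff in_keys_iff lookup_add)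

lemma power_reps: "bialgebra_reps scale (power_monoid N)"
proof unfold_locales
  show "comult (power_monoid N) (monomial 0) = monomial 0"
    by (simp add: power_monoid_def poly_eval_one)
  show "counit (power_monoid N) (monomial 0) = 1"
    by (simp add: power_monoid_def poly_eval_one)
qed (auto simp: power_monoid_def poly_eval_monomial_add subset_iff in_keys_iff lookup_add)

lemma diagonal_restriction:
  "bialgebra_restriction scale (matrix_monoid N) (power_monoid N) restrict_to_diagonal diag"
proof -
  interpret M: bialgebra_reps scale "matrix_monoid N" by (rule matrix_reps)
  interpret M': bialgebra_reps scale "power_monoid N" by (rule power_reps)
  show ?thesis
  proof
    show "inj diag" by (rule inj_diag)
    show "diag 0 = 0" by (rule diag_0)
    show "diag (\<alpha> + \<beta>) = diag \<alpha> + diag \<beta>" for \<alpha> \<beta> by (rule diag_add)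
    show "p \<in> range diag" if "p + q \<in> range diag" for p q using that range_diag_add by blast
    show "restrict_to_diagonal (monomial (diag \<mu>)) = monomial \<mu>" for \<mu> by (rule restrict_to_diagonal_monomial)
    show "restrict_to_diagonal (monomial n) = 0" if "n \<notin> range diag" for n using that by (rule restrict_to_diagonal_monomial)
    show "counit (matrix_monoid N) (monomial (diag \<kappa>)) = counit (power_monoid N) (monomial \<kappa>)" for \<kappa>
      by (simp add: matrix_counit power_counit)
    show "counit (matrix_monoid N) (monomial n) = 0" if "n \<notin> range diag" for n
      using that by (simp add: matrix_counit)
    show "lookup (comult (matrix_monoid N :: (_, 'k) affine_monoid) (monomial (diag \<kappa>))) (diag \<alpha>, diag \<beta>) =
        lookup (comult (power_monoid N) (monomial \<kappa>)) (\<alpha>, \<beta>)"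
      if "diag \<kappa> \<in> exponents (matrix_monoid N :: (_, 'k) affine_monoid)" for \<kappa> \<alpha> \<beta>
      using mat_comult_diag_right[OF that[unfolded exponents_matrix], of "diag \<alpha>" \<beta>] inj_diag
      by (auto simp: mat_comult_def power_comult lookup_single when_def col_sum_diag inj_eq)
    show "lookup (comult (matrix_monoid N :: (_, 'k) affine_monoid) (monomial n)) (diag \<alpha>, diag \<beta>) = 0"
      if "n \<in> exponents (matrix_monoid N :: (_, 'k) affine_monoid)" "n \<notin> range diag" for n \<alpha> \<beta>
    proof -
      have "diag \<alpha> \<noteq> n" using that(2) by auto
      then show ?thesis
        using mat_comult_diag_right[OF that(1)[unfolded exponents_matrix], of "diag \<alpha>" \<beta>] by (simp add: mat_comult_def)
    qed
  next
    fix \<mu> assume "diag \<mu> \<in> exponents (matrix_monoid N :: (_, 'k) affine_monoid)"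
    then have \<mu>: "diag \<mu> \<in> mat_exponents N" by (simp add: exponents_matrix)
    show "\<mu> \<in> exponents (power_monoid N :: (_, 'k) affine_monoid)"
    proof -
      have "i < N" if "i \<in> keys \<mu>" for i
      proof -
        have "(i, i) \<in> keys (diag \<mu>)" using that by (simp add: in_keys_iff lookup_diag)
        then show ?thesis using \<mu> by (auto simp: mat_exponents_def)
      qed
      then show ?thesis by (auto simp: power_monoid_def)
    qed
  qed
qed

end

subsection \<open>Symmetry of the structure constants\<close>

lemma poly_mapping_sum_single: "F = (\<Sum>k\<in>keys F. single k (lookup F k))"
  by (rule poly_mapping_eqI) (auto simp: lookup_sum lookup_single when_def in_keys_iff)

definition transp :: "mat_exp \<Rightarrow> mat_exp"
  where "transp n = Abs_poly_mapping (\<lambda>p. lookup n (prod.swap p))"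

lemma lookup_transp [simp]: "lookup (transp n) p = lookup n (prod.swap p)"
proof -
  have "finite (prod.swap -` keys n)" by (rule finite_vimageI) simp_all
  then show ?thesis by (simp add: transp_def vimage_def in_keys_iff)
qed

lemma transp_transp [simp]: "transp (transp n) = n"
  by (rule poly_mapping_eqI) simp

lemma transp_0 [simp]: "transp 0 = 0"
  by (rule poly_mapping_eqI) simp

lemma transp_add: "transp (m + n) = transp m + transp n"
  by (rule poly_mapping_eqI) (simp add: lookup_add)

lemma transp_var [simp]: "transp (var (i, j)) = var (j, i)"
  by (rule poly_mapping_eqI) (auto simp: lookup_single when_def)

lemma inj_transp: "inj transp"
  by (metis injI transp_transp)

lemma keys_transp: "keys (transp n) = prod.swap ` keys n"
proof (intro set_eqI iffI)
  fix p assume "p \<in> keys (transp n)"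
  then have "prod.swap p \<in> keys n" by (simp add: in_keys_iff)
  then show "p \<in> prod.swap ` keys n" by (rule rev_image_eqI) simp
qed (auto simp: in_keys_iff)

lemma transp_mat_exponents [simp]: "transp n \<in> mat_exponents N \<longleftrightarrow> n \<in> mat_exponents N"
  by (auto simp: mat_exponents_def in_keys_iff subset_iff)

lemma row_sum_eq_0: "row_sum n = 0 \<longleftrightarrow> n = 0"
proof
  assume r: "row_sum n = 0"
  show "n = 0"
  proof (rule poly_mapping_eqI)
    fix p :: "nat \<times> nat"
    have "lookup (row_sum n) (fst p) = 0" using r by simp
    then have "(\<Sum>q\<in>keys n. lookup (single (fst q) (lookup n q)) (fst p)) = 0"
      by (simp add: row_sum_def lookup_sum)
    then have "p \<in> keys n \<Longrightarrow> lookup n p = 0" by (auto dest!: bspec[of _ _ p])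
    then show "lookup n p = lookup 0 p" by (auto simp: in_keys_iff)
  qed
qed simp

definition mfact :: "mat_exp \<Rightarrow> nat"
  where "mfact n = (\<Prod>p\<in>keys n. fact (lookup n p))"

lemma mfact_superset: "\<lbrakk>finite A; keys n \<subseteq> A\<rbrakk> \<Longrightarrow> mfact n = (\<Prod>p\<in>A. fact (lookup n p))"
  unfolding mfact_def by (rule prod.mono_neutral_left) (auto simp: in_keys_iff)

lemma mfact_0 [simp]: "mfact 0 = 1"
  by (simp add: mfact_def)

lemma mfact_var: "mfact (n + var p) = (lookup n p + 1) * mfact n"
proof -
  let ?A = "insert p (keys n)"
  have f: "fact (k + 1) = (k + 1) * fact k" for k :: nat
    by (simp only: Suc_eq_plus1[symmetric] fact_Suc of_nat_id)
  have k: "keys (n + var p) \<subseteq> ?A" using keys_add[of n "var p"] by auto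
  have "mfact (n + var p) = (\<Prod>q\<in>?A. fact (lookup (n + var p) q))"
    by (rule mfact_superset) (use k in auto)
  also have "\<dots> = (\<Prod>q\<in>?A. (if q = p then lookup n p + 1 else 1) * fact (lookup n q))"
    by (intro prod.cong) (auto simp: lookup_add lookup_single when_def f)
  also have "\<dots> = (lookup n p + 1) * mfact n"
    by (simp add: prod.distrib mfact_superset[of ?A] subset_insertI)
  finally show ?thesis .
qed

lemma mfact_pos: "mfact n > 0"
  by (simp add: mfact_def)

text \<open>Partial differentiation in the variables of the first tensor factor.  Where the subtraction of
  exponents is truncated, the coefficient vanishes.\<close>

definition pderiv1 :: "nat \<times> nat \<Rightarrow> (mat_exp \<times> mat_exp \<Rightarrow>\<^sub>0 'k::comm_ring_1) \<Rightarrow>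
    (mat_exp \<times> mat_exp \<Rightarrow>\<^sub>0 'k)"
  where "pderiv1 x F = (\<Sum>k\<in>keys F. single (fst k - var x, snd k)
    (of_nat (lookup (fst k) x) * lookup F k))"

lemma pderiv1_single: "pderiv1 x (single (l, m) c) =
    single (l - var x, m) (of_nat (lookup l x) * c)"
  by (cases "c = 0") (simp_all add: pderiv1_def)

lemma pderiv1_add: "pderiv1 x (F + G) = pderiv1 x F + pderiv1 x G"
  unfolding pderiv1_def by (rule setsum_keys_plus_distrib) (simp_all add: distrib_left single_add)

lemma pderiv1_0 [simp]: "pderiv1 x 0 = 0"
  by (simp add: pderiv1_def)

lemma pderiv1_sum: "pderiv1 x (\<Sum>i\<in>I. f i) = (\<Sum>i\<in>I. pderiv1 x (f i))"
  by (induction I rule: infinite_finite_induct) (simp_all add: pderiv1_add)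

lemma minus_var_plus:
  fixes n :: "'x \<Rightarrow>\<^sub>0 nat"
  assumes "lookup n x > 0"
  shows "n - var x + m = n + m - var x" "n - var x + var x = n"
  using assms by (auto intro!: poly_mapping_eqI simp: lookup_add lookup_minus lookup_single when_def)

text \<open>The Leibniz rule, with a monomial as second factor; this is the case that occurs in the
  recursion for \<open>mat_comult\<close>. By linearity it suffices to treat a single term of
  \<open>F\<close>.\<close>

lemma pderiv1_mult_monomial:
  "pderiv1 x (F * monomial (s, t)) = pderiv1 x F * monomial (s, t) + F * pderiv1 x (monomial (s, t))"
proof -
  have 1: "pderiv1 x (single (l, m) c * monomial (s, t)) =
      pderiv1 x (single (l, m) c) * monomial (s, t) + single (l, m) c * pderiv1 x (monomial (s, t))"
    for l m c
  proof -
    \<comment> \<open>If the variable is absent from \<open>l\<close>, truncation spoils the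
      exponent but the coefficient is 0 on both sides.\<close>
    have a: "single (l - var x + s, m + t) (of_nat (lookup l x) * c) =
        single (l + s - var x, m + t) (of_nat (lookup l x) * c)"
      using minus_var_plus(1)[of l x s] by (cases "lookup l x = 0") simp_all
    have b: "single (l + (s - var x), m + t) (c * of_nat (lookup s x)) =
        single (l + s - var x, m + t) (c * of_nat (lookup s x))"
      using minus_var_plus(1)[of s x l] by (cases "lookup s x = 0") (simp_all add: add.commute)
    have "pderiv1 x (single (l, m) c * monomial (s, t)) =
        single (l + s - var x, m + t) (of_nat (lookup l x + lookup s x) * c)"
      by (simp add: mult_single pderiv1_single lookup_add)
    also have "\<dots> = single (l + s - var x, m + t) (of_nat (lookup l x) * c) +
        single (l + s - var x, m + t) (c * of_nat (lookup s x))"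
      by (simp add: algebra_simps flip: single_add)
    also have "\<dots> = single (l - var x + s, m + t) (of_nat (lookup l x) * c) +
        single (l + (s - var x), m + t) (c * of_nat (lookup s x))"
      unfolding a b ..
    finally show ?thesis by (simp add: pderiv1_single mult_single)
  qed
  have "F * monomial (s, t) = (\<Sum>k\<in>keys F. single k (lookup F k) * monomial (s, t))"
    by (subst poly_mapping_sum_single[of F]) (rule sum_distrib_right)
  then have "pderiv1 x (F * monomial (s, t)) =
      (\<Sum>k\<in>keys F. pderiv1 x (single k (lookup F k) * monomial (s, t)))"
    by (simp add: pderiv1_sum)
  also have "\<dots> = (\<Sum>k\<in>keys F. pderiv1 x (single k (lookup F k)) * monomial (s, t) +
      single k (lookup F k) * pderiv1 x (monomial (s, t)))"
    by (rule sum.cong[OF refl]) (rule 1[of "fst k" "snd k" for k, unfolded prod.collapse])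
  also have "\<dots> = pderiv1 x (\<Sum>k\<in>keys F. single k (lookup F k)) * monomial (s, t) +
      (\<Sum>k\<in>keys F. single k (lookup F k)) * pderiv1 x (monomial (s, t))"
    by (simp add: sum.distrib pderiv1_sum sum_distrib_right)
  finally show ?thesis by (simp flip: poly_mapping_sum_single)
qed

lemma lookup_pderiv1:
  "lookup (pderiv1 x F) (l, m) = of_nat (lookup l x + 1) * lookup F (l + var x, m)"
proof -
  have "lookup (pderiv1 x F) (l, m) = (\<Sum>k\<in>keys F. if k = (l + var x, m) then
      of_nat (lookup l x + 1) * lookup F (l + var x, m) else 0)"
    unfolding pderiv1_def lookup_sum
  proof (intro sum.cong refl)
    fix k :: "mat_exp \<times> mat_exp"
    obtain p q where k: "k = (p, q)" by (cases k)
    show "lookup (single (fst k - var x, snd k) (of_nat (lookup (fst k) x) * lookup F k)) (l, m) =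
      (if k = (l + var x, m) then of_nat (lookup l x + 1) * lookup F (l + var x, m) else 0)"
    proof (cases "lookup p x = 0")
      case True
      then have "p \<noteq> l + var x" by (auto simp: lookup_add)
      then show ?thesis using True by (simp add: k)
    next
      case False
      then have "p - var x = l \<longleftrightarrow> p = l + var x" using minus_var_plus(2)[of p x] by auto
      then show ?thesis by (auto simp: k lookup_single when_def lookup_add)
    qed
  qed
  then show ?thesis by (auto simp: sum.delta in_keys_iff)
qed

text \<open>The chain rule: in X Y the variable X_pq occurs exactly in the entries (p, j), with
  coefficient Y_qj. Differentiating the monomial with exponent \<open>n\<close> in entry (p, j)
  yields the factor \<open>lookup n (p, j)\<close>.\<close>

lemma pderiv1_mat_comult:
  assumes "n \<in> mat_exponents N" "q < N"
  shows "pderiv1 (p, q) (mat_comult N n :: _ \<Rightarrow>\<^sub>0 'k::comm_ring_1) =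
    (\<Sum>j<N. single (0, var (q, j)) (of_nat (lookup n (p, j))) * mat_comult N (n - var (p, j)))"
  using assms(1)
proof (induction n rule: exponent_induct)
  case zero
  have "pderiv1 (p, q) (1 :: _ \<Rightarrow>\<^sub>0 'k) = pderiv1 (p, q) (single (0, 0) 1)"
    by (simp flip: zero_prod_def)
  also have "\<dots> = 0" by (subst pderiv1_single) simp
  finally show ?case by (simp add: mat_comult_0)
next
  case (var n x)
  obtain i j' where x: "x = (i, j')" by (cases x)
  have n: "n \<in> mat_exponents N" "i < N" "j' < N"
    using var.prems by (simp_all add: x mat_exponents_add mat_exponents_var)
  let ?D = "mat_comult N :: _ \<Rightarrow> _ \<Rightarrow>\<^sub>0 'k"
  have 1: "?D n * pderiv1 (p, q) (monomial (var (i, k), var (k, j'))) =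
     (if k = q then (if i = p then ?D n * monomial (0, var (q, j')) else 0) else 0)" for k
    by (auto simp: pderiv1_single lookup_single when_def)
  have "pderiv1 (p, q) (?D (n + var x)) = (\<Sum>k<N. pderiv1 (p, q) (?D n) * monomial (var (i, k), var (k, j')) +
      ?D n * pderiv1 (p, q) (monomial (var (i, k), var (k, j'))))"
    unfolding x mat_comult_Suc pderiv1_sum pderiv1_mult_monomial ..
  also have "\<dots> = pderiv1 (p, q) (?D n) * ?D (var (i, j')) + (if i = p then ?D n * monomial (0, var (q, j')) else 0)"
    unfolding sum.distrib 1 using assms(2) by (simp add: mat_comult_var sum_distrib_left)
  also have "\<dots> = (\<Sum>j<N. single (0, var (q, j)) (of_nat (lookup n (p, j))) * ?D (n - var (p, j)) * ?D (var (i, j'))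
      + (if j = j' then (if i = p then ?D n * monomial (0, var (q, j')) else 0) else 0))"
    unfolding var.IH[OF n(1)] using n(3) by (simp add: sum.distrib sum_distrib_right)
  also have "\<dots> = (\<Sum>j<N. single (0, var (q, j)) (of_nat (lookup (n + var x) (p, j))) * ?D (n + var x - var (p, j)))"
  proof (intro sum.cong refl)
    fix j
    have a: "single (0, var (q, j)) (of_nat (lookup n (p, j))) * ?D (n - var (p, j)) * ?D (var (i, j')) =
       single (0, var (q, j)) (of_nat (lookup n (p, j))) * ?D (n + var x - var (p, j))"
    proof (cases "lookup n (p, j) = 0")
      case False
      then have "n + var x - var (p, j) = n - var (p, j) + var (i, j')"
        using minus_var_plus(1)[of n "(p, j)" "var x"] by (simp add: x)
      then show ?thesis by (simp add: mat_comult_add mult.assoc)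
    qed simp
    have b: "of_nat (lookup (n + var x) (p, j)) = (of_nat (lookup n (p, j)) :: 'k) + (if i = p \<and> j = j' then 1 else 0)"
      by (auto simp: lookup_add x lookup_single when_def)
    show "single (0, var (q, j)) (of_nat (lookup n (p, j))) * ?D (n - var (p, j)) * ?D (var (i, j'))
      + (if j = j' then (if i = p then ?D n * monomial (0, var (q, j')) else 0) else 0) =
      single (0, var (q, j)) (of_nat (lookup (n + var x) (p, j))) * ?D (n + var x - var (p, j))"
      unfolding a b by (auto simp: x single_add algebra_simps)
  qed
  finally show ?case .
qed

text \<open>
  Polynomials carry the pairing under which multiplication by a variable is adjoint to
  differentiation, i.e. distinct monomials are orthogonal and \<open>x\<^sup>n\<close> has norm \<open>n!\<close>.  The lemma says
  that translation by a matrix and translation by its transpose are adjoint.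
\<close>

theorem mat_comult_symmetry:
  assumes "n \<in> mat_exponents N" "m \<in> mat_exponents N"
  shows "of_nat (mfact m) * lookup (mat_comult N n :: _ \<Rightarrow>\<^sub>0 'k::comm_ring_1) (l, m) =
    of_nat (mfact n) * lookup (mat_comult N (transp m)) (transp n, l)"
  using assms
proof (induction n arbitrary: l m rule: exponent_induct)
  case zero
  have t: "transp m \<in> mat_exponents N" using zero by simp
  have z: "transp m = 0 \<longleftrightarrow> m = 0" by (metis transp_0 transp_transp)
  show ?case
    using mat_comult_diag_left[OF t, of 0 l, where ?'k = 'k]
    by (auto simp: mat_comult_0 lookup_one when_def zero_prod_def diag_0 row_sum_eq_0 z)
next
  case (var n x)
  obtain i j where x: "x = (i, j)" by (cases x)
  have n: "n \<in> mat_exponents N" "i < N" "j < N"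
    using var.prems by (simp_all add: x mat_exponents_add mat_exponents_var)
  let ?D = "mat_comult N :: _ \<Rightarrow> _ \<Rightarrow>\<^sub>0 'k"
  have t: "transp m \<in> mat_exponents N" using var.prems by simp
  \<comment> \<open>The new factor in \<open>mfact (n + var x)\<close> is the one produced by
    differentiating with respect to the transposed variable e_ji. The expression thus becomes a
    coefficient of a derivative, and the chain rule applies.\<close>
  have "of_nat (mfact (n + var x)) * lookup (?D (transp m)) (transp (n + var x), l) =
     of_nat (mfact n) * lookup (pderiv1 (j, i) (?D (transp m))) (transp n, l)"
    unfolding lookup_pderiv1 by (simp add: x mfact_var transp_add mult.commute mult.assoc del: of_nat_add)
  also have "\<dots> = (\<Sum>k<N. of_nat (mfact n) * lookup (single (0, var (i, k)) (of_nat (lookup m (k, j))) * ?D (transp m - var (j, k))) (transp n, l))"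
    unfolding pderiv1_mat_comult[OF t n(2)] lookup_sum sum_distrib_left by simp
  also have "\<dots> = (\<Sum>k<N. of_nat (mfact m) * lookup (?D n * monomial (var (i, k), var (k, j))) (l, m))"
  proof (intro sum.cong refl)
    fix k
    have s: "single (0, var (i, k)) (of_nat c) * G = of_nat c * (G * monomial (0, var (i, k)))"
      for c and G :: "mat_exp \<times> mat_exp \<Rightarrow>\<^sub>0 'k"
    proof -
      have X: "single (0, var (i, k)) (of_nat c) = of_nat c * (monomial (0, var (i, k)) :: _ \<Rightarrow>\<^sub>0 'k)"
        by (simp add: mult_single flip: single_of_nat)
      show ?thesis unfolding X by (simp only: mult_ac)
    qed
    have lk: "lookup (of_nat c * G) y = of_nat c * lookup G y" for c y
      and G :: "mat_exp \<times> mat_exp \<Rightarrow>\<^sub>0 'k"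
      by (induction c) (simp_all add: distrib_right lookup_add)
    show "of_nat (mfact n) * lookup (single (0, var (i, k)) (of_nat (lookup m (k, j))) * ?D (transp m - var (j, k))) (transp n, l) =
       of_nat (mfact m) * lookup (?D n * monomial (var (i, k), var (k, j))) (l, m)"
    \<comment> \<open>Both sides vanish unless e_ik divides \<open>l\<close> and e_kj divides
      \<open>m\<close>. If they do, dividing these variables out leads to the induction
      hypothesis.\<close>
    proof (cases "(\<exists>l'. l = l' + var (i, k)) \<and> lookup m (k, j) > 0")
      case True
      then obtain l' where l: "l = l' + var (i, k)" by blast
      define m' where "m' = m - var (k, j)"
      have m: "m = m' + var (k, j)" using minus_var_plus(2)[of m "(k, j)"] True by (simp add: m'_def)
      have m'E: "m' \<in> mat_exponents N" using var.prems m by (simp add: mat_exponents_add)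
      have tm: "transp m - var (j, k) = transp m'" by (simp add: m transp_add)
      have e1: "(transp n, l) = (transp n, l') + (0, var (i, k))" by (simp add: l)
      have e2: "(l, m) = (l', m') + (var (i, k), var (k, j))" by (simp add: l m)
      have "of_nat (mfact m) * lookup (?D n * monomial (var (i, k), var (k, j))) (l, m) =
          of_nat (lookup m (k, j)) * (of_nat (mfact m') * lookup (?D n) (l', m'))"
        unfolding e2 lookup_times_monomial_add by (simp add: m mfact_var lookup_add mult.assoc)
      also have "\<dots> = of_nat (lookup m (k, j)) * (of_nat (mfact n) * lookup (?D (transp m')) (transp n, l'))"
        by (simp only: var.IH[OF n(1) m'E])
      also have "\<dots> = of_nat (mfact n) * lookup (single (0, var (i, k)) (of_nat (lookup m (k, j))) * ?D (transp m - var (j, k))) (transp n, l)"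
        unfolding s lk tm e1 lookup_times_monomial_add by (simp add: mult_ac)
      finally show ?thesis ..
    next
      case False
      have r: "lookup (?D n * monomial (var (i, k), var (k, j))) (l, m) = 0"
      proof (rule lookup_times_monomial_other)
        fix t' :: "mat_exp \<times> mat_exp"
        show "(l, m) \<noteq> t' + (var (i, k), var (k, j))"
          using False by (cases t') (auto simp: lookup_add)
      qed
      have "lookup m (k, j) = 0 \<or> lookup (?D (transp m - var (j, k)) * monomial (0, var (i, k))) (transp n, l) = 0"
      proof (cases "lookup m (k, j) = 0")
        case nz: False
        have "lookup (?D (transp m - var (j, k)) * monomial (0, var (i, k))) (transp n, l) = 0"
        proof (rule lookup_times_monomial_other)
          fix t' :: "mat_exp \<times> mat_exp"
          show "(transp n, l) \<noteq> t' + (0, var (i, k))"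
            using False nz by (cases t') auto
        qed
        then show ?thesis ..
      qed simp
      then show ?thesis unfolding s lk r by auto
    qed
  qed
  also have "\<dots> = of_nat (mfact m) * lookup (?D (n + var x)) (l, m)"
    unfolding x mat_comult_Suc lookup_sum sum_distrib_left ..
  finally show ?case ..
qed

subsection \<open>Polynomial functions of matrices\<close>

definition meval :: "('x \<Rightarrow> 'k::comm_semiring_1) \<Rightarrow> ('x \<Rightarrow>\<^sub>0 nat) \<Rightarrow> 'k"
  where "meval X n = (\<Prod>p\<in>keys n. X p ^ lookup n p)"

lemma meval_superset: "\<lbrakk>finite A; keys n \<subseteq> A\<rbrakk> \<Longrightarrow> meval X n = (\<Prod>p\<in>A. X p ^ lookup n p)"
  unfolding meval_def by (rule prod.mono_neutral_left) (auto simp: in_keys_iff)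

lemma meval_0 [simp]: "meval X 0 = 1"
  by (simp add: meval_def)

lemma meval_var [simp]: "meval X (var p) = X p"
  by (simp add: meval_def)

lemma meval_add: "meval X (m + n) = meval X m * meval X n"
proof -
  let ?A = "keys m \<union> keys n"
  have "meval X e = (\<Prod>p\<in>?A. X p ^ lookup e p)" if "keys e \<subseteq> ?A" for e
    by (rule meval_superset) (use that in auto)
  from this[of m] this[of n] this[of "m + n"] show ?thesis
    using keys_add[of m n] by (simp add: lookup_add power_add prod.distrib)
qed

lemma meval_cong: "(\<And>p. p \<in> keys n \<Longrightarrow> X p = Y p) \<Longrightarrow> meval X n = meval Y n"
  by (simp add: meval_def)

lemma meval_eq_0: "\<lbrakk>p \<in> keys n; X p = 0\<rbrakk> \<Longrightarrow> meval X n = 0"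
  unfolding meval_def by (rule prod_zero) (auto simp: in_keys_iff zero_power intro!: bexI[of _ p])

lemma meval_eq_1: "(\<And>p. p \<in> keys n \<Longrightarrow> X p = 1) \<Longrightarrow> meval X n = 1"
  by (simp add: meval_def)

text \<open>Separates the power of one variable, so that a polynomial in many variables can be
  viewed as a univariate one in that entry.\<close>

lemma meval_update: "meval (X(p := t)) n = t ^ lookup n p * meval (X(p := 1)) n"
proof -
  let ?A = "insert p (keys n)"
  have A: "finite ?A" "keys n \<subseteq> ?A" by auto
  have "(\<Prod>q\<in>?A. (X(p := t)) q ^ lookup n q) =
     (\<Prod>q\<in>?A. (if q = p then t ^ lookup n p else 1) * (X(p := 1)) q ^ lookup n q)"
    by (intro prod.cong) auto
  also have "\<dots> = t ^ lookup n p * (\<Prod>q\<in>?A. (X(p := 1)) q ^ lookup n q)"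
    by (simp add: prod.distrib)
  finally show ?thesis unfolding meval_superset[OF A] .
qed

lemma meval_transp: "meval X (transp n) = meval (\<lambda>p. X (prod.swap p)) n"
  unfolding meval_def keys_transp by (subst prod.reindex) (auto simp: inj_on_def)

lemma meval_of_rat: "meval (\<lambda>p. of_rat (X p)) n = (of_rat (meval X n) :: 'k::field_char_0)"
  by (simp add: meval_def of_rat_prod of_rat_power)

text \<open>Coefficients and arguments are rational: the sums of squares formed from such
  coefficients are positive, whereas \<open>k\<close> need not be ordered.\<close>

definition peval :: "('x \<Rightarrow>\<^sub>0 nat) set \<Rightarrow> (('x \<Rightarrow>\<^sub>0 nat) \<Rightarrow> rat) \<Rightarrow> ('x \<Rightarrow> rat) \<Rightarrow> rat"
  where "peval K c X = (\<Sum>n\<in>K. c n * meval X n)"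

lemma peval_update:
  "peval K c (X(p := t)) = poly (\<Sum>n\<in>K. monom (c n * meval (X(p := 1)) n) (lookup n p)) t"
  unfolding peval_def poly_sum poly_monom
  by (intro sum.cong refl) (subst meval_update, simp add: mult_ac)

text \<open>Vanishing is assumed only off 0, which is exactly what perturbing a pivot
  provides.\<close>

lemma poly_infinite_zeros:
  fixes q :: "rat poly"
  assumes "\<And>t. t \<noteq> 0 \<Longrightarrow> poly q t = 0"
  shows "q = 0"
proof (rule ccontr)
  assume "q \<noteq> 0"
  then have "finite {t. poly q t = 0}" by (rule poly_roots_finite)
  then have "finite (insert 0 {t. poly q t = 0})" by simp
  moreover have "insert 0 {t. poly q t = 0} = UNIV" using assms by auto
  ultimately show False using infinite_UNIV_char_0 by metis
qed

text \<open>Over an infinite field a polynomial function determines its coefficients. Singling out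
  one variable \<open>p\<close>, the function is univariate in its value, and each of its
  coefficients is a polynomial function of the remaining variables.\<close>

lemma peval_zero_imp_coeff_zero:
  assumes "finite I"
  shows "\<lbrakk>finite K; \<And>n. n \<in> K \<Longrightarrow> keys n \<subseteq> I; \<And>X. peval K c X = 0; n \<in> K\<rbrakk> \<Longrightarrow> c n = 0"
  using assms
proof (induction I arbitrary: K c n rule: finite_induct)
  case empty
  then have "K = {0}" by fastforce
  then show ?case using empty(3,4) by (auto simp: peval_def)
next
  case (insert p I)
  define d where "d = lookup n p"
  define Kd where "Kd = {m \<in> K. lookup m p = d}"
  have Kd: "finite Kd" using insert.prems by (simp add: Kd_def)
  \<comment> \<open>Strips the power of \<open>p\<close>. All exponents in \<open>Kd\<close> have
    degree \<open>d\<close> in \<open>p\<close>, so this is injective on them and leaves exponents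
    in the variables of \<open>I\<close>.\<close>
  define sub where "sub m = m - single p d" for m :: "'a \<Rightarrow>\<^sub>0 nat"
  have sub: "sub m + single p d = m" if "m \<in> Kd" for m
    using that by (intro poly_mapping_eqI) (auto simp: Kd_def sub_def lookup_add lookup_minus lookup_single when_def)
  have inj: "inj_on sub Kd" by (rule inj_on_inverseI[where g = "\<lambda>m. m + single p d"]) (rule sub)
  have 1: "(\<Sum>m\<in>Kd. c m * meval (X(p := 1)) m) = 0" for X
  proof -
    let ?q = "\<Sum>m\<in>K. monom (c m * meval (X(p := 1)) m) (lookup m p)"
    have "poly ?q t = 0" for t using peval_update[of K c X p t] insert.prems(3) by simp
    then have "?q = 0" by (intro poly_infinite_zeros)
    then have "coeff ?q d = 0" by simp
    then have "(\<Sum>m\<in>K. if lookup m p = d then c m * meval (X(p := 1)) m else 0) = 0"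
      by (simp add: coeff_sum)
    then show ?thesis using insert.prems(1) by (simp add: Kd_def sum.inter_filter)
  qed
  have 2: "meval (X(p := 1)) m = meval X (sub m)" if "m \<in> Kd" for m X
  proof -
    have "lookup (sub m) p = 0" using that by (simp add: sub_def lookup_minus Kd_def)
    then have "p \<notin> keys (sub m)" by (simp add: in_keys_iff)
    then have a: "meval (X(p := 1)) (sub m) = meval X (sub m)" by (intro meval_cong) auto
    have b: "meval (X(p := 1)) (single p d) = 1" by (rule meval_eq_1) (auto split: if_splits)
    show ?thesis using meval_add[of "X(p := 1)" "sub m" "single p d"] by (simp add: sub[OF that] a b)
  qed
  have "(c \<circ> (\<lambda>m. m + single p d)) (sub n) = 0"
  proof (rule insert.IH[of "sub ` Kd"])
    show "finite (sub ` Kd)" using Kd by simp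
    show "sub n \<in> sub ` Kd" using insert.prems(4) by (auto simp: Kd_def d_def)
    show "keys m \<subseteq> I" if m: "m \<in> sub ` Kd" for m
    proof
      fix x assume x: "x \<in> keys m"
      obtain k where k: "m = sub k" "k \<in> Kd" using m by auto
      have "x \<noteq> p" using x k by (auto simp: sub_def in_keys_iff lookup_minus Kd_def)
      moreover have "x \<in> keys k" using x k by (auto simp: sub_def in_keys_iff lookup_minus)
      ultimately show "x \<in> I" using insert.prems(2)[of k] k by (auto simp: Kd_def)
    qed
    show "peval (sub ` Kd) (c \<circ> (\<lambda>m. m + single p d)) X = 0" for X
    proof -
      have "peval (sub ` Kd) (c \<circ> (\<lambda>m. m + single p d)) X = (\<Sum>m\<in>Kd. c (sub m + single p d) * meval X (sub m))"
        unfolding peval_def by (subst sum.reindex[OF inj]) simp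
      also have "\<dots> = (\<Sum>m\<in>Kd. c m * meval (X(p := 1)) m)"
        by (intro sum.cong refl) (simp add: sub 2)
      finally show ?thesis using 1 by simp
    qed
  qed
  then show ?case using sub[of n] insert.prems(4) by (simp add: Kd_def d_def)
qed

text \<open>Left multiplication by a lower unitriangular matrix that differs from the identity only
  in column \<open>r\<close>: multiples of row \<open>r\<close> are added to all later rows at once.
  \<open>col_op\<close> is the transposed operation, a right multiplication by an upper
  unitriangular matrix.\<close>

definition row_op :: "nat \<Rightarrow> (nat \<Rightarrow> rat) \<Rightarrow> (nat \<times> nat \<Rightarrow> rat) \<Rightarrow> (nat \<times> nat \<Rightarrow> rat)"
  where "row_op r t X = (\<lambda>(i, j). if r < i then X (i, j) + t i * X (r, j) else X (i, j))"

definition col_op :: "nat \<Rightarrow> (nat \<Rightarrow> rat) \<Rightarrow> (nat \<times> nat \<Rightarrow> rat) \<Rightarrow> (nat \<times> nat \<Rightarrow> rat)"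
  where "col_op r t X = (\<lambda>(i, j). if r < j then X (i, j) + X (i, r) * t j else X (i, j))"

definition unipotent_invariant :: "nat \<Rightarrow> ((nat \<times> nat \<Rightarrow> rat) \<Rightarrow> rat) \<Rightarrow> bool"
  where "unipotent_invariant N F \<longleftrightarrow> (\<forall>r<N. \<forall>t X. F (row_op r t X) = F X \<and> F (col_op r t X) = F X)"

lemma unipotent_invariant_transp:
  assumes "unipotent_invariant N F"
  shows "unipotent_invariant N (\<lambda>X. F (\<lambda>p. X (prod.swap p)))"
proof -
  have "(\<lambda>p. row_op r t X (prod.swap p)) = col_op r t (\<lambda>p. X (prod.swap p))"
    and "(\<lambda>p. col_op r t X (prod.swap p)) = row_op r t (\<lambda>p. X (prod.swap p))" for r t X
    by (auto simp: row_op_def col_op_def fun_eq_iff)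
  then show ?thesis using assms by (simp add: unipotent_invariant_def)
qed

text \<open>
  A generic matrix is brought to diagonal form by the row and column operations; if a pivot
  vanishes it is first perturbed.
\<close>

theorem unipotent_invariant_zero:
  assumes K: "finite K" "K \<subseteq> mat_exponents N"
    and inv: "unipotent_invariant N (peval K c)"
    and diag: "\<And>X. (\<And>i j. i \<noteq> j \<Longrightarrow> X (i, j) = 0) \<Longrightarrow> peval K c X = 0"
    and n: "n \<in> K"
  shows "c n = 0"
proof -
  \<comment> \<open>The operations act on an infinite array, while the polynomial sees only the
    entries with indices below \<open>N\<close>.\<close>
  have cong: "peval K c X = peval K c Y" if "\<And>i j. \<lbrakk>i < N; j < N\<rbrakk> \<Longrightarrow> X (i, j) = Y (i, j)" for X Y
    unfolding peval_def using K(2) that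
    by (intro sum.cong refl arg_cong2[of _ _ _ _ times] meval_cong) (auto simp: mat_exponents_def subset_iff)
  \<comment> \<open>Here \<open>r\<close> counts the pivots already treated: rows and columns before
    \<open>r\<close> are zero off the diagonal. The induction runs on the number of remaining
    pivots.\<close>
  have main: "r \<le> N \<Longrightarrow> (\<And>i j. \<lbrakk>i < N; j < N; i \<noteq> j; i < r \<or> j < r\<rbrakk> \<Longrightarrow> X (i, j) = 0) \<Longrightarrow> peval K c X = 0" for r X
  proof (induction "N - r" arbitrary: r X)
    case 0
    then have "peval K c X = peval K c (\<lambda>(i, j). if i = j then X (i, j) else 0)"
      by (intro cong) auto
    also have "\<dots> = 0" by (rule diag) simp
    finally show ?case .
  next
    case (Suc d)
    then have r: "r < N" by simp
    have pivot: "peval K c Y = 0" if Y: "\<And>i j. \<lbrakk>i < N; j < N; i \<noteq> j; i < r \<or> j < r\<rbrakk> \<Longrightarrow> Y (i, j) = 0" and nz: "Y (r, r) \<noteq> 0" for Y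
    proof -
      \<comment> \<open>The multipliers of Gaussian elimination: column \<open>r\<close> is cleared
        below the pivot and then, in \<open>Y2\<close>, row \<open>r\<close> to the right of it. The
        first operation leaves row \<open>r\<close>, hence the pivot, unchanged.\<close>
      define Y1 where "Y1 = row_op r (\<lambda>i. - Y (i, r) / Y (r, r)) Y"
      define Y2 where "Y2 = col_op r (\<lambda>j. - Y1 (r, j) / Y1 (r, r)) Y1"
      have Y1r: "Y1 (r, j) = Y (r, j)" for j by (simp add: Y1_def row_op_def)
      have a: "Y1 (i, j) = 0" if "i < N" "j < N" "i \<noteq> j" "i < r \<or> j < r" for i j
        using that Y[of i j] Y[of r j] r by (auto simp: Y1_def row_op_def)
      have b: "Y1 (i, r) = 0" if "r < i" for i
        using that nz by (simp add: Y1_def row_op_def)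
      have c: "Y2 (r, j) = 0" if "r < j" for j
        using that nz by (simp add: Y2_def col_op_def Y1r)
      have d: "Y2 (i, j) = 0" if "i < N" "j < N" "i \<noteq> j" "i < r \<or> j < r" for i j
        using that a[of i j] a[of i r] r by (auto simp: Y2_def col_op_def)
      have e: "Y2 (i, r) = 0" if "r < i" for i
        using that b[of i] by (simp add: Y2_def col_op_def)
      have "peval K c Y2 = 0"
      proof (rule Suc.hyps(1)[of "Suc r"])
        show "d = N - Suc r" using Suc.hyps(2) by simp
        show "Suc r \<le> N" using r by simp
        fix i j assume ij: "i < N" "j < N" "i \<noteq> j" "i < Suc r \<or> j < Suc r"
        then consider "i < r \<or> j < r" | "i = r" "r < j" | "j = r" "r < i" by linarith
        then show "Y2 (i, j) = 0" by cases (use ij c d e in auto)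
      qed
      moreover have "peval K c Y2 = peval K c Y1" "peval K c Y1 = peval K c Y"
        using inv r unfolding unipotent_invariant_def Y1_def Y2_def by blast+
      ultimately show ?thesis by simp
    qed
    \<comment> \<open>As a function of the entry at \<open>(r, r)\<close> alone, the value is a
      polynomial. It vanishes for every nonzero pivot, hence identically, and so also at the
      original entry.\<close>
    let ?q = "\<Sum>n\<in>K. monom (c n * meval (X((r, r) := 1)) n) (lookup n (r, r))"
    have "?q = 0"
    proof (rule poly_infinite_zeros)
      fix t :: rat assume t: "t \<noteq> 0"
      have "peval K c (X((r, r) := t)) = 0"
        by (rule pivot) (use Suc.prems(2) t in auto)
      then show "poly ?q t = 0" by (simp only: peval_update)
    qed
    then have "peval K c (X((r, r) := X (r, r))) = 0" unfolding peval_update by simp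
    then show ?case by simp
  qed
  have "peval K c X = 0" for X by (rule main[of 0]) simp_all
  then show ?thesis
    using K n by (intro peval_zero_imp_coeff_zero[of "{..<N} \<times> {..<N}" K c n]) (auto simp: mat_exponents_def)
qed

section \<open>Comultiplication as the dual of the matrix product\<close>

definition mat_mult :: "nat \<Rightarrow> (nat \<times> nat \<Rightarrow> 'k::comm_ring_1) \<Rightarrow> (nat \<times> nat \<Rightarrow> 'k) \<Rightarrow> (nat \<times> nat \<Rightarrow> 'k)"
  where "mat_mult N X Y = (\<lambda>(i, j). \<Sum>l<N. X (i, l) * Y (l, j))"

definition eval2 :: "(nat \<times> nat \<Rightarrow> 'k::comm_ring_1) \<Rightarrow> (nat \<times> nat \<Rightarrow> 'k) \<Rightarrow> (mat_exp \<times> mat_exp \<Rightarrow>\<^sub>0 'k) \<Rightarrow> 'k"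
  where "eval2 X Y F = (\<Sum>k\<in>keys F. lookup F k * (meval X (fst k) * meval Y (snd k)))"

lemma eval2_add: "eval2 X Y (F + G) = eval2 X Y F + eval2 X Y G"
  unfolding eval2_def by (rule setsum_keys_plus_distrib) (simp_all add: distrib_right)

lemma eval2_0 [simp]: "eval2 X Y 0 = 0"
  by (simp add: eval2_def)

lemma eval2_sum: "eval2 X Y (\<Sum>i\<in>I. f i) = (\<Sum>i\<in>I. eval2 X Y (f i))"
  by (induction I rule: infinite_finite_induct) (simp_all add: eval2_add)

lemma eval2_single: "eval2 X Y (single (l, m) c) = c * (meval X l * meval Y m)"
  by (cases "c = 0") (simp_all add: eval2_def)

lemma eval2_mult_monomial: "eval2 X Y (F * monomial (s, t)) = eval2 X Y F * (meval X s * meval Y t)"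
proof -
  have "F * monomial (s, t) = (\<Sum>k\<in>keys F. single k (lookup F k) * monomial (s, t))"
    by (subst poly_mapping_sum_single[of F]) (rule sum_distrib_right)
  also have "\<dots> = (\<Sum>k\<in>keys F. single (fst k + s, snd k + t) (lookup F k))"
    by (intro sum.cong refl) (simp add: mult_single plus_prod_def)
  finally show ?thesis
    by (simp add: eval2_sum eval2_single meval_add) (simp add: eval2_def sum_distrib_left mult_ac)
qed

text \<open>On a variable this is the formula for an entry of a matrix product, and both sides are
  multiplicative in the monomial. It converts the structure constants into multiplication of actual
  matrices.\<close>

lemma eval2_mat_comult: "eval2 X Y (mat_comult N n) = meval (mat_mult N X Y) n"
proof (induction n rule: exponent_induct)
  case zero
  show ?case using eval2_single[of X Y 0 0 1] by (simp add: mat_comult_0 flip: zero_prod_def)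
next
  case (var n x)
  obtain i j where x: "x = (i, j)" by (cases x)
  show ?case
    by (simp add: x mat_comult_Suc eval2_sum eval2_mult_monomial var.IH meval_add mat_mult_def sum_distrib_left)
qed

subsection \<open>Dimensions\<close>

context ambient_vector_space
begin

lemma dim_lin_image_le:
  assumes "fin_dim_subspace V" "lin V f"
  shows "dim (f ` V) \<le> dim V"
proof -
  obtain A where A: "finite A" "independent A" "span A = V" using fin_dimE[OF assms(1)] .
  have "f ` V = span (f ` A)" using lin_image_span[of A f] assms(2) A by simp
  then have "dim (f ` V) \<le> card (f ` A)" using A by (intro dim_le_card) simp_all
  also have "\<dots> \<le> card A" using A by (intro card_image_le)
  also have "card A = dim V" using A dim_span_eq_card_independent by metis
  finally show ?thesis .
qed

lemma dim_pos:
  assumes "fin_dim_subspace V" "v \<in> V" "v \<noteq> 0"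
  shows "dim V > 0"
proof -
  obtain A where A: "finite A" "independent A" "span A = V" using fin_dimE[OF assms(1)] .
  have "A \<noteq> {}" using A assms by auto
  then have "card A > 0" using A by (simp add: card_gt_0_iff)
  then show ?thesis using A dim_span_eq_card_independent by metis
qed

text \<open>On the image \<open>p\<close> is the identity and on the kernel it is zero. Applying
  \<open>p\<close> to a linear relation between bases of the two splits it into two relations, and
  every \<open>x\<close> is \<open>p x\<close> plus an element of the kernel.\<close>

lemma dim_split:
  assumes V: "fin_dim_subspace V" and p: "lin V p" "\<And>x. x \<in> V \<Longrightarrow> p x \<in> V" "\<And>x. x \<in> V \<Longrightarrow> p (p x) = p x"
  shows "dim V = dim (p ` V) + dim {x \<in> V. p x = 0}"
proof -
  note sV = fin_dim_subspaceI[OF V]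
  have sk: "subspace {x \<in> V. p x = 0}"
    by (rule subspaceI) (use sV p(1) in \<open>auto simp: subspace_0 subspace_add subspace_scale lin_0 lin_add lin_scale\<close>)
  obtain A where A: "finite A" "independent A" "span A = p ` V" using fin_dimE[OF fin_dim_image[OF V p(1)]] .
  obtain B where B: "finite B" "independent B" "span B = {x \<in> V. p x = 0}"
    using fin_dimE[OF fin_dim_sub[OF V sk]] by blast
  have pA: "p x = x" if "x \<in> span A" for x using that p(3) unfolding A(3) by auto
  have pB: "p x = 0" if "x \<in> span B" for x using that unfolding B(3) by simp
  have AV: "span A \<subseteq> V" unfolding A(3) using p(2) by auto
  have BV: "span B \<subseteq> V" unfolding B(3) by auto
  have disj: "A \<inter> B = {}"
  proof (rule ccontr)
    assume "A \<inter> B \<noteq> {}"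
    then obtain x where x: "x \<in> A" "x \<in> B" by blast
    then have "x = 0" using pA[of x] pB[of x] span_base by metis
    then show False using x A dependent_zero by blast
  qed
  have ind: "independent (A \<union> B)"
  proof (rule independent_if_scalars_zero)
    show "finite (A \<union> B)" using A B by simp
    fix f x assume s: "(\<Sum>x\<in>A \<union> B. f x *s x) = 0" and x: "x \<in> A \<union> B"
    have s': "(\<Sum>x\<in>A. f x *s x) + (\<Sum>x\<in>B. f x *s x) = 0"
      using s by (simp add: sum.union_disjoint[OF A(1) B(1) disj])
    have iA: "(\<Sum>x\<in>A. f x *s x) \<in> span A" and iB: "(\<Sum>x\<in>B. f x *s x) \<in> span B"
      by (auto intro: span_sum span_scale span_base)
    have "p ((\<Sum>x\<in>A. f x *s x) + (\<Sum>x\<in>B. f x *s x)) = 0" unfolding s' by (rule lin_0[OF p(1) sV])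
    then have 0: "(\<Sum>x\<in>A. f x *s x) = 0"
      using lin_add[OF p(1) subsetD[OF AV iA] subsetD[OF BV iB]] pA[OF iA] pB[OF iB] by simp
    then have 1: "(\<Sum>x\<in>B. f x *s x) = 0" using s' by simp
    show "f x = 0"
      using x independentD[OF A(2,1) subset_refl 0] independentD[OF B(2,1) subset_refl 1] by blast
  qed
  have sp: "span (A \<union> B) = V"
  proof
    show "span (A \<union> B) \<subseteq> V"
      unfolding span_Un using AV BV sV by (auto intro: subspace_add)
    show "V \<subseteq> span (A \<union> B)"
    proof
      fix x assume x: "x \<in> V"
      have "p x \<in> span A" using x A by simp
      moreover have "x - p x \<in> span B"
        unfolding B(3) using x p by (simp add: subspace_diff[OF sV] lin_diff[OF p(1) sV])
      ultimately have "p x + (x - p x) \<in> span (A \<union> B)" unfolding span_Un by blast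
      then show "x \<in> span (A \<union> B)" by simp
    qed
  qed
  have "dim V = card (A \<union> B)" using dim_span_eq_card_independent[OF ind] sp by simp
  also have "\<dots> = card A + card B" by (rule card_Un_disjoint[OF A(1) B(1) disj])
  also have "\<dots> = dim (p ` V) + dim {x \<in> V. p x = 0}"
    using dim_span_eq_card_independent[OF A(2)] dim_span_eq_card_independent[OF B(2)] A(3) B(3) by simp
  finally show ?thesis .
qed

text \<open>The mutually inverse maps are extended linearly to the ambient space, so they can later
  be composed with weight projections without regard to domains.\<close>

lemma dim_eq_isomorphism:
  assumes "fin_dim_subspace V" "fin_dim_subspace W" "dim V = dim W"
  obtains t t' where "lin UNIV t" "lin UNIV t'" "\<And>v. v \<in> V \<Longrightarrow> t v \<in> W" "\<And>v. v \<in> V \<Longrightarrow> t' (t v) = v"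
    "\<And>w. w \<in> W \<Longrightarrow> t' w \<in> V" "\<And>w. w \<in> W \<Longrightarrow> t (t' w) = w"
proof -
  obtain A where A: "finite A" "independent A" "span A = V" using fin_dimE[OF assms(1)] .
  obtain B where B: "finite B" "independent B" "span B = W" using fin_dimE[OF assms(2)] .
  have "card A = card B" using A B assms(3) dim_span_eq_card_independent by metis
  then obtain h where h: "bij_betw h A B" using A B by (metis bij_betw_iff_card)
  obtain t where t: "lin UNIV t" "\<forall>x\<in>A. t x = h x" using independent_extend[OF A(2), of h] by blast
  obtain t' where t': "lin UNIV t'" "\<forall>x\<in>B. t' x = inv_into A h x" using independent_extend[OF B(2), of "inv_into A h"] by blast
  have l: "lin X t" "lin X t'" for X using t(1) t'(1) lin_mono by blast+
  have i: "inv_into A h (h x) = x" if "x \<in> A" for x using that h by (simp add: bij_betw_def)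
  have i': "h (inv_into A h y) = y" "inv_into A h y \<in> A" if "y \<in> B" for y
    using that h by (auto simp: bij_betw_def f_inv_into_f inv_into_into)
  have hB: "h x \<in> B" if "x \<in> A" for x using that h by (auto simp: bij_betw_def)
  have 1: "t ` A = B" using t(2) h by (simp add: bij_betw_def)
  have 2: "t' ` B = A" using t'(2) h by (metis bij_betw_def bij_betw_inv_into image_cong)
  have a: "t v \<in> W" if "v \<in> V" for v
    using lin_image_span[OF l(1)[of "span A"]] that unfolding 1 A(3) B(3) by blast
  have b: "t' w \<in> V" if "w \<in> W" for w
    using lin_image_span[OF l(2)[of "span B"]] that unfolding 2 A(3) B(3) by blast
  have c: "t' (t v) = v" if "v \<in> V" for v
    using lin_eq_on_span[of A "\<lambda>v. t' (t v)" "\<lambda>v. v" v, OF lin_compose[OF l(1) t'(1)] lin_ident]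
      that A(3) t(2) t'(2) i hB by simp
  have d: "t (t' w) = w" if "w \<in> W" for w
    using lin_eq_on_span[of B "\<lambda>v. t (t' v)" "\<lambda>v. v" w, OF lin_compose[OF l(2) t(1)] lin_ident]
      that B(3) t(2) t'(2) i' by simp
  show ?thesis using that[of t t'] t(1) t'(1) a b c d by blast
qed

end

subsection \<open>Weights\<close>

text \<open>For a weight on the indices below \<open>N\<close> this is the sum over k = 1, ...,
  \<open>N\<close> of the total of its first k entries, so it increases strictly along the dominance
  order: moving a unit to an earlier index raises it.\<close>

definition height :: "nat \<Rightarrow> (nat \<Rightarrow>\<^sub>0 nat) \<Rightarrow> nat"
  where "height N \<mu> = (\<Sum>i\<in>keys \<mu>. (N - i) * lookup \<mu> i)"

lemma height_add: "height N (\<mu> + \<nu>) = height N \<mu> + height N \<nu>"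
  unfolding height_def by (rule setsum_keys_plus_distrib) (simp_all add: distrib_left)

lemma height_sum: "height N (\<Sum>i\<in>I. f i) = (\<Sum>i\<in>I. height N (f i))"
proof (induction I rule: infinite_finite_induct)
  case (insert x F)
  then show ?case by (simp add: height_add)
qed (simp_all add: height_def)

lemma height_single: "height N (single i c) = (N - i) * c"
  by (cases "c = 0") (simp_all add: height_def)

lemma height_row_sum: "height N (row_sum n) = (\<Sum>p\<in>keys n. (N - fst p) * lookup n p)"
  and height_col_sum: "height N (col_sum n) = (\<Sum>p\<in>keys n. (N - snd p) * lookup n p)"
  by (simp_all add: row_sum_def col_sum_def height_sum height_single)

text \<open>The operator \<open>\<rho>\<^sub>n\<close> leads from weight \<open>col_sum n\<close> to
  weight \<open>row_sum n\<close>. A variable e_ij with i < j replaces a unit at j by one at i, and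
  earlier indices count more in the height.\<close>

lemma height_upper:
  assumes n: "n \<in> mat_exponents N" "n \<notin> range diag" and up: "\<And>i j. (i, j) \<in> keys n \<Longrightarrow> i \<le> j"
  shows "height N (col_sum n) < height N (row_sum n)"
proof -
  obtain i j where ij: "i \<noteq> j" "(i, j) \<in> keys n" using n(2) by (auto simp: range_diag_iff in_keys_iff)
  have "i < j" "j < N" using up[OF ij(2)] ij n(1) by (auto simp: mat_exponents_def)
  then have "(N - snd (i, j)) * lookup n (i, j) < (N - fst (i, j)) * lookup n (i, j)"
    using ij(2) by (simp add: in_keys_iff)
  moreover have "\<forall>p\<in>keys n. (N - snd p) * lookup n p \<le> (N - fst p) * lookup n p"
    using up by (auto intro!: mult_le_mono1 diff_le_mono2)
  ultimately show ?thesis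
    unfolding height_row_sum height_col_sum using ij(2) by (intro sum_strict_mono_ex1) auto
qed

lemma height_lower:
  assumes n: "n \<in> mat_exponents N" "n \<notin> range diag" and lo: "\<And>i j. (i, j) \<in> keys n \<Longrightarrow> j \<le> i"
  shows "height N (row_sum n) < height N (col_sum n)"
proof -
  obtain i j where ij: "i \<noteq> j" "(i, j) \<in> keys n" using n(2) by (auto simp: range_diag_iff in_keys_iff)
  have "j < i" "i < N" using lo[OF ij(2)] ij n(1) by (auto simp: mat_exponents_def)
  then have "(N - fst (i, j)) * lookup n (i, j) < (N - snd (i, j)) * lookup n (i, j)"
    using ij(2) by (simp add: in_keys_iff)
  moreover have "\<forall>p\<in>keys n. (N - fst p) * lookup n p \<le> (N - snd p) * lookup n p"
    using lo by (auto intro!: mult_le_mono1 diff_le_mono2)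
  ultimately show ?thesis
    unfolding height_row_sum height_col_sum using ij(2) by (intro sum_strict_mono_ex1) auto
qed

section \<open>Weight spaces of representations of the matrix monoid\<close>

locale matrix_reps_char_0 = ambient_vector_space scale
  for scale :: "'k::field_char_0 \<Rightarrow> 'v::ab_group_add \<Rightarrow> 'v"  (infixr "*s" 75) +
  fixes N :: nat
begin

sublocale M: bialgebra_reps scale "matrix_monoid N"
  by (rule matrix_reps)

abbreviation mrep :: "(mat_exp, 'v) comodule \<Rightarrow> bool"
  where "mrep a \<equiv> is_comodule (matrix_monoid N :: (_, 'k) affine_monoid) a"

lemma csupp_mat_exponents: "mrep a \<Longrightarrow> csupp a \<subseteq> mat_exponents N"
  using csupp_exponents[of "matrix_monoid N" a] by (simp add: exponents_matrix)

lemma co_coassoc_mat: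
  "\<lbrakk>mrep a; v \<in> vspace a\<rbrakk> \<Longrightarrow> co a l (co a m v) =
    (\<Sum>n\<in>csupp a. lookup (mat_comult N n) (l, m) *s co a n v)"
  using co_coassoc[of "matrix_monoid N" a v l m] by (simp add: mat_comult_def)

lemma co_0: "mrep a \<Longrightarrow> co a n 0 = 0"
  by (rule lin_0[OF co_lin comodule_subspace])

text \<open>Left multiplication by diagonal matrices scales the monomial \<open>n\<close> by the
  weight \<open>row_sum n\<close>, so the image of its operator lies in that weight space. Dually,
  \<open>co_co_diag\<close> shows that the operator depends only on the component of weight
  \<open>col_sum n\<close>.\<close>

lemma co_diag_co:
  assumes a: "mrep a" and v: "v \<in> vspace a"
  shows "co a (diag \<mu>) (co a n v) = (if row_sum n = \<mu> then co a n v else 0)"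
proof -
  have "co a (diag \<mu>) (co a n v) = (\<Sum>k\<in>csupp a. if k = n then (if row_sum n = \<mu> then co a n v else 0) else 0)"
    unfolding co_coassoc_mat[OF a v]
    by (intro sum.cong refl) (use csupp_mat_exponents[OF a] in \<open>auto simp: mat_comult_diag_left subset_iff\<close>)
  also have "\<dots> = (if row_sum n = \<mu> then co a n v else 0)"
    using co_outside[OF v] by (auto simp: sum.delta finite_csupp[OF a])
  finally show ?thesis .
qed

lemma co_co_diag:
  assumes a: "mrep a" and v: "v \<in> vspace a"
  shows "co a n (co a (diag \<mu>) v) = (if col_sum n = \<mu> then co a n v else 0)"
proof -
  have "co a n (co a (diag \<mu>) v) = (\<Sum>k\<in>csupp a. if k = n then (if col_sum n = \<mu> then co a n v else 0) else 0)"
    unfolding co_coassoc_mat[OF a v]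
    by (intro sum.cong refl) (use csupp_mat_exponents[OF a] in \<open>auto simp: mat_comult_diag_right subset_iff\<close>)
  also have "\<dots> = (if col_sum n = \<mu> then co a n v else 0)"
    using co_outside[OF v] by (auto simp: sum.delta finite_csupp[OF a])
  finally show ?thesis .
qed

definition weight_space :: "(mat_exp, 'v) comodule \<Rightarrow> (nat \<Rightarrow>\<^sub>0 nat) \<Rightarrow> 'v set"
  where "weight_space a \<mu> = {v \<in> vspace a. co a (diag \<mu>) v = v}"

lemma weight_space_sub: "v \<in> weight_space a \<mu> \<Longrightarrow> v \<in> vspace a"
  and weight_space_co: "v \<in> weight_space a \<mu> \<Longrightarrow> co a (diag \<mu>) v = v"
  by (simp_all add: weight_space_def)

lemma co_diag_in_weight_space: "\<lbrakk>mrep a; v \<in> vspace a\<rbrakk> \<Longrightarrow> co a (diag \<mu>) v \<in> weight_space a \<mu>"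
  by (simp add: weight_space_def co_in co_diag_co row_sum_diag)

lemma fin_dim_weight_space:
  assumes a: "mrep a"
  shows "fin_dim_subspace (weight_space a \<mu>)"
proof (rule fin_dim_sub[OF comodule_fin_dim[OF a]])
  note s = comodule_subspace[OF a] and l = co_lin[OF a]
  show "subspace (weight_space a \<mu>)"
    by (rule subspaceI) (auto simp: weight_space_def subspace_0[OF s] subspace_add[OF s] subspace_scale[OF s]
       co_0[OF a] lin_add[OF l] lin_scale[OF l])
qed (auto simp: weight_space_def)

lemma co_weight: "\<lbrakk>mrep a; u \<in> weight_space a \<mu>; col_sum n \<noteq> \<mu>\<rbrakk> \<Longrightarrow> co a n u = 0"
  using co_co_diag[of a u n \<mu>] by (simp add: weight_space_sub weight_space_co)

text \<open>The counit is supported on diagonal monomials, so the counit law writes \<open>v\<close>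
  as the sum of its weight components.\<close>

lemma zero_if_no_weights:
  assumes a: "mrep a" and v: "v \<in> vspace a" and w: "\<And>\<mu>. co a (diag \<mu>) v = 0"
  shows "v = 0"
proof -
  have "v = (\<Sum>n\<in>csupp a. counit (matrix_monoid N) (monomial n) *s co a n v)" using co_counit[OF a v] by simp
  also have "\<dots> = 0" by (rule sum.neutral) (auto simp: matrix_counit w)
  finally show ?thesis .
qed

subsection \<open>Matrices acting on representations\<close>

definition act :: "(mat_exp, 'v) comodule \<Rightarrow> (nat \<times> nat \<Rightarrow> 'k) \<Rightarrow> 'v \<Rightarrow> 'v"
  where "act a X v = (\<Sum>n\<in>csupp a. meval X n *s co a n v)"

lemma act_in: "\<lbrakk>mrep a; v \<in> vspace a\<rbrakk> \<Longrightarrow> act a X v \<in> vspace a"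
  unfolding act_def using comodule_subspace[of "matrix_monoid N" a]
  by (intro subspace_sum subspace_scale co_in) auto

lemma act_cong:
  assumes "mrep a" "\<And>i j. \<lbrakk>i < N; j < N\<rbrakk> \<Longrightarrow> X (i, j) = Y (i, j)"
  shows "act a X v = act a Y v"
  unfolding act_def using csupp_mat_exponents[OF assms(1)] assms(2)
  by (intro sum.cong refl arg_cong2[of _ _ _ _ scale] meval_cong) (auto simp: mat_exponents_def subset_iff)

text \<open>Expanding both actions by coassociativity collects, at each operator, the
  comultiplication of its monomial evaluated at \<open>(X, Y)\<close>; this is the monomial
  evaluated at the product.\<close>

lemma act_mat_mult:
  assumes a: "mrep a" and v: "v \<in> vspace a"
  shows "act a (mat_mult N X Y) v = act a X (act a Y v)"
proof -
  let ?D = "mat_comult N :: _ \<Rightarrow> _ \<Rightarrow>\<^sub>0 'k"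
  define A where "A = csupp a \<union> (\<Union>n\<in>csupp a. fst ` keys (?D n) \<union> snd ` keys (?D n))"
  have A: "finite A" "csupp a \<subseteq> A" using finite_csupp[OF a] by (auto simp: A_def)
  have kA: "keys (?D n) \<subseteq> A \<times> A" if "n \<in> csupp a" for n using that by (force simp: A_def)
  note l = co_lin[OF a] and s = comodule_subspace[OF a] and ci = co_in[OF a]
  have sup: "act a Z w = (\<Sum>n\<in>A. meval Z n *s co a n w)" if "w \<in> vspace a" for Z w
    unfolding act_def by (rule sum.mono_neutral_left) (use A co_outside[OF that] in auto)
  have "act a X (act a Y v) = (\<Sum>p\<in>A. meval X p *s co a p (\<Sum>q\<in>A. meval Y q *s co a q v))"
    unfolding sup[OF act_in[OF a v]] unfolding sup[OF v] ..
  also have "\<dots> = (\<Sum>p\<in>A. \<Sum>q\<in>A. (meval X p * meval Y q) *s co a p (co a q v))"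
    by (subst lin_sum[OF l s]) (simp_all add: lin_scale[OF l] ci v subspace_scale[OF s] scale_sum_right)
  also have "\<dots> = (\<Sum>p\<in>A. \<Sum>q\<in>A. \<Sum>n\<in>csupp a. (lookup (?D n) (p, q) * (meval X p * meval Y q)) *s co a n v)"
    by (simp add: co_coassoc_mat[OF a v] scale_sum_right mult.commute)
  also have "\<dots> = (\<Sum>n\<in>csupp a. \<Sum>k\<in>A \<times> A. (lookup (?D n) k * (meval X (fst k) * meval Y (snd k))) *s co a n v)"
    unfolding sum.cartesian_product
    by (rule sum.reindex_bij_witness[where i = "\<lambda>(n, (p, q)). (p, q, n)" and j = "\<lambda>(p, q, n). (n, (p, q))"]) auto
  also have "\<dots> = (\<Sum>n\<in>csupp a. eval2 X Y (?D n) *s co a n v)"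
  proof (intro sum.cong refl)
    fix n assume "n \<in> csupp a"
    then have "eval2 X Y (?D n) = (\<Sum>k\<in>A \<times> A. lookup (?D n) k * (meval X (fst k) * meval Y (snd k)))"
      unfolding eval2_def by (intro sum.mono_neutral_left) (use A kA in \<open>auto simp: in_keys_iff\<close>)
    then show "(\<Sum>k\<in>A \<times> A. (lookup (?D n) k * (meval X (fst k) * meval Y (snd k))) *s co a n v) =
       eval2 X Y (?D n) *s co a n v" by (simp add: scale_sum_left)
  qed
  also have "\<dots> = act a (mat_mult N X Y) v" by (simp add: eval2_mat_comult act_def)
  finally show ?thesis ..
qed

text \<open>A condition on strictly larger heights only. It therefore passes from one representation
  to another as soon as the dimensions of their weight spaces agree.\<close>

definition highest :: "(mat_exp, 'v) comodule \<Rightarrow> (nat \<Rightarrow>\<^sub>0 nat) \<Rightarrow> bool"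
  where "highest a \<nu> \<longleftrightarrow> (\<forall>\<mu>. height N \<nu> < height N \<mu> \<longrightarrow> (\<forall>v\<in>vspace a. co a (diag \<mu>) v = 0))"

text \<open>A monomial containing a variable below the diagonal vanishes at \<open>U\<close>. An
  upper one that is not diagonal would carry \<open>u\<close> to a weight of larger height, so its
  operator kills \<open>u\<close>. There remain the diagonal monomials, of which only
  \<open>diag \<nu>\<close> acts nontrivially on \<open>u\<close>.\<close>

lemma act_upper:
  assumes a: "mrep a" and h: "highest a \<nu>" and u: "u \<in> weight_space a \<nu>"
    and U: "\<And>i. i < N \<Longrightarrow> U (i, i) = 1" "\<And>i j. \<lbrakk>i < N; j < i\<rbrakk> \<Longrightarrow> U (i, j) = 0"
  shows "act a U u = u"
proof -
  note uV = weight_space_sub[OF u]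
  have "meval U n *s co a n u = (if n = diag \<nu> then u else 0)" if "n \<in> csupp a" for n
  proof -
    have nE: "n \<in> mat_exponents N" using that csupp_mat_exponents[OF a] by blast
    show ?thesis
    proof (cases "n \<in> range diag")
      case True
      then obtain \<kappa> where k: "n = diag \<kappa>" by auto
      have "meval U n = 1"
      proof (rule meval_eq_1)
        fix p assume p: "p \<in> keys n"
        then have "fst p = snd p" "fst p < N" using nE by (cases p; auto simp: k in_keys_iff lookup_diag mat_exponents_def subset_iff split: if_splits)+
        then show "U p = 1" using U(1)[of "fst p"] by (cases p) auto
      qed
      moreover have "co a n u = (if n = diag \<nu> then u else 0)"
        using co_weight[OF a u, of n] weight_space_co[OF u] inj_diag by (auto simp: k col_sum_diag inj_eq)
      ultimately show ?thesis by simp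
    next
      case False
      then have nd: "n \<noteq> diag \<nu>" by auto
      show ?thesis
      proof (cases "\<forall>i j. (i, j) \<in> keys n \<longrightarrow> i \<le> j")
        case True
        then have "height N (col_sum n) < height N (row_sum n)" using height_upper[OF nE False] by blast
        then have "co a n u = 0" if "col_sum n = \<nu>"
          using h that co_diag_co[OF a uV, of "row_sum n" n] co_in[OF a uV] by (simp add: highest_def uV)
        then show ?thesis using co_weight[OF a u, of n] nd by auto
      next
        case lower: False
        then obtain i j where ij: "(i, j) \<in> keys n" "j < i" by auto
        then have "i < N" using nE by (auto simp: mat_exponents_def)
        then have "meval U n = 0" using meval_eq_0[OF ij(1), of U] U(2) ij(2) by blast
        then show ?thesis using nd by simp
      qed
    qed
  qed
  then have "act a U u = (\<Sum>n\<in>csupp a. if n = diag \<nu> then u else 0)" by (simp add: act_def)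
  also have "\<dots> = u"
    using co_outside[OF uV, of "diag \<nu>"] weight_space_co[OF u] by (auto simp: sum.delta finite_csupp[OF a])
  finally show ?thesis .
qed

text \<open>Dual to the upper triangular case: a lower monomial that is not diagonal and leads into
  weight \<open>\<nu>\<close> starts from a weight of larger height, where \<open>x\<close> has no
  component. Multiplying by \<open>L\<close> thus leaves the component of weight
  \<open>\<nu>\<close> unchanged.\<close>

lemma act_lower:
  assumes a: "mrep a" and h: "highest a \<nu>" and x: "x \<in> vspace a"
    and L: "\<And>i. i < N \<Longrightarrow> L (i, i) = 1" "\<And>i j. \<lbrakk>j < N; i < j\<rbrakk> \<Longrightarrow> L (i, j) = 0"
  shows "co a (diag \<nu>) (act a L x) = co a (diag \<nu>) x"
proof -
  note l = co_lin[OF a] and s = comodule_subspace[OF a]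
  have "meval L n *s co a (diag \<nu>) (co a n x) = (if n = diag \<nu> then co a (diag \<nu>) x else 0)" if "n \<in> csupp a" for n
  proof -
    have nE: "n \<in> mat_exponents N" using that csupp_mat_exponents[OF a] by blast
    show ?thesis
    proof (cases "n \<in> range diag")
      case True
      then obtain \<kappa> where k: "n = diag \<kappa>" by auto
      have "meval L n = 1"
      proof (rule meval_eq_1)
        fix p assume p: "p \<in> keys n"
        then have "fst p = snd p" "fst p < N" using nE by (cases p; auto simp: k in_keys_iff lookup_diag mat_exponents_def subset_iff split: if_splits)+
        then show "L p = 1" using L(1)[of "fst p"] by (cases p) auto
      qed
      then show ?thesis using co_diag_co[OF a x, of \<nu> n] inj_diag by (auto simp: k row_sum_diag inj_eq)
    next
      case False
      then have nd: "n \<noteq> diag \<nu>" by auto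
      show ?thesis
      proof (cases "\<forall>i j. (i, j) \<in> keys n \<longrightarrow> j \<le> i")
        case True
        then have "height N (row_sum n) < height N (col_sum n)" using height_lower[OF nE False] by blast
        then have "co a n x = 0" if "row_sum n = \<nu>"
          using h that co_co_diag[OF a x, of n "col_sum n"] by (simp add: highest_def x co_0[OF a])
        then show ?thesis using co_diag_co[OF a x, of \<nu> n] nd by auto
      next
        case upper: False
        then obtain i j where ij: "(i, j) \<in> keys n" "i < j" by auto
        then have "j < N" using nE by (auto simp: mat_exponents_def)
        then have "meval L n = 0" using meval_eq_0[OF ij(1), of L] L(2) ij(2) by blast
        then show ?thesis using nd by simp
      qed
    qed
  qed
  then have "co a (diag \<nu>) (act a L x) = (\<Sum>n\<in>csupp a. if n = diag \<nu> then co a (diag \<nu>) x else 0)"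
    unfolding act_def by (subst lin_sum[OF l s]) (simp_all add: co_in[OF a] x subspace_scale[OF s] lin_scale[OF l])
  also have "\<dots> = co a (diag \<nu>) x"
    using co_outside[OF x, of "diag \<nu>"] by (auto simp: sum.delta finite_csupp[OF a])
  finally show ?thesis .
qed

subsection \<open>Matrix coefficients of highest weight vectors\<close>

abbreviation rmat :: "(nat \<times> nat \<Rightarrow> rat) \<Rightarrow> (nat \<times> nat \<Rightarrow> 'k)"
  where "rmat X \<equiv> \<lambda>p. of_rat (X p)"

text \<open>Only rational matrices are inserted: the elimination argument compares rational
  polynomials. The values are vectors, and that they are scalar multiples of \<open>u\<close>
  emerges only from the comparison of two such functions.\<close>

definition hw_coeff :: "(mat_exp, 'v) comodule \<Rightarrow> (nat \<Rightarrow>\<^sub>0 nat) \<Rightarrow> 'v \<Rightarrow> (nat \<times> nat \<Rightarrow> rat) \<Rightarrow> 'v"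
  where "hw_coeff a \<nu> u X = co a (diag \<nu>) (act a (rmat X) u)"

lemma hw_coeff_row_op:
  assumes a: "mrep a" and h: "highest a \<nu>" and u: "u \<in> weight_space a \<nu>" and r: "r < N"
  shows "hw_coeff a \<nu> u (row_op r t X) = hw_coeff a \<nu> u X"
proof -
  note uV = weight_space_sub[OF u]
  \<comment> \<open>\<open>row_op r t\<close> is left multiplication by this lower unitriangular
    matrix, which the projection to weight \<open>\<nu>\<close> does not see.\<close>
  define L :: "nat \<times> nat \<Rightarrow> 'k" where "L = (\<lambda>(i, k). if i = k then 1 else if k = r \<and> r < i then of_rat (t i) else 0)"
  have e: "rmat (row_op r t X) (i, j) = mat_mult N L (rmat X) (i, j)" if "i < N" "j < N" for i j
  proof -
    have "mat_mult N L (rmat X) (i, j) = (\<Sum>k<N. (if k = i then of_rat (X (i, j)) else 0) + (if k = r then (if r < i then of_rat (t i) * of_rat (X (r, j)) else 0) else 0))"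
      unfolding mat_mult_def L_def prod.case by (intro sum.cong refl) auto
    also have "\<dots> = rmat (row_op r t X) (i, j)"
      using that r by (simp add: sum.distrib row_op_def of_rat_add of_rat_mult)
    finally show ?thesis ..
  qed
  then have "act a (rmat (row_op r t X)) u = act a L (act a (rmat X) u)"
    unfolding act_mat_mult[OF a uV, symmetric] by (intro act_cong[OF a]) simp
  then show ?thesis
    unfolding hw_coeff_def using act_lower[OF a h act_in[OF a uV], of L] by (simp add: L_def)
qed

lemma hw_coeff_col_op:
  assumes a: "mrep a" and h: "highest a \<nu>" and u: "u \<in> weight_space a \<nu>" and r: "r < N"
  shows "hw_coeff a \<nu> u (col_op r t X) = hw_coeff a \<nu> u X"
proof -
  note uV = weight_space_sub[OF u]
  \<comment> \<open>\<open>col_op r t\<close> is right multiplication by this upper unitriangular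
    matrix, which fixes the highest weight vector.\<close>
  define U :: "nat \<times> nat \<Rightarrow> 'k" where "U = (\<lambda>(k, j). if k = j then 1 else if k = r \<and> r < j then of_rat (t j) else 0)"
  have e: "rmat (col_op r t X) (i, j) = mat_mult N (rmat X) U (i, j)" if "i < N" "j < N" for i j
  proof -
    have "mat_mult N (rmat X) U (i, j) = (\<Sum>k<N. (if k = j then of_rat (X (i, j)) else 0) + (if k = r then (if r < j then of_rat (X (i, r)) * of_rat (t j) else 0) else 0))"
      unfolding mat_mult_def U_def prod.case by (intro sum.cong refl) auto
    also have "\<dots> = rmat (col_op r t X) (i, j)"
      using that r by (simp add: sum.distrib col_op_def of_rat_add of_rat_mult)
    finally show ?thesis ..
  qed
  then have "act a (rmat (col_op r t X)) u = act a (rmat X) (act a U u)"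
    unfolding act_mat_mult[OF a uV, symmetric] by (intro act_cong[OF a]) simp
  then show ?thesis
    unfolding hw_coeff_def using act_upper[OF a h u, of U] by (simp add: U_def)
qed

text \<open>Off-diagonal monomials vanish at a diagonal matrix, and among the diagonal ones only
  \<open>diag \<nu>\<close> acts nontrivially on weight \<open>\<nu>\<close>. The resulting factor
  depends on \<open>\<nu>\<close> alone and not on the representation.\<close>

lemma hw_coeff_diag:
  assumes a: "mrep a" and u: "u \<in> weight_space a \<nu>" and X: "\<And>i j. i \<noteq> j \<Longrightarrow> X (i, j) = 0"
  shows "hw_coeff a \<nu> u X = of_rat (meval X (diag \<nu>)) *s u"
proof -
  note uV = weight_space_sub[OF u]
  note l = co_lin[OF a] and s = comodule_subspace[OF a]
  have "meval (rmat X) n *s co a (diag \<nu>) (co a n u) = (if n = diag \<nu> then of_rat (meval X (diag \<nu>)) *s u else 0)" for n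
  proof (cases "n \<in> range diag")
    case True
    then obtain \<kappa> where k: "n = diag \<kappa>" by auto
    then show ?thesis
      using co_weight[OF a u, of n] weight_space_co[OF u] inj_diag
      by (auto simp: col_sum_diag inj_eq meval_of_rat co_0[OF a])
  next
    case False
    then obtain i j where "i \<noteq> j" "(i, j) \<in> keys n" by (auto simp: range_diag_iff in_keys_iff)
    then have "meval (rmat X) n = 0" using X by (intro meval_eq_0[of "(i, j)"]) auto
    then show ?thesis using False by auto
  qed
  then have "hw_coeff a \<nu> u X = (\<Sum>n\<in>csupp a. if n = diag \<nu> then of_rat (meval X (diag \<nu>)) *s u else 0)"
    unfolding hw_coeff_def act_def
    by (subst lin_sum[OF l s]) (simp_all add: co_in[OF a] uV subspace_scale[OF s] lin_scale[OF l])
  also have "\<dots> = of_rat (meval X (diag \<nu>)) *s u"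
    using co_outside[OF uV, of "diag \<nu>"] weight_space_co[OF u] by (auto simp: sum.delta finite_csupp[OF a])
  finally show ?thesis .
qed

text \<open>A functional on the underlying rational vector space, with rational values. It turns
  vector-valued polynomial functions of rational matrices into rational polynomials.\<close>

definition ratlin :: "('v \<Rightarrow> rat) \<Rightarrow> bool"
  where "ratlin H \<longleftrightarrow> (\<forall>x y. H (x + y) = H x + H y) \<and> (\<forall>q x. H (of_rat q *s x) = q * H x)"

text \<open>The space is viewed over the rational numbers, where \<open>v\<close> extends to a
  basis. A \<open>k\<close>-linear functional would take values in \<open>k\<close>, in which sums
  of squares can vanish.\<close>

lemma ratlin_exists:
  assumes "v \<noteq> 0"
  shows "\<exists>H. ratlin H \<and> H v = 1"
proof -
  interpret Q: vector_space "\<lambda>q v. of_rat q *s v :: 'v"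
    by unfold_locales (simp_all add: scale_right_distrib scale_left_distrib of_rat_add of_rat_mult)
  interpret R: vector_space "(*) :: rat \<Rightarrow> rat \<Rightarrow> rat"
    by unfold_locales (simp_all add: distrib_left distrib_right)
  interpret P: vector_space_pair "\<lambda>q v. of_rat q *s v :: 'v" "(*) :: rat \<Rightarrow> rat \<Rightarrow> rat" by unfold_locales
  have "\<not> Q.dependent {v}" using assms Q.dependent_single by blast
  from P.linear_independent_extend[OF this, of "\<lambda>_. 1"] obtain H where
    H: "Vector_Spaces.linear (\<lambda>q v. of_rat q *s v) (*) H" "H v = 1" by auto
  then have "ratlin H" using P.linear_add[OF H(1)] P.linear_scale[OF H(1)] by (simp add: ratlin_def)
  then show ?thesis using H(2) by blast
qed

lemma ratlin_add: "ratlin H \<Longrightarrow> H (x + y) = H x + H y"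
  and ratlin_scale: "ratlin H \<Longrightarrow> H (of_rat q *s x) = q * H x"
  by (simp_all add: ratlin_def)

lemma ratlin_0: "ratlin H \<Longrightarrow> H 0 = 0"
  using ratlin_scale[of H 0 0] by simp

lemma ratlin_diff: "ratlin H \<Longrightarrow> H (x - y) = H x - H y"
  using ratlin_add[of H "x - y" y] by simp

lemma ratlin_sum: "ratlin H \<Longrightarrow> H (\<Sum>i\<in>I. f i) = (\<Sum>i\<in>I. H (f i))"
  by (induction I rule: infinite_finite_induct) (simp_all add: ratlin_0 ratlin_add)

text \<open>Identifies the coefficients of the polynomial function. The superset \<open>K\<close>
  allows the polynomials of two representations, or of one and its transpose, to share an index
  set.\<close>

lemma hw_coeff_peval:
  assumes a: "mrep a" and u: "u \<in> vspace a" and H: "ratlin H" and K: "finite K" "csupp a \<subseteq> K"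
  shows "peval K (\<lambda>n. H (co a (diag \<nu>) (co a n u))) X = H (hw_coeff a \<nu> u X)"
proof -
  note l = co_lin[OF a] and s = comodule_subspace[OF a]
  have "H (hw_coeff a \<nu> u X) = (\<Sum>n\<in>csupp a. H (co a (diag \<nu>) (co a n u)) * meval X n)"
    unfolding hw_coeff_def act_def
    by (subst lin_sum[OF l s])
      (simp_all add: co_in[OF a] u subspace_scale[OF s] lin_scale[OF l] ratlin_sum[OF H] meval_of_rat ratlin_scale[OF H] mult.commute)
  also have "\<dots> = peval K (\<lambda>n. H (co a (diag \<nu>) (co a n u))) X"
    unfolding peval_def
    by (rule sum.mono_neutral_left) (use K co_outside[OF u] in \<open>auto simp: co_0[OF a] ratlin_0[OF H]\<close>)
  finally show ?thesis ..
qed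

text \<open>Both weight components are invariant under row and column operations and have the same
  scalar factor on diagonal matrices, so elimination identifies them. Taking \<open>b = a\<close>
  shows that the component acts on the weight space by scalars; a different \<open>b\<close> has the
  same scalars, which are rational as values of \<open>H\<close>.\<close>

theorem hw_coeff_unique:
  assumes a: "mrep a" "highest a \<nu>" "u \<in> weight_space a \<nu>" and b: "mrep b" "highest b \<nu>" "w \<in> weight_space b \<nu>"
    and H: "ratlin H" "H u = 1"
  shows "co b (diag \<nu>) (co b n w) = of_rat (H (co a (diag \<nu>) (co a n u))) *s w"
proof (rule ccontr)
  assume ne: "co b (diag \<nu>) (co b n w) \<noteq> of_rat (H (co a (diag \<nu>) (co a n u))) *s w"
  define s where "s n = H (co a (diag \<nu>) (co a n u))" for n
  note uV = weight_space_sub[OF a(3)] and wV = weight_space_sub[OF b(3)]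
  \<comment> \<open>If the two sides differed, a rational-linear functional would take the value 1
    on their difference.\<close>
  obtain H' where H': "ratlin H'" "H' (co b (diag \<nu>) (co b n w) - of_rat (s n) *s w) = 1"
    using ratlin_exists ne unfolding s_def by (metis eq_iff_diff_eq_0)
  let ?K = "csupp a \<union> csupp b"
  \<comment> \<open>The polynomial with these coefficients is \<open>H'\<close> of the component of
    \<open>X w\<close>, minus \<open>H' w\<close> times the scalar function obtained from
    \<open>u\<close>. It vanishes at diagonal matrices because \<open>H u = 1\<close>.\<close>
  define c where "c n = H' (co b (diag \<nu>) (co b n w)) - s n * H' w" for n
  have K: "finite ?K" "?K \<subseteq> mat_exponents N"
    using finite_csupp[OF a(1)] finite_csupp[OF b(1)] csupp_mat_exponents[OF a(1)] csupp_mat_exponents[OF b(1)] by auto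
  have F: "peval ?K c X = H' (hw_coeff b \<nu> w X) - H (hw_coeff a \<nu> u X) * H' w" for X
  proof -
    have "peval ?K c X = peval ?K (\<lambda>n. H' (co b (diag \<nu>) (co b n w))) X - peval ?K s X * H' w"
      by (simp add: peval_def c_def algebra_simps sum_subtractf sum_distrib_left)
    then show ?thesis
      using hw_coeff_peval[OF b(1) wV H'(1) K(1)] hw_coeff_peval[OF a(1) uV H(1) K(1)] by (simp add: s_def[abs_def])
  qed
  have "c n = 0" if "n \<in> ?K"
  proof (rule unipotent_invariant_zero[OF K _ _ that])
    show "unipotent_invariant N (peval ?K c)"
      unfolding unipotent_invariant_def F
      using hw_coeff_row_op[OF a] hw_coeff_row_op[OF b] hw_coeff_col_op[OF a] hw_coeff_col_op[OF b] by simp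
    fix X :: "nat \<times> nat \<Rightarrow> rat" assume "\<And>i j. i \<noteq> j \<Longrightarrow> X (i, j) = 0"
    then show "peval ?K c X = 0"
      using hw_coeff_diag[OF a(1,3)] hw_coeff_diag[OF b(1,3)]
      by (simp add: F ratlin_scale[OF H(1)] ratlin_scale[OF H'(1)] H(2))
  qed
  moreover have "c n = 0" if "n \<notin> ?K"
    using that co_outside[OF uV, of n] co_outside[OF wV, of n]
    by (simp add: c_def s_def co_0[OF a(1)] co_0[OF b(1)] ratlin_0[OF H(1)] ratlin_0[OF H'(1)])
  ultimately have "c n = 0" by blast
  then show False using H'(2) by (simp add: c_def ratlin_diff[OF H'(1)] ratlin_scale[OF H'(1)])
qed

text \<open>Transposing the matrix exchanges row and column operations and fixes diagonal matrices.
  The polynomial and its transpose are thus both invariant and agree on diagonal matrices, so they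
  have the same coefficients.\<close>

theorem hw_coeff_transp:
  assumes a: "mrep a" "highest a \<nu>" "u \<in> weight_space a \<nu>" and H: "ratlin H"
  shows "H (co a (diag \<nu>) (co a (transp n) u)) = H (co a (diag \<nu>) (co a n u))"
proof -
  define s where "s n = H (co a (diag \<nu>) (co a n u))" for n
  note uV = weight_space_sub[OF a(3)]
  \<comment> \<open>Closed under transposition, so that reindexing by \<open>transp\<close> keeps
    the index set.\<close>
  let ?K = "csupp a \<union> transp ` csupp a"
  have K: "finite ?K" "?K \<subseteq> mat_exponents N" "csupp a \<subseteq> ?K"
    using finite_csupp[OF a(1)] csupp_mat_exponents[OF a(1)] by auto
  have tK: "transp ` ?K = ?K" by (auto simp: image_Un image_image)
  define c where "c n = s (transp n) - s n" for n
  let ?F = "\<lambda>X. H (hw_coeff a \<nu> u X)"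
  have inv: "unipotent_invariant N ?F"
    unfolding unipotent_invariant_def using hw_coeff_row_op[OF a] hw_coeff_col_op[OF a] by simp
  have s: "peval ?K s X = ?F X" for X
    using hw_coeff_peval[OF a(1) uV H K(1,3)] by (simp add: s_def[abs_def])
  have F: "peval ?K c X = ?F (\<lambda>p. X (prod.swap p)) - ?F X" for X
  proof -
    have "peval ?K (\<lambda>n. s (transp n)) X = (\<Sum>n\<in>transp ` ?K. s n * meval X (transp n))"
      unfolding peval_def by (subst sum.reindex) (simp_all add: inj_on_subset[OF inj_transp])
    also have "\<dots> = peval ?K s (\<lambda>p. X (prod.swap p))"
      unfolding tK by (simp add: peval_def meval_transp)
    finally show ?thesis
      using s by (simp add: c_def peval_def algebra_simps sum_subtractf)
  qed
  have "c n = 0" if "n \<in> ?K"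
  proof (rule unipotent_invariant_zero[OF K(1,2) _ _ that])
    show "unipotent_invariant N (peval ?K c)"
      using inv unipotent_invariant_transp[OF inv] unfolding unipotent_invariant_def F by simp
    fix X :: "nat \<times> nat \<Rightarrow> rat" assume X: "\<And>i j. i \<noteq> j \<Longrightarrow> X (i, j) = 0"
    have "meval (\<lambda>p. X (prod.swap p)) (diag \<nu>) = meval X (diag \<nu>)"
      by (rule meval_cong) (auto simp: in_keys_iff lookup_diag split: if_splits)
    then show "peval ?K c X = 0"
      using hw_coeff_diag[OF a(1,3), of X] hw_coeff_diag[OF a(1,3), of "\<lambda>p. X (prod.swap p)"] X by (simp add: F)
  qed
  moreover have "c n = 0" if "n \<notin> ?K"
  proof -
    have "transp n \<notin> csupp a" using that by (metis UnI2 imageI transp_transp)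
    then show ?thesis
      using that co_outside[OF uV, of n] co_outside[OF uV, of "transp n"] by (simp add: c_def s_def)
  qed
  ultimately have "c n = 0" by blast
  then show ?thesis by (simp add: c_def s_def)
qed

subsection \<open>Averaging\<close>

definition average :: "mat_exp set \<Rightarrow> (mat_exp, 'v) comodule \<Rightarrow> (mat_exp, 'v) comodule \<Rightarrow>
    ('v \<Rightarrow> 'v) \<Rightarrow> 'v \<Rightarrow> 'v"
  where "average K a b f x = (\<Sum>n\<in>K. of_nat (mfact n) *s co b n (f (co a (transp n) x)))"

text \<open>
  Over the complex numbers this is the integral of \<open>g f g\<^sup>*\<close> against the Gaussian measure on
  matrices, which is invariant under the unitary group.
\<close>

lemma average_equivariant:
  assumes a: "mrep a" and b: "mrep b" and f: "lin (vspace a) f" "\<And>v. v \<in> vspace a \<Longrightarrow> f v \<in> vspace b"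
    and K: "finite K" "K \<subseteq> mat_exponents N" "csupp a \<subseteq> K" "csupp b \<subseteq> K" "transp ` K = K"
    and x: "x \<in> vspace a"
  shows "co b l (average K a b f x) = average K a b f (co a l x)"
proof -
  let ?D = "mat_comult N :: _ \<Rightarrow> _ \<Rightarrow>\<^sub>0 'k"
  note la = co_lin[OF a] and lb = co_lin[OF b] and sa = comodule_subspace[OF a] and sb = comodule_subspace[OF b]
  note ca = co_in[OF a] and cb = co_in[OF b]
  have supa: "co a p (co a q v) = (\<Sum>n\<in>K. lookup (?D n) (p, q) *s co a n v)" if "v \<in> vspace a" for p q v
    unfolding co_coassoc_mat[OF a that] by (rule sum.mono_neutral_left) (use K co_outside[OF that] in auto)
  have supb: "co b p (co b q v) = (\<Sum>n\<in>K. lookup (?D n) (p, q) *s co b n v)" if "v \<in> vspace b" for p q v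
    unfolding co_coassoc_mat[OF b that] by (rule sum.mono_neutral_left) (use K co_outside[OF that] in auto)
  have "co b l (average K a b f x) = (\<Sum>n\<in>K. of_nat (mfact n) *s co b l (co b n (f (co a (transp n) x))))"
    unfolding average_def
    by (subst lin_sum[OF lb sb]) (simp_all add: lin_scale[OF lb] cb f(2) ca x subspace_scale[OF sb])
  also have "\<dots> = (\<Sum>n\<in>K. \<Sum>k\<in>K. (of_nat (mfact n) * lookup (?D k) (l, n)) *s co b k (f (co a (transp n) x)))"
    by (simp add: supb f(2) ca x scale_sum_right)
  \<comment> \<open>The symmetry of the structure constants moves \<open>l\<close> across
    \<open>f\<close>: the constants expanding \<open>co b l\<close> after \<open>co b n\<close>
    become those expanding \<open>co a (transp k)\<close> after \<open>co a l\<close>, while the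
    factor \<open>mfact n\<close> turns into \<open>mfact k\<close>.\<close>
  also have "\<dots> = (\<Sum>n\<in>K. \<Sum>k\<in>K. (of_nat (mfact k) * lookup (?D (transp n)) (transp k, l)) *s co b k (f (co a (transp n) x)))"
    by (intro sum.cong refl arg_cong2[of _ _ _ _ scale] mat_comult_symmetry) (use K(2) in auto)
  also have "\<dots> = (\<Sum>k\<in>K. \<Sum>n\<in>K. (of_nat (mfact k) * lookup (?D (transp n)) (transp k, l)) *s co b k (f (co a (transp n) x)))"
    by (rule sum.swap)
  also have "\<dots> = (\<Sum>k\<in>K. \<Sum>m\<in>transp ` K. (of_nat (mfact k) * lookup (?D m) (transp k, l)) *s co b k (f (co a m x)))"
    by (subst sum.reindex) (simp_all add: inj_on_subset[OF inj_transp])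
  also have "\<dots> = (\<Sum>k\<in>K. of_nat (mfact k) *s co b k (f (\<Sum>m\<in>K. lookup (?D m) (transp k, l) *s co a m x)))"
  proof (intro sum.cong refl)
    fix k
    have "f (\<Sum>m\<in>K. lookup (?D m) (transp k, l) *s co a m x) = (\<Sum>m\<in>K. lookup (?D m) (transp k, l) *s f (co a m x))"
      by (subst lin_sum[OF f(1) sa]) (simp_all add: lin_scale[OF f(1)] ca x subspace_scale[OF sa])
    moreover have "co b k (\<Sum>m\<in>K. lookup (?D m) (transp k, l) *s f (co a m x)) =
       (\<Sum>m\<in>K. lookup (?D m) (transp k, l) *s co b k (f (co a m x)))"
      by (subst lin_sum[OF lb sb]) (simp_all add: lin_scale[OF lb] ca f(2) x subspace_scale[OF sb])
    ultimately show "(\<Sum>m\<in>transp ` K. (of_nat (mfact k) * lookup (?D m) (transp k, l)) *s co b k (f (co a m x))) =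
        of_nat (mfact k) *s co b k (f (\<Sum>m\<in>K. lookup (?D m) (transp k, l) *s co a m x))"
      by (simp add: K(5) scale_sum_right)
  qed
  also have "\<dots> = average K a b f (co a l x)"
    unfolding average_def by (simp add: supa x)
  finally show ?thesis .
qed

lemma average_in:
  assumes "mrep a" "mrep b" "\<And>v. v \<in> vspace a \<Longrightarrow> f v \<in> vspace b" "x \<in> vspace a"
  shows "average K a b f x \<in> vspace b"
  unfolding average_def
  by (intro subspace_sum subspace_scale comodule_subspace[OF assms(2)] co_in[OF assms(2)] assms(3) co_in[OF assms(1) assms(4)])

lemma average_lin:
  assumes a: "mrep a" and b: "mrep b" and f: "lin (vspace a) f" "\<And>v. v \<in> vspace a \<Longrightarrow> f v \<in> vspace b"
  shows "lin (vspace a) (average K a b f)"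
  unfolding average_def
proof (intro lin_setsum lin_cmult)
  fix n
  have "lin (vspace a) (\<lambda>x. f (co a (transp n) x))"
    by (rule lin_compose[OF co_lin[OF a] f(1)]) (auto simp: co_in[OF a])
  then show "lin (vspace a) (\<lambda>x. co b n (f (co a (transp n) x)))"
    by (rule lin_compose[OF _ co_lin[OF b]]) (auto simp: co_in[OF a] f(2))
qed

text \<open>
  The averages of a linear isomorphism of highest weight spaces and of its inverse, rescaled, are
  mutually inverse on the subrepresentations generated by these weight spaces.
\<close>

theorem highest_weight_splitting:
  assumes a: "mrep a" "highest a \<nu>" and b: "mrep b" "highest b \<nu>"
    and dim: "dim (weight_space a \<nu>) = dim (weight_space b \<nu>)" and u: "u \<in> weight_space a \<nu>" "u \<noteq> 0"
  obtains f g where "M.chom a b f" "M.chom b a g" "\<And>v. v \<in> vspace a \<Longrightarrow> f (g (f v)) = f v"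
    "\<And>w. w \<in> vspace b \<Longrightarrow> g (f (g w)) = g w" "g (f u) = u"
proof -
  let ?Va = "weight_space a \<nu>" and ?Vb = "weight_space b \<nu>"
  obtain t t' where t: "lin UNIV t" "lin UNIV t'" "\<And>v. v \<in> ?Va \<Longrightarrow> t v \<in> ?Vb" "\<And>v. v \<in> ?Va \<Longrightarrow> t' (t v) = v"
    "\<And>w. w \<in> ?Vb \<Longrightarrow> t' w \<in> ?Va" "\<And>w. w \<in> ?Vb \<Longrightarrow> t (t' w) = w"
    using dim_eq_isomorphism[OF fin_dim_weight_space[OF a(1)] fin_dim_weight_space[OF b(1)] dim] by metis
  \<comment> \<open>Normalised at \<open>u\<close>, which gives \<open>s (diag \<nu>) = 1\<close>
    below and keeps the sum of squares from vanishing.\<close>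
  obtain H where H: "ratlin H" "H u = 1" using ratlin_exists[OF u(2)] by blast
  \<comment> \<open>The coefficients of the universal polynomial: computed from the single vector
    \<open>u\<close>, but valid on both weight spaces by \<open>hw_coeff_unique\<close>.\<close>
  define s where "s n = H (co a (diag \<nu>) (co a n u))" for n
  have st: "s (transp n) = s n" for n unfolding s_def by (rule hw_coeff_transp[OF a u(1) H(1)])
  have sa: "co a (diag \<nu>) (co a n v) = of_rat (s n) *s v" if "v \<in> ?Va" for n v
    unfolding s_def by (rule hw_coeff_unique[OF a u(1) a that H])
  have sb: "co b (diag \<nu>) (co b n v) = of_rat (s n) *s v" if "v \<in> ?Vb" for n v
    unfolding s_def by (rule hw_coeff_unique[OF a u(1) b that H])
  define A where "A = csupp a \<union> csupp b"
  define K where "K = A \<union> transp ` A"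
  have A: "finite A" "A \<subseteq> mat_exponents N"
    unfolding A_def using finite_csupp[OF a(1)] finite_csupp[OF b(1)] csupp_mat_exponents[OF a(1)] csupp_mat_exponents[OF b(1)] by auto
  have K: "finite K" "K \<subseteq> mat_exponents N" "transp ` K = K" "csupp a \<subseteq> K" "csupp b \<subseteq> K"
    using A by (auto simp: K_def A_def image_Un image_image)
  \<comment> \<open>The scalar produced by averaging. One factor \<open>s n\<close> comes from the
    operator at \<open>n\<close> after the inserted map, the other from the operator at
    \<open>transp n\<close> before it, and \<open>s (transp n) = s n\<close>.\<close>
  define \<kappa> where "\<kappa> = (\<Sum>n\<in>K. of_nat (mfact n) * (s n)\<^sup>2)"
  have "\<kappa> > 0"
    unfolding \<kappa>_def
  proof (rule sum_pos2)
    have uV: "u \<in> vspace a" by (rule weight_space_sub[OF u(1)])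
    show "finite K" by (rule K(1))
    have "diag \<nu> \<in> csupp a" using co_outside[OF uV, of "diag \<nu>"] weight_space_co[OF u(1)] u(2) by auto
    then show "diag \<nu> \<in> K" using K(4) by blast
    have "s (diag \<nu>) = 1" using weight_space_co[OF u(1)] H(2) by (simp add: s_def)
    then show "0 < of_nat (mfact (diag \<nu>)) * (s (diag \<nu>))\<^sup>2" by (simp add: mfact_pos)
  qed simp
  then have \<kappa>: "(of_rat \<kappa> :: 'k) \<noteq> 0" by simp
  \<comment> \<open>Stated for a general pair of representations, since it is applied both to
    \<open>t\<close> from \<open>a\<close> to \<open>b\<close> and to \<open>t'\<close> in the
    opposite direction. The projection inside makes the inserted map land in the weight
    space.\<close>
  have avg: "average K x y (\<lambda>v. h (co x (diag \<nu>) v)) v = of_rat \<kappa> *s h v"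
    if x: "mrep x" and y: "mrep y" and cs: "csupp x \<subseteq> K" "csupp y \<subseteq> K" and h: "lin UNIV h" "\<And>v. v \<in> weight_space x \<nu> \<Longrightarrow> h v \<in> weight_space y \<nu>"
      and sx: "\<And>n v. v \<in> weight_space x \<nu> \<Longrightarrow> co x (diag \<nu>) (co x n v) = of_rat (s n) *s v"
      and sy: "\<And>n v. v \<in> weight_space y \<nu> \<Longrightarrow> co y (diag \<nu>) (co y n v) = of_rat (s n) *s v"
      and v: "v \<in> weight_space x \<nu>" for x y h v
  proof -
    let ?f = "\<lambda>v. h (co x (diag \<nu>) v)"
    note vV = weight_space_sub[OF v]
    have fl: "lin (vspace x) ?f" by (rule lin_compose[OF co_lin[OF x] h(1)]) simp
    have fi: "?f z \<in> vspace y" if "z \<in> vspace x" for z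
      by (rule weight_space_sub[OF h(2)[OF co_diag_in_weight_space[OF x that]]])
    note l = co_lin[OF y] and sub = comodule_subspace[OF y]
    \<comment> \<open>By equivariance the average of a vector of weight \<open>\<nu>\<close> has
      weight \<open>\<nu>\<close>. Inserting the projection brings each term into the form to which
      \<open>sy\<close> applies.\<close>
    have "average K x y ?f v = co y (diag \<nu>) (average K x y ?f v)"
      using average_equivariant[OF x y fl fi K(1,2) cs K(3) vV, of "diag \<nu>"] weight_space_co[OF v] by simp
    also have "\<dots> = (\<Sum>n\<in>K. of_nat (mfact n) *s co y (diag \<nu>) (co y n (?f (co x (transp n) v))))"
      unfolding average_def
      by (subst lin_sum[OF l sub]) (simp_all add: lin_scale[OF l] co_in[OF y] fi co_in[OF x] vV subspace_scale[OF sub])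
    also have "\<dots> = (\<Sum>n\<in>K. of_rat (of_nat (mfact n) * (s n)\<^sup>2) *s h v)"
    proof (intro sum.cong refl)
      fix n
      have "?f (co x (transp n) v) = of_rat (s n) *s h v"
        using lin_scale[OF h(1)] by (simp add: sx[OF v] st)
      moreover have "of_rat (s n) *s h v \<in> weight_space y \<nu>"
        using h(2)[OF v] fin_dim_subspaceI[OF fin_dim_weight_space[OF y]] by (simp add: subspace_scale)
      ultimately show "of_nat (mfact n) *s co y (diag \<nu>) (co y n (?f (co x (transp n) v))) = of_rat (of_nat (mfact n) * (s n)\<^sup>2) *s h v"
        by (simp add: sy of_rat_mult power2_eq_square)
    qed
    also have "\<dots> = of_rat \<kappa> *s h v" by (simp add: \<kappa>_def of_rat_sum scale_sum_left)
    finally show ?thesis .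
  qed
  \<comment> \<open>The last clause places the image in the subrepresentation generated by the
    weight space: the outermost operators of the average are applied to vectors of weight
    \<open>\<nu>\<close>.\<close>
  have build: "\<exists>f. M.chom x y f \<and> (\<forall>v\<in>weight_space x \<nu>. f v = h v) \<and>
      (\<forall>v\<in>vspace x. \<exists>c. (\<forall>n. c n \<in> weight_space y \<nu>) \<and> f v = (\<Sum>n\<in>K. co y n (c n)))"
    if x: "mrep x" and y: "mrep y" and cs: "csupp x \<subseteq> K" "csupp y \<subseteq> K" and h: "lin UNIV h" "\<And>v. v \<in> weight_space x \<nu> \<Longrightarrow> h v \<in> weight_space y \<nu>"
      and sx: "\<And>n v. v \<in> weight_space x \<nu> \<Longrightarrow> co x (diag \<nu>) (co x n v) = of_rat (s n) *s v"
      and sy: "\<And>n v. v \<in> weight_space y \<nu> \<Longrightarrow> co y (diag \<nu>) (co y n v) = of_rat (s n) *s v" for x y h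
  proof -
    let ?f = "\<lambda>v. h (co x (diag \<nu>) v)"
    have fl: "lin (vspace x) ?f" by (rule lin_compose[OF co_lin[OF x] h(1)]) simp
    have fw: "?f z \<in> weight_space y \<nu>" if "z \<in> vspace x" for z
      by (rule h(2)[OF co_diag_in_weight_space[OF x that]])
    have fi: "?f z \<in> vspace y" if "z \<in> vspace x" for z
      by (rule weight_space_sub[OF fw[OF that]])
    let ?A = "average K x y ?f"
    let ?g = "\<lambda>v. inverse (of_rat \<kappa>) *s ?A v"
    note sub = comodule_subspace[OF y] and l = co_lin[OF y]
    have "M.chom x y (restrict ?g (vspace x))"
    proof (rule M.chom_restrictI[OF x y])
      show "lin (vspace x) ?g" by (rule lin_cmult[OF average_lin[OF x y fl fi]])
      show "?g v \<in> vspace y" if "v \<in> vspace x" for v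
        using average_in[of x y ?f v K, OF x y fi that] by (simp add: subspace_scale[OF sub])
      show "co y m (?g v) = ?g (co x m v)" if "v \<in> vspace x" for m v
        using average_in[of x y ?f v K, OF x y fi that] average_equivariant[OF x y fl fi K(1,2) cs K(3) that, of m]
        by (simp add: lin_scale[OF l])
    qed
    moreover have "restrict ?g (vspace x) v = h v" if "v \<in> weight_space x \<nu>" for v
      using avg[OF x y cs h sx sy that] weight_space_sub[OF that] \<kappa> by simp
    moreover have "\<exists>c. (\<forall>n. c n \<in> weight_space y \<nu>) \<and> restrict ?g (vspace x) v = (\<Sum>n\<in>K. co y n (c n))" if v: "v \<in> vspace x" for v
    proof (intro exI conjI allI)
      let ?c = "\<lambda>n. (inverse (of_rat \<kappa>) * of_nat (mfact n)) *s ?f (co x (transp n) v)"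
      have w: "?f (co x (transp n) v) \<in> weight_space y \<nu>" for n by (rule fw[OF co_in[OF x v]])
      then show "?c n \<in> weight_space y \<nu>" for n
        using fin_dim_subspaceI[OF fin_dim_weight_space[OF y]] by (simp add: subspace_scale)
      show "restrict ?g (vspace x) v = (\<Sum>n\<in>K. co y n (?c n))"
        using v weight_space_sub[OF w] by (simp add: average_def scale_sum_right lin_scale[OF l])
    qed
    ultimately show ?thesis by blast
  qed
  obtain f where f: "M.chom a b f" "\<And>v. v \<in> ?Va \<Longrightarrow> f v = t v"
    "\<And>v. v \<in> vspace a \<Longrightarrow> \<exists>c. (\<forall>n. c n \<in> ?Vb) \<and> f v = (\<Sum>n\<in>K. co b n (c n))"
    using build[OF a(1) b(1) K(4,5) t(1,3) sa sb] by blast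
  obtain g where g: "M.chom b a g" "\<And>v. v \<in> ?Vb \<Longrightarrow> g v = t' v"
    "\<And>v. v \<in> vspace b \<Longrightarrow> \<exists>c. (\<forall>n. c n \<in> ?Va) \<and> g v = (\<Sum>n\<in>K. co a n (c n))"
    using build[OF b(1) a(1) K(5,4) t(2,5) sb sa] by blast
  \<comment> \<open>The composite of \<open>g'\<close> and \<open>f'\<close> commutes with all
    coefficient operators. Being the identity on the weight space, it is the identity on everything
    that the weight space generates.\<close>
  have cyc: "f' (g' (\<Sum>n\<in>K. co y n (c n))) = (\<Sum>n\<in>K. co y n (c n))"
    if y: "mrep y" and f': "M.chom x y f'" and g': "M.chom y x g'" and c: "\<And>n. c n \<in> weight_space y \<nu>"
      and fg: "\<And>w. w \<in> weight_space y \<nu> \<Longrightarrow> f' (g' w) = w" for x y f' g' and c :: "_ \<Rightarrow> 'v"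
  proof -
    have cV: "c n \<in> vspace y" for n by (rule weight_space_sub[OF c])
    have "g' (\<Sum>n\<in>K. co y n (c n)) = (\<Sum>n\<in>K. co x n (g' (c n)))"
      by (subst lin_sum[OF M.chom_lin[OF g'] comodule_subspace[OF y]])
        (simp_all add: co_in[OF y] cV M.chom_co[OF g'])
    also have "f' \<dots> = (\<Sum>n\<in>K. co y n (f' (g' (c n))))"
      by (subst lin_sum[OF M.chom_lin[OF f'] comodule_subspace[OF M.chom_dom[OF f']]])
        (simp_all add: co_in[OF M.chom_dom[OF f']] M.chom_in[OF g'] cV M.chom_co[OF f'])
    finally show ?thesis by (simp add: fg c)
  qed
  show ?thesis
  proof (rule that[OF f(1) g(1)])
    show "f (g (f v)) = f v" if v: "v \<in> vspace a" for v
    proof -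
      obtain c where c: "\<And>n. c n \<in> ?Vb" "f v = (\<Sum>n\<in>K. co b n (c n))" using f(3)[OF v] by blast
      show ?thesis unfolding c(2) by (rule cyc[OF b(1) f(1) g(1) c(1)]) (simp add: f(2) g(2) t)
    qed
    show "g (f (g w)) = g w" if w: "w \<in> vspace b" for w
    proof -
      obtain c where c: "\<And>n. c n \<in> ?Va" "g w = (\<Sum>n\<in>K. co a n (c n))" using g(3)[OF w] by blast
      show ?thesis unfolding c(2) by (rule cyc[OF a(1) g(1) f(1) c(1)]) (simp add: f(2) g(2) t)
    qed
    show "g (f u) = u" using u(1) by (simp add: f(2) g(2) t)
  qed
qed

subsection \<open>Weight multiplicities determine the representation\<close>

definition iso_rep :: "(mat_exp, 'v) comodule \<Rightarrow> (mat_exp, 'v) comodule \<Rightarrow> bool"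
  where "iso_rep a b \<longleftrightarrow> (\<exists>f g. M.chom a b f \<and> M.chom b a g \<and> (\<forall>v\<in>vspace a. g (f v) = v) \<and> (\<forall>w\<in>vspace b. f (g w) = w))"

text \<open>On the weight space \<open>f\<close> followed by \<open>g\<close> is idempotent, and its
  kernel is that of \<open>f\<close> because \<open>f (g (f v)) = f v\<close>.\<close>

lemma dim_kernel_weight_space:
  assumes f: "M.chom a b f" and g: "M.chom b a g" and fgf: "\<And>v. v \<in> vspace a \<Longrightarrow> f (g (f v)) = f v"
  shows "dim (weight_space a \<mu>) = dim ((\<lambda>v. g (f v)) ` weight_space a \<mu>) + dim {v \<in> weight_space a \<mu>. f v = 0}"
proof -
  note a = M.chom_dom[OF f]
  let ?W = "weight_space a \<mu>"
  have sub: "v \<in> vspace a" if "v \<in> ?W" for v by (rule weight_space_sub[OF that])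
  have f0: "f 0 = 0" and g0: "g 0 = 0"
    using lin_0[OF M.chom_lin[OF f] comodule_subspace[OF a]] lin_0[OF M.chom_lin[OF g] comodule_subspace[OF M.chom_dom[OF g]]] .
  have "dim ?W = dim ((\<lambda>v. g (f v)) ` ?W) + dim {v \<in> ?W. g (f v) = 0}"
  proof (rule dim_split[OF fin_dim_weight_space[OF a]])
    show "lin ?W (\<lambda>v. g (f v))"
      by (rule lin_compose[OF lin_mono[OF M.chom_lin[OF f]] M.chom_lin[OF g]]) (auto simp: sub M.chom_in[OF f])
    fix v assume v: "v \<in> ?W"
    show "g (f v) \<in> ?W"
      using sub[OF v] weight_space_co[OF v] by (simp add: weight_space_def M.chom_in[OF f] M.chom_in[OF g] M.chom_co[OF f] M.chom_co[OF g])
    show "g (f (g (f v))) = g (f v)" using fgf[OF sub[OF v]] by simp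
  qed
  moreover have "{v \<in> ?W. g (f v) = 0} = {v \<in> ?W. f v = 0}"
    using fgf sub f0 g0 by fastforce
  ultimately show ?thesis by simp
qed

text \<open>The map \<open>g\<close> carries the image of one composite onto the image of the other.
  Applied in both directions, this gives the split summands equal multiplicities.\<close>

lemma dim_image_weight_space_le:
  assumes f: "M.chom a b f" and g: "M.chom b a g" and fgf: "\<And>v. v \<in> vspace a \<Longrightarrow> f (g (f v)) = f v"
  shows "dim ((\<lambda>v. g (f v)) ` weight_space a \<mu>) \<le> dim ((\<lambda>w. f (g w)) ` weight_space b \<mu>)"
proof -
  note a = M.chom_dom[OF f] and b = M.chom_dom[OF g]
  let ?Wa = "weight_space a \<mu>" and ?Wb = "weight_space b \<mu>"
  let ?q = "\<lambda>w. f (g w)"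
  have fw: "f v \<in> ?Wb" if "v \<in> ?Wa" for v
    using weight_space_sub[OF that] weight_space_co[OF that] by (simp add: weight_space_def M.chom_in[OF f] M.chom_co[OF f])
  have gw: "g v \<in> ?Wa" if "v \<in> ?Wb" for v
    using weight_space_sub[OF that] weight_space_co[OF that] by (simp add: weight_space_def M.chom_in[OF g] M.chom_co[OF g])
  have lq: "lin ?Wb ?q"
    by (rule lin_compose[OF lin_mono[OF M.chom_lin[OF g]] M.chom_lin[OF f]]) (auto simp: weight_space_sub M.chom_in[OF g])
  note fdq = fin_dim_image[OF fin_dim_weight_space[OF b] lq]
  have qsub: "?q ` ?Wb \<subseteq> vspace b" using gw fw weight_space_sub by blast
  have "(\<lambda>v. g (f v)) ` ?Wa = g ` (?q ` ?Wb)"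
  proof
    show "(\<lambda>v. g (f v)) ` ?Wa \<subseteq> g ` (?q ` ?Wb)"
    proof
      fix x assume "x \<in> (\<lambda>v. g (f v)) ` ?Wa"
      then obtain v where v: "v \<in> ?Wa" "x = g (f v)" by blast
      then have "x = g (?q (f v))" using fgf[OF weight_space_sub[OF v(1)]] by simp
      then show "x \<in> g ` (?q ` ?Wb)" using fw[OF v(1)] by blast
    qed
    show "g ` (?q ` ?Wb) \<subseteq> (\<lambda>v. g (f v)) ` ?Wa" using gw by blast
  qed
  then show ?thesis
    using dim_lin_image_le[OF fdq lin_mono[OF M.chom_lin[OF g] qsub]] by simp
qed

text \<open>The kernels of the two splitting maps are complements of the isomorphic summands, and
  their weight multiplicities again agree. They are therefore isomorphic by the induction
  hypothesis, and the two isomorphisms are glued along the direct sum decompositions.\<close>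

theorem weight_dims_determine:
  "\<lbrakk>mrep a; mrep b; \<And>\<mu>. dim (weight_space a \<mu>) = dim (weight_space b \<mu>)\<rbrakk> \<Longrightarrow> iso_rep a b"
proof (induction "dim (vspace a)" arbitrary: a b rule: less_induct)
  case less
  note a = less.prems(1) and b = less.prems(2) and dims = less.prems(3)
  have triv: "weight_space c \<mu> = {0}" if c: "mrep c" "dim (weight_space c \<mu>) = 0" for c \<mu>
    using dim_pos[OF fin_dim_weight_space[OF c(1)]] c(2) subspace_0[OF fin_dim_subspaceI[OF fin_dim_weight_space[OF c(1)]]]
    by (metis less_numeral_extra(3) singletonI subsetI subset_singletonD empty_iff)
  have dim0: "dim {0} = 0" using dim_span_eq_card_independent[OF independent_empty] by simp
  show ?case
  proof (cases "\<exists>\<mu>. weight_space a \<mu> \<noteq> {0}")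
    case False
    have z: "vspace c = {0}" if c: "mrep c" "\<And>\<mu>. weight_space c \<mu> = {0}" for c
    proof -
      have "v = 0" if "v \<in> vspace c" for v
        by (rule zero_if_no_weights[OF c(1) that]) (use co_diag_in_weight_space[OF c(1) that] c(2) in simp)
      then show ?thesis using subspace_0[OF comodule_subspace[OF c(1)]] by blast
    qed
    have za: "vspace a = {0}" using False by (intro z[OF a]) simp
    have "weight_space b \<mu> = {0}" for \<mu> using triv[OF b] dims[of \<mu>] dim0 False by simp
    then have zb: "vspace b = {0}" by (rule z[OF b])
    show ?thesis
      unfolding iso_rep_def using M.chom_zero[OF a b] M.chom_zero[OF b a] za zb
      by (intro exI[of _ "\<lambda>v\<in>vspace a. 0"] exI[of _ "\<lambda>v\<in>vspace b. 0"]) simp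
  next
    case True
    define S where "S = {\<mu>. weight_space a \<mu> \<noteq> {0}}"
    have "S \<subseteq> diag -` csupp a"
    proof
      fix \<mu> assume "\<mu> \<in> S"
      then obtain v where v: "v \<in> weight_space a \<mu>" "v \<noteq> 0"
        using subspace_0[OF fin_dim_subspaceI[OF fin_dim_weight_space[OF a]]] unfolding S_def by blast
      then have "co a (diag \<mu>) v \<noteq> 0" by (simp add: weight_space_co)
      then show "\<mu> \<in> diag -` csupp a" using co_outside[OF weight_space_sub[OF v(1)], of "diag \<mu>"] by blast
    qed
    then have finS: "finite S" using finite_vimageI[OF finite_csupp[OF a] inj_diag] finite_subset by blast
    have neS: "S \<noteq> {}" using True by (auto simp: S_def)
    obtain \<nu> where \<nu>: "\<nu> \<in> S" "\<And>\<mu>. \<mu> \<in> S \<Longrightarrow> height N \<mu> \<le> height N \<nu>"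
    proof -
      have "Max (height N ` S) \<in> height N ` S" using finS neS by (intro Max_in) auto
      then obtain \<nu> where "\<nu> \<in> S" "height N \<nu> = Max (height N ` S)" by auto
      then show ?thesis using that[of \<nu>] finS by simp
    qed
    have above: "weight_space a \<mu> = {0}" if "height N \<nu> < height N \<mu>" for \<mu>
      using that \<nu>(2)[of \<mu>] by (auto simp: S_def)
    have ha: "highest a \<nu>"
      unfolding highest_def using above co_diag_in_weight_space[OF a] by blast
    \<comment> \<open>Equal dimensions give \<open>a\<close> and \<open>b\<close> the same weights,
      so a weight of maximal height for \<open>a\<close> is bounded from above in \<open>b\<close>
      as well.\<close>
    have hb: "highest b \<nu>"
      unfolding highest_def
    proof (intro allI impI ballI)
      fix \<mu> v assume "height N \<nu> < height N \<mu>" and v: "v \<in> vspace b"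
      then have "dim (weight_space b \<mu>) = 0" using above[of \<mu>] dims[of \<mu>] dim0 by simp
      then show "co b (diag \<mu>) v = 0" using triv[OF b] co_diag_in_weight_space[OF b v] by blast
    qed
    obtain u where u: "u \<in> weight_space a \<nu>" "u \<noteq> 0"
      using \<nu>(1) subspace_0[OF fin_dim_subspaceI[OF fin_dim_weight_space[OF a]]] unfolding S_def by blast
    obtain f g where f: "M.chom a b f" and g: "M.chom b a g" and fgf: "\<And>v. v \<in> vspace a \<Longrightarrow> f (g (f v)) = f v"
      and gfg: "\<And>w. w \<in> vspace b \<Longrightarrow> g (f (g w)) = g w" and gfu: "g (f u) = u"
      using highest_weight_splitting[OF a ha b hb dims u] by blast
    note sa = comodule_subspace[OF a] and sb = comodule_subspace[OF b]
    note fl = M.chom_lin[OF f] and gl = M.chom_lin[OF g] and fi = M.chom_in[OF f] and gi = M.chom_in[OF g]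
    note f0 = lin_0[OF fl sa] and g0 = lin_0[OF gl sb]
    let ?Ka = "{v \<in> vspace a. f v = 0}" and ?Kb = "{w \<in> vspace b. g w = 0}"
    define a' where "a' = mk_comodule ?Ka (co a)"
    define b' where "b' = mk_comodule ?Kb (co b)"
    have Ka: "subspace ?Ka" "?Ka \<subseteq> vspace a" "\<And>m v. v \<in> ?Ka \<Longrightarrow> co a m v \<in> ?Ka"
      by (auto intro!: subspaceI simp: subspace_0[OF sa] subspace_add[OF sa] subspace_scale[OF sa] f0 lin_add[OF fl] lin_scale[OF fl]
          co_in[OF a] co_0[OF b] simp flip: M.chom_co[OF f])
    have Kb: "subspace ?Kb" "?Kb \<subseteq> vspace b" "\<And>m v. v \<in> ?Kb \<Longrightarrow> co b m v \<in> ?Kb"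
      by (auto intro!: subspaceI simp: subspace_0[OF sb] subspace_add[OF sb] subspace_scale[OF sb] g0 lin_add[OF gl] lin_scale[OF gl]
          co_in[OF b] co_0[OF a] simp flip: M.chom_co[OF g])
    have a': "mrep a'" "\<And>m v. v \<in> ?Ka \<Longrightarrow> co a' m v = co a m v" "vspace a' = ?Ka"
      unfolding a'_def using M.subcomodule[OF a Ka] by simp_all
    have b': "mrep b'" "\<And>m v. v \<in> ?Kb \<Longrightarrow> co b' m v = co b m v" "vspace b' = ?Kb"
      unfolding b'_def using M.subcomodule[OF b Kb] by simp_all
    have wa: "weight_space a' \<mu> = {v \<in> weight_space a \<mu>. f v = 0}" for \<mu>
      using a'(2) by (auto simp: weight_space_def a'(3))
    have wb: "weight_space b' \<mu> = {v \<in> weight_space b \<mu>. g v = 0}" for \<mu>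
      using b'(2) by (auto simp: weight_space_def b'(3))
    \<comment> \<open>The split summands have equal multiplicities by the two inequalities;
      subtracting them from the equal totals leaves equal multiplicities on the kernels.\<close>
    have dims': "dim (weight_space a' \<mu>) = dim (weight_space b' \<mu>)" for \<mu>
      using dim_kernel_weight_space[OF f g fgf, of \<mu>] dim_kernel_weight_space[OF g f gfg, of \<mu>] dims[of \<mu>]
        dim_image_weight_space_le[OF f g fgf, of \<mu>] dim_image_weight_space_le[OF g f gfg, of \<mu>]
      unfolding wa wb by linarith
    \<comment> \<open>The split summand contains \<open>u = g (f u)\<close>, which is nonzero, so
      the kernel is strictly smaller.\<close>
    have "dim (vspace a') < dim (vspace a)"
    proof -
      note uV = weight_space_sub[OF u(1)]
      have l: "lin (vspace a) (\<lambda>v. g (f v))" by (rule lin_compose[OF fl gl]) (auto simp: fi)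
      have "dim (vspace a) = dim ((\<lambda>v. g (f v)) ` vspace a) + dim {v \<in> vspace a. g (f v) = 0}"
        by (rule dim_split[OF comodule_fin_dim[OF a] l]) (simp_all add: fi gi fgf)
      moreover have "{v \<in> vspace a. g (f v) = 0} = ?Ka" using fgf f0 g0 by fastforce
      moreover have "dim ((\<lambda>v. g (f v)) ` vspace a) > 0"
        by (rule dim_pos[OF fin_dim_image[OF comodule_fin_dim[OF a] l], of u]) (use uV gfu u(2) in \<open>auto simp: image_iff intro!: bexI[of _ u]\<close>)
      ultimately show ?thesis by (simp add: a'(3))
    qed
    then have "iso_rep a' b'" using less.hyps a'(1) b'(1) dims' by blast
    then obtain h h' where h: "M.chom a' b' h" and h': "M.chom b' a' h'"
      and h'h: "\<And>v. v \<in> ?Ka \<Longrightarrow> h' (h v) = v" and hh': "\<And>w. w \<in> ?Kb \<Longrightarrow> h (h' w) = w"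
      unfolding iso_rep_def a'(3) b'(3) by blast
    \<comment> \<open>The vector \<open>v - q (p v)\<close> is the component of \<open>v\<close> in
      the kernel of \<open>p\<close>. The glued map is \<open>p\<close> on the image of
      \<open>q\<close> after \<open>p\<close>, and \<open>k\<close> on that kernel.\<close>
    have key: "M.chom x y (\<lambda>v\<in>vspace x. p v + k (v - q (p v)))"
      if x: "mrep x" and y: "mrep y" and p: "M.chom x y p" and q: "M.chom y x q" and k: "M.chom x' y' k"
        and vx: "vspace x' = {v \<in> vspace x. p v = 0}" and cx: "\<And>m v. v \<in> vspace x' \<Longrightarrow> co x' m v = co x m v"
        and vy: "vspace y' \<subseteq> vspace y" and cy: "\<And>m v. v \<in> vspace y' \<Longrightarrow> co y' m v = co y m v"
        and pqp: "\<And>v. v \<in> vspace x \<Longrightarrow> p (q (p v)) = p v" for x y p q k x' y'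
    proof -
      note sx = comodule_subspace[OF x] and sy = comodule_subspace[OF y]
      note pl = M.chom_lin[OF p] and ql = M.chom_lin[OF q] and kl = M.chom_lin[OF k]
      have ker: "v - q (p v) \<in> vspace x'" if "v \<in> vspace x" for v
        unfolding vx using that by (simp add: subspace_diff[OF sx] M.chom_in[OF p] M.chom_in[OF q] lin_diff[OF pl sx] pqp)
      have dl: "lin (vspace x) (\<lambda>v. v - q (p v))"
        by (rule lin_minus[OF lin_ident lin_compose[OF pl ql]]) (auto simp: M.chom_in[OF p])
      show ?thesis
      proof (rule M.chom_restrictI[OF x y])
        show "lin (vspace x) (\<lambda>v. p v + k (v - q (p v)))"
          by (rule lin_plus[OF pl lin_compose[OF dl kl]]) (auto simp: ker)
        fix v assume v: "v \<in> vspace x"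
        have kv: "k (v - q (p v)) \<in> vspace y'" by (rule M.chom_in[OF k ker[OF v]])
        show "p v + k (v - q (p v)) \<in> vspace y"
          using kv vy v by (auto intro: subspace_add[OF sy] M.chom_in[OF p])
        fix m
        have "co y m (p v + k (v - q (p v))) = co y m (p v) + co y m (k (v - q (p v)))"
          using kv vy v by (intro lin_add[OF co_lin[OF y]]) (auto intro: M.chom_in[OF p])
        also have "co y m (k (v - q (p v))) = k (co x m (v - q (p v)))"
          using cy[OF kv, of m] M.chom_co[OF k ker[OF v], of m] cx[OF ker[OF v], of m] by simp
        also have "co x m (v - q (p v)) = co x m v - q (p (co x m v))"
          using v by (simp add: lin_diff[OF co_lin[OF x] sx] M.chom_in[OF p] M.chom_in[OF q] M.chom_co[OF p] M.chom_co[OF q])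
        finally show "co y m (p v + k (v - q (p v))) = p (co x m v) + k (co x m v - q (p (co x m v)))"
          using v by (simp add: M.chom_co[OF p])
      qed
    qed
    let ?F = "\<lambda>v\<in>vspace a. f v + h (v - g (f v))" and ?G = "\<lambda>w\<in>vspace b. g w + h' (w - f (g w))"
    have F: "M.chom a b ?F" by (rule key[OF a b f g h]) (use a' b' fgf in auto)
    have G: "M.chom b a ?G" by (rule key[OF b a g f h']) (use a' b' gfg in auto)
    have GF: "?G (?F v) = v" if v: "v \<in> vspace a" for v
    proof -
      have kv: "v - g (f v) \<in> ?Ka" using v by (simp add: subspace_diff[OF sa] fi gi lin_diff[OF fl sa] fgf)
      have hv: "h (v - g (f v)) \<in> ?Kb" using M.chom_in[OF h, of "v - g (f v)"] kv unfolding a'(3) b'(3) by blast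
      have "g (f v + h (v - g (f v))) = g (f v)" using hv v by (simp add: lin_add[OF gl] fi)
      moreover have "f v + h (v - g (f v)) \<in> vspace b" using hv v by (simp add: subspace_add[OF sb] fi)
      ultimately show ?thesis using v by (simp add: fgf h'h[OF kv])
    qed
    have FG: "?F (?G w) = w" if w: "w \<in> vspace b" for w
    proof -
      have kw: "w - f (g w) \<in> ?Kb" using w by (simp add: subspace_diff[OF sb] fi gi lin_diff[OF gl sb] gfg)
      have hw: "h' (w - f (g w)) \<in> ?Ka" using M.chom_in[OF h', of "w - f (g w)"] kw unfolding a'(3) b'(3) by blast
      have "f (g w + h' (w - f (g w))) = f (g w)" using hw w by (simp add: lin_add[OF fl] gi)
      moreover have "g w + h' (w - f (g w)) \<in> vspace a" using hw w by (simp add: subspace_add[OF sa] gi)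
      ultimately show ?thesis using w by (simp add: gfg hh'[OF kw])
    qed
    show ?thesis unfolding iso_rep_def using F G GF FG by blast
  qed
qed

section \<open>Essential injectivity of restriction to diagonal matrices\<close>

sublocale bialgebra_restriction scale "matrix_monoid N" "power_monoid N" restrict_to_diagonal diag
  by (rule diagonal_restriction)

text \<open>Maps commuting with the diagonal operators preserve weight spaces. The right inverse
  \<open>g\<close> also respects weights, so \<open>f\<close> is onto in each weight.\<close>

lemma dim_weight_space_le_of_chom:
  assumes a: "mrep a" and b: "mrep b"
    and f: "M'.chom (restrict_comodule restrict_to_diagonal a) (restrict_comodule restrict_to_diagonal b) f"
    and g: "M'.chom (restrict_comodule restrict_to_diagonal b) (restrict_comodule restrict_to_diagonal a) g"
    and gf: "\<And>v. v \<in> vspace b \<Longrightarrow> f (g v) = v"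
  shows "dim (weight_space b \<mu>) \<le> dim (weight_space a \<mu>)"
proof -
  have fi: "f v \<in> weight_space b \<mu>" if "v \<in> weight_space a \<mu>" for v
    using weight_space_sub[OF that] weight_space_co[OF that] M'.chom_in[OF f, of v] M'.chom_co[OF f, of v \<mu>]
    by (simp add: weight_space_def co_restrict[OF a] co_restrict[OF b])
  have gi: "g v \<in> weight_space a \<mu>" if "v \<in> weight_space b \<mu>" for v
    using weight_space_sub[OF that] weight_space_co[OF that] M'.chom_in[OF g, of v] M'.chom_co[OF g, of v \<mu>]
    by (simp add: weight_space_def co_restrict[OF a] co_restrict[OF b])
  have "weight_space b \<mu> = f ` weight_space a \<mu>"
  proof
    show "weight_space b \<mu> \<subseteq> f ` weight_space a \<mu>"
    proof
      fix w assume w: "w \<in> weight_space b \<mu>"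
      then have "w = f (g w)" using gf weight_space_sub by simp
      then show "w \<in> f ` weight_space a \<mu>" using gi[OF w] by blast
    qed
  qed (use fi in blast)
  moreover have "lin (weight_space a \<mu>) f"
    by (rule lin_mono[OF M'.chom_lin[OF f]]) (auto simp: weight_space_sub)
  ultimately show ?thesis using dim_lin_image_le[OF fin_dim_weight_space[OF a]] by simp
qed

theorem restriction_essentially_injective:
  assumes a: "mrep a" and b: "mrep b"
    and iso: "isomorphic (Rep (power_monoid N)) (restrict_comodule restrict_to_diagonal a) (restrict_comodule restrict_to_diagonal b)"
  shows "isomorphic (Rep (matrix_monoid N)) a b"
proof -
  let ?a = "restrict_comodule restrict_to_diagonal a" and ?b = "restrict_comodule restrict_to_diagonal b"
  obtain F where F: "F \<in> Hom (Rep (power_monoid N)) ?a ?b" "iso_arr (Rep (power_monoid N)) F"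
    using iso by (auto simp: isomorphic_def)
  obtain f where f: "F = Arrow ?a f ?b" using F(1) by (rule M'.HomE_Rep)
  obtain a1 b1 f1 g where g: "F = Arrow a1 f1 b1" "M'.chom a1 b1 f1" "M'.chom b1 a1 g"
    "\<And>v. v \<in> vspace a1 \<Longrightarrow> g (f1 v) = v" "\<And>w. w \<in> vspace b1 \<Longrightarrow> f1 (g w) = w"
    by (rule M'.iso_arr_RepE[OF F(2)]) (rule that)
  have e: "a1 = ?a" "b1 = ?b" "f1 = f" using g(1) f by auto
  note fg = g(2,3)[unfolded e]
  have "dim (weight_space a \<mu>) = dim (weight_space b \<mu>)" for \<mu>
    using dim_weight_space_le_of_chom[OF a b fg, of \<mu>] dim_weight_space_le_of_chom[OF b a fg(2,1), of \<mu>] g(4,5)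
    by (simp add: e)
  then obtain f' g' where h: "M.chom a b f'" "M.chom b a g'" "\<forall>v\<in>vspace a. g' (f' v) = v" "\<forall>w\<in>vspace b. f' (g' w) = w"
    using weight_dims_determine[OF a b] unfolding iso_rep_def by blast
  then show ?thesis
    unfolding isomorphic_def
    by (intro bexI[of _ "Arrow a f' b"]) (simp_all add: M.iso_arr_RepI)
qed

end

theorem lemma11p3:
  fixes scale :: "'k::field_char_0 \<Rightarrow> 'v::ab_group_add \<Rightarrow> 'v"
    and N :: nat
  assumes "ambient_vector_space scale"
  shows "two_rig_extension
    (ambient_vector_space.Rep scale (matrix_monoid N))
    (ambient_vector_space.Rep scale (power_monoid N))
    (ambient_vector_space.restriction scale restrict_to_diagonal)"
proof -
  interpret matrix_reps_char_0 scale N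
    using assms by (simp add: matrix_reps_char_0_def)
  show ?thesis
    by (rule two_rig_extension_restriction) (rule restriction_essentially_injective)
qed

end
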